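(* Let $\alpha>0$, let $\phi_\alpha(z)=|z|^\alpha$, $z\in\mathbb{C}$, and let $\Lambda_\alpha^M$ be the hybrid point process associated with the weight $\phi_\alpha$. Then $$\mathbb{P}\bigl(\Lambda_\alpha^M\ \text{is separated}\bigr)=\begin{cases}1 & \text{if }\alpha<1,\\ 0 & \text{if }\alpha\ge 1.\end{cases}$$
   Context: $m$ denotes Lebesgue measure on $\mathbb{C}$ and $D(z,r)$ the open disk with center $z$ and radius $r$. Write $\phi=\phi_\alpha$ and $\nu=\Delta\phi$, i.e. $d\nu(z)=\alpha^2|z|^{\alpha-2}\,dm(z)$ (an infinite doubling measure). Radius function: for $z\in\mathbb{C}$, $\rho(z)>0$ is the radius such that $\nu(D(z,\rho(z)))=1$. Fock space: let $d\mu_\phi(z)=e^{-2\phi(z)}\frac{dm(z)}{\rho^2(z)}$ and let $\mathcal{F}_\phi$ be the space of entire functions $f$ with $\int_{\mathbb{C}}|f|^2\,d\mu_\phi<\infty$, with the inner product of $L^2(\mu_\phi)$. It is a reproducing kernel Hilbert space; its reproducing kernel is denoted $K_\phi(z,\zeta)$. Determinantal process: $\Lambda_\phi=\{\lambda_k\}_{k\ge1}$ is the (simple) determinantal point process in $\mathbb{C}$ with kernel $K_\phi$ and background measure $\mu_\phi$, i.e. for all $n$ and all pairwise disjoint bounded Borel sets $B_1,\dots,B_n\subset\mathbb{C}$, $$\mathbb{E}\Bigl[\prod_{k=1}^n\#(B_k\cap\Lambda_\phi)\Bigr]=\int_{B_1}\cdots\int_{B_n}\det\bigl(K_\phi(z_i,z_j)\bigr)_{1\le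 i,j\le n}\,d\mu_\phi(z_1)\cdots d\mu_\phi(z_n).$$ Hybrid process: $\Lambda_\alpha^M=\{|\lambda_k|e^{i\theta_k}\}_{k\ge1}$, where $\{\lambda_k\}_{k\ge1}=\Lambda_\phi$ and the $\theta_k$ are i.i.d. uniform on $[0,2\pi)$, independent of $\Lambda_\phi$. A sequence $\{\lambda_k\}_{k\ge1}\subset\mathbb{C}$ is separated if $\inf_{j\ne k}|\lambda_k-\lambda_j|>0$. *)

theory Defs
  imports
    "HOL-Probability.Probability"
    "HOL-Complex_Analysis.Complex_Analysis"
    "Jordan_Normal_Form.Determinant"
begin

definition fock_space :: "complex measure \<Rightarrow> (complex \<Rightarrow> complex) set" where
  "fock_space \<mu> = {f. f holomorphic_on UNIV \<and> integrable \<mu> (\<lambda>z. (cmod (f z))\<^sup>2)}"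

text \<open>
  The inner product is that of \<open>L\<^sup>2(\<mu>)\<close>, linear in the first argument:
  \<open>\<langle>f, g\<rangle> = \<integral> f \<cdot> cnj g d\<mu>\<close>. The reproducing property is \<open>f \<zeta> = \<langle>f, K(\<cdot>, \<zeta>)\<rangle>\<close>.
\<close>

definition is_reproducing_kernel ::
    "complex measure \<Rightarrow> (complex \<Rightarrow> complex \<Rightarrow> complex) \<Rightarrow> bool" where
  "is_reproducing_kernel \<mu> K \<longleftrightarrow>
     (\<forall>\<zeta>. (\<lambda>z. K z \<zeta>) \<in> fock_space \<mu> \<and>
          (\<forall>f\<in>fock_space \<mu>. f \<zeta> = (LINT z|\<mu>. f z * cnj (K z \<zeta>))))"

definition reproducing_kernel :: "complex measure \<Rightarrow> complex \<Rightarrow> complex \<Rightarrow> complex" where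
  "reproducing_kernel \<mu> = (THE K. is_reproducing_kernel \<mu> K)"

definition weight :: "real \<Rightarrow> complex \<Rightarrow> real" where
  "weight \<alpha> z = cmod z powr \<alpha>"

text \<open>
  \<open>weight_laplacian \<alpha>\<close> is the measure \<open>\<Delta>|z|\<^sup>\<alpha> = \<alpha>\<^sup>2|z|\<^sup>\<alpha>\<^sup>-\<^sup>2 dm(z)\<close>. The value of the density at \<open>0\<close>
  (which is \<open>0\<close>, because \<open>0 powr _ = 0\<close>) is irrelevant.
\<close>

definition weight_laplacian :: "real \<Rightarrow> complex measure" where
  "weight_laplacian \<alpha> = density lborel (\<lambda>z. ennreal (\<alpha>\<^sup>2 * cmod z powr (\<alpha> - 2)))"

definition radius_fun :: "real \<Rightarrow> complex \<Rightarrow> real" where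
  "radius_fun \<alpha> z = (THE r. r > 0 \<and> emeasure (weight_laplacian \<alpha>) (ball z r) = 1)"

definition fock_measure :: "real \<Rightarrow> complex measure" where
  "fock_measure \<alpha> =
     density lborel (\<lambda>z. ennreal (exp (- 2 * weight \<alpha> z) / (radius_fun \<alpha> z)\<^sup>2))"

definition fock_kernel :: "real \<Rightarrow> complex \<Rightarrow> complex \<Rightarrow> complex" where
  "fock_kernel \<alpha> = reproducing_kernel (fock_measure \<alpha>)"

text \<open>
  A point process with infinitely many points is represented by a measurable enumeration
  \<open>\<Lambda> 0, \<Lambda> 1, \<dots>\<close> of its points. Counts are taken in \<open>[0, \<infinity>]\<close>, so that an infinite count is
  \<open>\<infinity>\<close> and not \<open>0\<close>. A kernel of a determinantal process has nonnegative real determinants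
  (a reproducing kernel is Hermitian and positive semidefinite), so the integrand
  \<open>ennreal (Re (det \<dots>))\<close> below is just the determinant. For a
  \<open>\<sigma>\<close>-finite \<open>\<mu>\<close>, the integral over the product measure is the iterated integral.
\<close>

definition point_count :: "(nat \<Rightarrow> complex) \<Rightarrow> complex set \<Rightarrow> ennreal" where
  "point_count s B = emeasure (count_space UNIV) {k. s k \<in> B}"

definition determinantal_process ::
    "'w measure \<Rightarrow> (nat \<Rightarrow> 'w \<Rightarrow> complex) \<Rightarrow> (complex \<Rightarrow> complex \<Rightarrow> complex) \<Rightarrow> complex measure \<Rightarrow> bool"
  where
  "determinantal_process M \<Lambda> K \<mu> \<longleftrightarrow>
     (\<forall>k. \<Lambda> k \<in> borel_measurable M) \<and>
     (AE \<omega> in M. inj (\<lambda>k. \<Lambda> k \<omega>)) \<and>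
     (\<forall>(n::nat) B. (\<forall>i<n. B i \<in> sets borel \<and> bounded (B i)) \<and> disjoint_family_on B {..<n} \<longrightarrow>
        (\<integral>\<^sup>+ \<omega>. (\<Prod>i<n. point_count (\<lambda>k. \<Lambda> k \<omega>) (B i)) \<partial>M) =
        (\<integral>\<^sup>+ z \<in> (PiE {..<n} B).
            ennreal (Re (Determinant.det (Matrix.mat n n (\<lambda>(i, j). K (z i) (z j)))))
          \<partial>(PiM {..<n} (\<lambda>_. \<mu>))))"

definition hybrid_process ::
    "(nat \<Rightarrow> 'w \<Rightarrow> complex) \<Rightarrow> (nat \<Rightarrow> 'w \<Rightarrow> real) \<Rightarrow> nat \<Rightarrow> 'w \<Rightarrow> complex" where
  "hybrid_process \<Lambda> \<theta> k \<omega> = complex_of_real (cmod (\<Lambda> k \<omega>)) * cis (\<theta> k \<omega>)"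

definition separated :: "(nat \<Rightarrow> complex) \<Rightarrow> bool" where
  "separated s \<longleftrightarrow> (INF (j, k)\<in>{(j, k). j \<noteq> k}. cmod (s j - s k)) > 0"

end

theory Submission
  imports Defs "HOL-Real_Asymp.Real_Asymp"
begin

text \<open>
  The Fock measure is rotation invariant, so the normalized monomials \<open>e\<^sub>k\<close> diagonalize the kernel.
  Integrating the determinants by orthogonality shows that counts in disjoint shells have the same
  product moments as for independent moduli, one for each \<open>k\<close>, with law proportional to
  \<open>|z|\<^sup>2\<^sup>k d\<mu>\<close>. In the variable
  \<open>u = |z|\<^sup>\<alpha>\<close> the moduli have intensity bounded above and below (the radius function is comparable to
  \<open>|z| powr (1 - \<alpha> / 2)\<close>, and the sum over \<open>k\<close> is a Mittag-Leffler series comparable to the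
  exponential), while each individual modulus contributes a vanishing fraction.

  The moduli with \<open>m \<le> u < m + 2\<close> lie at distance about \<open>m powr (1 / \<alpha>)\<close> from the origin, so that for
  independent uniform angles the expected number of pairs of points at distance less than a constant is of order
  \<open>m powr (- 1 / \<alpha>)\<close>. For \<open>\<alpha> < 1\<close> this is summable: almost surely only finitely many pairs
  are close. For \<open>\<alpha> \<ge> 1\<close>, two moduli whose values of \<open>u\<close> differ by less than a constant are close, and
  disjoint shells give a divergent expected number of close pairs with nearly uncorrelated counts, so
  that by the second moment method close pairs exist almost surely, for every distance \<open>d > 0\<close>.
\<close>

section \<open>Lebesgue measure on the complex plane\<close>

text \<open>The correlation formula speaks only of disjoint bounded sets, and this shapes the proof.
  Independence of the moduli is never established: what is extracted from the determinants is an
  upper bound of every product moment over disjoint shells by the product of the masses, and for two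
  shells an almost matching lower bound. The square of a count is not of this kind. It is recovered
  by cutting the shell into ever finer cells and applying Fatou's lemma, which requires the moduli
  to be distinct; simplicity of the process only makes the points distinct, so coincidences of
  moduli have to be excluded separately.

  With second moments as the only tool, the case \<alpha> >= 1 rests on the Cauchy-Schwarz
  inequality E(T)^2 <= E(T^2) P(T > 0). There T counts only pairs taken from two neighbouring
  disjoint shells whose angles share a sector, so that its first two moments reduce to counts in
  disjoint shells. The variable u = |z|^\<alpha> is natural because \<nu>(D(0,r)) = 2 pi \<alpha>
  r^\<alpha>: in it the intensity is of constant order, whatever \<alpha> is.\<close>

lemma distr_Complex_lborel:
  "distr (lborel \<Otimes>\<^sub>M lborel) lborel (\<lambda>(x, y). Complex x y) = (lborel :: complex measure)"
proof -
  have m[measurable]: "(\<lambda>(x, y). Complex x y) \<in> borel_measurable (lborel \<Otimes>\<^sub>M lborel)"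
    by (simp add: complex_eq borel_measurable_complex_iff split_beta)
  show ?thesis
  proof (rule lborel_eqI[symmetric])
    fix l u :: complex
    assume lu: "\<And>b. b \<in> Basis \<Longrightarrow> inner l b \<le> inner u b"
    have le: "Re l \<le> Re u" "Im l \<le> Im u"
      using lu[of 1] lu[of \<i>] by (auto simp: Basis_complex_def)
    have eq: "(\<lambda>(x, y). Complex x y) -` box l u \<inter> space (lborel \<Otimes>\<^sub>M lborel)
        = {Re l<..<Re u} \<times> {Im l<..<Im u}"
      by (auto simp: box_def Basis_complex_def space_pair_measure)
    have "emeasure (distr (lborel \<Otimes>\<^sub>M lborel) lborel (\<lambda>(x, y). Complex x y)) (box l u)
       = emeasure (lborel \<Otimes>\<^sub>M lborel) ({Re l<..<Re u} \<times> {Im l<..<Im u})"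
      by (subst emeasure_distr) (auto simp: eq)
    also have "\<dots> = ennreal (Re u - Re l) * ennreal (Im u - Im l)"
      using le by (subst lborel.emeasure_pair_measure_Times) auto
    also have "\<dots> = ennreal (\<Prod>b\<in>Basis. inner (u - l) b)"
      using le by (simp add: Basis_complex_def ennreal_mult)
    finally show "emeasure (distr (lborel \<Otimes>\<^sub>M lborel) lborel (\<lambda>(x, y). Complex x y)) (box l u)
       = ennreal (\<Prod>b\<in>Basis. inner (u - l) b)" .
  qed simp
qed

lemma nn_integral_complex_lborel:
  fixes f :: "complex \<Rightarrow> ennreal"
  assumes [measurable]: "f \<in> borel_measurable borel"
  shows "(\<integral>\<^sup>+z. f z \<partial>lborel) = (\<integral>\<^sup>+x. \<integral>\<^sup>+y. f (Complex x y) \<partial>lborel \<partial>lborel)"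
proof -
  have m[measurable]: "(\<lambda>(x, y). Complex x y) \<in> borel_measurable (lborel \<Otimes>\<^sub>M lborel)"
    by (simp add: complex_eq borel_measurable_complex_iff split_beta)
  have "(\<integral>\<^sup>+z. f z \<partial>lborel) = (\<integral>\<^sup>+p. f (Complex (fst p) (snd p)) \<partial>(lborel \<Otimes>\<^sub>M lborel))"
    by (subst distr_Complex_lborel[symmetric], subst nn_integral_distr) (auto simp: split_beta)
  also have "\<dots> = (\<integral>\<^sup>+x. \<integral>\<^sup>+y. f (Complex x y) \<partial>lborel \<partial>lborel)"
    using m by (subst lborel.nn_integral_fst[symmetric]) (auto simp: split_beta)
  finally show ?thesis .
qed

lemma nn_integral_complex_lborel':
  fixes f :: "complex \<Rightarrow> ennreal"
  assumes [measurable]: "f \<in> borel_measurable borel"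
  shows "(\<integral>\<^sup>+z. f z \<partial>lborel) = (\<integral>\<^sup>+y. \<integral>\<^sup>+x. f (Complex x y) \<partial>lborel \<partial>lborel)"
proof -
  have m[measurable]: "(\<lambda>(x, y). Complex x y) \<in> borel_measurable (lborel \<Otimes>\<^sub>M lborel)"
    by (simp add: complex_eq borel_measurable_complex_iff split_beta)
  have "(\<lambda>(x, y). f (Complex x y)) \<in> borel_measurable (lborel \<Otimes>\<^sub>M lborel)"
    using measurable_compose[OF m, of f borel] by (simp add: split_beta)
  from lborel_pair.Fubini'[OF this] show ?thesis
    by (simp add: nn_integral_complex_lborel)
qed

lemma nn_integral_translate:
  fixes f :: "real \<Rightarrow> ennreal"
  assumes [measurable]: "f \<in> borel_measurable borel"
  shows "(\<integral>\<^sup>+x. f (x + c) \<partial>lborel) = (\<integral>\<^sup>+x. f x \<partial>lborel)"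
proof -
  have "(\<integral>\<^sup>+x. f x \<partial>lborel) = (\<integral>\<^sup>+x. f x \<partial>distr lborel borel ((+) c))"
    by (simp add: lborel_distr_plus)
  also have "\<dots> = (\<integral>\<^sup>+x. f (x + c) \<partial>lborel)"
    by (subst nn_integral_distr) (auto simp: add.commute)
  finally show ?thesis by simp
qed

definition shear_Re :: "real \<Rightarrow> complex \<Rightarrow> complex" where
  "shear_Re t z = Complex (Re z + t * Im z) (Im z)"

definition shear_Im :: "real \<Rightarrow> complex \<Rightarrow> complex" where
  "shear_Im t z = Complex (Re z) (Im z + t * Re z)"

lemma shear_measurable[measurable]:
  "shear_Re t \<in> borel_measurable borel" "shear_Im t \<in> borel_measurable borel"
  by (simp_all add: shear_Re_def[abs_def] shear_Im_def[abs_def] borel_measurable_complex_iff)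

lemma nn_integral_shear:
  fixes f :: "complex \<Rightarrow> ennreal"
  assumes [measurable]: "f \<in> borel_measurable borel"
  shows "(\<integral>\<^sup>+z. f (shear_Re t z) \<partial>lborel) = (\<integral>\<^sup>+z. f z \<partial>lborel)"
    and "(\<integral>\<^sup>+z. f (shear_Im t z) \<partial>lborel) = (\<integral>\<^sup>+z. f z \<partial>lborel)"
proof -
  have m: "(\<lambda>x. f (Complex x y)) \<in> borel_measurable borel"
    "(\<lambda>x. f (Complex y x)) \<in> borel_measurable borel" for y
    by (auto intro!: measurable_compose[OF _ assms] simp: borel_measurable_complex_iff)
  have m': "(\<lambda>z. f (Complex (Re z + t * Im z) (Im z))) \<in> borel_measurable borel"
    "(\<lambda>z. f (Complex (Re z) (Im z + t * Re z))) \<in> borel_measurable borel"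
    by (auto intro!: measurable_compose[OF _ assms] simp: borel_measurable_complex_iff)
  show "(\<integral>\<^sup>+z. f (shear_Re t z) \<partial>lborel) = (\<integral>\<^sup>+z. f z \<partial>lborel)"
    unfolding shear_Re_def nn_integral_complex_lborel'[OF assms] nn_integral_complex_lborel'[OF m'(1)]
    by (simp add: nn_integral_translate[OF m(1)])
  show "(\<integral>\<^sup>+z. f (shear_Im t z) \<partial>lborel) = (\<integral>\<^sup>+z. f z \<partial>lborel)"
    unfolding shear_Im_def nn_integral_complex_lborel[OF assms] nn_integral_complex_lborel[OF m'(2)]
    by (simp add: nn_integral_translate[OF m(2)])
qed

text \<open>The classical factorisation of a rotation matrix: a horizontal shear by - tan (t / 2), a
  vertical one by sin t, and the same horizontal one again. It breaks down exactly at half-turns,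
  where the tangent has a pole.\<close>

lemma cis_eq_shears:
  assumes "cos (t / 2) \<noteq> 0"
  shows "cis t * z = shear_Re (- tan (t / 2)) (shear_Im (sin t) (shear_Re (- tan (t / 2)) z))"
proof -
  define s c where "s = sin (t / 2)" and "c = cos (t / 2)"
  have c: "c \<noteq> 0" and sc: "s\<^sup>2 = 1 - c\<^sup>2"
    using assms sin_squared_eq[of "t / 2"] by (auto simp: s_def c_def)
  have S: "sin t = 2 * s * c" "cos t = 1 - 2 * s\<^sup>2"
    using sin_double[of "t / 2"] cos_double_sin[of "t / 2"] by (auto simp: s_def c_def)
  have T: "tan (t / 2) = s / c" by (simp add: tan_def s_def c_def)
  have s3: "s * s = 1 - c * c" using sc by (simp add: power2_eq_square)
  have s4: "s * (s * q) = (1 - c * c) * q" for q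
    using s3 by (simp add: mult.assoc[symmetric])
  show ?thesis
    unfolding shear_Re_def shear_Im_def complex_eq_iff using c
    by (simp add: S T field_simps power2_eq_square s3 s4)
qed

text \<open>
  A rotation is a product of three shears, and shears preserve Lebesgue measure by Fubini.
\<close>

lemma nn_integral_rotate:
  fixes f :: "complex \<Rightarrow> ennreal"
  assumes [measurable]: "f \<in> borel_measurable borel" and c: "cmod c = 1"
  shows "(\<integral>\<^sup>+z. f (c * z) \<partial>lborel) = (\<integral>\<^sup>+z. f z \<partial>lborel)"
proof -
  have *: "(\<integral>\<^sup>+z. g (cis t * z) \<partial>lborel) = (\<integral>\<^sup>+z. g z \<partial>lborel)"
    if "g \<in> borel_measurable borel" "cos (t / 2) \<noteq> 0" for g :: "complex \<Rightarrow> ennreal" and t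
    using that by (simp add: cis_eq_shears nn_integral_shear[where f="\<lambda>z. g (shear_Re _ (shear_Im _ z))"]
       nn_integral_shear[where f="\<lambda>z. g (shear_Re _ z)"] nn_integral_shear)
  define t where "t = Arg c"
  have t: "- pi < t" "t \<le> pi" "c = cis t"
    using Arg_bounded[of c] cis_Arg[of c] c by (force simp: t_def sgn_div_norm)+
  \<comment> \<open>\<open>t\<close> may be \<open>pi\<close>, where the factorisation is undefined.
    Two rotations by t / 2 avoid this, since t / 4 stays inside (- pi / 2, pi / 2).\<close>
  have "cos (t / 2 / 2) > 0"
    using t by (intro cos_gt_zero_pi) auto
  hence "(\<integral>\<^sup>+z. f (cis (t / 2) * (cis (t / 2) * z)) \<partial>lborel) = (\<integral>\<^sup>+z. f z \<partial>lborel)"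
    using *[of "\<lambda>z. f (cis (t / 2) * z)" "t / 2"] *[of f "t / 2"] by simp
  moreover have "cis (t / 2) * (cis (t / 2) * z) = c * z" for z
    by (subst t(3)) (simp only: mult.assoc[symmetric] cis_mult field_sum_of_halves)
  ultimately show ?thesis by simp
qed

section \<open>Polar coordinates in the variable |z|^a\<close>

lemma emeasure_lborel_complex_ball:
  "emeasure lborel (ball (z::complex) r) = ennreal (pi * (max 0 r)\<^sup>2)"
  by (cases "r \<ge> 0") (simp_all add: emeasure_ball unit_ball_vol_2 max_def ball_empty)

lemma nn_integral_lborel_powr_0:
  assumes "b > 0" "c \<ge> 0"
  shows "(\<integral>\<^sup>+x. ennreal (b * x powr (b - 1)) * indicator {0<..<c} x \<partial>lborel) = ennreal (c powr b)"
proof -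
  have "((\<lambda>x. x powr (b - 1)) has_integral (c powr (b - 1 + 1) / (b - 1 + 1))) {0..c}"
    using assms by (intro has_integral_powr_from_0) auto
  hence "((\<lambda>x. b * x powr (b - 1)) has_integral (b * (c powr b / b))) {0..c}"
    by (intro has_integral_mult_right) simp
  hence "((\<lambda>x. b * x powr (b - 1)) has_integral (c powr b)) {0..c}"
    using assms by simp
  hence "(\<integral>\<^sup>+x. ennreal (b * x powr (b - 1)) * indicator {0..c} x \<partial>lborel) = ennreal (c powr b)"
    using assms by (intro nn_integral_has_integral_lebesgue') auto
  moreover have "(\<integral>\<^sup>+x. ennreal (b * x powr (b - 1)) * indicator {0<..<c} x \<partial>lborel) =
     (\<integral>\<^sup>+x. ennreal (b * x powr (b - 1)) * indicator {0..c} x \<partial>lborel)"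
  proof (rule nn_integral_cong_AE)
    have "AE x in lborel. x \<noteq> 0 \<and> x \<noteq> c"
      using AE_lborel_singleton[of 0] AE_lborel_singleton[of c] by eventually_elim auto
    thus "AE x in lborel. ennreal (b * x powr (b - 1)) * indicator {0<..<c} x
       = ennreal (b * x powr (b - 1)) * indicator {0..c} x"
      by eventually_elim (auto simp: indicator_def)
  qed
  ultimately show ?thesis by simp
qed

text \<open>Two measures that agree and are finite on all half lines {..<x} are equal; on these the
  left one is the area of a disk of radius x^(1/a). The exponent is kept general because a = 1
  serves the Laplacian of the weight and a = \<alpha> the Fock measure.\<close>

lemma distr_cmod_powr:
  assumes a: "a > 0"
  shows "distr lborel borel (\<lambda>z. cmod z powr a) =
    density lborel (\<lambda>u. ennreal (2 * pi / a * u powr (2 / a - 1)) * indicator {0<..} u)" (is "?L = ?R")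
proof -
  have L: "emeasure ?L {..<x} = ennreal (pi * max 0 x powr (2 / a))" for x
  proof -
    have eq: "(\<lambda>z. cmod z powr a) -` {..<x} = ball (0::complex) (max 0 x powr (1 / a))"
    proof (cases "x \<le> 0")
      case True
      have "\<not> cmod z powr a < x" for z using True powr_ge_zero[of "cmod z" a] by linarith
      thus ?thesis using True a by auto
    next
      case False
      have "cmod z powr a < x \<longleftrightarrow> cmod z < x powr (1 / a)" for z
      proof -
        have "cmod z < x powr (1 / a) \<longleftrightarrow> cmod z powr a < (x powr (1 / a)) powr a"
          using a False powr_less_cancel2[of a "cmod z" "x powr (1/a)"]
             powr_less_mono2[of a "cmod z" "x powr (1/a)"] by fastforce
        thus ?thesis using a False by (simp add: powr_powr)
      qed
      thus ?thesis using False by (auto simp: max_def)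
    qed
    have "(max 0 x powr (1 / a))\<^sup>2 = max 0 x powr (2 / a)"
      by (cases "max 0 x = 0") (auto simp flip: powr_realpow simp: powr_powr power2_eq_square powr_add[symmetric])
    thus ?thesis
      by (subst emeasure_distr) (auto simp: eq emeasure_lborel_complex_ball)
  qed
  have R: "emeasure ?R {..<x} = ennreal (pi * max 0 x powr (2 / a))" for x
  proof -
    have "emeasure ?R {..<x} = (\<integral>\<^sup>+u. ennreal pi * (ennreal (2 / a * u powr (2 / a - 1)) * indicator {0<..<max 0 x} u) \<partial>lborel)"
      using a by (subst emeasure_density)
        (auto intro!: nn_integral_cong simp: indicator_def ennreal_mult'[symmetric] field_simps)
    also have "\<dots> = ennreal pi * ennreal (max 0 x powr (2 / a))"
      using a by (subst nn_integral_cmult, simp, subst nn_integral_lborel_powr_0) auto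
    finally show ?thesis by (simp add: ennreal_mult)
  qed
  show ?thesis
  proof (rule measure_eqI_generator_eq[where E="range lessThan" and \<Omega>=UNIV and A="\<lambda>i. {..<real i}"])
    show "Int_stable (range (lessThan :: real \<Rightarrow> _))"
    proof (unfold Int_stable_def, safe)
      fix a b :: real
      have "{..<a} \<inter> {..<b} = {..<min a b}" by auto
      thus "{..<a} \<inter> {..<b} \<in> range lessThan" by blast
    qed
    show "sets ?L = sigma_sets UNIV (range lessThan)" "sets ?R = sigma_sets UNIV (range lessThan)"
      by (simp, subst borel_Iio, simp add: sets_measure_of)+
    show "(\<Union>i. {..<real i}) = UNIV"
      using reals_Archimedean2 by auto
    show "emeasure ?L X = emeasure ?R X" if "X \<in> range lessThan" for X
      using that by (elim rangeE) (simp only: L R)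
    show "emeasure ?L {..<real i} \<noteq> \<infinity>" for i
      by (simp only: L) simp
  qed auto
qed

lemma nn_integral_cmod_powr:
  fixes h :: "real \<Rightarrow> ennreal"
  assumes "a > 0" and [measurable]: "h \<in> borel_measurable borel"
  shows "(\<integral>\<^sup>+z. h (cmod z powr a) \<partial>lborel) =
    (\<integral>\<^sup>+u. ennreal (2 * pi / a * u powr (2 / a - 1)) * indicator {0<..} u * h u \<partial>lborel)"
proof -
  have "(\<integral>\<^sup>+z. h (cmod z powr a) \<partial>lborel) = (\<integral>\<^sup>+u. h u \<partial>distr lborel borel (\<lambda>z. cmod z powr a))"
    by (subst nn_integral_distr) auto
  also have "\<dots> = (\<integral>\<^sup>+u. ennreal (2 * pi / a * u powr (2 / a - 1)) * indicator {0<..} u * h u \<partial>lborel)"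
    using assms by (subst distr_cmod_powr, simp, subst nn_integral_density) auto
  finally show ?thesis .
qed

section \<open>The radius function\<close>

lemma emeasure_weight_laplacian:
  assumes [measurable]: "A \<in> sets borel"
  shows "emeasure (weight_laplacian \<alpha>) A = (\<integral>\<^sup>+z. ennreal (\<alpha>\<^sup>2 * cmod z powr (\<alpha> - 2)) * indicator A z \<partial>lborel)"
  unfolding weight_laplacian_def by (subst emeasure_density) auto

lemma sets_weight_laplacian [simp, measurable_cong]: "sets (weight_laplacian \<alpha>) = sets borel"
  by (simp add: weight_laplacian_def)

lemma weight_laplacian_ball_0:
  assumes "\<alpha> > 0" "r \<ge> 0"
  shows "emeasure (weight_laplacian \<alpha>) (ball 0 r) = ennreal (2 * pi * \<alpha> * r powr \<alpha>)"
proof -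
  have "emeasure (weight_laplacian \<alpha>) (ball 0 r)
     = (\<integral>\<^sup>+z. ennreal (\<alpha>\<^sup>2 * (cmod z powr 1) powr (\<alpha> - 2)) * indicator {..<r} (cmod z powr 1) \<partial>lborel)"
    by (subst emeasure_weight_laplacian) (auto intro!: nn_integral_cong simp: indicator_def)
  also have "\<dots> = (\<integral>\<^sup>+u. ennreal (2 * pi / 1 * u powr (2 / 1 - 1)) * indicator {0<..} u *
     (ennreal (\<alpha>\<^sup>2 * u powr (\<alpha> - 2)) * indicator {..<r} u) \<partial>lborel)"
    by (rule nn_integral_cmod_powr) auto
  also have "\<dots> = (\<integral>\<^sup>+u. ennreal (2 * pi * \<alpha>) * (ennreal (\<alpha> * u powr (\<alpha> - 1)) * indicator {0<..<r} u) \<partial>lborel)"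
  proof (rule nn_integral_cong)
    fix u :: real
    have "u powr (\<alpha> - 1) = u * u powr (\<alpha> - 2)" if "u > 0"
      using that powr_mult_base[of u "\<alpha> - 2"] by simp
    thus "ennreal (2 * pi / 1 * u powr (2 / 1 - 1)) * indicator {0<..} u *
     (ennreal (\<alpha>\<^sup>2 * u powr (\<alpha> - 2)) * indicator {..<r} u) =
      ennreal (2 * pi * \<alpha>) * (ennreal (\<alpha> * u powr (\<alpha> - 1)) * indicator {0<..<r} u)"
      using assms by (auto simp: indicator_def ennreal_mult'[symmetric] power2_eq_square mult_ac)
  qed
  also have "\<dots> = ennreal (2 * pi * \<alpha>) * ennreal (r powr \<alpha>)"
    using assms by (subst nn_integral_cmult, simp, subst nn_integral_lborel_powr_0) auto
  finally show ?thesis using assms by (simp add: ennreal_mult)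
qed

lemma weight_laplacian_bounded_finite:
  assumes "\<alpha> > 0" "bounded A"
  shows "emeasure (weight_laplacian \<alpha>) A < \<infinity>"
proof -
  obtain r where r: "r > 0" "A \<subseteq> ball 0 r" using assms(2) bounded_subset_ballD by blast
  have "emeasure (weight_laplacian \<alpha>) A \<le> emeasure (weight_laplacian \<alpha>) (ball 0 r)"
    by (intro emeasure_mono r) auto
  also have "\<dots> < \<infinity>" using weight_laplacian_ball_0[OF assms(1), of r] r by simp
  finally show ?thesis .
qed

lemma emeasure_lborel_sphere: "emeasure lborel (sphere (z::complex) r) = 0"
proof (cases "r \<ge> 0")
  case True
  have "sphere z r = cball z r - ball z r" by auto
  hence "emeasure lborel (sphere z r) = emeasure lborel (cball z r) - emeasure lborel (ball z r)"
    by (simp only:, subst emeasure_Diff) (auto simp: emeasure_lborel_complex_ball)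
  thus ?thesis using True by (simp add: emeasure_lborel_complex_ball emeasure_cball unit_ball_vol_2 max_def)
next
  case False
  hence "sphere z r = {}" by auto
  thus ?thesis by simp
qed

lemma weight_laplacian_sphere: "emeasure (weight_laplacian \<alpha>) (sphere z r) = 0"
proof -
  have "sphere z r \<in> null_sets lborel" using emeasure_lborel_sphere[of z r] by (auto simp: null_sets_def)
  hence "AE w in lborel. w \<notin> sphere z r" by (rule AE_not_in)
  hence "AE w in lborel. ennreal (\<alpha>\<^sup>2 * cmod w powr (\<alpha> - 2)) * indicator (sphere z r) w = 0"
    by eventually_elim simp
  hence "(\<integral>\<^sup>+w. ennreal (\<alpha>\<^sup>2 * cmod w powr (\<alpha> - 2)) * indicator (sphere z r) w \<partial>lborel) = (\<integral>\<^sup>+w. 0 \<partial>(lborel :: complex measure))"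
    by (rule nn_integral_cong_AE)
  thus ?thesis by (subst emeasure_weight_laplacian) simp_all
qed

lemma weight_laplacian_open_pos:
  assumes "\<alpha> > 0" "open U" "U \<noteq> {}"
  shows "emeasure (weight_laplacian \<alpha>) U > 0"
proof (rule ccontr)
  assume "\<not> ?thesis"
  hence "emeasure (weight_laplacian \<alpha>) U = 0" by (simp add: zero_less_iff_neq_zero)
  hence "AE z in lborel. ennreal (\<alpha>\<^sup>2 * cmod z powr (\<alpha> - 2)) * indicator U z = 0"
    using assms by (subst (asm) emeasure_weight_laplacian) (auto simp: nn_integral_0_iff_AE)
  moreover have "AE z in lborel. (z::complex) \<noteq> 0" by (rule AE_lborel_singleton)
  ultimately have "AE z in lborel. z \<notin> U"
  proof eventually_elim
    case (elim z)
    hence "\<alpha>\<^sup>2 * cmod z powr (\<alpha> - 2) > 0" using assms(1) by simp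
    thus ?case using elim by (auto simp: indicator_def ennreal_eq_0_iff not_le split: if_splits)
  qed
  hence "emeasure lborel U = 0" using assms(2)
    by (subst (asm) AE_iff_measurable[of U]) auto
  moreover obtain z r where zr: "r > 0" "ball z r \<subseteq> U" using assms open_contains_ball by blast
  hence "emeasure lborel (ball z r) \<le> emeasure lborel U" using assms by (intro emeasure_mono) auto
  moreover have "emeasure lborel (ball z r) > 0" using zr by (simp add: emeasure_lborel_complex_ball)
  ultimately show False by simp
qed

text \<open>The larger ball minus the closed smaller one is open and nonempty, so it has positive
  mass. Strictness makes the radius of mass 1 unique, which the definite description in
  \<open>radius_fun\<close> requires.\<close>

lemma weight_laplacian_ball_strict_mono:
  assumes "\<alpha> > 0" "0 < r" "r < s"
  shows "emeasure (weight_laplacian \<alpha>) (ball z r) < emeasure (weight_laplacian \<alpha>) (ball z s)"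
proof -
  have "z + of_real ((r + s) / 2) \<in> ball z s - cball z r" using assms
    by (auto simp: dist_norm simp del: of_real_add of_real_divide)
  hence "emeasure (weight_laplacian \<alpha>) (ball z s - cball z r) > 0"
    using assms by (intro weight_laplacian_open_pos) auto
  moreover have "emeasure (weight_laplacian \<alpha>) (ball z s) =
     emeasure (weight_laplacian \<alpha>) (ball z r) + emeasure (weight_laplacian \<alpha>) (ball z s - ball z r)"
    using assms by (subst plus_emeasure) (auto intro!: arg_cong2[where f=emeasure])
  moreover have "emeasure (weight_laplacian \<alpha>) (ball z s - cball z r) \<le> emeasure (weight_laplacian \<alpha>) (ball z s - ball z r)"
    by (intro emeasure_mono) auto
  moreover have "emeasure (weight_laplacian \<alpha>) (ball z r) \<noteq> \<infinity>"
    using weight_laplacian_bounded_finite[OF assms(1), of "ball z r"] by auto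
  ultimately show ?thesis
    using ennreal_add_left_cancel_less[of "emeasure (weight_laplacian \<alpha>) (ball z r)" 0] by auto
qed

lemma weight_laplacian_cball:
  "emeasure (weight_laplacian \<alpha>) (cball z r) = emeasure (weight_laplacian \<alpha>) (ball z r)"
proof -
  have "cball z r = ball z r \<union> sphere z r" by auto
  thus ?thesis by (simp only:, subst emeasure_Un_null_set)
     (auto simp: null_sets_def weight_laplacian_sphere)
qed

text \<open>Intermediate value argument for the mass as a function of the radius. Open balls give
  continuity from the left, closed balls from the right, and both have the same mass because circles
  are null sets. The radius is the supremum of all radii of mass at most 1.\<close>

lemma weight_laplacian_radius_exists:
  assumes "\<alpha> > 0"
  shows "\<exists>r>0. emeasure (weight_laplacian \<alpha>) (ball z r) = 1"
proof -
  let ?\<nu> = "weight_laplacian \<alpha>"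
  define F where "F = (\<lambda>r. measure ?\<nu> (ball z r))"
  have fin: "emeasure ?\<nu> (ball z r) \<noteq> \<infinity>" "emeasure ?\<nu> (cball z r) \<noteq> \<infinity>" for r
    using weight_laplacian_bounded_finite[OF assms, of "ball z r"]
      weight_laplacian_bounded_finite[OF assms, of "cball z r"] by auto
  have Fc: "F r = measure ?\<nu> (cball z r)" for r
    by (simp add: F_def measure_def weight_laplacian_cball)
  have mono: "F r \<le> F s" if "r \<le> s" for r s
    unfolding F_def using that fin by (intro measure_mono_fmeasurable) (auto simp: fmeasurable_def less_top)
  have left: "(\<lambda>n. F (r - 1 / Suc n)) \<longlonglongrightarrow> F r" for r
  proof -
    have "(\<Union>n. ball z (r - 1 / Suc n)) = ball z r"
    proof (intro equalityI subsetI)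
      fix w :: complex assume "w \<in> ball z r"
      then obtain n where "1 / Suc n < r - dist z w" using nat_approx_posE[of "r - dist z w"] by auto
      thus "w \<in> (\<Union>n. ball z (r - 1 / Suc n))" by (auto intro!: exI[of _ n])
    next
      fix w :: complex assume "w \<in> (\<Union>n. ball z (r - 1 / Suc n))"
      then obtain n where "dist z w < r - 1 / Suc n" by auto
      also have "\<dots> \<le> r" by simp
      finally show "w \<in> ball z r" by simp
    qed
    moreover have "(\<lambda>n. measure ?\<nu> (ball z (r - 1 / Suc n))) \<longlonglongrightarrow> measure ?\<nu> (\<Union>n. ball z (r - 1 / Suc n))"
    proof (rule Lim_measure_incseq)
      show "incseq (\<lambda>n. ball z (r - 1 / real (Suc n)))"
        by (auto simp: incseq_def intro!: subset_ball frac_le)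
    qed (use calculation fin in auto)
    ultimately show ?thesis by (simp add: F_def)
  qed
  have right: "(\<lambda>n. F (r + 1 / Suc n)) \<longlonglongrightarrow> F r" for r
  proof -
    have "(\<Inter>n. cball z (r + 1 / Suc n)) = cball z r"
    proof (intro equalityI subsetI)
      fix w :: complex assume w: "w \<in> (\<Inter>n. cball z (r + 1 / Suc n))"
      show "w \<in> cball z r"
      proof (rule ccontr)
        assume "w \<notin> cball z r"
        then obtain n where "1 / Suc n < dist z w - r" using nat_approx_posE[of "dist z w - r"] by auto
        moreover have "w \<in> cball z (r + 1 / Suc n)" using w by blast
        ultimately show False by auto
      qed
    next
      fix w :: complex assume w: "w \<in> cball z r"
      have "dist z w \<le> r + 1 / Suc n" for n
        using w by (simp add: add_increasing2)
      thus "w \<in> (\<Inter>n. cball z (r + 1 / Suc n))" by auto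
    qed
    moreover have "(\<lambda>n. measure ?\<nu> (cball z (r + 1 / Suc n))) \<longlonglongrightarrow> measure ?\<nu> (\<Inter>n. cball z (r + 1 / Suc n))"
    proof (rule Lim_measure_decseq)
      show "decseq (\<lambda>n. cball z (r + 1 / real (Suc n)))"
        by (auto simp: decseq_def intro!: subset_cball frac_le)
    qed (use fin in auto)
    ultimately show ?thesis by (simp add: Fc)
  qed
  define S where "S = {r. F r \<le> 1}"
  \<comment> \<open>The disk about 0 of radius (1 / (2 pi \<alpha>))^(1 / \<alpha>) has mass exactly
    1. \<open>R\<close> is large enough for the ball about \<open>z\<close> to contain a strictly
    larger disk about 0.\<close>
  define R where "R = 1 + cmod z + (1 / (2 * pi * \<alpha>)) powr (1 / \<alpha>) + 1"
  have "F R > 1"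
  proof -
    have "ball 0 ((1 / (2 * pi * \<alpha>)) powr (1 / \<alpha>) + 1) \<subseteq> ball z R"
    proof
      fix w :: complex assume "w \<in> ball 0 ((1 / (2 * pi * \<alpha>)) powr (1 / \<alpha>) + 1)"
      moreover have "dist z w \<le> cmod z + cmod w" by (simp add: dist_norm norm_triangle_ineq4)
      ultimately show "w \<in> ball z R" by (auto simp: R_def)
    qed
    hence "measure ?\<nu> (ball 0 ((1 / (2 * pi * \<alpha>)) powr (1 / \<alpha>) + 1)) \<le> F R"
      unfolding F_def using fin by (intro measure_mono_fmeasurable) (auto simp: fmeasurable_def less_top)
    moreover have "measure ?\<nu> (ball 0 ((1 / (2 * pi * \<alpha>)) powr (1 / \<alpha>) + 1))
       = 2 * pi * \<alpha> * ((1 / (2 * pi * \<alpha>)) powr (1 / \<alpha>) + 1) powr \<alpha>"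
      using assms by (simp add: measure_def weight_laplacian_ball_0)
    moreover have "((1 / (2 * pi * \<alpha>)) powr (1 / \<alpha>) + 1) powr \<alpha> > ((1 / (2 * pi * \<alpha>)) powr (1 / \<alpha>)) powr \<alpha>"
      using assms by (intro powr_less_mono2) auto
    hence "((1 / (2 * pi * \<alpha>)) powr (1 / \<alpha>) + 1) powr \<alpha> > 1 / (2 * pi * \<alpha>)"
      using assms by (simp add: powr_powr)
    hence "2 * pi * \<alpha> * ((1 / (2 * pi * \<alpha>)) powr (1 / \<alpha>) + 1) powr \<alpha> > 2 * pi * \<alpha> * (1 / (2 * pi * \<alpha>))"
      using assms by (intro mult_strict_left_mono) auto
    ultimately show ?thesis using assms by (simp add: field_simps)
  qed
  have F0: "F 0 = 0" by (simp add: F_def)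
  have bdd: "bdd_above S"
  proof (rule bdd_aboveI[of _ R])
    fix s assume "s \<in> S"
    thus "s \<le> R" using mono[of R s] \<open>F R > 1\<close> by (cases "s \<le> R") (auto simp: S_def)
  qed
  have ne: "0 \<in> S" using F0 by (simp add: S_def)
  define r where "r = Sup S"
  have "F r \<le> 1"
  proof (rule LIMSEQ_le_const2[OF left], intro exI allI impI)
    fix n
    have "r - 1 / Suc n < Sup S" by (simp add: r_def)
    then obtain s where "s \<in> S" "r - 1 / Suc n < s"
      using less_cSup_iff[of S] bdd ne by blast
    thus "F (r - 1 / Suc n) \<le> 1" using mono[of "r - 1 / Suc n" s] by (auto simp: S_def)
  qed
  moreover have "F r \<ge> 1"
  proof (rule LIMSEQ_le_const[OF right], intro exI allI impI)
    fix n
    have "r + 1 / Suc n \<notin> S"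
    proof
      assume "r + 1 / Suc n \<in> S"
      hence "r + 1 / Suc n \<le> r" unfolding r_def using bdd by (rule cSup_upper)
      thus False by simp
    qed
    thus "F (r + 1 / Suc n) \<ge> 1" by (simp add: S_def)
  qed
  ultimately have Fr: "F r = 1" by simp
  have "r > 0"
  proof (rule ccontr)
    assume "\<not> r > 0"
    hence "F r \<le> F 0" by (intro mono) simp
    thus False using Fr F0 by simp
  qed
  moreover have "emeasure ?\<nu> (ball z r) = 1"
    using Fr fin(1)[of r] unfolding F_def by (simp add: emeasure_eq_ennreal_measure)
  ultimately show ?thesis by blast
qed

lemma radius_fun:
  assumes "\<alpha> > 0"
  shows "radius_fun \<alpha> z > 0" "emeasure (weight_laplacian \<alpha>) (ball z (radius_fun \<alpha> z)) = 1"
proof -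
  obtain r where r: "r > 0" "emeasure (weight_laplacian \<alpha>) (ball z r) = 1"
    using weight_laplacian_radius_exists[OF assms] by blast
  have "\<exists>!r. r > 0 \<and> emeasure (weight_laplacian \<alpha>) (ball z r) = 1"
  proof (rule ex1I[of _ r])
    fix s assume s: "s > 0 \<and> emeasure (weight_laplacian \<alpha>) (ball z s) = 1"
    show "s = r"
      using weight_laplacian_ball_strict_mono[OF assms, of r s z]
        weight_laplacian_ball_strict_mono[OF assms, of s r z] r s by (cases r s rule: linorder_cases) auto
  qed (use r in auto)
  from theI'[OF this] show "radius_fun \<alpha> z > 0" "emeasure (weight_laplacian \<alpha>) (ball z (radius_fun \<alpha> z)) = 1"
    by (auto simp: radius_fun_def)
qed

lemma radius_fun_ge:
  assumes "\<alpha> > 0" "emeasure (weight_laplacian \<alpha>) (ball z r) \<le> 1"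
  shows "r \<le> radius_fun \<alpha> z"
  using weight_laplacian_ball_strict_mono[OF assms(1), of "radius_fun \<alpha> z" r z] radius_fun[OF assms(1), of z]
    assms(2) by force

lemma radius_fun_le:
  assumes "\<alpha> > 0" "emeasure (weight_laplacian \<alpha>) (ball z r) \<ge> 1"
  shows "radius_fun \<alpha> z \<le> r"
proof (cases "r > 0")
  case True
  thus ?thesis
  using weight_laplacian_ball_strict_mono[OF assms(1), of r "radius_fun \<alpha> z" z] radius_fun[OF assms(1), of z]
    assms(2) by force
next
  case False
  hence "ball z r = {}" by (simp add: ball_empty)
  thus ?thesis using assms by (simp del: ball_eq_empty)
qed

text \<open>The ball about \<open>w\<close> of the radius on the left lies inside the ball about
  \<open>z\<close> of mass 1. Together with its mirror image this makes the radius function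
  1-Lipschitz, hence continuous and measurable.\<close>

lemma radius_fun_lipschitz:
  assumes "\<alpha> > 0"
  shows "radius_fun \<alpha> z - dist z w \<le> radius_fun \<alpha> w"
proof (rule radius_fun_ge[OF assms])
  have "ball w (radius_fun \<alpha> z - dist z w) \<subseteq> ball z (radius_fun \<alpha> z)"
  proof
    fix x assume "x \<in> ball w (radius_fun \<alpha> z - dist z w)"
    thus "x \<in> ball z (radius_fun \<alpha> z)" using dist_triangle[of z x w] by auto
  qed
  hence "emeasure (weight_laplacian \<alpha>) (ball w (radius_fun \<alpha> z - dist z w))
    \<le> emeasure (weight_laplacian \<alpha>) (ball z (radius_fun \<alpha> z))"
    by (intro emeasure_mono) auto
  thus "emeasure (weight_laplacian \<alpha>) (ball w (radius_fun \<alpha> z - dist z w)) \<le> 1"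
    using radius_fun[OF assms] by simp
qed

lemma continuous_on_radius_fun:
  assumes "\<alpha> > 0"
  shows "continuous_on S (radius_fun \<alpha>)"
proof -
  have "1-lipschitz_on S (radius_fun \<alpha>)"
  proof (rule lipschitz_onI)
    fix z w show "dist (radius_fun \<alpha> z) (radius_fun \<alpha> w) \<le> 1 * dist z w"
      using radius_fun_lipschitz[OF assms, of z w] radius_fun_lipschitz[OF assms, of w z]
      by (simp add: dist_real_def dist_commute abs_le_iff)
  qed simp
  thus ?thesis by (rule lipschitz_on_continuous_on)
qed

lemma radius_fun_rotate:
  assumes "\<alpha> > 0" "cmod c = 1"
  shows "radius_fun \<alpha> (c * z) = radius_fun \<alpha> z"
proof -
  have "emeasure (weight_laplacian \<alpha>) (ball (c * z) r) = emeasure (weight_laplacian \<alpha>) (ball z r)" for r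
  proof -
    have ind: "indicator (ball (c * z) r) (c * w) = (indicator (ball z r) w :: ennreal)" for w
      using assms(2) by (auto simp: indicator_def dist_norm norm_mult right_diff_distrib[symmetric])
    have [measurable]: "ball (c * z) r \<in> sets borel" by simp
    have "emeasure (weight_laplacian \<alpha>) (ball (c * z) r) =
      (\<integral>\<^sup>+w. ennreal (\<alpha>\<^sup>2 * cmod (c * w) powr (\<alpha> - 2)) * indicator (ball (c * z) r) (c * w) \<partial>lborel)"
      by (subst emeasure_weight_laplacian, simp, subst nn_integral_rotate[OF _ assms(2), symmetric]) auto
    also have "\<dots> = emeasure (weight_laplacian \<alpha>) (ball z r)"
      using assms(2) by (subst emeasure_weight_laplacian) (auto simp: ind norm_mult)
    finally show ?thesis .
  qed
  thus ?thesis by (simp add: radius_fun_def)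
qed

lemma radius_fun_cmod:
  assumes "\<alpha> > 0"
  shows "radius_fun \<alpha> (complex_of_real (cmod z)) = radius_fun \<alpha> z"
  using radius_fun_rotate[OF assms, of "cis (Arg z)" "complex_of_real (cmod z)"] rcis_cmod_Arg[of z]
  by (simp add: rcis_def mult.commute)

section \<open>Size of the radius function far from the origin\<close>

lemma weight_laplacian_ball_bounds:
  assumes "\<alpha> > 0" "0 \<le> r" "r \<le> cmod z / 2"
  shows "emeasure (weight_laplacian \<alpha>) (ball z r)
           \<le> ennreal (\<alpha>\<^sup>2 * max ((1/2) powr (\<alpha> - 2)) ((3/2) powr (\<alpha> - 2)) * cmod z powr (\<alpha> - 2) * (pi * r\<^sup>2))" (is ?upper)
    and "emeasure (weight_laplacian \<alpha>) (ball z r)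
           \<ge> ennreal (\<alpha>\<^sup>2 * min ((1/2) powr (\<alpha> - 2)) ((3/2) powr (\<alpha> - 2)) * cmod z powr (\<alpha> - 2) * (pi * r\<^sup>2))" (is ?lower)
proof -
  define A where "A = max ((1/2) powr (\<alpha> - 2)) ((3/2) powr (\<alpha> - 2))"
  define a where "a = min ((1/2) powr (\<alpha> - 2)) ((3/2) powr (\<alpha> - 2))"
  have Aa: "A \<ge> 0" "a \<ge> 0" by (auto simp: A_def a_def le_max_iff_disj)
  have bounds: "a * cmod z powr (\<alpha> - 2) \<le> cmod w powr (\<alpha> - 2)" "cmod w powr (\<alpha> - 2) \<le> A * cmod z powr (\<alpha> - 2)"
    if w: "w \<in> ball z r" for w
  proof -
    have "cmod z > 0" using w assms by (auto intro: le_less_trans[OF zero_le_dist] simp: zero_less_norm_iff)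
    define t where "t = cmod w / cmod z"
    have "cmod z - cmod w \<le> cmod z / 2" "cmod w - cmod z \<le> cmod z / 2"
      using w assms norm_triangle_ineq2[of z w] norm_triangle_ineq2[of w z]
      by (auto simp: dist_norm norm_minus_commute)
    hence t: "1/2 \<le> t" "t \<le> 3/2" using \<open>cmod z > 0\<close> by (auto simp: t_def field_simps)
    have wz: "cmod w = t * cmod z" using \<open>cmod z > 0\<close> by (simp add: t_def)
    have "a \<le> t powr (\<alpha> - 2) \<and> t powr (\<alpha> - 2) \<le> A"
    proof (cases "\<alpha> \<ge> 2")
      case True
      thus ?thesis using t powr_mono2[of "\<alpha> - 2" "1/2" t] powr_mono2[of "\<alpha> - 2" t "3/2"]
        by (auto simp: a_def A_def min_le_iff_disj le_max_iff_disj)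
    next
      case False
      thus ?thesis using t powr_mono2'[of "\<alpha> - 2" "1/2" t] powr_mono2'[of "\<alpha> - 2" t "3/2"]
        by (auto simp: a_def A_def min_le_iff_disj le_max_iff_disj)
    qed
    moreover have "cmod w powr (\<alpha> - 2) = t powr (\<alpha> - 2) * cmod z powr (\<alpha> - 2)"
      using t by (simp add: wz powr_mult)
    ultimately show "a * cmod z powr (\<alpha> - 2) \<le> cmod w powr (\<alpha> - 2)" "cmod w powr (\<alpha> - 2) \<le> A * cmod z powr (\<alpha> - 2)"
      by (auto intro: mult_right_mono)
  qed
  have const: "(\<integral>\<^sup>+w. ennreal (\<alpha>\<^sup>2 * (b * cmod z powr (\<alpha> - 2))) * indicator (ball z r) w \<partial>lborel)
     = ennreal (\<alpha>\<^sup>2 * b * cmod z powr (\<alpha> - 2) * (pi * r\<^sup>2))" if "b \<ge> 0" for b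
    using that assms by (subst nn_integral_cmult_indicator)
      (auto simp: emeasure_lborel_complex_ball ennreal_mult'[symmetric] mult_ac)
  show ?upper
    unfolding A_def[symmetric] const[OF Aa(1), symmetric]
    by (subst emeasure_weight_laplacian, simp, intro nn_integral_mono)
       (auto simp: indicator_def simp del: mem_ball intro!: ennreal_leI mult_left_mono bounds)
  show ?lower
    unfolding a_def[symmetric] const[OF Aa(2), symmetric]
    by (subst emeasure_weight_laplacian, simp, intro nn_integral_mono)
       (auto simp: indicator_def simp del: mem_ball intro!: ennreal_leI mult_left_mono bounds)
qed

text \<open>On a ball of radius at most |z| / 2 the density of \<nu> is comparable to |z|^(\<alpha>
  - 2), so a ball of mass 1 has squared radius comparable to |z|^(2 - \<alpha>). The candidates with
  the two extreme constants are compared with the true radius.\<close>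

lemma radius_fun_asymptotics:
  assumes \<alpha>: "\<alpha> > 0"
  obtains c C R where "c > 0" "C > 0" "R > 0"
    "\<And>z. cmod z \<ge> R \<Longrightarrow> c * cmod z powr (\<alpha> - 2) \<le> 1 / (radius_fun \<alpha> z)\<^sup>2"
    "\<And>z. cmod z \<ge> R \<Longrightarrow> 1 / (radius_fun \<alpha> z)\<^sup>2 \<le> C * cmod z powr (\<alpha> - 2)"
proof -
  define C where "C = pi * \<alpha>\<^sup>2 * max ((1/2) powr (\<alpha> - 2)) ((3/2) powr (\<alpha> - 2))"
  define c where "c = pi * \<alpha>\<^sup>2 * min ((1/2) powr (\<alpha> - 2)) ((3/2) powr (\<alpha> - 2))"
  \<comment> \<open>The radius r with c |z|^(\<alpha> - 2) r^2 = 1 is at most |z| / 2 precisely when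
    |z|^\<alpha> >= 4 / c.\<close>
  define R where "R = (4 / c) powr (1 / \<alpha>)"
  have pos: "c > 0" "C > 0" "R > 0" "c \<le> C"
    using \<alpha> by (auto simp: C_def c_def R_def min_def max_def)
  have key: "sqrt (1 / (b * cmod z powr (\<alpha> - 2))) \<le> cmod z / 2" "cmod z > 0" if "b \<ge> c" "cmod z \<ge> R" for b z
  proof -
    have z: "cmod z > 0" using that pos by linarith
    have "4 / c = R powr \<alpha>" using \<alpha> pos by (simp add: R_def powr_powr)
    also have "\<dots> \<le> cmod z powr \<alpha>" using that \<alpha> pos by (intro powr_mono2) auto
    also have "\<dots> = (cmod z)\<^sup>2 * cmod z powr (\<alpha> - 2)"
      using z by (simp add: powr_diff powr_numeral)
    finally have "4 \<le> c * ((cmod z)\<^sup>2 * cmod z powr (\<alpha> - 2))" using pos by (simp add: field_simps)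
    also have "\<dots> \<le> b * ((cmod z)\<^sup>2 * cmod z powr (\<alpha> - 2))" using that by (intro mult_right_mono) auto
    finally have "1 / (b * cmod z powr (\<alpha> - 2)) \<le> (cmod z / 2)\<^sup>2"
      using z that pos by (simp add: field_simps power2_eq_square)
    thus "sqrt (1 / (b * cmod z powr (\<alpha> - 2))) \<le> cmod z / 2" by (intro real_le_lsqrt) auto
    show "cmod z > 0" by fact
  qed
  show thesis
  proof (rule that[OF pos(1-3)])
    fix z assume z: "cmod z \<ge> R"
    define r where "r = sqrt (1 / (c * cmod z powr (\<alpha> - 2)))"
    define s where "s = sqrt (1 / (C * cmod z powr (\<alpha> - 2)))"
    have r2: "r\<^sup>2 = 1 / (c * cmod z powr (\<alpha> - 2))" "s\<^sup>2 = 1 / (C * cmod z powr (\<alpha> - 2))" "r \<ge> 0" "s > 0"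
      using pos key(2)[OF order_refl z] by (auto simp: r_def s_def)
    have one: "c * cmod z powr (\<alpha> - 2) * r\<^sup>2 = 1" "C * cmod z powr (\<alpha> - 2) * s\<^sup>2 = 1"
      using key(2)[OF order_refl z] pos by (auto simp: r2)
    have "\<alpha>\<^sup>2 * min ((1/2) powr (\<alpha> - 2)) ((3/2) powr (\<alpha> - 2)) * cmod z powr (\<alpha> - 2) * (pi * r\<^sup>2) = 1"
      "\<alpha>\<^sup>2 * max ((1/2) powr (\<alpha> - 2)) ((3/2) powr (\<alpha> - 2)) * cmod z powr (\<alpha> - 2) * (pi * s\<^sup>2) = 1"
      using one by (simp_all only: c_def C_def mult_ac)
    note one = this
    have "ennreal 1 \<le> emeasure (weight_laplacian \<alpha>) (ball z r)"
      using weight_laplacian_ball_bounds(2)[OF \<alpha> r2(3), of z] key(1)[OF order_refl z]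
      unfolding one r_def[symmetric] .
    hence "radius_fun \<alpha> z \<le> r" by (intro radius_fun_le \<alpha>) simp
    hence "(radius_fun \<alpha> z)\<^sup>2 \<le> r\<^sup>2" using radius_fun[OF \<alpha>, of z] by (intro power_mono) auto
    thus "c * cmod z powr (\<alpha> - 2) \<le> 1 / (radius_fun \<alpha> z)\<^sup>2"
      using radius_fun[OF \<alpha>, of z] pos key(2)[OF order_refl z] unfolding r2 by (simp add: field_simps)
    have "emeasure (weight_laplacian \<alpha>) (ball z s) \<le> ennreal 1"
      using weight_laplacian_ball_bounds(1)[OF \<alpha>, of s z] key(1)[OF pos(4) z] r2(4)
      unfolding one s_def[symmetric] by simp
    hence "s \<le> radius_fun \<alpha> z" by (intro radius_fun_ge \<alpha>) simp
    hence "s\<^sup>2 \<le> (radius_fun \<alpha> z)\<^sup>2" using r2 by (intro power_mono) auto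
    thus "1 / (radius_fun \<alpha> z)\<^sup>2 \<le> C * cmod z powr (\<alpha> - 2)"
      using radius_fun[OF \<alpha>, of z] pos key(2)[OF order_refl z] unfolding r2 by (simp add: field_simps)
  qed
qed

lemma radius_fun_bounded_below:
  assumes \<alpha>: "\<alpha> > 0"
  obtains C where "C > 0" "\<And>z. cmod z \<le> R \<Longrightarrow> 1 / (radius_fun \<alpha> z)\<^sup>2 \<le> C"
proof (cases "R \<ge> 0")
  case True
  have "\<exists>x\<in>cball 0 R. \<forall>y\<in>cball 0 R. radius_fun \<alpha> x \<le> radius_fun \<alpha> y"
    using True by (intro continuous_attains_inf continuous_on_radius_fun \<alpha>) auto
  then obtain x where x: "\<forall>y\<in>cball 0 R. radius_fun \<alpha> x \<le> radius_fun \<alpha> y" by blast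
  show ?thesis
  proof (rule that[of "1 / (radius_fun \<alpha> x)\<^sup>2"])
    fix z assume "cmod z \<le> R"
    thus "1 / (radius_fun \<alpha> z)\<^sup>2 \<le> 1 / (radius_fun \<alpha> x)\<^sup>2"
      using x radius_fun(1)[OF \<alpha>]
      by (intro divide_left_mono power_mono mult_pos_pos zero_less_power) (auto simp: less_imp_le)
  qed (use radius_fun(1)[OF \<alpha>, of x] in auto)
next
  case False
  show ?thesis
  proof (rule that[of 1])
    fix z assume "cmod z \<le> R"
    thus "1 / (radius_fun \<alpha> z)\<^sup>2 \<le> 1" using False norm_ge_zero[of z] by linarith
  qed simp
qed

lemma borel_measurable_radius_fun [measurable]:
  "\<alpha> > 0 \<Longrightarrow> radius_fun \<alpha> \<in> borel_measurable borel"
  by (intro borel_measurable_continuous_onI continuous_on_radius_fun)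

section \<open>The Fock measure in polar coordinates\<close>

text \<open>The density of the image of dm / \<rho>^2 under z -> |z|^\<alpha>: the Jacobian of polar
  coordinates times the value of 1 / \<rho>^2 on the circle. The Fock measure becomes this density
  times exp (- 2 u).\<close>

definition radial_density :: "real \<Rightarrow> real \<Rightarrow> real" where
  "radial_density \<alpha> u =
     (if u > 0 then 2 * pi / \<alpha> * u powr (2 / \<alpha> - 1) / (radius_fun \<alpha> (complex_of_real (u powr (1 / \<alpha>))))\<^sup>2 else 0)"

lemma radial_density_nonneg: "\<alpha> > 0 \<Longrightarrow> radial_density \<alpha> u \<ge> 0"
  by (simp add: radial_density_def)

lemma borel_measurable_radial_density [measurable]:
  assumes "\<alpha> > 0" shows "radial_density \<alpha> \<in> borel_measurable borel"
proof -
  have [measurable]: "radius_fun \<alpha> \<in> borel_measurable borel" using assms by measurable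
  show ?thesis unfolding radial_density_def[abs_def] by measurable
qed

lemma sets_fock_measure [simp, measurable_cong]: "sets (fock_measure \<alpha>) = sets borel"
  by (simp add: fock_measure_def)

lemma nn_integral_fock_measure:
  assumes \<alpha>: "\<alpha> > 0" and [measurable]: "f \<in> borel_measurable borel"
  shows "(\<integral>\<^sup>+z. f z \<partial>fock_measure \<alpha>) =
    (\<integral>\<^sup>+z. ennreal (exp (- 2 * cmod z powr \<alpha>) / (radius_fun \<alpha> z)\<^sup>2) * f z \<partial>lborel)"
proof -
  have [measurable]: "radius_fun \<alpha> \<in> borel_measurable borel" using \<alpha> by measurable
  show ?thesis unfolding fock_measure_def weight_def by (subst nn_integral_density) auto
qed

lemma nn_integral_fock_measure_radial:
  assumes \<alpha>: "\<alpha> > 0" and [measurable]: "h \<in> borel_measurable borel"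
  shows "(\<integral>\<^sup>+z. h (cmod z powr \<alpha>) \<partial>fock_measure \<alpha>) =
    (\<integral>\<^sup>+u. ennreal (radial_density \<alpha> u * exp (- 2 * u)) * h u \<partial>lborel)"
proof -
  have [measurable]: "radius_fun \<alpha> \<in> borel_measurable borel" using \<alpha> by measurable
  have "(\<integral>\<^sup>+z. h (cmod z powr \<alpha>) \<partial>fock_measure \<alpha>) =
    (\<integral>\<^sup>+z. ennreal (exp (- 2 * cmod z powr \<alpha>) / (radius_fun \<alpha> z)\<^sup>2) * h (cmod z powr \<alpha>) \<partial>lborel)"
    by (rule nn_integral_fock_measure[OF \<alpha>]) simp
  also have "\<dots> = (\<integral>\<^sup>+z. ennreal (exp (- 2 * cmod z powr \<alpha>) /
      (radius_fun \<alpha> (complex_of_real ((cmod z powr \<alpha>) powr (1 / \<alpha>))))\<^sup>2) * h (cmod z powr \<alpha>) \<partial>lborel)"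
    using \<alpha> by (simp add: powr_powr radius_fun_cmod)
  also have "\<dots> = (\<integral>\<^sup>+u. ennreal (2 * pi / \<alpha> * u powr (2 / \<alpha> - 1)) * indicator {0<..} u *
     (ennreal (exp (- 2 * u) / (radius_fun \<alpha> (complex_of_real (u powr (1 / \<alpha>))))\<^sup>2) * h u) \<partial>lborel)"
    by (rule nn_integral_cmod_powr[OF \<alpha>]) simp
  also have "\<dots> = (\<integral>\<^sup>+u. ennreal (radial_density \<alpha> u * exp (- 2 * u)) * h u \<partial>lborel)"
  proof (rule nn_integral_cong)
    fix u :: real
    let ?a = "2 * pi / \<alpha> * u powr (2 / \<alpha> - 1)"
      and ?b = "exp (- 2 * u) / (radius_fun \<alpha> (complex_of_real (u powr (1 / \<alpha>))))\<^sup>2"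
    have "ennreal ?a * (ennreal ?b * h u) = ennreal (?a * ?b) * h u"
      using \<alpha> by (subst ennreal_mult) (auto simp: mult.assoc)
    thus "ennreal ?a * indicator {0<..} u * (ennreal ?b * h u) = ennreal (radial_density \<alpha> u * exp (- 2 * u)) * h u"
      by (auto simp: radial_density_def indicator_def)
  qed
  finally show ?thesis .
qed

text \<open>The Jacobian u^(2 / \<alpha> - 1) cancels against 1 / \<rho>^2, which is of order (u^(1
  / \<alpha>))^(\<alpha> - 2). Near 0 only integrability is claimed, because the Jacobian is
  unbounded there when \<alpha> > 2.\<close>

lemma radial_density_bounds:
  assumes \<alpha>: "\<alpha> > 0"
  obtains c C v where "c > 0" "C > 0" "v > 0"
    "\<And>u. u \<ge> v \<Longrightarrow> c \<le> radial_density \<alpha> u" "\<And>u. u \<ge> v \<Longrightarrow> radial_density \<alpha> u \<le> C"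
    "(\<integral>\<^sup>+u. ennreal (radial_density \<alpha> u) * indicator {..<v} u \<partial>lborel) < \<infinity>"
proof -
  obtain c C R where R: "c > 0" "C > 0" "R > 0"
    "\<And>z. cmod z \<ge> R \<Longrightarrow> c * cmod z powr (\<alpha> - 2) \<le> 1 / (radius_fun \<alpha> z)\<^sup>2"
    "\<And>z. cmod z \<ge> R \<Longrightarrow> 1 / (radius_fun \<alpha> z)\<^sup>2 \<le> C * cmod z powr (\<alpha> - 2)"
    using radius_fun_asymptotics[OF \<alpha>] by metis
  define v where "v = R powr \<alpha>"
  have v: "v > 0" using R by (simp add: v_def)
  obtain D where D: "D > 0" "\<And>z. cmod z \<le> R \<Longrightarrow> 1 / (radius_fun \<alpha> z)\<^sup>2 \<le> D"
    using radius_fun_bounded_below[OF \<alpha>] by metis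
  have uR: "u powr (1 / \<alpha>) \<ge> R \<and> u powr (2 / \<alpha> - 1) * (u powr (1 / \<alpha>)) powr (\<alpha> - 2) = 1" if "u \<ge> v" for u
  proof
    have "v powr (1 / \<alpha>) \<le> u powr (1 / \<alpha>)" using that v \<alpha> by (intro powr_mono2) auto
    thus "u powr (1 / \<alpha>) \<ge> R" using R \<alpha> by (simp add: v_def powr_powr)
    have "2 / \<alpha> - 1 + 1 / \<alpha> * (\<alpha> - 2) = 0" using \<alpha> by (simp add: field_simps)
    thus "u powr (2 / \<alpha> - 1) * (u powr (1 / \<alpha>)) powr (\<alpha> - 2) = 1"
      using that v by (simp add: powr_powr powr_add[symmetric])
  qed
  show thesis
  proof (rule that[of "2 * pi / \<alpha> * c" "2 * pi / \<alpha> * C" v])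
    fix u assume u: "u \<ge> v"
    have eq: "radial_density \<alpha> u = 2 * pi / \<alpha> * (u powr (2 / \<alpha> - 1) * (1 / (radius_fun \<alpha> (complex_of_real (u powr (1 / \<alpha>))))\<^sup>2))"
      using u v by (simp add: radial_density_def)
    have "u powr (2 / \<alpha> - 1) * (c * (u powr (1 / \<alpha>)) powr (\<alpha> - 2)) \<le>
        u powr (2 / \<alpha> - 1) * (1 / (radius_fun \<alpha> (complex_of_real (u powr (1 / \<alpha>))))\<^sup>2)"
      using R(4)[of "complex_of_real (u powr (1 / \<alpha>))"] uR[OF u] by (intro mult_left_mono) auto
    hence "c \<le> u powr (2 / \<alpha> - 1) * (1 / (radius_fun \<alpha> (complex_of_real (u powr (1 / \<alpha>))))\<^sup>2)"
      using uR[OF u] by (simp add: mult.left_commute[of _ c])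
    thus "2 * pi / \<alpha> * c \<le> radial_density \<alpha> u"
      unfolding eq using \<alpha> by (intro mult_left_mono) auto
    have "u powr (2 / \<alpha> - 1) * (C * (u powr (1 / \<alpha>)) powr (\<alpha> - 2)) \<ge>
        u powr (2 / \<alpha> - 1) * (1 / (radius_fun \<alpha> (complex_of_real (u powr (1 / \<alpha>))))\<^sup>2)"
      using R(5)[of "complex_of_real (u powr (1 / \<alpha>))"] uR[OF u] by (intro mult_left_mono) auto
    hence "C \<ge> u powr (2 / \<alpha> - 1) * (1 / (radius_fun \<alpha> (complex_of_real (u powr (1 / \<alpha>))))\<^sup>2)"
      using uR[OF u] by (simp add: mult.left_commute[of _ C])
    thus "2 * pi / \<alpha> * C \<ge> radial_density \<alpha> u"
      unfolding eq using \<alpha> by (intro mult_left_mono) auto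
  next
    have "ennreal (radial_density \<alpha> u) * indicator {..<v} u \<le>
       ennreal (pi * D) * (ennreal (2 / \<alpha> * u powr (2 / \<alpha> - 1)) * indicator {0<..<v} u)" for u
    proof (cases "0 < u \<and> u < v")
      case True
      hence "u powr (1 / \<alpha>) \<le> v powr (1 / \<alpha>)" using \<alpha> by (intro powr_mono2) auto
      hence "u powr (1 / \<alpha>) \<le> R" using R \<alpha> by (simp add: v_def powr_powr)
      hence "1 / (radius_fun \<alpha> (complex_of_real (u powr (1 / \<alpha>))))\<^sup>2 \<le> D" by (intro D) auto
      hence "(2 / \<alpha> * u powr (2 / \<alpha> - 1) * pi) * (1 / (radius_fun \<alpha> (complex_of_real (u powr (1 / \<alpha>))))\<^sup>2)
         \<le> (2 / \<alpha> * u powr (2 / \<alpha> - 1) * pi) * D" using \<alpha> by (intro mult_left_mono) auto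
      thus ?thesis using True D \<alpha>
        by (simp add: radial_density_def ennreal_mult'[symmetric] mult_ac)
    next
      case False
      thus ?thesis by (auto simp: radial_density_def indicator_def)
    qed
    hence "(\<integral>\<^sup>+u. ennreal (radial_density \<alpha> u) * indicator {..<v} u \<partial>lborel) \<le>
       (\<integral>\<^sup>+u. ennreal (pi * D) * (ennreal (2 / \<alpha> * u powr (2 / \<alpha> - 1)) * indicator {0<..<v} u) \<partial>lborel)"
      by (intro nn_integral_mono) auto
    also have "\<dots> = ennreal (pi * D) * ennreal (v powr (2 / \<alpha>))"
      using \<alpha> v by (subst nn_integral_cmult, simp, subst nn_integral_lborel_powr_0) auto
    also have "\<dots> < \<infinity>" by (simp add: ennreal_mult_less_top)
    finally show "(\<integral>\<^sup>+u. ennreal (radial_density \<alpha> u) * indicator {..<v} u \<partial>lborel) < \<infinity>" .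
  qed (use R \<alpha> v in auto)
qed

section \<open>Mittag-Leffler series\<close>

text \<open>With s = \<beta> k these are the terms of the Mittag-Leffler function with parameter
  \<beta> at the point x^\<beta>; for natural \<open>s\<close> they are the terms of the exponential
  series.\<close>

definition ml_term :: "real \<Rightarrow> real \<Rightarrow> real" where
  "ml_term x s = x powr s / Gamma (s + 1)"

lemma ml_term_nonneg: "s \<ge> 0 \<Longrightarrow> ml_term x s \<ge> 0"
  by (simp add: ml_term_def less_imp_le)

lemma ml_term_of_nat: "x > 0 \<Longrightarrow> ml_term x (real n) = x ^ n / fact n"
  using Gamma_fact[of n, where 'a=real] by (simp add: ml_term_def powr_realpow add.commute)

lemma ml_term_Suc: "x > 0 \<Longrightarrow> ml_term x (real (Suc n)) = ml_term x (real n) * (x / (real n + 1))"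
  by (simp only: ml_term_of_nat) (simp add: field_simps)

lemma sums_ml_term_of_nat: "x > 0 \<Longrightarrow> (\<lambda>n. ml_term x (real n)) sums exp x"
  using exp_converges[of x] by (simp add: ml_term_of_nat divide_inverse mult.commute)

lemma sum_ml_term_of_nat_le:
  assumes "x > 0" shows "(\<Sum>n<N. ml_term x (real n)) \<le> exp x"
  using sum_le_suminf[of "\<lambda>n. ml_term x (real n)" "{..<N}"] sums_ml_term_of_nat[OF assms]
  by (auto simp: sums_iff ml_term_nonneg)

lemma Gamma_log_convex_real:
  fixes a b t :: real
  assumes "a > 0" "b > 0" "0 \<le> t" "t \<le> 1"
  shows "ln (Gamma ((1 - t) * a + t * b)) \<le> (1 - t) * ln (Gamma a) + t * ln (Gamma b)"
  using convex_onD[OF log_convex_Gamma_real, of t a b] assms by simp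

text \<open>Log-convexity of Gamma makes ln (\<open>ml_term x s\<close>) concave in
  \<open>s\<close>, and a concave function on an interval is bounded below by its smaller end
  value.\<close>

lemma ml_term_ge_min:
  assumes "x > 0" "0 \<le> a" "a \<le> s" "s \<le> b"
  shows "ml_term x s \<ge> min (ml_term x a) (ml_term x b)"
proof (cases "a = b")
  case True thus ?thesis using assms by simp
next
  case False
  define t where "t = (s - a) / (b - a)"
  have t: "0 \<le> t" "t \<le> 1" "t * (b - a) = s - a"
    using assms False by (auto simp: t_def field_simps)
  hence s: "s = (1 - t) * a + t * b" by (simp add: algebra_simps)
  have s1: "s + 1 = (1 - t) * (a + 1) + t * (b + 1)" by (simp add: s algebra_simps)
  have lnml: "ln (ml_term x u) = u * ln x - ln (Gamma (u + 1))" if "u \<ge> 0" for u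
    using that assms Gamma_real_pos[of "u + 1"] by (simp add: ml_term_def ln_div ln_powr del: Gamma_real_pos)
  have pos: "ml_term x u > 0" if "u \<ge> 0" for u
    using that assms by (simp add: ml_term_def)
  have "ln (ml_term x s) \<ge> (1 - t) * ln (ml_term x a) + t * ln (ml_term x b)"
    using Gamma_log_convex_real[of "a + 1" "b + 1" t] assms t
    by (simp only: lnml) (simp only: s1[symmetric], simp add: s algebra_simps lnml)
  moreover have "(1 - t) * ln (ml_term x a) + t * ln (ml_term x b) \<ge>
     (1 - t) * ln (min (ml_term x a) (ml_term x b)) + t * ln (min (ml_term x a) (ml_term x b))"
    using t pos assms by (intro add_mono mult_left_mono) (auto simp: min_def)
  ultimately have "ln (min (ml_term x a) (ml_term x b)) \<le> ln (ml_term x s)"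
    by (simp add: algebra_simps)
  thus ?thesis using pos assms by (subst (asm) ln_le_cancel_iff) (auto simp: min_def)
qed

text \<open>Log-convexity, used with n + 1 between n and s + 1, gives Gamma (s + 1) >= Gamma (n + 1)
  n^(s - n). What remains is (x / n)^t <= 1 + x / n; the factor 2 pays for replacing n by n + 1 in
  the second term.\<close>

lemma ml_term_le:
  assumes "x > 0" "n \<ge> 1" "real n \<le> s" "s \<le> real n + 1"
  shows "ml_term x s \<le> ml_term x n + 2 * ml_term x (Suc n)"
proof -
  define t where "t = s - real n"
  have t: "0 \<le> t" "t \<le> 1" and s: "s = real n + t" using assms by (auto simp: t_def)
  \<comment> \<open>n + 1 is the convex combination of n and s + 1 = n + 1 + t with weight 1 / (1 +
    t) on the latter.\<close>
  have *: "ln (Gamma (real n + 1)) \<le> (1 - 1/(1+t)) * ln (Gamma n) + 1/(1+t) * ln (Gamma (s + 1))"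
  proof -
    have "(1 - u) * real n + u * (s + 1) = real n + u * (1 + t)" for u
      by (simp add: s algebra_simps)
    hence "(1 - 1/(1+t)) * real n + 1/(1+t) * (s + 1) = real n + 1"
      using t by (simp only:) simp
    thus ?thesis using Gamma_log_convex_real[of n "s + 1" "1/(1+t)"] assms t by simp
  qed
  have "(1 + t) * ln (Gamma (real n + 1)) \<le> t * ln (Gamma n) + ln (Gamma (s + 1))"
  proof -
    have "(1 + t) * ln (Gamma (real n + 1)) \<le>
       (1 + t) * ((1 - 1/(1+t)) * ln (Gamma n) + 1/(1+t) * ln (Gamma (s + 1)))"
      using * t by (intro mult_left_mono) auto
    also have "\<dots> = t * ln (Gamma n) + ln (Gamma (s + 1))"
      using t by (simp add: ring_distribs(1) right_diff_distrib mult.assoc[symmetric])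
    finally show ?thesis .
  qed
  moreover have "Gamma (real n + 1) = real n * Gamma (real n)"
    using assms by (intro Gamma_plus1) auto
  ultimately have "ln (Gamma (real n + 1)) + t * ln n \<le> ln (Gamma (s + 1))"
    using assms Gamma_real_pos[of "real n"] by (simp add: ln_mult algebra_simps del: Gamma_real_pos)
  hence "ln (Gamma (real n + 1) * n powr t) \<le> ln (Gamma (s + 1))"
    using assms Gamma_real_pos[of "real n + 1"] by (simp add: ln_mult ln_powr del: Gamma_real_pos)
  hence G: "Gamma (real n + 1) * n powr t \<le> Gamma (s + 1)"
    using assms by (subst (asm) ln_le_cancel_iff) auto
  have "ml_term x s \<le> x powr s / (Gamma (real n + 1) * n powr t)"
    unfolding ml_term_def using G assms by (intro divide_left_mono mult_pos_pos) auto
  also have "\<dots> = ml_term x n * (x / n) powr t"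
    using assms by (simp add: ml_term_def s powr_add powr_divide)
  also have "\<dots> \<le> ml_term x n * (1 + x / n)"
  proof (rule mult_left_mono)
    show "(x / n) powr t \<le> 1 + x / n"
    proof (cases "x / n \<le> 1")
      case True
      hence "(x / n) powr t \<le> 1" using assms t by (intro powr_le1) auto
      moreover have "x / n \<ge> 0" using assms by simp
      ultimately show ?thesis by linarith
    next
      case False
      hence "(x / n) powr t \<le> (x / n) powr 1" using t by (intro powr_mono) auto
      thus ?thesis using False by simp
    qed
  qed (simp add: ml_term_nonneg)
  also have "\<dots> = ml_term x n + ml_term x n * (x / n)" by (simp add: algebra_simps)
  also have "ml_term x n * (x / n) \<le> ml_term x n * (2 * (x / (real n + 1)))"
    using assms by (intro mult_left_mono ml_term_nonneg) (auto simp: field_simps)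
  also have "ml_term x n * (2 * (x / (real n + 1))) = 2 * ml_term x (Suc n)"
    by (simp only: ml_term_Suc[OF assms(1)] mult.left_commute)
  finally show ?thesis by simp
qed

section \<open>No single term carries a fixed share of the exponential\<close>

lemma Gamma_ge_nn_integral:
  assumes "s \<ge> 0" "S \<in> sets borel" "S \<subseteq> {0..}" "\<And>t. t \<in> S \<Longrightarrow> c \<le> t powr s / exp t" "c \<ge> 0"
    "emeasure lborel S = ennreal l" "l \<ge> 0"
  shows "Gamma (s + 1) \<ge> c * l"
proof -
  have "ennreal (c * l) = (\<integral>\<^sup>+t. ennreal c * indicator S t \<partial>lborel)"
    using assms by (subst nn_integral_cmult_indicator) (auto simp: ennreal_mult)
  also have "\<dots> \<le> (\<integral>\<^sup>+t. ennreal (indicator {0..} t * t powr (s + 1 - 1) / exp t) \<partial>lborel)"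
    using assms by (intro nn_integral_mono) (auto simp: indicator_def intro!: ennreal_leI)
  also have "\<dots> = ennreal (Gamma (s + 1))"
    using assms by (intro Gamma_conv_nn_integral_real[symmetric]) auto
  finally show ?thesis using assms by (subst (asm) ennreal_le_iff) (auto simp: less_imp_le)
qed

lemma Gamma_lower:
  assumes "s \<ge> (0 :: real)" shows "Gamma (s + 1) \<ge> exp (- 2)"
proof -
  have "exp (- 2) \<le> t powr s / exp t" if "t \<in> {1..2}" for t
  proof -
    have "exp (- 2) * 1 \<le> exp (- t) * t powr s"
      using that assms by (intro mult_mono ge_one_powr_ge_zero) auto
    thus ?thesis by (simp add: exp_minus field_simps)
  qed
  thus ?thesis using Gamma_ge_nn_integral[of s "{1..2}" "exp (- 2)" 1] assms by auto
qed

text \<open>Half of Stirling's formula: the integrand t^s exp (- t) of the Euler integral has its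
  maximum at t = s and loses at most a factor e over the window of length sqrt s to the right of
  it.\<close>

lemma Gamma_lower_sqrt:
  assumes "s \<ge> (1::real)"
  shows "Gamma (s + 1) \<ge> s powr s * exp (- s) * exp (- 1) * sqrt s"
proof (rule Gamma_ge_nn_integral[where S="{s..s + sqrt s}"])
  fix t assume t: "t \<in> {s..s + sqrt s}"
  define y where "y = (t - s) / s"
  have "y \<le> sqrt s / s" unfolding y_def using t assms by (intro divide_right_mono) auto
  hence y: "0 \<le> y" "y \<le> 1 / sqrt s"
    using t assms by (auto simp: y_def sqrt_divide_self_eq inverse_eq_divide)
  have "1 / sqrt s \<le> 1" using assms by simp
  hence "y \<le> 1" using y by linarith
  have "y\<^sup>2 \<le> (1 / sqrt s)\<^sup>2" using y by (intro power_mono) auto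
  hence "s * y\<^sup>2 \<le> 1" using assms by (simp add: power_divide field_simps)
  have "y - y\<^sup>2 \<le> ln (1 + y)" using y(1) \<open>y \<le> 1\<close> by (rule ln_one_plus_pos_lower_bound)
  hence "s * (y - y\<^sup>2) \<le> s * ln (1 + y)" using assms by (intro mult_left_mono) auto
  hence *: "s * y - 1 \<le> s * ln (1 + y)" using \<open>s * y\<^sup>2 \<le> 1\<close> by (simp add: algebra_simps)
  have ty: "t = s * (1 + y)" using assms by (simp add: y_def field_simps)
  have "ln t = ln s + ln (1 + y)" using assms y by (simp add: ty ln_mult del: distrib_left)
  hence "s * ln s - s - 1 \<le> s * ln t - t"
    using * by (simp add: ty distrib_left)
  hence "exp (s * ln s - s - 1) \<le> exp (s * ln t - t)" by simp
  thus "s powr s * exp (- s) * exp (- 1) \<le> t powr s / exp t"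
    using assms t by (simp add: powr_def exp_diff exp_minus exp_add field_simps)
qed (use assms in auto)

lemma ml_term_le_sqrt:
  assumes "x > 0" "s \<ge> 1"
  shows "ml_term x s \<le> exp x * (exp 1 / sqrt s)"
proof -
  have "ln (x / s) \<le> x / s - 1" using assms by (intro ln_le_minus_one) auto
  hence "s * ln (x / s) \<le> s * (x / s - 1)" using assms by (intro mult_left_mono) auto
  hence "s * ln x - s * ln s \<le> x - s" using assms by (simp add: ln_div algebra_simps)
  hence "exp (s * ln x) \<le> exp (x + s * ln s - s)" by simp
  hence x: "x powr s \<le> exp x * (s powr s * exp (- s))"
    using assms by (simp add: powr_def exp_diff exp_add exp_minus field_simps)
  have pos: "s powr s * exp (- s) * exp (- 1) * sqrt s > 0" using assms by simp
  have "ml_term x s \<le> x powr s / (s powr s * exp (- s) * exp (- 1) * sqrt s)"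
    unfolding ml_term_def using assms Gamma_lower_sqrt[OF assms(2)] pos
    by (intro divide_left_mono mult_pos_pos[OF _ pos]) auto
  also have "\<dots> \<le> exp x * (s powr s * exp (- s)) / (s powr s * exp (- s) * exp (- 1) * sqrt s)"
    using x pos by (intro divide_right_mono) auto
  also have "\<dots> = exp x * (exp 1 / sqrt s)" using assms by (simp add: exp_minus field_simps)
  finally show ?thesis .
qed

lemma ml_term_le_powr:
  assumes "x \<ge> 1" "0 \<le> s" "s \<le> S"
  shows "ml_term x s \<le> exp 2 * x powr S"
proof -
  have "ml_term x s \<le> x powr s / exp (- 2)"
    unfolding ml_term_def using assms Gamma_lower[of s] by (intro divide_left_mono mult_pos_pos) auto
  also have "\<dots> \<le> x powr S / exp (- 2)" using assms by (intro divide_right_mono powr_mono) auto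
  finally show ?thesis by (simp add: exp_minus field_simps)
qed

text \<open>Large \<open>s\<close> is controlled by the decay exp 1 / sqrt s of the Stirling bound,
  small \<open>s\<close> by the fact that a power of \<open>x\<close> is negligible against exp x.
  Uniformity in \<open>s\<close> is the point: it later bounds the share of every single modulus at
  once.\<close>

lemma ml_term_uniformly_small:
  assumes "\<epsilon> > 0"
  shows "\<exists>X\<ge>1. \<forall>x\<ge>X. \<forall>s\<ge>0. ml_term x s \<le> \<epsilon> * exp x"
proof -
  \<comment> \<open>Beyond \<open>S\<close> the factor exp 1 / sqrt s is at most \<epsilon>.\<close>
  define S where "S = max 1 ((exp 1 / \<epsilon>)\<^sup>2)"
  have "((\<lambda>x. exp 2 * x powr S / exp x) \<longlongrightarrow> 0) at_top"
    by real_asymp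
  hence "eventually (\<lambda>x. exp 2 * x powr S / exp x < \<epsilon>) at_top"
    using assms by (rule order_tendstoD)
  then obtain X where X: "\<And>x. x \<ge> X \<Longrightarrow> exp 2 * x powr S / exp x < \<epsilon>"
    by (auto simp: eventually_at_top_linorder)
  show ?thesis
  proof (intro exI[of _ "max 1 X"] conjI allI impI)
    fix x s :: real assume x: "x \<ge> max 1 X" and s: "s \<ge> 0"
    show "ml_term x s \<le> \<epsilon> * exp x"
    proof (cases "s \<le> S")
      case True
      hence "ml_term x s \<le> exp 2 * x powr S" using x s by (intro ml_term_le_powr) auto
      also have "\<dots> \<le> \<epsilon> * exp x" using X[of x] x by (simp add: field_simps)
      finally show ?thesis .
    next
      case False
      hence "1 \<le> s" "(exp 1 / \<epsilon>)\<^sup>2 \<le> s" by (auto simp: S_def)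
      hence "exp 1 / \<epsilon> \<le> sqrt s" using assms by (intro real_le_rsqrt) auto
      hence "exp 1 / sqrt s \<le> \<epsilon>" using assms \<open>1 \<le> s\<close> by (simp add: field_simps)
      hence "exp x * (exp 1 / sqrt s) \<le> exp x * \<epsilon>" by (intro mult_left_mono) auto
      thus ?thesis using ml_term_le_sqrt[of x s] x \<open>1 \<le> s\<close> by (simp add: mult.commute)
    qed
  qed simp
qed

section \<open>Comparison of the whole series with the exponential\<close>

lemma card_scaled_nats:
  assumes "\<beta> > (0::real)"
  shows "finite {k. real n \<le> \<beta> * real k \<and> \<beta> * real k < real n + 1}"
    "card {k. real n \<le> \<beta> * real k \<and> \<beta> * real k < real n + 1} \<le> nat \<lceil>1 / \<beta>\<rceil>"
proof -
  have sub: "{k. real n \<le> \<beta> * real k \<and> \<beta> * real k < real n + 1}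
     \<subseteq> {nat \<lceil>real n / \<beta>\<rceil>..<nat \<lceil>real n / \<beta>\<rceil> + nat \<lceil>1 / \<beta>\<rceil>}"
  proof safe
    fix k assume k: "real n \<le> \<beta> * real k" "\<beta> * real k < real n + 1"
    have "real n / \<beta> \<le> real k" "real k < real n / \<beta> + 1 / \<beta>" using k assms by (auto simp: field_simps)
    moreover have "real n / \<beta> \<le> real (nat \<lceil>real n / \<beta>\<rceil>)" "1 / \<beta> \<le> real (nat \<lceil>1 / \<beta>\<rceil>)" by linarith+
    ultimately have "real k < real (nat \<lceil>real n / \<beta>\<rceil> + nat \<lceil>1 / \<beta>\<rceil>)" unfolding of_nat_add by linarith
    hence "k < nat \<lceil>real n / \<beta>\<rceil> + nat \<lceil>1 / \<beta>\<rceil>" by (simp only: of_nat_less_iff)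
    moreover have "nat \<lceil>real n / \<beta>\<rceil> \<le> k" using \<open>real n / \<beta> \<le> real k\<close> by (simp add: nat_le_iff ceiling_le_iff)
    ultimately show "k \<in> {nat \<lceil>real n / \<beta>\<rceil>..<nat \<lceil>real n / \<beta>\<rceil> + nat \<lceil>1 / \<beta>\<rceil>}" by simp
  qed
  show "finite {k. real n \<le> \<beta> * real k \<and> \<beta> * real k < real n + 1}"
    using sub by (rule finite_subset) simp
  show "card {k. real n \<le> \<beta> * real k \<and> \<beta> * real k < real n + 1} \<le> nat \<lceil>1 / \<beta>\<rceil>"
    using card_mono[OF _ sub] by simp
qed

lemma ml_term_small_index:
  assumes "x > 0" "0 \<le> s" "s < 1"
  shows "ml_term x s \<le> exp 2 * exp x"
proof -
  have "ml_term x s \<le> x powr s / exp (- 2)"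
    unfolding ml_term_def using assms Gamma_lower[of s] by (intro divide_left_mono mult_pos_pos) auto
  also have "x powr s \<le> exp x"
  proof (cases "x \<le> 1")
    case True
    hence "x powr s \<le> 1" using assms by (intro powr_le1) auto
    also have "1 \<le> exp x" using assms by simp
    finally show ?thesis .
  next
    case False
    hence "x powr s \<le> x powr 1" using assms by (intro powr_mono) auto
    also have "x powr 1 = x" using assms by simp
    also have "\<dots> \<le> exp x" using exp_ge_add_one_self[of x] by linarith
    finally show ?thesis .
  qed
  finally show ?thesis by (simp add: exp_minus field_simps)
qed

text \<open>Each unit interval [n, n + 1) contains a bounded number of the points \<beta> k, and a
  term there is at most a combination of the integer terms at its ends. Summation leads back to the
  exponential series. The interval at n = 0 has its own bound because Gamma n is singular
  there.\<close>

lemma ml_series_upper: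
  assumes "\<beta> > 0"
  obtains C where "C > 0" "\<And>x. x > 0 \<Longrightarrow> summable (\<lambda>k. ml_term x (\<beta> * real k))"
    "\<And>x. x > 0 \<Longrightarrow> (\<Sum>k. ml_term x (\<beta> * real k)) \<le> C * exp x"
proof -
  define q where "q = real (nat \<lceil>1 / \<beta>\<rceil>)"
  have q: "q > 0" using assms by (simp add: q_def)
  have bound: "(\<Sum>k<K. ml_term x (\<beta> * real k)) \<le> q * (exp 2 + 3) * exp x" if x: "x > 0" for x K
  proof -
    define g where "g = (\<lambda>n::nat. if n = 0 then exp 2 * exp x else ml_term x n + 2 * ml_term x (Suc n))"
    define N where "N = Suc (nat \<lfloor>\<beta> * real K\<rfloor>)"
    have g0: "g n \<ge> 0" for n using x by (simp add: g_def ml_term_nonneg)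
    have "(\<Sum>k<K. ml_term x (\<beta> * real k)) \<le>
       (\<Sum>k<K. \<Sum>n<N. if real n \<le> \<beta> * real k \<and> \<beta> * real k < real n + 1 then g n else 0)"
    proof (rule sum_mono)
      fix k assume k: "k \<in> {..<K}"
      define n where "n = nat \<lfloor>\<beta> * real k\<rfloor>"
      have n: "real n \<le> \<beta> * real k" "\<beta> * real k < real n + 1"
        using assms by (auto simp: n_def)
      have "\<beta> * real k \<le> \<beta> * real K" using k assms by (intro mult_left_mono) auto
      hence "n < N" unfolding n_def N_def using assms by (auto simp: less_Suc_eq_le intro!: nat_mono floor_mono)
      have "ml_term x (\<beta> * real k) \<le> g n"
        using n x ml_term_le[of x n "\<beta> * real k"] ml_term_small_index[of x "\<beta> * real k"] assms
        by (cases "n = 0") (auto simp: g_def)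
      also have "\<dots> = (\<Sum>m\<in>{n}. if real m \<le> \<beta> * real k \<and> \<beta> * real k < real m + 1 then g m else 0)"
        using n by simp
      also have "\<dots> \<le> (\<Sum>m<N. if real m \<le> \<beta> * real k \<and> \<beta> * real k < real m + 1 then g m else 0)"
        using \<open>n < N\<close> g0 by (intro sum_mono2) auto
      finally show "ml_term x (\<beta> * real k) \<le> (\<Sum>m<N. if real m \<le> \<beta> * real k \<and> \<beta> * real k < real m + 1 then g m else 0)" .
    qed
    also have "\<dots> = (\<Sum>n<N. \<Sum>k<K. if real n \<le> \<beta> * real k \<and> \<beta> * real k < real n + 1 then g n else 0)"
      by (rule sum.swap)
    also have "\<dots> \<le> (\<Sum>n<N. q * g n)"
    proof (rule sum_mono)
      fix n
      have "(\<Sum>k<K. if real n \<le> \<beta> * real k \<and> \<beta> * real k < real n + 1 then g n else 0)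
        = real (card ({..<K} \<inter> {k. real n \<le> \<beta> * real k \<and> \<beta> * real k < real n + 1})) * g n"
        by (simp add: sum.If_cases)
      also have "\<dots> \<le> q * g n"
      proof (rule mult_right_mono[OF _ g0])
        have "card ({..<K} \<inter> {k. real n \<le> \<beta> * real k \<and> \<beta> * real k < real n + 1})
          \<le> card {k. real n \<le> \<beta> * real k \<and> \<beta> * real k < real n + 1}"
          using card_scaled_nats[OF assms] by (intro card_mono) auto
        thus "real (card ({..<K} \<inter> {k. real n \<le> \<beta> * real k \<and> \<beta> * real k < real n + 1})) \<le> q"
          using card_scaled_nats(2)[OF assms, of n] by (simp add: q_def)
      qed
      finally show "(\<Sum>k<K. if real n \<le> \<beta> * real k \<and> \<beta> * real k < real n + 1 then g n else 0) \<le> q * g n" .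
    qed
    also have "\<dots> = q * (\<Sum>n<N. g n)" by (simp add: sum_distrib_left)
    also have "(\<Sum>n<N. g n) \<le> exp 2 * exp x + (\<Sum>n<N. ml_term x n) + 2 * (\<Sum>n<N. ml_term x (Suc n))"
    proof -
      have "(\<Sum>n<N. g n) \<le> (\<Sum>n<N. (if n = 0 then exp 2 * exp x else 0) + (ml_term x n + 2 * ml_term x (Suc n)))"
        using x by (intro sum_mono) (auto simp: g_def ml_term_nonneg)
      also have "\<dots> \<le> exp 2 * exp x + (\<Sum>n<N. ml_term x n) + 2 * (\<Sum>n<N. ml_term x (Suc n))"
        by (simp add: sum.distrib sum_distrib_left sum.delta)
      finally show ?thesis .
    qed
    also have "(\<Sum>n<N. ml_term x n) \<le> exp x"
      by (rule sum_ml_term_of_nat_le[OF x])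
    also have "(\<Sum>n<N. ml_term x (Suc n)) \<le> (\<Sum>n<Suc N. ml_term x n)"
      by (subst sum.lessThan_Suc_shift) (simp add: ml_term_nonneg)
    also have "(\<Sum>n<Suc N. ml_term x n) \<le> exp x"
      by (rule sum_ml_term_of_nat_le[OF x])
    finally show ?thesis using q by (simp add: algebra_simps)
  qed
  have summable: "summable (\<lambda>k. ml_term x (\<beta> * real k))" if "x > 0" for x
    using bound[OF that] assms by (intro summableI_nonneg_bounded) (auto simp: ml_term_nonneg)
  have "q * (exp 2 + 3) > 0" using q by (intro mult_pos_pos add_pos_pos) auto
  thus thesis
    using summable bound by (intro that[of "q * (exp 2 + 3)"]) (auto intro: suminf_le_const)
qed

text \<open>The reverse comparison. Every window [n, n + h] with h >= \<beta> contains some \<beta>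
  k, where the term is at least the minimum \<open>m n\<close> of the end terms. As the integer
  terms rise up to x and fall beyond it, each of them away from x equals such a minimum; the few
  near x are discarded as uniformly small.\<close>

lemma ml_series_lower:
  assumes "\<beta> > 0"
  obtains c X where "c > 0" "X \<ge> 1" "\<And>x. x \<ge> X \<Longrightarrow> c * exp x \<le> (\<Sum>k. ml_term x (\<beta> * real k))"
proof -
  define h where "h = nat \<lceil>\<beta>\<rceil>"
  have h: "h \<ge> 1" "\<beta> \<le> real h" using assms by (auto simp: h_def) linarith
  \<comment> \<open>At most 2 h + 1 indices are discarded, so together they cost no more than half
    of exp x.\<close>
  define \<epsilon> where "\<epsilon> = 1 / (2 * (2 * real h + 1))"
  obtain X where X: "X \<ge> 1" "\<And>x s. x \<ge> X \<Longrightarrow> s \<ge> 0 \<Longrightarrow> ml_term x s \<le> \<epsilon> * exp x"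
    using ml_term_uniformly_small[of \<epsilon>] h by (auto simp: \<epsilon>_def)
  show thesis
  proof (rule that[of "1 / (4 * (real h + 1))" X])
    fix x assume x: "x \<ge> X"
    have x0: "x > 0" using x X by linarith
    define f where "f = (\<lambda>s. ml_term x s)"
    have f0: "f s \<ge> 0" if "s \<ge> 0" for s using that by (simp add: f_def ml_term_nonneg)
    define m where "m = (\<lambda>n::nat. min (f n) (f (n + h)))"
    have m0: "m n \<ge> 0" for n using f0 by (simp add: m_def)
    define S where "S = (\<Sum>k. f (\<beta> * real k))"
    obtain C where "summable (\<lambda>k. f (\<beta> * real k))"
      unfolding f_def using ml_series_upper[OF assms] x0 by metis
    have up: "f n \<le> f (n + i)" if "real (n + i) \<le> x" for n i
      using that
    proof (induction i)
      case (Suc i)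
      have "f (n + i) * 1 \<le> f (n + i) * (x / (real (n + i) + 1))"
        using Suc.prems f0 by (intro mult_left_mono) auto
      also have "\<dots> = f (n + Suc i)" using ml_term_Suc[OF x0, of "n + i"] by (simp add: f_def)
      finally show ?case using Suc by simp
    qed simp
    have down: "f (n + i) \<le> f n" if "x \<le> real n" for n i
    proof (induction i)
      case (Suc i)
      have "f (n + Suc i) = f (n + i) * (x / (real (n + i) + 1))"
        using ml_term_Suc[OF x0, of "n + i"] by (simp add: f_def)
      also have "\<dots> \<le> f (n + i) * 1" using that f0 x0 by (intro mult_left_mono) auto
      finally show ?case using Suc by simp
    qed simp
    \<comment> \<open>The indices at distance less than h from x, for which neither window adjacent
      to \<open>n\<close> is certain to lie on one side of x.\<close>
    define W where "W = {n::nat. x < real n + h \<and> real n < x + h}"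
    have W: "W \<subseteq> {nat \<lfloor>x\<rfloor> - h..<nat \<lfloor>x\<rfloor> + h + 1}"
    proof
      fix n assume "n \<in> W"
      hence n: "x < real n + h" "real n < x + h" by (auto simp: W_def)
      have fl: "real (nat \<lfloor>x\<rfloor>) \<le> x" "x < real (nat \<lfloor>x\<rfloor>) + 1" using x0 by auto
      have "real (nat \<lfloor>x\<rfloor>) < real (n + h)" "real n < real (nat \<lfloor>x\<rfloor> + h + 1)" unfolding of_nat_add using n fl by linarith+
      hence "nat \<lfloor>x\<rfloor> < n + h" "n < nat \<lfloor>x\<rfloor> + h + 1" by (simp_all only: of_nat_less_iff)
      thus "n \<in> {nat \<lfloor>x\<rfloor> - h..<nat \<lfloor>x\<rfloor> + h + 1}" by auto
    qed
    hence Wfin: "finite W" by (rule finite_subset) simp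
    have "card W \<le> 2 * h + 1" using card_mono[OF _ W] by simp
    have main: "(\<Sum>n<N. f (real n)) \<le> 2 * (real h + 1) * S + (2 * real h + 1) * (\<epsilon> * exp x)" for N :: nat
    proof -
      \<comment> \<open>Left of \<open>W\<close> the terms increase over [n, n + h], so
        \<open>m n\<close> is the term itself; right of \<open>W\<close> they decrease over
        [n - h, n], so \<open>m (n - h)\<close> is.\<close>
      have "f (real n) \<le> m n + (if n \<ge> h then m (n - h) else 0) + (if n \<in> W then \<epsilon> * exp x else 0)" for n
      proof -
        consider "real n + h \<le> x" | "n \<in> W" | "x + h \<le> real n" by (force simp: W_def)
        thus ?thesis
        proof cases
          case 1
          have "m n = f n" using up[of n h] 1 by (simp add: m_def)
          moreover have "\<epsilon> * exp x \<ge> 0" by (simp add: \<epsilon>_def)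
          ultimately show ?thesis using m0[of "n - h"] by simp
        next
          case 2
          thus ?thesis using m0 X(2)[OF x, of n] by (auto simp: f_def intro!: add_increasing)
        next
          case 3
          hence "h \<le> n" using x0 by linarith
          moreover have "m (n - h) = f n"
            using down[of "n - h" h] 3 \<open>h \<le> n\<close> by (simp add: m_def of_nat_diff)
          ultimately show ?thesis using m0[of n] X(2)[OF x, of 0] f0[of 0] by (auto simp: f_def)
        qed
      qed
      hence "(\<Sum>n<N. f (real n)) \<le> (\<Sum>n<N. m n + (if n \<ge> h then m (n - h) else 0) + (if n \<in> W then \<epsilon> * exp x else 0))"
        by (intro sum_mono)
      also have "\<dots> = (\<Sum>n<N. m n) + (\<Sum>n<N. if n \<ge> h then m (n - h) else 0) + real (card ({..<N} \<inter> W)) * (\<epsilon> * exp x)"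
        by (simp add: sum.distrib sum.If_cases)
      also have "(\<Sum>n<N. if n \<ge> h then m (n - h) else 0) \<le> (\<Sum>n<N. m n)"
      proof -
        have "(\<Sum>n<N. if n \<ge> h then m (n - h) else 0) = (\<Sum>n\<in>{..<N} \<inter> {n. n \<ge> h}. m (n - h))"
          by (simp add: sum.If_cases)
        also have "\<dots> = (\<Sum>n\<in>(\<lambda>n. n - h) ` ({..<N} \<inter> {n. n \<ge> h}). m n)"
          by (subst sum.reindex) (auto simp: inj_on_def)
        also have "\<dots> \<le> (\<Sum>n<N. m n)" using m0 by (intro sum_mono2) auto
        finally show ?thesis .
      qed
      also have "real (card ({..<N} \<inter> W)) * (\<epsilon> * exp x) \<le> (2 * real h + 1) * (\<epsilon> * exp x)"
      proof (rule mult_right_mono)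
        have "card ({..<N} \<inter> W) \<le> card W" using Wfin by (intro card_mono) auto
        thus "real (card ({..<N} \<inter> W)) \<le> 2 * real h + 1" using \<open>card W \<le> 2 * h + 1\<close> by linarith
      qed (simp add: \<epsilon>_def)
      also have "(\<Sum>n<N. m n) \<le> (real h + 1) * S"
      proof -
        \<comment> \<open>The least k with \<beta> k >= n. It overshoots n by less than \<beta> <=
          h, so \<beta> k lies in the window, and one k serves at most h + 1 values of n.\<close>
        define \<kappa> where "\<kappa> = (\<lambda>n::nat. nat \<lceil>real n / \<beta>\<rceil>)"
        have \<kappa>: "real n \<le> \<beta> * real (\<kappa> n)" "\<beta> * real (\<kappa> n) < real n + \<beta>" for n
        proof -
          have "real n / \<beta> \<le> real (\<kappa> n)" "real (\<kappa> n) < real n / \<beta> + 1"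
            using assms ceiling_correct[of "real n / \<beta>"] by (auto simp: \<kappa>_def)
          thus "real n \<le> \<beta> * real (\<kappa> n)" "\<beta> * real (\<kappa> n) < real n + \<beta>"
            using assms by (auto simp: field_simps)
        qed
        have "(\<Sum>n<N. m n) \<le> (\<Sum>n<N. f (\<beta> * real (\<kappa> n)))"
        proof (rule sum_mono)
          fix n
          have "\<beta> * real (\<kappa> n) \<le> real (n + h)" using \<kappa>(2)[of n] h by simp
          thus "m n \<le> f (\<beta> * real (\<kappa> n))"
            unfolding m_def f_def using ml_term_ge_min[OF x0, of n "\<beta> * real (\<kappa> n)" "real (n + h)"] \<kappa>(1)[of n] by simp
        qed
        also have "\<dots> = (\<Sum>k\<in>\<kappa> ` {..<N}. \<Sum>n\<in>{n\<in>{..<N}. \<kappa> n = k}. f (\<beta> * real (\<kappa> n)))"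
          by (rule sum.image_gen) simp
        also have "\<dots> \<le> (\<Sum>k\<in>\<kappa> ` {..<N}. (real h + 1) * f (\<beta> * real k))"
        proof (rule sum_mono)
          fix k
          have "{n\<in>{..<N}. \<kappa> n = k} \<subseteq> {nat \<lfloor>\<beta> * real k\<rfloor> - h..<nat \<lfloor>\<beta> * real k\<rfloor> + 1}"
          proof safe
            fix n assume k: "k = \<kappa> n"
            have fl: "real (nat \<lfloor>\<beta> * real k\<rfloor>) \<le> \<beta> * real k" "\<beta> * real k < real (nat \<lfloor>\<beta> * real k\<rfloor>) + 1"
              using assms by auto
            have "real (nat \<lfloor>\<beta> * real k\<rfloor>) \<le> real (n + h)" "real n < real (nat \<lfloor>\<beta> * real k\<rfloor> + 1)"
              unfolding of_nat_add using \<kappa>[of n, folded k] fl h by linarith+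
            hence "nat \<lfloor>\<beta> * real k\<rfloor> \<le> n + h" "n < nat \<lfloor>\<beta> * real k\<rfloor> + 1"
              by (simp_all only: of_nat_less_iff of_nat_le_iff)
            thus "n \<in> {nat \<lfloor>\<beta> * real (\<kappa> n)\<rfloor> - h..<nat \<lfloor>\<beta> * real (\<kappa> n)\<rfloor> + 1}" by (auto simp: k)
          qed
          from card_mono[OF _ this] have "card {n\<in>{..<N}. \<kappa> n = k} \<le> h + 1"
            by simp
          hence "real (card {n\<in>{..<N}. \<kappa> n = k}) * f (\<beta> * real k) \<le> (real h + 1) * f (\<beta> * real k)"
            using assms by (intro mult_right_mono f0) auto
          thus "(\<Sum>n\<in>{n\<in>{..<N}. \<kappa> n = k}. f (\<beta> * real (\<kappa> n))) \<le> (real h + 1) * f (\<beta> * real k)"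
            by simp
        qed
        also have "\<dots> = (real h + 1) * (\<Sum>k\<in>\<kappa> ` {..<N}. f (\<beta> * real k))" by (simp add: sum_distrib_left)
        also have "\<dots> \<le> (real h + 1) * S" unfolding S_def
          using \<open>summable (\<lambda>k. f (\<beta> * real k))\<close> assms f0 by (intro mult_left_mono sum_le_suminf) auto
        finally show ?thesis .
      qed
      finally show ?thesis by (simp add: algebra_simps)
    qed
    have "exp x = (\<Sum>n. f (real n))" using sums_ml_term_of_nat[OF x0] by (simp add: sums_iff f_def)
    also have "\<dots> \<le> 2 * (real h + 1) * S + (2 * real h + 1) * (\<epsilon> * exp x)"
      using sums_ml_term_of_nat[OF x0] main by (intro suminf_le_const) (auto simp: sums_iff f_def)
    also have "(2 * real h + 1) * (\<epsilon> * exp x) = exp x / 2" using h by (simp add: \<epsilon>_def field_simps)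
    finally have "exp x \<le> 4 * (real h + 1) * S" by (simp add: algebra_simps)
    thus "1 / (4 * (real h + 1)) * exp x \<le> (\<Sum>k. ml_term x (\<beta> * real k))"
      using h by (simp add: S_def f_def field_simps)
  qed (use X in auto)
qed

section \<open>The reproducing kernel of a rotation invariant measure\<close>

lemma borel_measurable_cnj [measurable]:
  "f \<in> borel_measurable M \<Longrightarrow> (\<lambda>x. cnj (f x)) \<in> borel_measurable M"
  by (simp add: borel_measurable_complex_iff)

text \<open>All moments finite makes the monomials square integrable. Positive mass outside every
  disk makes the moments grow faster than any geometric sequence, so that the kernel series
  converges on the whole plane.\<close>

locale radial_measure =
  fixes \<mu> :: "complex measure"
  assumes sets_mu [simp, measurable_cong]: "sets \<mu> = sets borel"
    and rotation_invariant: "cmod c = 1 \<Longrightarrow> distr \<mu> borel ((*) c) = \<mu>"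
    and moments: "integrable \<mu> (\<lambda>z. cmod z ^ n)"
    and tails: "emeasure \<mu> {z. cmod z > L} > 0"
begin

lemma space_mu [simp]: "space \<mu> = UNIV"
  using sets_eq_imp_space_eq[OF sets_mu] by simp

sublocale finite_measure \<mu>
proof
  show "emeasure \<mu> (space \<mu>) \<noteq> \<infinity>"
    using moments[of 0] by (simp add: integrable_iff_bounded)
qed

definition moment :: "nat \<Rightarrow> real" where
  "moment k = (\<integral>z. cmod z ^ (2 * k) \<partial>\<mu>)"

lemma moment_ge: "L \<ge> 0 \<Longrightarrow> L ^ (2 * k) * measure \<mu> {z. cmod z > L} \<le> moment k"
proof -
  assume L: "L \<ge> 0"
  have "(\<integral>z. L ^ (2 * k) * indicator {z. cmod z > L} z \<partial>\<mu>) \<le> moment k"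
    unfolding moment_def using L
    by (intro integral_mono integrable_mult_right moments integrable_real_indicator)
       (auto simp: indicator_def less_top[symmetric] intro!: power_mono)
  thus ?thesis by simp
qed

lemma tail_pos: "measure \<mu> {z. cmod z > L} > 0"
  using tails[of L] by (simp add: emeasure_eq_measure)

lemma moment_pos: "moment k > 0"
  using moment_ge[of 1 k] tail_pos[of 1] by simp

text \<open>The mass outside radius L = 2 |r| + 1 forces \<open>moment k\<close> >= L^(2 k) t with t
  > 0, which leaves a geometric series of ratio |r| / L < 1 / 2.\<close>

lemma summable_moment_root: "summable (\<lambda>k. r ^ k / sqrt (moment k))"
proof -
  define L where "L = 2 * \<bar>r\<bar> + 1"
  define q where "q = \<bar>r\<bar> / L"
  define t where "t = measure \<mu> {z. cmod z > L}"
  have t: "t > 0" using tail_pos[of L] by (simp add: t_def)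
  have L: "L > 0" by (simp add: L_def)
  have q: "0 \<le> q" "q < 1" using L by (auto simp: q_def L_def)
  show ?thesis
  proof (rule summable_comparison_test'[of "\<lambda>k. q ^ k / sqrt t"])
    show "summable (\<lambda>k. q ^ k / sqrt t)"
      using q by (intro summable_divide summable_geometric) auto
    fix k :: nat
    have "sqrt (L ^ (2 * k) * t) \<le> sqrt (moment k)"
      using moment_ge[of L k] L unfolding t_def by (intro real_sqrt_le_mono) auto
    hence "L ^ k * sqrt t \<le> sqrt (moment k)"
      using L by (simp add: real_sqrt_mult power_mult power2_eq_square mult.commute[of 2] real_sqrt_power)
    hence "\<bar>r\<bar> ^ k / sqrt (moment k) \<le> \<bar>r\<bar> ^ k / (L ^ k * sqrt t)"
      using L t moment_pos[of k] by (intro divide_left_mono mult_pos_pos) auto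
    thus "norm (r ^ k / sqrt (moment k)) \<le> q ^ k / sqrt t"
      using moment_pos[of k] by (simp add: q_def power_abs power_divide)
  qed
qed

definition emon :: "nat \<Rightarrow> complex \<Rightarrow> complex" where
  "emon k z = z ^ k / complex_of_real (sqrt (moment k))"

definition kern :: "complex \<Rightarrow> complex \<Rightarrow> complex" where
  "kern z w = (\<Sum>k. emon k z * cnj (emon k w))"

definition shell_prob :: "nat \<Rightarrow> real set \<Rightarrow> real" where
  "shell_prob k S = (\<integral>z. indicator S (cmod z) * (cmod (emon k z))\<^sup>2 \<partial>\<mu>)"

lemma emon_measurable [measurable]: "emon k \<in> borel_measurable borel"
  unfolding emon_def[abs_def] by measurable

lemma cmod_emon: "cmod (emon k z) = cmod z ^ k / sqrt (moment k)"
  using moment_pos[of k] by (simp add: emon_def norm_divide norm_power)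

lemma cmod_emon_sq: "(cmod (emon k z))\<^sup>2 = cmod z ^ (2 * k) / moment k"
  using moment_pos[of k] by (simp add: cmod_emon power_divide power_mult[symmetric] mult.commute)

lemma summable_cmod_emon: "summable (\<lambda>k. cmod (emon k z))"
  by (simp add: cmod_emon summable_moment_root)

lemma integrable_emon_sq: "integrable \<mu> (\<lambda>z. (cmod (emon k z))\<^sup>2)"
  by (simp add: cmod_emon_sq moments)

lemma integral_emon_sq: "(\<integral>z. (cmod (emon k z))\<^sup>2 \<partial>\<mu>) = 1"
  using moment_pos[of k] by (simp add: cmod_emon_sq moment_def)

lemma summable_kern: "summable (\<lambda>k. cmod (emon k z * cnj (emon k w)))"
proof -
  have "summable (\<lambda>k. (cmod z * cmod w) ^ k / sqrt (moment k) / sqrt (moment k))"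
  proof (rule summable_comparison_test_ev)
    have "(\<lambda>k. 1 / sqrt (moment k)) \<longlonglongrightarrow> 0"
      using summable_LIMSEQ_zero[OF summable_moment_root[of 1]] by simp
    hence "eventually (\<lambda>k. 1 / sqrt (moment k) < 1) sequentially" by (rule order_tendstoD(2)) simp
    thus "eventually (\<lambda>k. norm ((cmod z * cmod w) ^ k / sqrt (moment k) / sqrt (moment k))
       \<le> (cmod z * cmod w) ^ k / sqrt (moment k)) sequentially"
    proof eventually_elim
      case (elim k)
      have "(cmod z * cmod w) ^ k / sqrt (moment k) * (1 / sqrt (moment k)) \<le> (cmod z * cmod w) ^ k / sqrt (moment k) * 1"
        using elim moment_pos[of k] by (intro mult_left_mono) auto
      thus ?case using moment_pos[of k] by simp
    qed
  qed (rule summable_moment_root)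
  thus ?thesis by (simp add: norm_mult cmod_emon power_mult_distrib)
qed

lemma kern_sums: "(\<lambda>k. emon k z * cnj (emon k w)) sums kern z w"
  unfolding kern_def using summable_norm_cancel[OF summable_kern] by (rule summable_sums)

lemma kern_measurable [measurable]: "(\<lambda>p. kern (fst p) (snd p)) \<in> borel_measurable (borel \<Otimes>\<^sub>M borel)"
  unfolding kern_def by measurable

lemma integral_rotate:
  fixes f :: "complex \<Rightarrow> complex"
  assumes [measurable]: "f \<in> borel_measurable borel" and "cmod c = 1"
  shows "(\<integral>z. f (c * z) \<partial>\<mu>) = (\<integral>z. f z \<partial>\<mu>)"
proof -
  have "(\<integral>z. f z \<partial>\<mu>) = (\<integral>z. f z \<partial>distr \<mu> borel ((*) c))"
    using rotation_invariant[OF assms(2)] by simp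
  also have "\<dots> = (\<integral>z. f (c * z) \<partial>\<mu>)"
    by (subst integral_distr) (auto simp: measurable_cong_sets[OF sets_mu refl])
  finally show ?thesis by simp
qed

lemma integrable_emon_mult:
  assumes [measurable]: "S \<in> sets borel"
  shows "integrable \<mu> (\<lambda>z. indicator S (cmod z) * (emon j z * cnj (emon k z)))"
proof (rule Bochner_Integration.integrable_bound)
  show "integrable \<mu> (\<lambda>z. (cmod (emon j z))\<^sup>2 + (cmod (emon k z))\<^sup>2)"
    by (intro Bochner_Integration.integrable_add integrable_emon_sq)
  show "AE z in \<mu>. norm (indicator S (cmod z) * (emon j z * cnj (emon k z)) :: complex)
     \<le> norm ((cmod (emon j z))\<^sup>2 + (cmod (emon k z))\<^sup>2)"
  proof (rule AE_I2)
    fix z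
    have "0 \<le> (cmod (emon j z) - cmod (emon k z))\<^sup>2 + (cmod (emon j z))\<^sup>2 + (cmod (emon k z))\<^sup>2" by simp
    hence "cmod (emon j z) * cmod (emon k z) \<le> (cmod (emon j z))\<^sup>2 + (cmod (emon k z))\<^sup>2"
      by (simp add: power2_diff)
    thus "norm (indicator S (cmod z) * (emon j z * cnj (emon k z)) :: complex)
     \<le> norm ((cmod (emon j z))\<^sup>2 + (cmod (emon k z))\<^sup>2)"
      by (auto simp: norm_mult indicator_def)
  qed
qed measurable

text \<open>For j \<noteq> k the rotation by pi / (j - k) multiplies the integrand by - 1, while
  rotation invariance preserves its integral. Restriction to a radial set does not disturb this,
  which is why the whole determinantal calculus survives in shells.\<close>

lemma shell_orthogonal:
  assumes [measurable]: "S \<in> sets borel"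
  shows "(\<integral>z. indicator S (cmod z) * (emon j z * cnj (emon k z)) \<partial>\<mu>)
    = (if j = k then complex_of_real (shell_prob k S) else 0)"
proof (cases "j = k")
  case True
  have "(\<integral>z. indicator S (cmod z) * (emon k z * cnj (emon k z)) \<partial>\<mu>)
     = (\<integral>z. complex_of_real (indicator S (cmod z) * (cmod (emon k z))\<^sup>2) \<partial>\<mu>)"
    by (intro Bochner_Integration.integral_cong refl)
       (auto simp: indicator_def complex_norm_square simp del: of_real_power)
  thus ?thesis using True by (simp only: shell_prob_def integral_complex_of_real if_True simp_thms)
next
  case False
  define f where "f = (\<lambda>z. indicator S (cmod z) * (emon j z * cnj (emon k z)) :: complex)"
  define t where "t = pi / (real j - real k)"
  have "f (cis t * z) = - f z" for z
  proof -
    have "cis t ^ j * cnj (cis t ^ k) = cis (real j * t - real k * t)"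
      by (simp add: Complex.DeMoivre cis_cnj cis_mult)
    also have "real j * t - real k * t = pi" using False unfolding t_def left_diff_distrib[symmetric] by simp
    finally have *: "cis t ^ j * cnj (cis t ^ k) = -1" by simp
    have "f (cis t * z) = (cis t ^ j * cnj (cis t ^ k)) * f z"
      by (simp add: f_def emon_def norm_mult power_mult_distrib mult_ac)
    thus ?thesis by (simp only: *) simp
  qed
  moreover have "(\<integral>z. f (cis t * z) \<partial>\<mu>) = (\<integral>z. f z \<partial>\<mu>)"
    by (rule integral_rotate) (auto simp: f_def)
  ultimately have "(\<integral>z. f z \<partial>\<mu>) = 0" by simp
  thus ?thesis using False by (simp add: f_def)
qed

lemma integrable_shell: "S \<in> sets borel \<Longrightarrow> integrable \<mu> (\<lambda>z. indicator S (cmod z) * (cmod (emon k z))\<^sup>2)"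
  by (rule Bochner_Integration.integrable_bound[OF integrable_emon_sq[of k]]) (auto simp: indicator_def)

lemma shell_prob_nonneg: "shell_prob k S \<ge> 0"
  unfolding shell_prob_def by (intro integral_nonneg_AE) auto

lemma nn_integral_shell:
  assumes [measurable]: "S \<in> sets borel"
  shows "(\<integral>\<^sup>+z. indicator S (cmod z) * ennreal ((cmod (emon k z))\<^sup>2) \<partial>\<mu>) = ennreal (shell_prob k S)"
proof -
  have "(\<integral>\<^sup>+z. indicator S (cmod z) * ennreal ((cmod (emon k z))\<^sup>2) \<partial>\<mu>)
    = (\<integral>\<^sup>+z. ennreal (indicator S (cmod z) * (cmod (emon k z))\<^sup>2) \<partial>\<mu>)"
    by (intro nn_integral_cong) (auto simp: indicator_def)
  also have "\<dots> = ennreal (shell_prob k S)"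
    unfolding shell_prob_def by (intro nn_integral_eq_integral integrable_shell) auto
  finally show ?thesis .
qed

lemma kern_holomorphic: "(\<lambda>z. kern z w) holomorphic_on UNIV"
proof -
  have "(\<lambda>z. kern z w) holomorphic_on ball 0 r" for r
  proof (rule power_series_holomorphic)
    fix z
    show "(\<lambda>n. cnj (emon n w) / complex_of_real (sqrt (moment n)) * (z - 0) ^ n) sums kern z w"
      using kern_sums[of z w] by (simp add: emon_def mult_ac)
  qed
  from holomorphic_on_imp_differentiable_at[OF this open_ball]
  have "(\<lambda>z. kern z w) field_differentiable at z" for z
    by (meson mem_ball_0 less_add_one)
  thus ?thesis by (simp add: holomorphic_on_open field_differentiable_def)
qed

text \<open>Cauchy-Schwarz with the summable weights a k = |e_k(w)| gives |K(z,w)|^2 <= A * (sum of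
  a k |e_k(z)|^2), whose integral is A^2 because the monomials are normalized.\<close>

lemma kern_square_integrable: "integrable \<mu> (\<lambda>z. (cmod (kern z w))\<^sup>2)"
proof (rule integrableI_bounded)
  have [measurable]: "(\<lambda>z. kern z w) \<in> borel_measurable borel"
    unfolding kern_def by measurable
  show "(\<lambda>z. (cmod (kern z w))\<^sup>2) \<in> borel_measurable \<mu>" by measurable
  define a where "a = (\<lambda>k. cmod (emon k w))"
  define A where "A = (\<Sum>k. a k)"
  have a: "a k \<ge> 0" "summable a" for k by (auto simp: a_def[abs_def] summable_cmod_emon)
  have A: "A \<ge> 0" "(\<Sum>k<N. a k) \<le> A" for N
    using a unfolding A_def by (auto intro!: suminf_nonneg sum_le_suminf)
  have "ennreal ((cmod (kern z w))\<^sup>2) \<le> (\<Sum>k. ennreal (A * a k) * ennreal ((cmod (emon k z))\<^sup>2))" for z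
  proof (rule LIMSEQ_le_const2)
    show "(\<lambda>N. ennreal ((cmod (\<Sum>k<N. emon k z * cnj (emon k w)))\<^sup>2)) \<longlonglongrightarrow> ennreal ((cmod (kern z w))\<^sup>2)"
      using kern_sums[of z w] by (intro tendsto_ennrealI tendsto_intros) (simp add: sums_def)
    show "\<exists>N. \<forall>n\<ge>N. ennreal ((cmod (\<Sum>k<n. emon k z * cnj (emon k w)))\<^sup>2)
       \<le> (\<Sum>k. ennreal (A * a k) * ennreal ((cmod (emon k z))\<^sup>2))"
    proof (intro exI allI impI)
      fix N
      have "(cmod (\<Sum>k<N. emon k z * cnj (emon k w)))\<^sup>2 \<le> (\<Sum>k<N. sqrt (a k) * (sqrt (a k) * cmod (emon k z)))\<^sup>2"
      proof (rule power_mono)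
        have "cmod (\<Sum>k<N. emon k z * cnj (emon k w)) \<le> (\<Sum>k<N. cmod (emon k z * cnj (emon k w)))"
          by (rule norm_sum)
        also have "\<dots> = (\<Sum>k<N. sqrt (a k) * (sqrt (a k) * cmod (emon k z)))"
          unfolding mult.assoc[symmetric] real_sqrt_mult_self abs_of_nonneg[OF a(1)]
          by (simp add: norm_mult a_def mult.commute)
        finally show "cmod (\<Sum>k<N. emon k z * cnj (emon k w)) \<le> (\<Sum>k<N. sqrt (a k) * (sqrt (a k) * cmod (emon k z)))" .
      qed simp
      also have "\<dots> \<le> (\<Sum>k<N. (sqrt (a k))\<^sup>2) * (\<Sum>k<N. (sqrt (a k) * cmod (emon k z))\<^sup>2)"
        by (rule Cauchy_Schwarz_ineq_sum)
      also have "\<dots> = (\<Sum>k<N. a k) * (\<Sum>k<N. a k * (cmod (emon k z))\<^sup>2)"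
        using a by (simp add: power_mult_distrib)
      also have "\<dots> \<le> A * (\<Sum>k<N. a k * (cmod (emon k z))\<^sup>2)"
        using A a by (intro mult_right_mono sum_nonneg) auto
      also have "\<dots> = (\<Sum>k<N. A * a k * (cmod (emon k z))\<^sup>2)" by (simp add: sum_distrib_left mult.assoc)
      finally have "ennreal ((cmod (\<Sum>k<N. emon k z * cnj (emon k w)))\<^sup>2) \<le> ennreal (\<Sum>k<N. A * a k * (cmod (emon k z))\<^sup>2)"
        by (rule ennreal_leI)
      also have "\<dots> = (\<Sum>k<N. ennreal (A * a k) * ennreal ((cmod (emon k z))\<^sup>2))"
        using A a by (subst sum_ennreal[symmetric]) (auto simp: ennreal_mult)
      also have "\<dots> \<le> (\<Sum>k. ennreal (A * a k) * ennreal ((cmod (emon k z))\<^sup>2))"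
        by (intro sum_le_suminf) auto
      finally show "ennreal ((cmod (\<Sum>k<N. emon k z * cnj (emon k w)))\<^sup>2)
        \<le> (\<Sum>k. ennreal (A * a k) * ennreal ((cmod (emon k z))\<^sup>2))" .
    qed
  qed
  hence "(\<integral>\<^sup>+z. ennreal (norm ((cmod (kern z w))\<^sup>2)) \<partial>\<mu>)
     \<le> (\<integral>\<^sup>+z. (\<Sum>k. ennreal (A * a k) * ennreal ((cmod (emon k z))\<^sup>2)) \<partial>\<mu>)"
    by (intro nn_integral_mono) auto
  also have "\<dots> = (\<Sum>k. ennreal (A * a k) * (\<integral>\<^sup>+z. ennreal ((cmod (emon k z))\<^sup>2) \<partial>\<mu>))"
    by (simp add: nn_integral_suminf nn_integral_cmult)
  also have "\<dots> = (\<Sum>k. ennreal (A * a k))"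
    by (subst nn_integral_eq_integral[OF integrable_emon_sq]) (auto simp: integral_emon_sq)
  also have "\<dots> < \<infinity>"
    using A a by (subst suminf_ennreal2) (auto intro!: summable_mult)
  finally show "(\<integral>\<^sup>+z. ennreal (norm ((cmod (kern z w))\<^sup>2)) \<partial>\<mu>) < \<infinity>" .
qed

lemma kern_in_fock: "(\<lambda>z. kern z w) \<in> fock_space \<mu>"
  using kern_holomorphic kern_square_integrable by (simp add: fock_space_def)

lemma fock_measurable:
  assumes "f \<in> fock_space \<mu>" shows "f \<in> borel_measurable borel"
  using assms by (intro borel_measurable_continuous_onI holomorphic_on_imp_continuous_on) (auto simp: fock_space_def)

lemma emon_fock: "emon k \<in> fock_space \<mu>"
  using integrable_emon_sq[of k] moment_pos[of k]
  by (auto simp: fock_space_def emon_def[abs_def] intro!: holomorphic_intros)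

lemma fock_mult:
  assumes "f \<in> fock_space \<mu>" "g \<in> fock_space \<mu>"
  shows "integrable \<mu> (\<lambda>z. f z * cnj (g z))"
    and "(\<integral>z. cmod (f z * cnj (g z)) \<partial>\<mu>) \<le> (\<integral>z. (cmod (f z))\<^sup>2 \<partial>\<mu>) + (\<integral>z. (cmod (g z))\<^sup>2 \<partial>\<mu>)"
proof -
  note [measurable] = fock_measurable[OF assms(1)] fock_measurable[OF assms(2)]
  have int: "integrable \<mu> (\<lambda>z. (cmod (f z))\<^sup>2)" "integrable \<mu> (\<lambda>z. (cmod (g z))\<^sup>2)"
    using assms by (auto simp: fock_space_def)
  have le: "cmod (f z * cnj (g z)) \<le> (cmod (f z))\<^sup>2 + (cmod (g z))\<^sup>2" for z
  proof -
    have "0 \<le> (cmod (f z) - cmod (g z))\<^sup>2 + (cmod (f z))\<^sup>2 + (cmod (g z))\<^sup>2" by simp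
    thus ?thesis by (simp add: power2_diff norm_mult)
  qed
  show *: "integrable \<mu> (\<lambda>z. f z * cnj (g z))"
  proof (rule Bochner_Integration.integrable_bound)
    show "integrable \<mu> (\<lambda>z. (cmod (f z))\<^sup>2 + (cmod (g z))\<^sup>2)"
      by (intro Bochner_Integration.integrable_add int)
    show "AE z in \<mu>. norm (f z * cnj (g z)) \<le> norm ((cmod (f z))\<^sup>2 + (cmod (g z))\<^sup>2)"
      using le by (auto simp: order_trans[OF le abs_ge_self])
  qed measurable
  show "(\<integral>z. cmod (f z * cnj (g z)) \<partial>\<mu>) \<le> (\<integral>z. (cmod (f z))\<^sup>2 \<partial>\<mu>) + (\<integral>z. (cmod (g z))\<^sup>2 \<partial>\<mu>)"
    unfolding Bochner_Integration.integral_add[OF int, symmetric]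
    using le by (intro integral_mono integrable_norm * Bochner_Integration.integrable_add int)
qed

text \<open>Completeness of the monomials. On the disk |z| <= R the power series may be integrated
  term by term, and orthogonality inside the disk keeps only the n-th term. Then R tends to infinity
  by dominated convergence, with \<open>shell_prob n {..R}\<close> tending to 1.\<close>

lemma fock_coefficient:
  assumes f: "f \<in> fock_space \<mu>" and a: "\<And>z. (\<lambda>n. a n * z ^ n) sums f z"
  shows "(\<integral>z. f z * cnj (emon n z) \<partial>\<mu>) = a n * complex_of_real (sqrt (moment n))"
proof -
  note [measurable] = fock_measurable[OF f]
  have a_emon: "a k * z ^ k = a k * complex_of_real (sqrt (moment k)) * emon k z" for k z
    using moment_pos[of k] by (simp add: emon_def)
  have abs_summable: "summable (\<lambda>k. cmod (a k) * R ^ k)" if "R \<ge> 0" for R :: real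
  proof -
    have "summable (\<lambda>k. norm (a k * complex_of_real R ^ k))"
      by (rule powser_insidea[of a "complex_of_real (R + 1)"]) (use a that in \<open>auto simp: sums_iff simp del: of_real_add\<close>)
    thus ?thesis using that by (simp add: norm_mult norm_power)
  qed
  have disc: "(\<integral>z. indicator {..R} (cmod z) * (f z * cnj (emon n z)) \<partial>\<mu>)
      = a n * complex_of_real (sqrt (moment n)) * complex_of_real (shell_prob n {..R})" if R: "R \<ge> 0" for R
  proof -
    let ?g = "\<lambda>k z. indicator {..R} (cmod z) * (a k * z ^ k * cnj (emon n z)) :: complex"
    have g: "?g k z = a k * complex_of_real (sqrt (moment k)) * (indicator {..R} (cmod z) * (emon k z * cnj (emon n z)))" for k z
      by (simp only: a_emon) (simp add: mult_ac)
    have int: "integrable \<mu> (?g k)" for k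
      unfolding g by (intro integrable_mult_right integrable_emon_mult) simp
    define B where "B = R ^ n / sqrt (moment n)"
    have B: "B \<ge> 0" using R moment_pos[of n] by (simp add: B_def)
    have bound: "norm (?g k z) \<le> cmod (a k) * R ^ k * B" for k z
    proof (cases "cmod z \<le> R")
      case True
      hence "cmod (emon n z) \<le> B" unfolding B_def cmod_emon
        using moment_pos[of n] by (intro divide_right_mono power_mono) auto
      thus ?thesis using True R B
        by (auto simp: norm_mult norm_power intro!: mult_mono power_mono)
    qed (use B R in auto)
    have summ: "summable (\<lambda>k. cmod (a k) * R ^ k * B)" by (intro summable_mult2 abs_summable R)
    have "(\<integral>z. (\<Sum>k. ?g k z) \<partial>\<mu>) = (\<Sum>k. \<integral>z. ?g k z \<partial>\<mu>)"
    proof (rule integral_suminf[OF int])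
      show "AE z in \<mu>. summable (\<lambda>k. norm (?g k z))"
        by (intro AE_I2 summable_comparison_test'[OF summ]) (use bound in auto)
      show "summable (\<lambda>k. \<integral>z. norm (?g k z) \<partial>\<mu>)"
      proof (rule summable_comparison_test'[of "\<lambda>k. cmod (a k) * R ^ k * B * measure \<mu> UNIV"])
        show "summable (\<lambda>k. cmod (a k) * R ^ k * B * measure \<mu> UNIV)" by (intro summable_mult2 abs_summable R)
        fix k
        have "(\<integral>z. norm (?g k z) \<partial>\<mu>) \<le> (\<integral>z. cmod (a k) * R ^ k * B \<partial>\<mu>)"
          using bound by (intro integral_mono integrable_norm int integrable_const)
        thus "norm (\<integral>z. norm (?g k z) \<partial>\<mu>) \<le> cmod (a k) * R ^ k * B * measure \<mu> UNIV"
          by (simp add: mult_ac)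
      qed
    qed
    also have "(\<lambda>z. \<Sum>k. ?g k z) = (\<lambda>z. indicator {..R} (cmod z) * (f z * cnj (emon n z)))"
    proof
      fix z
      have "(\<lambda>k. ?g k z) sums (indicator {..R} (cmod z) * (f z * cnj (emon n z)))"
        by (intro sums_mult sums_mult2 a)
      thus "(\<Sum>k. ?g k z) = indicator {..R} (cmod z) * (f z * cnj (emon n z))" by (simp add: sums_iff)
    qed
    also have "(\<Sum>k. \<integral>z. ?g k z \<partial>\<mu>) = (\<Sum>k. if k = n then a n * complex_of_real (sqrt (moment n)) * complex_of_real (shell_prob n {..R}) else 0)"
      unfolding g by (intro suminf_cong) (simp add: shell_orthogonal)
    also have "\<dots> = a n * complex_of_real (sqrt (moment n)) * complex_of_real (shell_prob n {..R})"
      by (subst suminf_finite[of "{n}"]) auto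
    finally show ?thesis .
  qed
  have "(\<lambda>R. \<integral>z. indicator {..real R} (cmod z) * (f z * cnj (emon n z)) \<partial>\<mu>) \<longlonglongrightarrow> (\<integral>z. f z * cnj (emon n z) \<partial>\<mu>)"
  proof (rule integral_dominated_convergence[where w="\<lambda>z. norm (f z * cnj (emon n z))"])
    show "integrable \<mu> (\<lambda>z. norm (f z * cnj (emon n z)))"
      by (intro integrable_norm fock_mult f emon_fock)
    show "AE z in \<mu>. (\<lambda>R. indicator {..real R} (cmod z) * (f z * cnj (emon n z))) \<longlonglongrightarrow> f z * cnj (emon n z)"
    proof (rule AE_I2, rule tendsto_eventually)
      fix z
      obtain N where "cmod z \<le> real N" using real_arch_simple by blast
      thus "eventually (\<lambda>R. indicator {..real R} (cmod z) * (f z * cnj (emon n z)) = f z * cnj (emon n z)) sequentially"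
        by (intro eventually_sequentiallyI[of N]) auto
    qed
  qed (auto simp: indicator_def)
  moreover have "(\<lambda>R. shell_prob n {..real R}) \<longlonglongrightarrow> (\<integral>z. (cmod (emon n z))\<^sup>2 \<partial>\<mu>)"
    unfolding shell_prob_def
  proof (rule integral_dominated_convergence[where w="\<lambda>z. (cmod (emon n z))\<^sup>2"])
    show "AE z in \<mu>. (\<lambda>R. indicator {..real R} (cmod z) * (cmod (emon n z))\<^sup>2) \<longlonglongrightarrow> (cmod (emon n z))\<^sup>2"
    proof (rule AE_I2, rule tendsto_eventually)
      fix z
      obtain N where "cmod z \<le> real N" using real_arch_simple by blast
      thus "eventually (\<lambda>R. indicator {..real R} (cmod z) * (cmod (emon n z))\<^sup>2 = (cmod (emon n z))\<^sup>2) sequentially"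
        by (intro eventually_sequentiallyI[of N]) auto
    qed
  qed (auto simp: indicator_def integrable_emon_sq)
  hence "(\<lambda>R. a n * complex_of_real (sqrt (moment n)) * complex_of_real (shell_prob n {..real R}))
     \<longlonglongrightarrow> a n * complex_of_real (sqrt (moment n)) * complex_of_real 1"
    unfolding integral_emon_sq by (intro tendsto_intros)
  ultimately show ?thesis
    by (simp add: disc LIMSEQ_unique)
qed

text \<open>Expanding the kernel turns the inner product into the Taylor series of \<open>f\<close>
  at \<zeta>. Sum and integral may be exchanged because the L1 norm of f times the conjugate of e_k
  is bounded independently of k, while |e_k(\<zeta>)| is summable.\<close>

lemma kern_reproducing: "is_reproducing_kernel \<mu> kern"
  unfolding is_reproducing_kernel_def
proof (intro allI conjI ballI kern_in_fock)
  fix \<zeta> f assume f: "f \<in> fock_space \<mu>"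
  note [measurable] = fock_measurable[OF f]
  define a where "a = (\<lambda>n. (deriv ^^ n) f 0 / fact n)"
  have a: "(\<lambda>n. a n * z ^ n) sums f z" for z
    using holomorphic_power_series[of f 0 "cmod z + 1" z] f
    by (auto simp: a_def fock_space_def intro: holomorphic_on_subset)
  let ?g = "\<lambda>k z. f z * cnj (emon k z) * emon k \<zeta>"
  have "(\<integral>z. (\<Sum>k. ?g k z) \<partial>\<mu>) = (\<Sum>k. \<integral>z. ?g k z \<partial>\<mu>)"
  proof (rule integral_suminf)
    show "integrable \<mu> (?g k)" for k by (intro integrable_mult_left fock_mult f emon_fock)
    show "AE z in \<mu>. summable (\<lambda>k. norm (?g k z))"
    proof (rule AE_I2)
      fix z
      have "summable (\<lambda>k. cmod (f z) * cmod (emon k z * cnj (emon k \<zeta>)))"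
        by (intro summable_mult summable_kern)
      thus "summable (\<lambda>k. norm (?g k z))" by (simp add: norm_mult mult.assoc)
    qed
    define F where "F = (\<integral>z. (cmod (f z))\<^sup>2 \<partial>\<mu>) + 1"
    show "summable (\<lambda>k. \<integral>z. norm (?g k z) \<partial>\<mu>)"
    proof (rule summable_comparison_test'[of "\<lambda>k. F * cmod (emon k \<zeta>)"])
      show "summable (\<lambda>k. F * cmod (emon k \<zeta>))" by (intro summable_mult summable_cmod_emon)
      fix k
      have "(\<integral>z. norm (?g k z) \<partial>\<mu>) = (\<integral>z. norm (f z * cnj (emon k z)) \<partial>\<mu>) * cmod (emon k \<zeta>)"
        by (simp add: norm_mult)
      also have "\<dots> \<le> F * cmod (emon k \<zeta>)"
        using fock_mult(2)[OF f emon_fock, of k] by (intro mult_right_mono) (auto simp: F_def integral_emon_sq)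
      finally show "norm (\<integral>z. norm (?g k z) \<partial>\<mu>) \<le> F * cmod (emon k \<zeta>)"
        by (subst real_norm_def, subst abs_of_nonneg) (auto intro!: integral_nonneg_AE)
    qed
  qed
  also have "(\<lambda>z. \<Sum>k. ?g k z) = (\<lambda>z. f z * cnj (kern z \<zeta>))"
  proof
    fix z
    have "(\<lambda>k. cnj (emon k z * cnj (emon k \<zeta>))) sums cnj (kern z \<zeta>)"
      using kern_sums[of z \<zeta>] by (simp only: sums_cnj)
    from sums_mult[OF this, of "f z"] show "(\<Sum>k. ?g k z) = f z * cnj (kern z \<zeta>)"
      by (simp add: sums_iff mult_ac)
  qed
  also have "(\<Sum>k. \<integral>z. ?g k z \<partial>\<mu>) = (\<Sum>k. a k * \<zeta> ^ k)"
  proof (rule suminf_cong)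
    fix k
    have "(\<integral>z. ?g k z \<partial>\<mu>) = a k * complex_of_real (sqrt (moment k)) * emon k \<zeta>"
      by (simp add: fock_coefficient[OF f a])
    thus "(\<integral>z. ?g k z \<partial>\<mu>) = a k * \<zeta> ^ k" using moment_pos[of k] by (simp add: emon_def)
  qed
  also have "\<dots> = f \<zeta>" using a by (simp add: sums_iff)
  finally show "f \<zeta> = (\<integral>z. f z * cnj (kern z \<zeta>) \<partial>\<mu>)" by simp
qed

end

text \<open>Any two reproducing kernels reproduce each other: A(z,w) is the conjugate of B(w,z).
  Applied to the pairs (K, L) and (L, L) this identifies K with L.\<close>

lemma reproducing_kernel_unique:
  assumes "is_reproducing_kernel \<mu> K" "is_reproducing_kernel \<mu> L"
  shows "K = L"
proof (intro ext)
  have swap: "A z w = cnj (B w z)" if "is_reproducing_kernel \<mu> A" "is_reproducing_kernel \<mu> B" for A B z w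
  proof -
    have "A z w = (LINT x|\<mu>. A x w * cnj (B x z))"
      using that by (auto simp: is_reproducing_kernel_def)
    moreover have "B w z = (LINT x|\<mu>. B x z * cnj (A x w))"
      using that by (auto simp: is_reproducing_kernel_def)
    moreover have "cnj (LINT x|\<mu>. B x z * cnj (A x w)) = (LINT x|\<mu>. A x w * cnj (B x z))"
      by (subst Bochner_Integration.integral_cnj[symmetric]) (simp add: mult.commute)
    ultimately show ?thesis by simp
  qed
  fix z w
  show "K z w = L z w" by (rule trans[OF swap[OF assms] swap[OF assms(2) assms(2), symmetric]])
qed

context radial_measure begin

lemma reproducing_kernel_eq: "reproducing_kernel \<mu> = kern"
  unfolding reproducing_kernel_def
  using kern_reproducing reproducing_kernel_unique by (intro the_equality) auto

end

section \<open>Correlations of the moduli\<close>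

lemma fact_ennreal: "(fact n :: ennreal) = ennreal (fact n)"
  by (metis ennreal_of_nat_eq_real_of_nat of_nat_fact)

lemma det_mat_rows:
  "Determinant.det (Matrix.mat n n (\<lambda>(i, j). f i j)) =
    (\<Sum>p | p permutes {..<n}. of_int (sign p) * (\<Prod>i<n. f i (p i)))"
proof -
  have "Determinant.det (Matrix.mat n n (\<lambda>(i, j). f i j)) =
    (\<Sum>p | p permutes {0..<n}. of_int (sign p) * (\<Prod>i = 0..<n. Matrix.mat n n (\<lambda>(i, j). f i j) $$ (i, p i)))"
    by (rule det_def') simp
  also have "\<dots> = (\<Sum>p | p permutes {0..<n}. of_int (sign p) * (\<Prod>i = 0..<n. f i (p i)))"
    by (intro sum.cong refl arg_cong2[where f="(*)"] prod.cong) (auto dest: permutes_in_image)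
  finally show ?thesis by (simp add: atLeast0LessThan)
qed

lemma det_mat_cols:
  "Determinant.det (Matrix.mat n n (\<lambda>(i, j). f i j)) =
    (\<Sum>p | p permutes {..<n}. of_int (sign p) * (\<Prod>j<n. f (p j) j))"
proof -
  have "Determinant.det (Matrix.mat n n (\<lambda>(i, j). f i j)) =
    (\<Sum>p | p permutes {0..<n}. of_int (sign p) * (\<Prod>j<n. Matrix.mat n n (\<lambda>(i, j). f i j) $$ (p j, j)))"
    by (rule det_col) simp
  also have "\<dots> = (\<Sum>p | p permutes {0..<n}. of_int (sign p) * (\<Prod>j<n. f (p j) j))"
    by (intro sum.cong refl arg_cong2[where f="(*)"] prod.cong)
       (auto dest: permutes_in_image simp: atLeast0LessThan)
  finally show ?thesis by (simp add: atLeast0LessThan)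
qed

lemma bij_betw_PiE_permute:
  assumes p: "p permutes {..<n}"
  shows "bij_betw (\<lambda>k. restrict (k \<circ> p) {..<n}) ({..<n} \<rightarrow>\<^sub>E B) ({..<n} \<rightarrow>\<^sub>E B)"
proof (rule bij_betw_byWitness[where f'="\<lambda>k. restrict (k \<circ> Hilbert_Choice.inv p) {..<n}"])
  have img: "p i < n \<longleftrightarrow> i < n" "Hilbert_Choice.inv p i < n \<longleftrightarrow> i < n" for i
    using permutes_in_image[OF p] permutes_in_image[OF permutes_inv[OF p]] by auto
  show "\<forall>k\<in>{..<n} \<rightarrow>\<^sub>E B. restrict (restrict (k \<circ> p) {..<n} \<circ> Hilbert_Choice.inv p) {..<n} = k"
    using p by (auto simp: fun_eq_iff restrict_def img permutes_inverses PiE_def extensional_def)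
  show "\<forall>k\<in>{..<n} \<rightarrow>\<^sub>E B. restrict (restrict (k \<circ> Hilbert_Choice.inv p) {..<n} \<circ> p) {..<n} = k"
    using p by (auto simp: fun_eq_iff restrict_def img permutes_inverses PiE_def extensional_def)
  show "(\<lambda>k. restrict (k \<circ> p) {..<n}) ` ({..<n} \<rightarrow>\<^sub>E B) \<subseteq> {..<n} \<rightarrow>\<^sub>E B"
    by (auto simp: img PiE_def Pi_def)
  show "(\<lambda>k. restrict (k \<circ> Hilbert_Choice.inv p) {..<n}) ` ({..<n} \<rightarrow>\<^sub>E B) \<subseteq> {..<n} \<rightarrow>\<^sub>E B"
    by (auto simp: img PiE_def Pi_def)
qed

text \<open>
  A Cauchy-Binet formula with \<open>k\<close> ranging over all index tuples instead of increasing ones; this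
  accounts for the factor \<open>fact n\<close>.
\<close>

lemma det_gram:
  fixes a :: "nat \<Rightarrow> nat \<Rightarrow> complex"
  shows "fact n * Determinant.det (Matrix.mat n n (\<lambda>(i, j). \<Sum>k<N. a k i * cnj (a k j))) =
    complex_of_real (\<Sum>k\<in>{..<n} \<rightarrow>\<^sub>E {..<N}. (cmod (Determinant.det (Matrix.mat n n (\<lambda>(i, j). a (k i) j))))\<^sup>2)"
proof -
  define P where "P = {p. p permutes {..<n}}"
  define F where "F = {..<n} \<rightarrow>\<^sub>E {..<N}"
  define s where "s = (\<lambda>p. of_int (sign (p :: nat \<Rightarrow> nat)) :: complex)"
  define D where "D = (\<lambda>k. Determinant.det (Matrix.mat n n (\<lambda>(i, j). a (k i) j)))"
  define G where "G = Determinant.det (Matrix.mat n n (\<lambda>(i, j). \<Sum>k<N. a k i * cnj (a k j)))"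
  have D_rows: "D k = (\<Sum>p\<in>P. s p * (\<Prod>i<n. a (k i) (p i)))" for k
    by (simp add: D_def det_mat_rows P_def s_def)
  have D_cols: "D k = (\<Sum>p\<in>P. s p * (\<Prod>i<n. a (k (p i)) i))" for k
    by (simp add: D_def det_mat_cols P_def s_def)
  have cnj_s: "cnj (s p) = s p" for p by (simp add: s_def)
  have G1: "G = (\<Sum>k\<in>F. (\<Prod>i<n. a (k i) i) * cnj (D k))"
  proof -
    have "G = (\<Sum>p\<in>P. s p * (\<Prod>i<n. \<Sum>k<N. a k i * cnj (a k (p i))))"
      by (simp add: G_def det_mat_rows P_def s_def)
    also have "\<dots> = (\<Sum>p\<in>P. s p * (\<Sum>k\<in>F. \<Prod>i<n. a (k i) i * cnj (a (k i) (p i))))"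
      unfolding F_def by (subst prod_sum_PiE) auto
    also have "\<dots> = (\<Sum>p\<in>P. \<Sum>k\<in>F. (\<Prod>i<n. a (k i) i) * cnj (s p * (\<Prod>i<n. a (k i) (p i))))"
      by (simp add: sum_distrib_left prod.distrib cnj_s mult_ac)
    also have "\<dots> = (\<Sum>k\<in>F. (\<Prod>i<n. a (k i) i) * cnj (D k))"
      by (subst sum.swap) (simp add: sum_distrib_left D_rows)
    finally show ?thesis .
  qed
  \<comment> \<open>Permuting the index tuple multiplies \<open>D k\<close> by the sign of the
    permutation. Adding these \<open>fact n\<close> representations of the same number turns the
    product of diagonal entries into a second determinant.\<close>
  have G2: "G = (\<Sum>k\<in>F. s p * (\<Prod>i<n. a (k (p i)) i) * cnj (D k))" if p: "p \<in> P" for p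
  proof -
    have p': "p permutes {0..<n}" "p permutes {..<n}" using p by (auto simp: P_def atLeast0LessThan)
    have "D (restrict (k \<circ> p) {..<n}) = s p * D k" for k
    proof -
      let ?A = "Matrix.mat n n (\<lambda>(i, j). a (k i) j)"
      have "Matrix.mat n n (\<lambda>(i, j). a (restrict (k \<circ> p) {..<n} i) j) = Matrix.mat n n (\<lambda>(i, j). ?A $$ (p i, j))"
        using permutes_in_image[OF p'(2)] by (intro eq_matI) auto
      thus ?thesis unfolding D_def using det_permute_rows[of ?A n p] p' by (simp add: s_def)
    qed
    moreover have "G = (\<Sum>k\<in>F. (\<Prod>i<n. a (restrict (k \<circ> p) {..<n} i) i) * cnj (D (restrict (k \<circ> p) {..<n})))"
      unfolding G1 F_def by (rule sum.reindex_bij_betw[OF bij_betw_PiE_permute[OF p'(2)], symmetric])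
    ultimately show ?thesis by (simp add: cnj_s mult_ac)
  qed
  have "fact n * G = (\<Sum>p\<in>P. G)"
    by (simp add: P_def card_permutations)
  also have "\<dots> = (\<Sum>p\<in>P. \<Sum>k\<in>F. s p * (\<Prod>i<n. a (k (p i)) i) * cnj (D k))"
    by (intro sum.cong refl G2)
  also have "\<dots> = (\<Sum>k\<in>F. (\<Sum>p\<in>P. s p * (\<Prod>i<n. a (k (p i)) i)) * cnj (D k))"
    by (subst sum.swap) (simp add: sum_distrib_right)
  also have "\<dots> = (\<Sum>k\<in>F. D k * cnj (D k))" by (simp add: D_cols)
  also have "\<dots> = complex_of_real (\<Sum>k\<in>F. (cmod (D k))\<^sup>2)"
    by (simp add: complex_norm_square del: of_real_power)
  finally show ?thesis by (simp add: G_def F_def D_def)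
qed

lemma det_eq_0_if_not_inj:
  fixes a :: "nat \<Rightarrow> nat \<Rightarrow> complex"
  assumes "\<not> inj_on k {..<n}"
  shows "Determinant.det (Matrix.mat n n (\<lambda>(i, j). a (k i) j)) = 0"
proof -
  obtain i j where ij: "i < n" "j < n" "i \<noteq> j" "k i = k j"
    using assms by (auto simp: inj_on_def)
  show ?thesis
    by (rule det_identical_rows[where n=n and i=i and j=j]) (use ij in \<open>auto intro!: eq_vecI\<close>)
qed

section \<open>Product moments over shells from orthogonality\<close>

context radial_measure begin

sublocale fp: product_sigma_finite "\<lambda>_ :: nat. \<mu>"
  by standard

abbreviation gram :: "nat \<Rightarrow> (nat \<Rightarrow> complex) \<Rightarrow> complex" where
  "gram n z \<equiv> Determinant.det (Matrix.mat n n (\<lambda>(i, j). kern (z i) (z j)))"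

text \<open>The Slater determinant of the monomials with indices \<open>k 0\<close>,
  \<open>k 1\<close> and so on, that is, the antisymmetrisation of their product.\<close>

definition slater :: "nat \<Rightarrow> (nat \<Rightarrow> nat) \<Rightarrow> (nat \<Rightarrow> complex) \<Rightarrow> complex" where
  "slater n k z = Determinant.det (Matrix.mat n n (\<lambda>(i, j). emon (k i) (z j)))"

text \<open>Cauchy-Binet is applied to the kernel truncated to N monomials, and a determinant is
  continuous in its entries. The sums of squares increase with N; hence the determinant is
  nonnegative and monotone convergence is available.\<close>

lemma gram_LIMSEQ:
  "(\<lambda>N. (\<Sum>k\<in>{..<n} \<rightarrow>\<^sub>E {..<N}. (cmod (slater n k z))\<^sup>2)) \<longlonglongrightarrow> fact n * Re (gram n z)"
proof -
  have "(\<lambda>N. \<Sum>k<N. emon k (z i) * cnj (emon k (z j))) \<longlonglongrightarrow> kern (z i) (z j)" for i j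
    using kern_sums[of "z i" "z j"] by (simp add: sums_def)
  hence "(\<lambda>N. Re (fact n * Determinant.det (Matrix.mat n n (\<lambda>(i, j). \<Sum>k<N. emon k (z i) * cnj (emon k (z j))))))
    \<longlonglongrightarrow> Re (fact n * gram n z)"
    unfolding det_mat_rows by (intro tendsto_intros)
  moreover have "Re (fact n * gram n z) = fact n * Re (gram n z)"
    by simp
  ultimately show ?thesis
    unfolding det_gram[where a="\<lambda>k i. emon k (z i)"] slater_def by simp
qed

lemma gram_sum_mono:
  assumes "N \<le> N'"
  shows "(\<Sum>k\<in>{..<n} \<rightarrow>\<^sub>E {..<N}. (cmod (slater n k z))\<^sup>2) \<le> (\<Sum>k\<in>{..<n} \<rightarrow>\<^sub>E {..<N'}. (cmod (slater n k z))\<^sup>2)"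
  using assms by (intro sum_mono2 finite_PiE PiE_mono) auto

lemma gram_nonneg: "Re (gram n z) \<ge> 0"
proof -
  have "fact n * Re (gram n z) \<ge> 0"
    by (rule LIMSEQ_le_const[OF gram_LIMSEQ]) (auto intro!: sum_nonneg)
  thus ?thesis using mult_le_cancel_left_pos[OF fact_gt_zero[where 'a=real], of n 0 "Re (gram n z)"] by simp
qed

lemma gram_SUP:
  "fact n * ennreal (Re (gram n z)) = (SUP N. ennreal (\<Sum>k\<in>{..<n} \<rightarrow>\<^sub>E {..<N}. (cmod (slater n k z))\<^sup>2))"
proof -
  have "(\<lambda>N. ennreal (\<Sum>k\<in>{..<n} \<rightarrow>\<^sub>E {..<N}. (cmod (slater n k z))\<^sup>2)) \<longlonglongrightarrow> ennreal (fact n * Re (gram n z))"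
    by (intro tendsto_ennrealI gram_LIMSEQ)
  moreover have "incseq (\<lambda>N. ennreal (\<Sum>k\<in>{..<n} \<rightarrow>\<^sub>E {..<N}. (cmod (slater n k z))\<^sup>2))"
    by (auto simp: incseq_def intro!: ennreal_leI gram_sum_mono)
  ultimately have "(SUP N. ennreal (\<Sum>k\<in>{..<n} \<rightarrow>\<^sub>E {..<N}. (cmod (slater n k z))\<^sup>2)) = ennreal (fact n * Re (gram n z))"
    using LIMSEQ_SUP LIMSEQ_unique by blast
  also have "\<dots> = fact n * ennreal (Re (gram n z))"
    using gram_nonneg[of n z] by (subst ennreal_mult) (auto simp: fact_ennreal)
  finally show ?thesis by simp
qed

lemma component_measurable: "i < n \<Longrightarrow> (\<lambda>z. z i) \<in> borel_measurable (PiM {..<n} (\<lambda>_. \<mu>))"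
  using measurable_component_singleton[of i "{..<n}" "\<lambda>_. \<mu>"] measurable_cong_sets[OF refl sets_mu] by auto

lemma slater_measurable [measurable]: "slater n k \<in> borel_measurable (PiM {..<n} (\<lambda>_. \<mu>))"
proof -
  have [measurable]: "(\<lambda>z. emon i (z j)) \<in> borel_measurable (PiM {..<n} (\<lambda>_. \<mu>))" if "j < n" for i j
    using that by (auto intro!: measurable_compose[OF measurable_component_singleton[of j]])
  show ?thesis unfolding slater_def[abs_def] det_mat_cols
    by (intro borel_measurable_sum borel_measurable_times borel_measurable_prod) auto
qed

text \<open>The squared modulus expands over pairs of permutations, and the integral over a product
  of shells factors. For injective \<open>k\<close> orthogonality annihilates every pair p \<noteq>
  q; for other \<open>k\<close> two rows of the determinant coincide.\<close>

lemma slater_integral: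
  assumes S: "\<And>i. i < n \<Longrightarrow> S i \<in> sets borel"
  shows "(\<integral>\<^sup>+z. ennreal ((cmod (slater n k z))\<^sup>2) * indicator (PiE {..<n} (\<lambda>i. {z. cmod z \<in> S i})) z \<partial>PiM {..<n} (\<lambda>_. \<mu>))
    = (if inj_on k {..<n} then (\<Sum>p | p permutes {..<n}. \<Prod>j<n. ennreal (shell_prob (k (p j)) (S j))) else 0)"
proof (cases "inj_on k {..<n}")
  case False
  thus ?thesis by (simp add: slater_def det_eq_0_if_not_inj[where a="\<lambda>i j. emon i (_ j)"])
next
  case inj: True
  define P where "P = {p. p permutes {..<n}}"
  define s where "s = (\<lambda>p. of_int (sign (p :: nat \<Rightarrow> nat)) :: complex)"
  define PM where "PM = PiM {..<n} (\<lambda>_. \<mu>)"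
  have finP: "finite P" by (simp add: P_def finite_permutations)
  define I where "I = (\<lambda>p q z. \<Prod>j<n. indicator (S j) (cmod (z j)) * (emon (k (p j)) (z j) * cnj (emon (k (q j)) (z j))) :: complex)"
  have int: "integrable PM (I p q)" for p q
    unfolding I_def PM_def using S by (intro fp.product_integrable_prod integrable_emon_mult) auto
  have val: "integral\<^sup>L PM (I p q) = (if p = q then complex_of_real (\<Prod>j<n. shell_prob (k (p j)) (S j)) else 0)"
    if "p \<in> P" "q \<in> P" for p q
  proof -
    have "integral\<^sup>L PM (I p q) = (\<Prod>j<n. if k (p j) = k (q j) then complex_of_real (shell_prob (k (p j)) (S j)) else 0)"
      unfolding I_def PM_def
      by (subst fp.product_integral_prod) (use S in \<open>auto intro!: integrable_emon_mult prod.cong simp: shell_orthogonal\<close>)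
    also have "\<dots> = (if p = q then complex_of_real (\<Prod>j<n. shell_prob (k (p j)) (S j)) else 0)"
    proof (cases "p = q")
      case False
      then obtain j where j: "p j \<noteq> q j" by blast
      have pq: "p permutes {..<n}" "q permutes {..<n}" using that by (auto simp: P_def)
      have "j < n" using j permutes_not_in[OF pq(1), of j] permutes_not_in[OF pq(2), of j] by force
      moreover from this have "p j < n" "q j < n" using permutes_in_image[OF pq(1)] permutes_in_image[OF pq(2)] by auto
      ultimately have "k (p j) \<noteq> k (q j)" using inj j by (auto simp: inj_on_def)
      hence "(\<Prod>j<n. if k (p j) = k (q j) then complex_of_real (shell_prob (k (p j)) (S j)) else 0) = 0"
        using \<open>j < n\<close> by (intro prod_zero) auto
      thus ?thesis using False by simp
    qed simp
    finally show ?thesis .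
  qed
  have eq: "complex_of_real ((cmod (slater n k z))\<^sup>2 * indicator (PiE {..<n} (\<lambda>i. {z. cmod z \<in> S i})) z)
    = (\<Sum>p\<in>P. \<Sum>q\<in>P. s p * s q * I p q z)" if "z \<in> space PM" for z
  proof -
    have ind: "complex_of_real (indicator (PiE {..<n} (\<lambda>i. {z. cmod z \<in> S i})) z) = (\<Prod>j<n. indicator (S j) (cmod (z j)) :: complex)"
    proof (cases "\<forall>j<n. cmod (z j) \<in> S j")
      case True
      thus ?thesis using that by (auto simp: PM_def space_PiM PiE_def Pi_def intro!: prod.neutral[symmetric])
    next
      case False
      thus ?thesis by (auto simp: PiE_def Pi_def indicator_def intro!: prod_zero[symmetric])
    qed
    have "complex_of_real ((cmod (slater n k z))\<^sup>2) = slater n k z * cnj (slater n k z)"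
      by (rule complex_norm_square)
    also have "\<dots> = (\<Sum>p\<in>P. \<Sum>q\<in>P. s p * s q * (\<Prod>j<n. emon (k (p j)) (z j) * cnj (emon (k (q j)) (z j))))"
      by (simp add: slater_def det_mat_cols P_def s_def sum_product prod.distrib mult_ac)
    finally show ?thesis
      by (simp add: ind I_def prod.distrib sum_distrib_left sum_distrib_right mult_ac)
  qed
  have eqR: "(cmod (slater n k z))\<^sup>2 * indicator (PiE {..<n} (\<lambda>i. {z. cmod z \<in> S i})) z
    = Re (\<Sum>p\<in>P. \<Sum>q\<in>P. s p * s q * I p q z)" if "z \<in> space PM" for z
    using eq[OF that] by (metis Re_complex_of_real)
  have intC: "integrable PM (\<lambda>z. \<Sum>p\<in>P. \<Sum>q\<in>P. s p * s q * I p q z)"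
    by (intro Bochner_Integration.integrable_sum integrable_mult_right int)
  have "(\<integral>\<^sup>+z. ennreal ((cmod (slater n k z))\<^sup>2) * indicator (PiE {..<n} (\<lambda>i. {z. cmod z \<in> S i})) z \<partial>PM)
    = (\<integral>\<^sup>+z. ennreal (Re (\<Sum>p\<in>P. \<Sum>q\<in>P. s p * s q * I p q z)) \<partial>PM)"
  proof (rule nn_integral_cong)
    fix z assume z: "z \<in> space PM"
    have "ennreal c * indicator A z = ennreal (c * indicator A z)" for c and A :: "(nat \<Rightarrow> complex) set"
      by (auto simp: indicator_def)
    thus "ennreal ((cmod (slater n k z))\<^sup>2) * indicator (PiE {..<n} (\<lambda>i. {z. cmod z \<in> S i})) z
      = ennreal (Re (\<Sum>p\<in>P. \<Sum>q\<in>P. s p * s q * I p q z))"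
      by (simp only: eqR[OF z])
  qed
  also have "\<dots> = ennreal (\<integral>z. Re (\<Sum>p\<in>P. \<Sum>q\<in>P. s p * s q * I p q z) \<partial>PM)"
  proof (intro nn_integral_eq_integral integrable_Re intC AE_I2)
    fix z assume z: "z \<in> space PM"
    show "0 \<le> Re (\<Sum>p\<in>P. \<Sum>q\<in>P. s p * s q * I p q z)"
      unfolding eqR[OF z, symmetric] by simp
  qed
  also have "(\<integral>z. Re (\<Sum>p\<in>P. \<Sum>q\<in>P. s p * s q * I p q z) \<partial>PM) = Re (\<Sum>p\<in>P. \<Sum>q\<in>P. s p * s q * integral\<^sup>L PM (I p q))"
    by (subst integral_Re[OF intC]) (simp add: Bochner_Integration.integral_sum Bochner_Integration.integrable_sum int)
  also have "(\<Sum>p\<in>P. \<Sum>q\<in>P. s p * s q * integral\<^sup>L PM (I p q)) =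
     (\<Sum>p\<in>P. \<Sum>q\<in>P. if p = q then s p * s p * complex_of_real (\<Prod>j<n. shell_prob (k (p j)) (S j)) else 0)"
    by (intro sum.cong refl) (auto simp: val)
  also have "\<dots> = (\<Sum>p\<in>P. complex_of_real (\<Prod>j<n. shell_prob (k (p j)) (S j)))"
    using finP by (intro sum.cong refl) (auto simp: s_def sum.delta simp flip: of_int_mult)
  also have "Re \<dots> = (\<Sum>p\<in>P. \<Prod>j<n. shell_prob (k (p j)) (S j))"
    by (simp flip: of_real_prod)
  also have "ennreal \<dots> = (\<Sum>p\<in>P. \<Prod>j<n. ennreal (shell_prob (k (p j)) (S j)))"
    by (subst sum_ennreal[symmetric]) (auto intro!: prod_nonneg sum.cong simp: shell_prob_nonneg prod_ennreal)
  finally show ?thesis using inj by (simp add: P_def PM_def)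
qed

text \<open>Exactly the product moment of independent moduli, modulus number k lying in S with
  probability \<open>shell_prob k S\<close>: disjoint shells must be hit by different moduli, hence
  the injective tuples. The factor \<open>fact n\<close> of Cauchy-Binet cancels against the number
  of permutations in \<open>slater_integral\<close>, all of which contribute equally.\<close>

theorem gram_integral:
  assumes S: "\<And>i. i < n \<Longrightarrow> S i \<in> sets borel"
  shows "(\<integral>\<^sup>+z\<in>PiE {..<n} (\<lambda>i. {z. cmod z \<in> S i}). ennreal (Re (gram n z)) \<partial>PiM {..<n} (\<lambda>_. \<mu>))
    = (SUP N. \<Sum>k | k \<in> {..<n} \<rightarrow>\<^sub>E {..<N} \<and> inj_on k {..<n}. \<Prod>j<n. ennreal (shell_prob (k j) (S j)))"
proof -
  let ?PM = "PiM {..<n} (\<lambda>_. \<mu>)"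
  define A where "A = PiE {..<n} (\<lambda>i. {z. cmod z \<in> S i})"
  define P where "P = {p. p permutes {..<n}}"
  define Q where "Q = (\<lambda>N. \<Sum>k | k \<in> {..<n} \<rightarrow>\<^sub>E {..<N} \<and> inj_on k {..<n}. \<Prod>j<n. ennreal (shell_prob (k j) (S j)))"
  have A[measurable]: "A \<in> sets ?PM"
    unfolding A_def using S by (intro sets_PiM_I_finite) (auto intro!: measurable_sets_borel[of cmod, simplified])
  have fact0: "(fact n :: ennreal) \<noteq> 0" "(fact n :: ennreal) \<noteq> \<infinity>"
    by (auto simp: fact_ennreal)
  have inj_perm: "inj_on (restrict (k \<circ> p) {..<n}) {..<n} \<longleftrightarrow> inj_on k {..<n}" if "p \<in> P" for k p
  proof -
    have p: "p permutes {..<n}" using that by (simp add: P_def)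
    have "inj_on (restrict (k \<circ> p) {..<n}) {..<n} \<longleftrightarrow> inj_on (k \<circ> p) {..<n}"
      by (intro inj_on_cong) auto
    also have "\<dots> \<longleftrightarrow> inj_on k (p ` {..<n})"
      using permutes_inj_on[OF p] by (simp add: inj_on_imageI comp_inj_on_iff)
    finally show ?thesis using permutes_image[OF p] by simp
  qed
  \<comment> \<open>Composition with \<open>p\<close> permutes the injective tuples among
    themselves, so the sum does not depend on \<open>p\<close>.\<close>
  have reindex: "(\<Sum>k | k \<in> {..<n} \<rightarrow>\<^sub>E {..<N} \<and> inj_on k {..<n}. \<Prod>j<n. ennreal (shell_prob (k (p j)) (S j))) = Q N"
    if p: "p \<in> P" for N p
  proof -
    have bij: "bij_betw (\<lambda>k. restrict (k \<circ> p) {..<n}) ({..<n} \<rightarrow>\<^sub>E {..<N}) ({..<n} \<rightarrow>\<^sub>E {..<N})"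
      using p by (intro bij_betw_PiE_permute) (simp add: P_def)
    have "Q N = (\<Sum>k\<in>{..<n} \<rightarrow>\<^sub>E {..<N}. if inj_on k {..<n} then (\<Prod>j<n. ennreal (shell_prob (k j) (S j))) else 0)"
      unfolding Q_def by (subst sum.inter_filter) (auto intro!: finite_PiE)
    also have "\<dots> = (\<Sum>k\<in>{..<n} \<rightarrow>\<^sub>E {..<N}. if inj_on (restrict (k \<circ> p) {..<n}) {..<n}
       then (\<Prod>j<n. ennreal (shell_prob (restrict (k \<circ> p) {..<n} j) (S j))) else 0)"
      by (rule sum.reindex_bij_betw[OF bij, symmetric])
    also have "\<dots> = (\<Sum>k\<in>{..<n} \<rightarrow>\<^sub>E {..<N}. if inj_on k {..<n}
       then (\<Prod>j<n. ennreal (shell_prob (k (p j)) (S j))) else 0)"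
      by (intro sum.cong refl if_cong inj_perm[OF p] prod.cong) auto
    also have "\<dots> = (\<Sum>k | k \<in> {..<n} \<rightarrow>\<^sub>E {..<N} \<and> inj_on k {..<n}. \<Prod>j<n. ennreal (shell_prob (k (p j)) (S j)))"
      by (subst sum.inter_filter) (auto intro!: finite_PiE)
    finally show ?thesis by simp
  qed
  have "fact n * (\<integral>\<^sup>+z\<in>A. ennreal (Re (gram n z)) \<partial>?PM)
     = (\<integral>\<^sup>+z. (SUP N. \<Sum>k\<in>{..<n} \<rightarrow>\<^sub>E {..<N}. ennreal ((cmod (slater n k z))\<^sup>2) * indicator A z) \<partial>?PM)"
  proof -
    have "fact n * (\<integral>\<^sup>+z\<in>A. ennreal (Re (gram n z)) \<partial>?PM) = (\<integral>\<^sup>+z. fact n * ennreal (Re (gram n z)) * indicator A z \<partial>?PM)"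
    proof -
      have [measurable]: "(\<lambda>z. ennreal (Re (gram n z))) \<in> borel_measurable ?PM"
      proof -
        have m: "(\<lambda>z. kern (z i) (z j)) \<in> borel_measurable ?PM" if "i < n" "j < n" for i j
        proof -
          have "(\<lambda>z. (z i, z j)) \<in> ?PM \<rightarrow>\<^sub>M borel \<Otimes>\<^sub>M borel" using that
            by (intro measurable_Pair component_measurable) auto
          from measurable_compose[OF this kern_measurable] show ?thesis by simp
        qed
        have "(\<lambda>z. gram n z) \<in> borel_measurable ?PM" unfolding det_mat_rows
        proof (intro borel_measurable_sum borel_measurable_times borel_measurable_prod borel_measurable_const)
          fix p i assume "p \<in> {p. p permutes {..<n}}" "i \<in> {..<n}"
          thus "(\<lambda>z. kern (z i) (z (p i))) \<in> borel_measurable ?PM"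
            using permutes_in_image[of p "{..<n}" i] by (intro m) auto
        qed
        thus ?thesis by measurable
      qed
      show ?thesis by (subst nn_integral_cmult[symmetric]) (auto simp: mult.assoc)
    qed
    also have "\<dots> = (\<integral>\<^sup>+z. (SUP N. \<Sum>k\<in>{..<n} \<rightarrow>\<^sub>E {..<N}. ennreal ((cmod (slater n k z))\<^sup>2) * indicator A z) \<partial>?PM)"
    proof (rule nn_integral_cong)
      fix z
      show "fact n * ennreal (Re (gram n z)) * indicator A z
        = (SUP N. \<Sum>k\<in>{..<n} \<rightarrow>\<^sub>E {..<N}. ennreal ((cmod (slater n k z))\<^sup>2) * indicator A z)"
        by (cases "z \<in> A") (simp_all add: gram_SUP sum_ennreal)
    qed
    finally show ?thesis .
  qed
  also have "\<dots> = (SUP N. \<integral>\<^sup>+z. (\<Sum>k\<in>{..<n} \<rightarrow>\<^sub>E {..<N}. ennreal ((cmod (slater n k z))\<^sup>2) * indicator A z) \<partial>?PM)"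
  proof (rule nn_integral_monotone_convergence_SUP)
    show "incseq (\<lambda>N z. \<Sum>k\<in>{..<n} \<rightarrow>\<^sub>E {..<N}. ennreal ((cmod (slater n k z))\<^sup>2) * indicator A z)"
      by (intro monoI le_funI sum_mono2 finite_PiE PiE_mono) auto
    show "(\<lambda>z. \<Sum>k\<in>{..<n} \<rightarrow>\<^sub>E {..<N}. ennreal ((cmod (slater n k z))\<^sup>2) * indicator A z) \<in> borel_measurable ?PM" for N
      by measurable
  qed
  also have "\<dots> = (SUP N. fact n * Q N)"
  proof (rule SUP_cong[OF refl])
    fix N
    have "(\<integral>\<^sup>+z. (\<Sum>k\<in>{..<n} \<rightarrow>\<^sub>E {..<N}. ennreal ((cmod (slater n k z))\<^sup>2) * indicator A z) \<partial>?PM)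
      = (\<Sum>k\<in>{..<n} \<rightarrow>\<^sub>E {..<N}. \<integral>\<^sup>+z. ennreal ((cmod (slater n k z))\<^sup>2) * indicator A z \<partial>?PM)"
      by (intro nn_integral_sum) measurable
    also have "\<dots> = (\<Sum>k\<in>{..<n} \<rightarrow>\<^sub>E {..<N}. if inj_on k {..<n} then (\<Sum>p\<in>P. \<Prod>j<n. ennreal (shell_prob (k (p j)) (S j))) else 0)"
      unfolding A_def P_def by (intro sum.cong refl slater_integral S)
    also have "\<dots> = (\<Sum>k | k \<in> {..<n} \<rightarrow>\<^sub>E {..<N} \<and> inj_on k {..<n}. \<Sum>p\<in>P. \<Prod>j<n. ennreal (shell_prob (k (p j)) (S j)))"
      by (subst sum.inter_filter) (auto intro!: finite_PiE)
    also have "\<dots> = (\<Sum>p\<in>P. Q N)"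
      by (subst sum.swap) (intro sum.cong refl reindex)
    also have "\<dots> = fact n * Q N" by (simp add: P_def card_permutations)
    finally show "(\<integral>\<^sup>+z. (\<Sum>k\<in>{..<n} \<rightarrow>\<^sub>E {..<N}. ennreal ((cmod (slater n k z))\<^sup>2) * indicator A z) \<partial>?PM) = fact n * Q N" .
  qed
  also have "\<dots> = fact n * (SUP N. Q N)" by (simp add: SUP_mult_left_ennreal)
  finally show ?thesis
    using fact0 by (simp add: ennreal_mult_cancel_left A_def Q_def)
qed

end

lemma sums_if_suminf_ennreal:
  assumes "(\<Sum>k. ennreal (p k)) = ennreal x" "x \<ge> 0" "\<And>k. p k \<ge> 0"
  shows "p sums x"
proof -
  have "summable p" using assms by (intro summable_suminf_not_top) auto
  moreover from this have "ennreal (suminf p) = ennreal x"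
    using assms by (simp add: suminf_ennreal2)
  ultimately show ?thesis using assms by (auto simp: sums_iff suminf_nonneg)
qed

section \<open>Bounds for the product moments\<close>

context radial_measure begin

definition shell_mass :: "real set \<Rightarrow> ennreal" where
  "shell_mass S = (\<Sum>k. ennreal (shell_prob k S))"

text \<open>Dropping injectivity only adds nonnegative terms, and the sum over all tuples factors
  into a product of masses.\<close>

lemma gram_integral_le:
  assumes S: "\<And>i. i < n \<Longrightarrow> S i \<in> sets borel"
  shows "(\<integral>\<^sup>+z\<in>PiE {..<n} (\<lambda>i. {z. cmod z \<in> S i}). ennreal (Re (gram n z)) \<partial>PiM {..<n} (\<lambda>_. \<mu>))
    \<le> (\<Prod>i<n. shell_mass (S i))"
proof (subst gram_integral, erule S, rule SUP_least)
  fix N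
  have "(\<Sum>k | k \<in> {..<n} \<rightarrow>\<^sub>E {..<N} \<and> inj_on k {..<n}. \<Prod>j<n. ennreal (shell_prob (k j) (S j)))
    \<le> (\<Sum>k\<in>{..<n} \<rightarrow>\<^sub>E {..<N}. \<Prod>j<n. ennreal (shell_prob (k j) (S j)))"
    by (intro sum_mono2 finite_PiE) auto
  also have "\<dots> = (\<Prod>j<n. \<Sum>k<N. ennreal (shell_prob k (S j)))"
    by (subst prod_sum_PiE) auto
  also have "\<dots> \<le> (\<Prod>j<n. shell_mass (S j))"
    unfolding shell_mass_def by (intro prod_mono_ennreal sum_le_suminf) auto
  finally show "(\<Sum>k | k \<in> {..<n} \<rightarrow>\<^sub>E {..<N} \<and> inj_on k {..<n}. \<Prod>j<n. ennreal (shell_prob (k j) (S j)))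
    \<le> (\<Prod>i<n. shell_mass (S i))" .
qed

text \<open>Injectivity removes only equal index pairs. For each index used in the second shell this
  lowers the sum over the first by one \<open>shell_prob\<close>, hence by at most \<open>s\<close>.
  When single moduli contribute little, two disjoint shells are thus nearly uncorrelated.\<close>

lemma gram_integral_2_ge:
  assumes S: "S 0 \<in> sets borel" "S 1 \<in> sets borel"
    and s: "\<And>k. shell_prob k (S 0) \<le> s"
    and x: "shell_mass (S 0) = ennreal x" "x \<ge> 0" and y: "shell_mass (S 1) = ennreal y" "y \<ge> 0"
  shows "(\<integral>\<^sup>+z\<in>PiE {..<2} (\<lambda>i. {z. cmod z \<in> S i}). ennreal (Re (gram 2 z)) \<partial>PiM {..<2} (\<lambda>_. \<mu>))
    \<ge> ennreal ((x - s) * y)"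
proof -
  define p where "p = (\<lambda>k. shell_prob k (S 0))"
  define q where "q = (\<lambda>k. shell_prob k (S 1))"
  have nn: "p k \<ge> 0" "q k \<ge> 0" for k by (auto simp: p_def q_def shell_prob_nonneg)
  have "p sums x"
    using x nn by (intro sums_if_suminf_ennreal) (auto simp: shell_mass_def p_def)
  moreover have "q sums y"
    using y nn by (intro sums_if_suminf_ennreal) (auto simp: shell_mass_def q_def)
  ultimately have lim: "(\<lambda>N. ennreal (((\<Sum>k<N. p k) - s) * (\<Sum>k<N. q k))) \<longlonglongrightarrow> ennreal ((x - s) * y)"
    unfolding sums_def by (intro tendsto_ennrealI tendsto_intros)
  have SI: "S i \<in> sets borel" if "i < 2" for i :: nat using S that by (cases i) (auto simp: less_Suc_eq)
  have "ennreal (((\<Sum>k<N. p k) - s) * (\<Sum>k<N. q k)) \<le>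
    (\<Sum>k | k \<in> {..<2} \<rightarrow>\<^sub>E {..<N} \<and> inj_on k {..<2}. \<Prod>j<2. ennreal (shell_prob (k j) (S j)))" for N
  proof -
    define f where "f = (\<lambda>(i :: nat, j :: nat). restrict (\<lambda>l :: nat. if l = 0 then i else j) {..<2})"
    have "((\<Sum>k<N. p k) - s) * (\<Sum>k<N. q k) = (\<Sum>k<N. ((\<Sum>i<N. p i) - s) * q k)"
      by (simp add: sum_distrib_left)
    also have "\<dots> \<le> (\<Sum>k<N. (\<Sum>i\<in>{..<N} - {k}. p i) * q k)"
    proof (intro sum_mono mult_right_mono nn)
      fix k assume "k \<in> {..<N}"
      thus "(\<Sum>i<N. p i) - s \<le> (\<Sum>i\<in>{..<N} - {k}. p i)"
        using s[of k] by (simp add: sum_diff1 p_def)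
    qed
    also have "\<dots> = (\<Sum>(j, i)\<in>Sigma {..<N} (\<lambda>k. {..<N} - {k}). p i * q j)"
      by (simp add: sum_distrib_right sum.Sigma)
    finally have "ennreal (((\<Sum>k<N. p k) - s) * (\<Sum>k<N. q k)) \<le>
        ennreal (\<Sum>(j, i)\<in>Sigma {..<N} (\<lambda>k. {..<N} - {k}). p i * q j)"
      by (rule ennreal_leI)
    also have "\<dots> = (\<Sum>(j, i)\<in>Sigma {..<N} (\<lambda>k. {..<N} - {k}). ennreal (p i) * ennreal (q j))"
      using nn by (subst sum_ennreal[symmetric]) (auto intro!: sum.cong simp: ennreal_mult)
    also have "\<dots> = (\<Sum>x\<in>Sigma {..<N} (\<lambda>k. {..<N} - {k}).
        \<Prod>j<2. ennreal (shell_prob (f (snd x, fst x) j) (S j)))"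
      by (intro sum.cong refl) (auto simp: f_def p_def q_def numeral_2_eq_2 lessThan_Suc mult.commute)
    also have "\<dots> = (\<Sum>k\<in>(\<lambda>x. f (snd x, fst x)) ` Sigma {..<N} (\<lambda>k. {..<N} - {k}).
        \<Prod>j<2. ennreal (shell_prob (k j) (S j)))"
    proof (subst sum.reindex)
      show "inj_on (\<lambda>x. f (snd x, fst x)) (Sigma {..<N} (\<lambda>k. {..<N} - {k}))"
      proof (rule inj_onI)
        fix x y assume "f (snd x, fst x) = f (snd y, fst y)"
        from fun_cong[OF this, of 0] fun_cong[OF this, of 1] show "x = y"
          by (auto simp: f_def prod_eq_iff)
      qed
    qed simp
    also have "\<dots> \<le> (\<Sum>k | k \<in> {..<2} \<rightarrow>\<^sub>E {..<N} \<and> inj_on k {..<2}. \<Prod>j<2. ennreal (shell_prob (k j) (S j)))"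
    proof (intro sum_mono2)
      show "finite {k. k \<in> {..<2 :: nat} \<rightarrow>\<^sub>E {..<N} \<and> inj_on k {..<2}}"
        by (rule finite_subset[OF _ finite_PiE[of "{..<2}" "\<lambda>_. {..<N}"]]) auto
      have "f (i, j) \<in> {..<2} \<rightarrow>\<^sub>E {..<N} \<and> inj_on (f (i, j)) {..<2}" if "i < N" "j < N" "i \<noteq> j" for i j
      proof
        show "f (i, j) \<in> {..<2} \<rightarrow>\<^sub>E {..<N}"
          using that by (simp add: f_def)
        have two: "{..<2 :: nat} = {0, 1}" by auto
        show "inj_on (f (i, j)) {..<2}"
          unfolding two using that by (simp add: f_def)
      qed
      thus "(\<lambda>x. f (snd x, fst x)) ` Sigma {..<N} (\<lambda>k. {..<N} - {k}) \<subseteq>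
          {k. k \<in> {..<2} \<rightarrow>\<^sub>E {..<N} \<and> inj_on k {..<2}}"
        by force
    qed simp
    finally show ?thesis .
  qed
  also have "(\<Sum>k | k \<in> {..<2} \<rightarrow>\<^sub>E {..<N} \<and> inj_on k {..<2}. \<Prod>j<2. ennreal (shell_prob (k j) (S j)))
    \<le> (\<integral>\<^sup>+z\<in>PiE {..<2} (\<lambda>i. {z. cmod z \<in> S i}). ennreal (Re (gram 2 z)) \<partial>PiM {..<2} (\<lambda>_. \<mu>))" for N
    by (subst gram_integral, erule SI, rule SUP_upper) simp
  finally have "ennreal (((\<Sum>k<N. p k) - s) * (\<Sum>k<N. q k)) \<le>
    (\<integral>\<^sup>+z\<in>PiE {..<2} (\<lambda>i. {z. cmod z \<in> S i}). ennreal (Re (gram 2 z)) \<partial>PiM {..<2} (\<lambda>_. \<mu>))" for N .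
  thus ?thesis by (intro LIMSEQ_le_const2[OF lim]) auto
qed

lemma gram_integral_1:
  assumes S: "S \<in> sets borel"
  shows "(\<integral>\<^sup>+z\<in>PiE {..<1} (\<lambda>i. {z. cmod z \<in> S}). ennreal (Re (gram 1 z)) \<partial>PiM {..<1} (\<lambda>_. \<mu>)) = shell_mass S"
proof (rule antisym)
  show "(\<integral>\<^sup>+z\<in>PiE {..<1} (\<lambda>i. {z. cmod z \<in> S}). ennreal (Re (gram 1 z)) \<partial>PiM {..<1} (\<lambda>_. \<mu>)) \<le> shell_mass S"
    using gram_integral_le[of 1 "\<lambda>_. S"] S by simp
  have "(\<Sum>k<N. ennreal (shell_prob k S)) \<le>
    (\<Sum>k | k \<in> {..<1} \<rightarrow>\<^sub>E {..<N} \<and> inj_on k {..<1}. \<Prod>j<(1::nat). ennreal (shell_prob (k j) S))" for N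
  proof -
    define f where "f = (\<lambda>i :: nat. restrict (\<lambda>l :: nat. i) {..<1})"
    have "(\<Sum>k<N. ennreal (shell_prob k S)) = (\<Sum>i<N. \<Prod>j<(1::nat). ennreal (shell_prob (f i j) S))"
      by (simp add: f_def)
    also have "\<dots> = (\<Sum>k\<in>f ` {..<N}. \<Prod>j<(1::nat). ennreal (shell_prob (k j) S))"
    proof (subst sum.reindex)
      show "inj_on f {..<N}"
      proof (rule inj_onI)
        fix x y assume "f x = f y"
        from fun_cong[OF this, of 0] show "x = y" by (simp add: f_def)
      qed
    qed simp
    also have "\<dots> \<le> (\<Sum>k | k \<in> {..<1} \<rightarrow>\<^sub>E {..<N} \<and> inj_on k {..<1}. \<Prod>j<(1::nat). ennreal (shell_prob (k j) S))"
    proof (intro sum_mono2)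
      show "finite {k. k \<in> {..<1 :: nat} \<rightarrow>\<^sub>E {..<N} \<and> inj_on k {..<1}}"
        by (rule finite_subset[OF _ finite_PiE[of "{..<1}" "\<lambda>_. {..<N}"]]) auto
    qed (auto simp: f_def inj_on_def split: if_splits)
    finally show ?thesis .
  qed
  thus "shell_mass S \<le> (\<integral>\<^sup>+z\<in>PiE {..<1} (\<lambda>i. {z. cmod z \<in> S}). ennreal (Re (gram 1 z)) \<partial>PiM {..<1} (\<lambda>_. \<mu>))"
    unfolding shell_mass_def suminf_eq_SUP by (subst gram_integral[OF S], rule SUP_mono')
qed

lemma cnj_kern: "cnj (kern z w) = kern w z"
proof -
  have "(\<lambda>k. cnj (emon k z * cnj (emon k w))) sums cnj (kern z w)"
    using kern_sums[of z w] by (simp only: sums_cnj)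
  thus ?thesis using kern_sums[of w z] by (auto simp: mult.commute sums_iff)
qed

lemma kern_diag: "(\<lambda>k. (cmod (emon k z))\<^sup>2) sums Re (kern z z)" "Re (kern z z) \<ge> 0" "Im (kern z z) = 0"
proof -
  have "(\<lambda>k. complex_of_real ((cmod (emon k z))\<^sup>2)) sums kern z z"
    using kern_sums[of z z] by (simp add: complex_norm_square del: of_real_power)
  thus 1: "(\<lambda>k. (cmod (emon k z))\<^sup>2) sums Re (kern z z)" and "Im (kern z z) = 0"
    using sums_Re sums_Im[of _ "kern z z"] by (fastforce simp: sums_iff)+
  show "Re (kern z z) \<ge> 0" by (rule sums_le[OF _ sums_zero 1]) simp
qed

lemma gram_2_le: "Re (gram 2 z) \<le> Re (kern (z 0) (z 0)) * Re (kern (z 1) (z 1))"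
proof -
  have two: "{..<2 :: nat} = {0, 1}" by auto
  have P: "{p :: nat \<Rightarrow> nat. p permutes {..<2}} = {id, Transposition.transpose 0 1}"
    unfolding two by (auto simp: permutes_doubleton_iff)
  have ne: "id \<noteq> Transposition.transpose (0 :: nat) 1"
  proof
    assume "id = Transposition.transpose (0 :: nat) 1"
    from fun_cong[OF this, of 0] show False by simp
  qed
  have "gram 2 z = kern (z 0) (z 0) * kern (z 1) (z 1) - kern (z 0) (z 1) * kern (z 1) (z 0)"
    unfolding det_mat_rows P using ne by (simp add: two sign_swap_id transpose_def)
  moreover have "kern (z 0) (z 1) * kern (z 1) (z 0) = complex_of_real ((cmod (kern (z 0) (z 1)))\<^sup>2)"
    using cnj_kern[of "z 0" "z 1"] by (simp add: complex_norm_square del: of_real_power)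
  ultimately show ?thesis by (simp add: kern_diag)
qed

lemma nn_integral_kern_diag:
  assumes [measurable]: "S \<in> sets borel"
  shows "(\<integral>\<^sup>+z. ennreal (Re (kern z z)) * indicator {z. cmod z \<in> S} z \<partial>\<mu>) = shell_mass S"
proof -
  have e: "ennreal (Re (kern z z)) = (\<Sum>k. ennreal ((cmod (emon k z))\<^sup>2))" for z
    using kern_diag(1)[of z] by (subst suminf_ennreal_eq) auto
  have "(\<integral>\<^sup>+z. ennreal (Re (kern z z)) * indicator {z. cmod z \<in> S} z \<partial>\<mu>) =
    (\<integral>\<^sup>+z. (\<Sum>k. indicator S (cmod z) * ennreal ((cmod (emon k z))\<^sup>2)) \<partial>\<mu>)"
  proof (rule nn_integral_cong)
    fix z
    show "ennreal (Re (kern z z)) * indicator {z. cmod z \<in> S} z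
      = (\<Sum>k. indicator S (cmod z) * ennreal ((cmod (emon k z))\<^sup>2))"
      by (cases "cmod z \<in> S") (simp_all add: e)
  qed
  also have "\<dots> = shell_mass S"
    unfolding shell_mass_def by (subst nn_integral_suminf) (auto simp: nn_integral_shell)
  finally show ?thesis .
qed

lemma gram_2_integral_le:
  assumes B: "B 0 \<in> sets borel" "B 1 \<in> sets borel" "B 0 \<subseteq> {z. cmod z \<in> S}" "B 1 \<subseteq> {z. cmod z \<in> S}"
    and [measurable]: "S \<in> sets borel"
  shows "(\<integral>\<^sup>+z\<in>PiE {..<2} B. ennreal (Re (gram 2 z)) \<partial>PiM {..<2} (\<lambda>_. \<mu>)) \<le> shell_mass S * shell_mass S"
proof -
  have two: "{..<2 :: nat} = {0, 1}" by auto
  have [measurable]: "(\<lambda>z. kern z z) \<in> borel_measurable borel"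
    unfolding kern_def by measurable
  let ?f = "\<lambda>z. ennreal (Re (kern z z)) * indicator {z. cmod z \<in> S} z"
  have "(\<integral>\<^sup>+z\<in>PiE {..<2} B. ennreal (Re (gram 2 z)) \<partial>PiM {..<2} (\<lambda>_. \<mu>)) \<le>
     (\<integral>\<^sup>+z. (\<Prod>i<(2::nat). ?f (z i)) \<partial>PiM {..<2} (\<lambda>_. \<mu>))"
  proof (rule nn_integral_mono)
    fix z
    have "ennreal (Re (gram 2 z)) \<le> ennreal (Re (kern (z 0) (z 0))) * ennreal (Re (kern (z 1) (z 1)))"
      using ennreal_leI[OF gram_2_le[of z]] kern_diag(2) by (simp add: ennreal_mult)
    moreover have "cmod (z 0) \<in> S" "cmod (z 1) \<in> S" if "z \<in> PiE {..<2} B"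
      using that B(3,4) by (auto simp: two PiE_def Pi_def)
    ultimately show "ennreal (Re (gram 2 z)) * indicator (PiE {..<2} B) z \<le> (\<Prod>i<(2::nat). ?f (z i))"
      by (auto simp: two indicator_def)
  qed
  also have "\<dots> = (\<Prod>i<(2::nat). shell_mass S)"
    by (subst fp.product_nn_integral_prod) (auto simp: nn_integral_kern_diag)
  also have "\<dots> = shell_mass S * shell_mass S" by (simp add: two)
  finally show ?thesis .
qed

lemma shell_mass_finite:
  assumes [measurable]: "S \<in> sets borel" and "S \<subseteq> {..R}"
  shows "shell_mass S < \<infinity>"
proof -
  define r where "r = max R 0"
  have "shell_prob k S \<le> cmod (emon k r * cnj (emon k r)) * measure \<mu> UNIV" for k
  proof -
    have "shell_prob k S \<le> (\<integral>z. cmod (emon k r * cnj (emon k r)) \<partial>\<mu>)"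
      unfolding shell_prob_def
    proof (intro integral_mono integrable_shell integrable_const)
      fix z
      have "cmod (emon k z) \<le> cmod (emon k r)" if "cmod z \<in> S"
        unfolding cmod_emon using that assms(2) moment_pos[of k] by (intro divide_right_mono power_mono) (auto simp: r_def)
      thus "indicator S (cmod z) * (cmod (emon k z))\<^sup>2 \<le> cmod (emon k r * cnj (emon k r))"
        by (auto simp: indicator_def norm_mult power2_eq_square intro!: mult_mono)
    qed simp
    thus ?thesis by (simp add: mult.commute)
  qed
  hence bound: "norm (shell_prob k S) \<le> cmod (emon k r * cnj (emon k r)) * measure \<mu> UNIV" for k
    unfolding real_norm_def abs_of_nonneg[OF shell_prob_nonneg] .
  have "summable (\<lambda>k. cmod (emon k r * cnj (emon k r)) * measure \<mu> UNIV)"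
    by (intro summable_mult2 summable_kern)
  hence "summable (\<lambda>k. shell_prob k S)"
    by (rule summable_comparison_test') (rule bound)
  thus ?thesis unfolding shell_mass_def
    by (subst suminf_ennreal2) (auto simp: shell_prob_nonneg)
qed

text \<open>The image of the intensity K(z,z) d\<mu> under the modulus. Its value on S is
  \<open>shell_mass S\<close>, so that additivity, monotonicity and distribution functions become
  available for the masses.\<close>

definition mass_measure :: "real measure" where
  "mass_measure = distr (density \<mu> (\<lambda>z. ennreal (Re (kern z z)))) borel cmod"

lemma sets_mass_measure [simp, measurable_cong]: "sets mass_measure = sets borel"
  by (simp add: mass_measure_def)

lemma space_mass_measure [simp]: "space mass_measure = UNIV"
  by (simp add: mass_measure_def)

lemma emeasure_mass_measure:
  assumes [measurable]: "S \<in> sets borel"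
  shows "emeasure mass_measure S = shell_mass S"
proof -
  have [measurable]: "(\<lambda>z. kern z z) \<in> borel_measurable borel"
    unfolding kern_def by measurable
  have "emeasure mass_measure S = emeasure (density \<mu> (\<lambda>z. ennreal (Re (kern z z)))) {z. cmod z \<in> S}"
    unfolding mass_measure_def by (subst emeasure_distr) (auto simp: vimage_def)
  also have "\<dots> = shell_mass S"
    unfolding nn_integral_kern_diag[OF assms, symmetric] by (subst emeasure_density) auto
  finally show ?thesis .
qed

end

section \<open>Moduli of the points\<close>

locale radial_dpp = radial_measure \<mu> + prob_space M
  for \<mu> :: "complex measure" and M :: "'w measure" +
  fixes \<Lambda> :: "nat \<Rightarrow> 'w \<Rightarrow> complex"
  assumes dpp: "determinantal_process M \<Lambda> kern \<mu>"
    and no_atoms: "emeasure \<mu> {z. cmod z = r} = 0"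
begin

lemma points_measurable [measurable]: "\<Lambda> k \<in> borel_measurable M"
  using dpp by (simp add: determinantal_process_def)

lemma points_inj: "AE \<omega> in M. inj (\<lambda>k. \<Lambda> k \<omega>)"
  using dpp by (simp add: determinantal_process_def)

lemma point_count_suminf: "point_count s B = (\<Sum>k. indicator B (s k))"
proof -
  have "point_count s B = (\<integral>\<^sup>+k. indicator {k. s k \<in> B} k \<partial>count_space UNIV)"
    unfolding point_count_def by (subst nn_integral_indicator) auto
  also have "\<dots> = (\<Sum>k. indicator B (s k))"
    by (subst nn_integral_count_space_nat) (auto intro!: suminf_cong simp: indicator_def)
  finally show ?thesis .
qed

definition count :: "real set \<Rightarrow> 'w \<Rightarrow> ennreal" where
  "count S \<omega> = (\<Sum>k. indicator S (cmod (\<Lambda> k \<omega>)))"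

lemma count_point_count: "count S \<omega> = point_count (\<lambda>k. \<Lambda> k \<omega>) {z. cmod z \<in> S}"
  by (simp add: count_def point_count_suminf indicator_def)

lemma count_measurable [measurable]:
  assumes [measurable]: "S \<in> sets borel" shows "count S \<in> borel_measurable M"
  unfolding count_def[abs_def] by measurable

lemma correlation:
  assumes "\<And>i. i < n \<Longrightarrow> B i \<in> sets borel" "\<And>i. i < n \<Longrightarrow> bounded (B i)" "disjoint_family_on B {..<n}"
  shows "(\<integral>\<^sup>+\<omega>. (\<Prod>i<n. point_count (\<lambda>k. \<Lambda> k \<omega>) (B i)) \<partial>M) =
    (\<integral>\<^sup>+z\<in>PiE {..<n} B. ennreal (Re (gram n z)) \<partial>PiM {..<n} (\<lambda>_. \<mu>))"
  using dpp assms unfolding determinantal_process_def by blast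

lemma bounded_shell: "S \<subseteq> {..R} \<Longrightarrow> bounded {z :: complex. cmod z \<in> S}"
  by (rule boundedI[of _ R]) auto

lemma shell_borel: "S \<in> sets borel \<Longrightarrow> {z :: complex. cmod z \<in> S} \<in> sets borel"
  by (rule measurable_sets_borel[of cmod, simplified vimage_def]) auto

lemma correlation_shell:
  assumes "\<And>i. i < n \<Longrightarrow> S i \<in> sets borel" "\<And>i. i < n \<Longrightarrow> S i \<subseteq> {..R}" "disjoint_family_on S {..<n}"
  shows "(\<integral>\<^sup>+\<omega>. (\<Prod>i<n. count (S i) \<omega>) \<partial>M) =
    (\<integral>\<^sup>+z\<in>PiE {..<n} (\<lambda>i. {z. cmod z \<in> S i}). ennreal (Re (gram n z)) \<partial>PiM {..<n} (\<lambda>_. \<mu>))"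
  unfolding count_point_count
proof (rule correlation)
  show "disjoint_family_on (\<lambda>i. {z. cmod z \<in> S i}) {..<n}"
    using assms(3) by (fastforce simp: disjoint_family_on_def)
qed (use assms in \<open>auto intro!: shell_borel bounded_shell\<close>)

text \<open>The list form allows products of two, three and four counts to be treated by evaluation
  on explicit lists.\<close>

lemma correlation_list_le:
  assumes "\<And>X. X \<in> set xs \<Longrightarrow> X \<in> sets borel" "\<And>X. X \<in> set xs \<Longrightarrow> X \<subseteq> {..R}"
    and "\<And>i j. i < j \<Longrightarrow> j < length xs \<Longrightarrow> xs ! i \<inter> xs ! j = {}"
  shows "(\<integral>\<^sup>+\<omega>. prod_list (map (\<lambda>X. count X \<omega>) xs) \<partial>M) \<le> prod_list (map shell_mass xs)"
proof -
  have "disjoint_family_on (\<lambda>i. xs ! i) {..<length xs}"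
    unfolding disjoint_family_on_def
  proof (intro ballI impI)
    fix i j assume "i \<in> {..<length xs}" "j \<in> {..<length xs}" "i \<noteq> j"
    thus "xs ! i \<inter> xs ! j = {}"
      using assms(3)[of i j] assms(3)[of j i] by (cases i j rule: linorder_cases) auto
  qed
  hence "(\<integral>\<^sup>+\<omega>. (\<Prod>i<length xs. count (xs ! i) \<omega>) \<partial>M) \<le> (\<Prod>i<length xs. shell_mass (xs ! i))"
    using assms by (subst correlation_shell[where R=R]) (auto intro!: gram_integral_le)
  thus ?thesis by (simp add: prod.list_conv_set_nth atLeast0LessThan)
qed

lemma expected_count:
  assumes "S \<in> sets borel" "S \<subseteq> {..R}"
  shows "(\<integral>\<^sup>+\<omega>. count S \<omega> \<partial>M) = shell_mass S"
  using correlation_shell[of 1 "\<lambda>_. S" R] assms gram_integral_1[of S]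
  by (simp add: disjoint_family_on_def)

lemma expected_count_2_ge:
  assumes "B \<in> sets borel" "B \<subseteq> {..R}" "C \<in> sets borel" "C \<subseteq> {..R}" "B \<inter> C = {}"
    and s: "\<And>k. shell_prob k B \<le> s"
    and x: "shell_mass B = ennreal x" "x \<ge> 0" and y: "shell_mass C = ennreal y" "y \<ge> 0"
  shows "ennreal ((x - s) * y) \<le> (\<integral>\<^sup>+\<omega>. count B \<omega> * count C \<omega> \<partial>M)"
proof -
  define S where "S = (\<lambda>i :: nat. if i = 0 then B else C)"
  have two: "{..<2 :: nat} = {0, 1}" by auto
  have "ennreal ((x - s) * y) \<le> (\<integral>\<^sup>+\<omega>. (\<Prod>i<(2::nat). count (S i) \<omega>) \<partial>M)"
  proof (subst correlation_shell)
    show "disjoint_family_on S {..<2}" using assms by (auto simp: S_def disjoint_family_on_def two)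
    show "S i \<in> sets borel" "S i \<subseteq> {..R}" if "i < 2" for i using assms by (auto simp: S_def)
    show "ennreal ((x - s) * y) \<le>
      (\<integral>\<^sup>+z\<in>PiE {..<2} (\<lambda>i. {z. cmod z \<in> S i}). ennreal (Re (gram 2 z)) \<partial>PiM {..<2} (\<lambda>_. \<mu>))"
      using assms by (intro gram_integral_2_ge) (auto simp: S_def)
  qed
  thus ?thesis by (simp add: two S_def)
qed

section \<open>Almost surely all moduli are distinct\<close>

lemma shell_mass_singleton: "shell_mass {r} = 0"
proof -
  have "ennreal (shell_prob k {r}) = 0" for k
  proof -
    have "{z. cmod z = r} \<in> null_sets \<mu>"
      using no_atoms[of r] shell_borel[of "{r}"] by (auto simp: null_sets_def)
    from AE_not_in[OF this]
    have "AE z in \<mu>. indicator {r} (cmod z) * ennreal ((cmod (emon k z))\<^sup>2) = 0"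
      by eventually_elim auto
    hence "(\<integral>\<^sup>+z. indicator {r} (cmod z) * ennreal ((cmod (emon k z))\<^sup>2) \<partial>\<mu>) = (\<integral>\<^sup>+z. 0 \<partial>\<mu>)"
      by (rule nn_integral_cong_AE)
    thus ?thesis by (simp add: nn_integral_shell)
  qed
  thus ?thesis by (simp add: shell_mass_def)
qed

lemma shell_mass_mono: "S \<subseteq> T \<Longrightarrow> S \<in> sets borel \<Longrightarrow> T \<in> sets borel \<Longrightarrow> shell_mass S \<le> shell_mass T"
  by (auto simp: emeasure_mass_measure[symmetric] intro!: emeasure_mono)

text \<open>Since circles have no mass, the distribution function of the masses is continuous, hence
  uniformly continuous on [0, R].\<close>

lemma thin_shells:
  assumes "\<delta> > 0" "R > 0"
  shows "\<exists>n>0. \<forall>i<n. shell_mass {R * real i / real n<..R * real (Suc i) / real n} \<le> ennreal \<delta>"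
proof -
  \<comment> \<open>Cutting at R makes the measure finite, as a distribution function
    requires.\<close>
  define \<sigma> where "\<sigma> = density mass_measure (indicator {..R})"
  have em: "emeasure \<sigma> A = shell_mass (A \<inter> {..R})" if [measurable]: "A \<in> sets borel" for A
    unfolding \<sigma>_def by (subst emeasure_density)
      (auto simp: nn_integral_indicator[symmetric] indicator_inter_arith mult.commute
        emeasure_mass_measure[symmetric] simp del: nn_integral_indicator)
  interpret \<sigma>: finite_measure \<sigma>
    by (rule finite_measureI) (use shell_mass_finite[of "{..R}" R] em[of UNIV] in \<open>simp add: \<sigma>_def\<close>)
  interpret \<sigma>: finite_borel_measure \<sigma>
    by standard (simp add: \<sigma>_def)
  have "emeasure \<sigma> {x} = 0" for x
    using shell_mass_mono[of "{x} \<inter> {..R}" "{x}"] shell_mass_singleton[of x] by (simp add: em)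
  hence "isCont (cdf \<sigma>) x" for x
    by (simp add: \<sigma>.isCont_cdf measure_def)
  hence "continuous_on {0..R} (cdf \<sigma>)" by (simp add: continuous_at_imp_continuous_on)
  hence "uniformly_continuous_on {0..R} (cdf \<sigma>)" by (intro compact_uniformly_continuous) auto
  then obtain d where d: "d > 0"
    "\<And>x y. x \<in> {0..R} \<Longrightarrow> y \<in> {0..R} \<Longrightarrow> dist y x < d \<Longrightarrow> dist (cdf \<sigma> y) (cdf \<sigma> x) < \<delta>"
    using assms(1) unfolding uniformly_continuous_on_def by metis
  obtain n :: nat where n: "R / d < real n" using reals_Archimedean2 by blast
  have "R / d > 0" using assms d by simp
  hence n0: "n > 0" using n by (cases n) auto
  show ?thesis
  proof (intro exI[of _ n] conjI allI impI n0)
    fix i assume i: "i < n"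
    define a b where "a = R * real i / real n" and "b = R * real (Suc i) / real n"
    have ba: "b - a = R / real n" by (simp add: a_def b_def diff_divide_distrib[symmetric] algebra_simps)
    have "R * real (Suc i) \<le> R * real n" using i assms by (intro mult_left_mono) auto
    hence ab: "0 \<le> a" "a < b" "b \<le> R" using ba assms n0 by (auto simp: a_def b_def field_simps)
    have "R / real n < d" using n d n0 by (simp add: field_simps)
    hence "cdf \<sigma> b - cdf \<sigma> a < \<delta>"
      using d(2)[of a b] ab ba by (auto simp: dist_real_def)
    hence "measure \<sigma> {a<..b} < \<delta>" using ab by (simp add: \<sigma>.cdf_diff_eq)
    moreover have "shell_mass {a<..b} = emeasure \<sigma> {a<..b}"
      using ab by (subst em) (auto intro!: arg_cong[where f=shell_mass])
    ultimately show "shell_mass {a<..b} \<le> ennreal \<delta>"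
      by (simp add: \<sigma>.emeasure_eq_measure ennreal_leI)
  qed
qed

text \<open>Two points of equal modulus lie in the same thin shell. The expected number of such
  pairs is at most the sum of the squared masses of the shells, hence at most \<delta> times the
  total mass. \<open>U\<close> and \<open>V\<close> are disjoint so that the two-point correlation
  formula applies to their parts in a single shell.\<close>

lemma no_common_modulus:
  assumes [measurable]: "U \<in> sets borel" "V \<in> sets borel" and UV: "U \<inter> V = {}" and R: "R > 0"
  shows "AE \<omega> in M. \<forall>j k. \<not> (\<Lambda> j \<omega> \<in> U \<and> \<Lambda> k \<omega> \<in> V \<and> cmod (\<Lambda> j \<omega>) = cmod (\<Lambda> k \<omega>)
    \<and> 0 < cmod (\<Lambda> j \<omega>) \<and> cmod (\<Lambda> j \<omega>) \<le> R)"
proof -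
  define E where "E = {\<omega>\<in>space M. \<exists>j k. \<Lambda> j \<omega> \<in> U \<and> \<Lambda> k \<omega> \<in> V \<and> cmod (\<Lambda> j \<omega>) = cmod (\<Lambda> k \<omega>)
    \<and> 0 < cmod (\<Lambda> j \<omega>) \<and> cmod (\<Lambda> j \<omega>) \<le> R}"
  have E[measurable]: "E \<in> sets M" unfolding E_def by measurable
  define c where "c = shell_mass {..R}"
  have c: "c < \<infinity>" unfolding c_def by (rule shell_mass_finite) auto
  have bound: "emeasure M E \<le> ennreal \<delta> * c" if \<delta>: "\<delta> > 0" for \<delta>
  proof -
    obtain n where n: "n > 0" "\<And>i. i < n \<Longrightarrow> shell_mass {R * real i / real n<..R * real (Suc i) / real n} \<le> ennreal \<delta>"
      using thin_shells[OF \<delta> R] by blast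
    define S where "S = (\<lambda>i. {R * real i / real n<..R * real (Suc i) / real n})"
    define pc where "pc = (\<lambda>X \<omega>. point_count (\<lambda>k. \<Lambda> k \<omega>) X)"
    have pc_ge1: "pc X \<omega> \<ge> 1" if "\<Lambda> k \<omega> \<in> X" for k X \<omega>
    proof -
      have "(1::ennreal) = (\<Sum>i\<in>{k}. indicator X (\<Lambda> i \<omega>))" using that by simp
      also have "\<dots> \<le> pc X \<omega>" unfolding pc_def point_count_suminf by (intro sum_le_suminf) auto
      finally show ?thesis .
    qed
    have [measurable]: "pc X \<in> borel_measurable M" if "X \<in> sets borel" for X
      unfolding pc_def[abs_def] point_count_suminf using that by measurable
    have [measurable]: "{z. cmod z \<in> S i} \<in> sets borel" for i by (intro shell_borel) (simp add: S_def)
    let ?U = "\<lambda>i. U \<inter> {z. cmod z \<in> S i}" and ?V = "\<lambda>i. V \<inter> {z. cmod z \<in> S i}"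
    have "emeasure M E = (\<integral>\<^sup>+\<omega>. indicator E \<omega> \<partial>M)" by simp
    also have "\<dots> \<le> (\<integral>\<^sup>+\<omega>. (\<Sum>i<n. pc (?U i) \<omega> * pc (?V i) \<omega>) \<partial>M)"
    proof (rule nn_integral_mono)
      fix \<omega>
      show "indicator E \<omega> \<le> (\<Sum>i<n. pc (?U i) \<omega> * pc (?V i) \<omega>)"
      proof (cases "\<omega> \<in> E")
        case True
        then obtain j k where jk: "\<Lambda> j \<omega> \<in> U" "\<Lambda> k \<omega> \<in> V" "cmod (\<Lambda> j \<omega>) = cmod (\<Lambda> k \<omega>)"
          "0 < cmod (\<Lambda> j \<omega>)" "cmod (\<Lambda> j \<omega>) \<le> R" unfolding E_def by blast
        define x where "x = cmod (\<Lambda> j \<omega>) * real n / R"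
        have x: "0 < x" "x \<le> real n" using jk R n by (auto simp: x_def field_simps)
        \<comment> \<open>The thin shells are open on the left and closed on the right and cover (0,
          R], hence the ceiling minus one.\<close>
        define i where "i = nat (\<lceil>x\<rceil> - 1)"
        have i: "real i < x" "x \<le> real (Suc i)"
          using x ceiling_correct[of x] by (auto simp: i_def)
        have "real i < real n" using i x by linarith
        hence "i < n" by simp
        have "cmod (\<Lambda> j \<omega>) = R * x / real n" using R n by (simp add: x_def)
        hence "cmod (\<Lambda> j \<omega>) \<in> S i" using i R n by (auto simp: S_def divide_strict_right_mono divide_right_mono)
        hence "pc (?U i) \<omega> \<ge> 1" "pc (?V i) \<omega> \<ge> 1"
          using jk by (auto intro!: pc_ge1)
        hence "1 * 1 \<le> pc (?U i) \<omega> * pc (?V i) \<omega>" by (intro mult_mono) auto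
        also have "\<dots> = (\<Sum>i\<in>{i}. pc (?U i) \<omega> * pc (?V i) \<omega>)" by simp
        also have "\<dots> \<le> (\<Sum>i<n. pc (?U i) \<omega> * pc (?V i) \<omega>)"
          using \<open>i < n\<close> by (intro sum_mono2) auto
        finally show ?thesis using True by simp
      qed simp
    qed
    also have "\<dots> = (\<Sum>i<n. \<integral>\<^sup>+\<omega>. pc (?U i) \<omega> * pc (?V i) \<omega> \<partial>M)"
      by (intro nn_integral_sum) measurable
    also have "\<dots> \<le> (\<Sum>i<n. ennreal \<delta> * shell_mass (S i))"
    proof (rule sum_mono)
      fix i assume i: "i \<in> {..<n}"
      have two: "{..<2 :: nat} = {0, 1}" by auto
      define B where "B = (\<lambda>l :: nat. if l = 0 then ?U i else ?V i)"
      have "bounded {z. cmod z \<in> S i}" unfolding S_def by (rule bounded_shell[of _ "R * real (Suc i) / real n"]) auto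
      hence "(\<integral>\<^sup>+\<omega>. (\<Prod>l<(2::nat). pc (B l) \<omega>) \<partial>M) =
          (\<integral>\<^sup>+z\<in>PiE {..<2} B. ennreal (Re (gram 2 z)) \<partial>PiM {..<2} (\<lambda>_. \<mu>))"
        unfolding pc_def using UV
        by (intro correlation) (auto simp: B_def two disjoint_family_on_def intro: bounded_subset)
      also have "\<dots> \<le> shell_mass (S i) * shell_mass (S i)"
        by (intro gram_2_integral_le) (auto simp: B_def S_def)
      also have "\<dots> \<le> ennreal \<delta> * shell_mass (S i)"
        using n(2)[of i] i by (intro mult_right_mono) (auto simp: S_def)
      finally show "(\<integral>\<^sup>+\<omega>. pc (?U i) \<omega> * pc (?V i) \<omega> \<partial>M) \<le> ennreal \<delta> * shell_mass (S i)"
        by (simp add: two B_def)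
    qed
    also have "\<dots> = ennreal \<delta> * (\<Sum>i<n. emeasure mass_measure (S i))"
      by (simp add: sum_distrib_left S_def emeasure_mass_measure)
    also have "(\<Sum>i<n. emeasure mass_measure (S i)) = emeasure mass_measure (\<Union>i<n. S i)"
    proof (rule sum_emeasure)
      show "disjoint_family_on S {..<n}"
        unfolding disjoint_family_on_def
      proof (intro ballI impI)
        fix i j :: nat assume ij: "i \<noteq> j"
        have *: "S i \<inter> S j = {}" if "i < j" for i j :: nat
        proof -
          have "R * real (Suc i) / real n \<le> R * real j / real n"
            using that R by (intro divide_right_mono mult_left_mono) auto
          thus ?thesis by (auto simp: S_def simp del: of_nat_Suc)
        qed
        show "S i \<inter> S j = {}" using *[of i j] *[of j i] ij by (cases i j rule: linorder_cases) auto
      qed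
    qed (auto simp: S_def)
    also have "\<dots> \<le> c"
    proof -
      have "S i \<subseteq> {..R}" if "i < n" for i
      proof -
        have "R * real (Suc i) / real n \<le> R * real n / real n"
          using that R n by (intro divide_right_mono mult_left_mono) auto
        thus ?thesis using n by (auto simp: S_def)
      qed
      thus ?thesis unfolding c_def
        by (subst emeasure_mass_measure[symmetric], simp) (intro emeasure_mono, auto)
    qed
    finally show ?thesis by (simp add: mult_left_mono)
  qed
  have "emeasure M E \<le> 0"
  proof (rule LIMSEQ_le_const)
    obtain c' where c': "c = ennreal c'" "c' \<ge> 0" using c by (cases c) auto
    have "(\<lambda>n. ennreal (inverse (real (Suc n)) * c')) \<longlonglongrightarrow> ennreal (0 * c')"
      by (intro tendsto_ennrealI tendsto_mult_right LIMSEQ_inverse_real_of_nat)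
    thus "(\<lambda>n. ennreal (1 / real (Suc n)) * c) \<longlonglongrightarrow> 0"
      using c' by (simp add: ennreal_mult''[symmetric] inverse_eq_divide)
    show "\<exists>N. \<forall>n\<ge>N. emeasure M E \<le> ennreal (1 / real (Suc n)) * c"
      by (intro exI[of _ 0] allI impI bound) auto
  qed
  hence "E \<in> null_sets M" by (simp add: null_sets_def)
  from AE_not_in[OF this] AE_space show ?thesis
    by eventually_elim (auto simp: E_def)
qed

text \<open>Distinct points are separated by disjoint members of a countable base, so countably many
  null sets suffice. Distinct points of equal modulus are away from the origin, which the thin
  shells do not cover.\<close>

lemma moduli_inj: "AE \<omega> in M. inj (\<lambda>k. cmod (\<Lambda> k \<omega>))"
proof -
  obtain \<B> :: "complex set set" where \<B>: "countable \<B>" "topological_basis \<B>"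
    using ex_countable_basis by blast
  have "AE \<omega> in M. \<forall>U\<in>\<B>. \<forall>V\<in>\<B>. \<forall>R :: nat. U \<inter> V = {} \<longrightarrow> (\<forall>j k. \<not> (\<Lambda> j \<omega> \<in> U \<and> \<Lambda> k \<omega> \<in> V
    \<and> cmod (\<Lambda> j \<omega>) = cmod (\<Lambda> k \<omega>) \<and> 0 < cmod (\<Lambda> j \<omega>) \<and> cmod (\<Lambda> j \<omega>) \<le> real R + 1))"
    unfolding AE_ball_countable[OF \<B>(1)] AE_all_countable
  proof (intro ballI allI)
    fix U V and R :: nat assume "U \<in> \<B>" "V \<in> \<B>"
    hence [measurable]: "U \<in> sets borel" "V \<in> sets borel"
      using topological_basis_open[OF \<B>(2)] by auto
    show "AE \<omega> in M. U \<inter> V = {} \<longrightarrow> (\<forall>j k. \<not> (\<Lambda> j \<omega> \<in> U \<and> \<Lambda> k \<omega> \<in> V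
       \<and> cmod (\<Lambda> j \<omega>) = cmod (\<Lambda> k \<omega>) \<and> 0 < cmod (\<Lambda> j \<omega>) \<and> cmod (\<Lambda> j \<omega>) \<le> real R + 1))"
      using no_common_modulus[of U V "real R + 1"] by (cases "U \<inter> V = {}") auto
  qed
  thus ?thesis using points_inj
  proof eventually_elim
    case (elim \<omega>)
    show ?case
    proof (rule injI, rule ccontr)
      fix j k assume eq: "cmod (\<Lambda> j \<omega>) = cmod (\<Lambda> k \<omega>)" and "j \<noteq> k"
      hence ne: "\<Lambda> j \<omega> \<noteq> \<Lambda> k \<omega>" using elim(2) by (auto dest: injD)
      hence pos: "0 < cmod (\<Lambda> j \<omega>)" using eq by auto
      obtain U' V' where "open U'" "open V'" "\<Lambda> j \<omega> \<in> U'" "\<Lambda> k \<omega> \<in> V'" "U' \<inter> V' = {}"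
        using hausdorff[OF ne] by blast
      moreover obtain U where "U \<in> \<B>" "\<Lambda> j \<omega> \<in> U" "U \<subseteq> U'"
        using topological_basisE[OF \<B>(2) \<open>open U'\<close> \<open>\<Lambda> j \<omega> \<in> U'\<close>] by blast
      moreover obtain V where "V \<in> \<B>" "\<Lambda> k \<omega> \<in> V" "V \<subseteq> V'"
        using topological_basisE[OF \<B>(2) \<open>open V'\<close> \<open>\<Lambda> k \<omega> \<in> V'\<close>] by blast
      moreover obtain R :: nat where "cmod (\<Lambda> j \<omega>) \<le> real R" using real_arch_simple by blast
      hence "cmod (\<Lambda> j \<omega>) \<le> real R + 1" by simp
      moreover have "U \<inter> V = {}" using calculation by blast
      ultimately show False using elim(1) eq pos by blast
    qed
  qed
qed

end

section \<open>Second moments of counts by splitting into cells\<close>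

context radial_dpp begin

text \<open>For i > 0 the interval [i / (s + 1), (i + 1) / (s + 1)). Cell 0 also absorbs the
  negative numbers, so that the cells partition the whole line; s + 1 keeps the mesh meaningful at s
  = 0.\<close>

definition cell :: "nat \<Rightarrow> nat \<Rightarrow> real set" where
  "cell s i = {r. nat \<lfloor>r * (real s + 1)\<rfloor> = i}"

lemma cell_measurable [measurable]: "cell s i \<in> sets borel"
  unfolding cell_def by measurable

lemma cell_disjoint: "i \<noteq> j \<Longrightarrow> cell s i \<inter> cell s j = {}"
  by (auto simp: cell_def)

lemma sum_cells_le:
  assumes [measurable]: "S \<in> sets borel"
  shows "(\<Sum>i<K. shell_mass (S \<inter> cell s i)) \<le> shell_mass S"
proof -
  have "(\<Sum>i<K. shell_mass (S \<inter> cell s i)) = (\<Sum>i<K. emeasure mass_measure (S \<inter> cell s i))"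
    by (simp add: emeasure_mass_measure)
  also have "\<dots> = emeasure mass_measure (\<Union>i<K. S \<inter> cell s i)"
    by (intro sum_emeasure) (auto simp: disjoint_family_on_def cell_def)
  also have "\<dots> \<le> emeasure mass_measure S" by (intro emeasure_mono) auto
  finally show ?thesis by (simp add: emeasure_mass_measure)
qed

definition offdiag :: "nat \<Rightarrow> (nat \<times> nat) set" where
  "offdiag K = {(i, j). i < K \<and> j < K \<and> i \<noteq> j}"

lemma finite_offdiag [simp]: "finite (offdiag K)"
  by (rule finite_subset[of _ "{..<K} \<times> {..<K}"]) (auto simp: offdiag_def)

lemma sum_offdiag_le:
  fixes f :: "nat \<Rightarrow> ennreal"
  shows "(\<Sum>p\<in>offdiag K. f (fst p) * f (snd p)) \<le> (\<Sum>i<K. f i) * (\<Sum>i<K. f i)"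
proof -
  have "(\<Sum>p\<in>offdiag K. f (fst p) * f (snd p)) \<le> (\<Sum>p\<in>{..<K} \<times> {..<K}. f (fst p) * f (snd p))"
    by (intro sum_mono2) (auto simp: offdiag_def)
  also have "\<dots> = (\<Sum>i<K. f i) * (\<Sum>i<K. f i)"
    by (simp add: sum_product sum.cartesian_product split_beta)
  finally show ?thesis .
qed

text \<open>
  Where the moduli in \<open>S\<close> are finitely many and distinct, this is eventually \<open>(count S \<omega>)\<^sup>2\<close>; it
  only involves products of counts of disjoint shells, whose expectations are known.
\<close>

definition split_square :: "nat \<Rightarrow> nat \<Rightarrow> real set \<Rightarrow> 'w \<Rightarrow> ennreal" where
  "split_square K s S \<omega> =
     count S \<omega> + (\<Sum>p\<in>offdiag K. count (S \<inter> cell s (fst p)) \<omega> * count (S \<inter> cell s (snd p)) \<omega>)"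

lemma split_square_measurable [measurable]:
  assumes [measurable]: "S \<in> sets borel" shows "split_square K s S \<in> borel_measurable M"
  unfolding split_square_def[abs_def] by measurable

lemma count_finite:
  assumes "S \<in> sets borel" "S \<subseteq> {..R}"
  shows "AE \<omega> in M. finite {k. cmod (\<Lambda> k \<omega>) \<in> S}"
proof -
  note [measurable] = assms(1)
  have "(\<integral>\<^sup>+\<omega>. count S \<omega> \<partial>M) \<noteq> \<infinity>"
    using shell_mass_finite[OF assms] expected_count[OF assms] by auto
  hence "AE \<omega> in M. count S \<omega> \<noteq> \<infinity>"
    by (intro nn_integral_noteq_infinite) auto
  thus ?thesis
  proof eventually_elim
    case (elim \<omega>)
    have "count S \<omega> = emeasure (count_space UNIV) {k. cmod (\<Lambda> k \<omega>) \<in> S}"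
      by (simp add: count_point_count point_count_def)
    thus ?case using elim by (auto simp: emeasure_count_space split: if_splits)
  qed
qed

lemma eventually_cells_distinct:
  assumes "finite J" "inj_on r J" "\<And>j. j \<in> J \<Longrightarrow> 0 \<le> r j"
  shows "eventually (\<lambda>s. \<forall>j\<in>J. \<forall>k\<in>J. j \<noteq> k \<longrightarrow> nat \<lfloor>r j * (real s + 1)\<rfloor> \<noteq> nat \<lfloor>r k * (real s + 1)\<rfloor>) sequentially"
proof (intro eventually_ball_finite[OF assms(1)] ballI)
  have *: "eventually (\<lambda>s. nat \<lfloor>a * (real s + 1)\<rfloor> \<noteq> nat \<lfloor>b * (real s + 1)\<rfloor>) sequentially"
    if ab: "0 \<le> a" "a < b" for a b :: real
  proof -
    obtain N :: nat where N: "1 / (b - a) < real N" using reals_Archimedean2 by blast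
    show ?thesis
    proof (rule eventually_sequentiallyI[of N])
      fix s assume "N \<le> s"
      hence "1 / (b - a) < real s + 1" using N by linarith
      hence "1 < (b - a) * (real s + 1)" using ab by (simp add: field_simps)
      hence "a * (real s + 1) + 1 < b * (real s + 1)" by (simp add: algebra_simps)
      hence "\<lfloor>a * (real s + 1)\<rfloor> < \<lfloor>b * (real s + 1)\<rfloor>" by linarith
      moreover have "0 \<le> \<lfloor>a * (real s + 1)\<rfloor>" using ab by simp
      ultimately have "nat \<lfloor>a * (real s + 1)\<rfloor> < nat \<lfloor>b * (real s + 1)\<rfloor>"
        by (simp only: nat_less_eq_zless)
      thus "nat \<lfloor>a * (real s + 1)\<rfloor> \<noteq> nat \<lfloor>b * (real s + 1)\<rfloor>" by (rule less_imp_neq)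
    qed
  qed
  fix j k assume jk: "j \<in> J" "k \<in> J"
  show "eventually (\<lambda>s. j \<noteq> k \<longrightarrow> nat \<lfloor>r j * (real s + 1)\<rfloor> \<noteq> nat \<lfloor>r k * (real s + 1)\<rfloor>) sequentially"
  proof (cases "j = k")
    case False
    hence "r j \<noteq> r k" using assms(2) jk by (auto dest: inj_onD)
    thus ?thesis using *[of "r j" "r k"] *[of "r k" "r j"] assms(3) jk
      by (cases "r j" "r k" rule: linorder_cases) (auto elim: eventually_mono)
  qed simp
qed

lemma count_eq_sum:
  assumes "J = {k. cmod (\<Lambda> k \<omega>) \<in> S}" "finite J" "X \<subseteq> S"
  shows "count X \<omega> = (\<Sum>k\<in>J. indicator X (cmod (\<Lambda> k \<omega>)))"
  unfolding count_def using assms by (intro suminf_finite) (auto simp: indicator_def)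

text \<open>Finitely many distinct moduli end up in different cells once the mesh is fine. From then
  on every ordered pair of different points is caught by an off-diagonal pair of cells, and the
  diagonal pairs make up the count itself.\<close>

lemma square_le_liminf_split_square:
  assumes S: "S \<subseteq> {..R}" and fin: "finite {k. cmod (\<Lambda> k \<omega>) \<in> S}" and inj: "inj (\<lambda>k. cmod (\<Lambda> k \<omega>))"
  shows "eventually (\<lambda>s. (count S \<omega>)\<^sup>2 \<le> split_square (nat \<lfloor>R * (real s + 1)\<rfloor> + 1) s S \<omega>) sequentially"
proof -
  define J where "J = {k. cmod (\<Lambda> k \<omega>) \<in> S}"
  define r where "r = (\<lambda>k. cmod (\<Lambda> k \<omega>))"
  have J: "finite J" using fin by (simp add: J_def)
  have "eventually (\<lambda>s. \<forall>j\<in>J. \<forall>k\<in>J. j \<noteq> k \<longrightarrow> nat \<lfloor>r j * (real s + 1)\<rfloor> \<noteq> nat \<lfloor>r k * (real s + 1)\<rfloor>) sequentially"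
    using inj by (intro eventually_cells_distinct J) (auto simp: r_def inj_on_def)
  thus ?thesis
  proof eventually_elim
    case (elim s)
    define c where "c = (\<lambda>k. nat \<lfloor>r k * (real s + 1)\<rfloor>)"
    \<comment> \<open>One more than the floor, because a modulus equal to R lies in the cell with
      that index.\<close>
    define K where "K = nat \<lfloor>R * (real s + 1)\<rfloor> + 1"
    have cK: "c k < K" if "k \<in> J" for k
    proof -
      have "r k \<le> R" using that S by (auto simp: J_def r_def)
      hence "r k * (real s + 1) \<le> R * (real s + 1)" by (intro mult_right_mono) auto
      thus ?thesis by (auto simp: c_def K_def less_Suc_eq_le intro!: nat_mono floor_mono)
    qed
    have S1: "count S \<omega> = (\<Sum>k\<in>J. 1)"
      using count_eq_sum[OF J_def J, of S] by (auto simp: J_def)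
    have S2: "count (S \<inter> cell s i) \<omega> = (\<Sum>k\<in>J. if c k = i then 1 else 0)" for i
      using count_eq_sum[OF J_def J, of "S \<inter> cell s i"]
      by (auto simp: J_def cell_def c_def r_def indicator_def intro!: sum.cong)
    have "(count S \<omega>)\<^sup>2 = (\<Sum>j\<in>J. \<Sum>k\<in>J. 1)"
      by (simp add: S1 power2_eq_square)
    also have "\<dots> = (\<Sum>j\<in>J. \<Sum>k\<in>J. (if k = j then 1 else 0) + (if k = j then 0 else 1))"
      by (intro sum.cong refl) auto
    also have "\<dots> = count S \<omega> + (\<Sum>j\<in>J. \<Sum>k\<in>J. if k = j then 0 else 1)"
      using J by (simp add: sum.distrib S1)
    also have "(\<Sum>j\<in>J. \<Sum>k\<in>J. if k = j then 0 else 1 :: ennreal) \<le>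
        (\<Sum>j\<in>J. \<Sum>k\<in>J. \<Sum>p\<in>offdiag K. (if c j = fst p then 1 else 0) * (if c k = snd p then 1 else 0))"
    proof (intro sum_mono)
      fix j k assume jk: "j \<in> J" "k \<in> J"
      show "(if k = j then 0 else 1 :: ennreal) \<le>
        (\<Sum>p\<in>offdiag K. (if c j = fst p then 1 else 0) * (if c k = snd p then 1 else 0))"
      proof (cases "k = j")
        case False
        hence "c j \<noteq> c k" using elim jk by (auto simp: c_def)
        hence "(c j, c k) \<in> offdiag K" using cK jk by (simp add: offdiag_def)
        hence "(\<Sum>p\<in>{(c j, c k)}. (if c j = fst p then 1 else 0) * (if c k = snd p then 1 else 0 :: ennreal))
           \<le> (\<Sum>p\<in>offdiag K. (if c j = fst p then 1 else 0) * (if c k = snd p then 1 else 0))"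
          by (intro sum_mono2) auto
        thus ?thesis using False by simp
      qed simp
    qed
    also have "\<dots> = (\<Sum>p\<in>offdiag K. \<Sum>j\<in>J. \<Sum>k\<in>J. (if c j = fst p then 1 else 0) * (if c k = snd p then 1 else 0))"
      by (subst (2) sum.swap, subst sum.swap) (rule refl)
    also have "\<dots> = (\<Sum>p\<in>offdiag K. count (S \<inter> cell s (fst p)) \<omega> * count (S \<inter> cell s (snd p)) \<omega>)"
      by (simp only: S2 sum_product)
    finally show ?case by (simp add: split_square_def K_def add_left_mono)
  qed
qed

lemma split_square_expectation:
  assumes S: "S \<in> sets borel" "S \<subseteq> {..R}"
  shows "(\<integral>\<^sup>+\<omega>. split_square K s S \<omega> \<partial>M) \<le> shell_mass S + shell_mass S * shell_mass S"
proof -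
  note [measurable] = S(1)
  have "(\<integral>\<^sup>+\<omega>. split_square K s S \<omega> \<partial>M) = (\<integral>\<^sup>+\<omega>. count S \<omega> \<partial>M) +
     (\<Sum>p\<in>offdiag K. \<integral>\<^sup>+\<omega>. count (S \<inter> cell s (fst p)) \<omega> * count (S \<inter> cell s (snd p)) \<omega> \<partial>M)"
    unfolding split_square_def by (subst nn_integral_add) (auto simp: nn_integral_sum)
  also have "\<dots> \<le> shell_mass S + (\<Sum>p\<in>offdiag K. shell_mass (S \<inter> cell s (fst p)) * shell_mass (S \<inter> cell s (snd p)))"
  proof (intro add_mono sum_mono)
    show "(\<integral>\<^sup>+\<omega>. count S \<omega> \<partial>M) \<le> shell_mass S" using expected_count[OF S] by simp
    fix p assume p: "p \<in> offdiag K"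
    have "(\<integral>\<^sup>+\<omega>. prod_list (map (\<lambda>X. count X \<omega>) [S \<inter> cell s (fst p), S \<inter> cell s (snd p)]) \<partial>M) \<le>
      prod_list (map shell_mass [S \<inter> cell s (fst p), S \<inter> cell s (snd p)])"
    proof (rule correlation_list_le[where R=R])
      fix i j assume "i < j" "j < length [S \<inter> cell s (fst p), S \<inter> cell s (snd p)]"
      hence "i = 0" "j = 1" by auto
      thus "[S \<inter> cell s (fst p), S \<inter> cell s (snd p)] ! i \<inter> [S \<inter> cell s (fst p), S \<inter> cell s (snd p)] ! j = {}"
        using p cell_disjoint[of "fst p" "snd p" s] by (auto simp: offdiag_def)
    qed (use S in auto)
    thus "(\<integral>\<^sup>+\<omega>. count (S \<inter> cell s (fst p)) \<omega> * count (S \<inter> cell s (snd p)) \<omega> \<partial>M) \<le>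
      shell_mass (S \<inter> cell s (fst p)) * shell_mass (S \<inter> cell s (snd p))" by simp
  qed
  also have "\<dots> \<le> shell_mass S + shell_mass S * shell_mass S"
    by (intro add_left_mono order_trans[OF sum_offdiag_le] mult_mono sum_cells_le S) auto
  finally show ?thesis .
qed

text \<open>Fatou's lemma along refining cells: for each mesh the expectation involves only disjoint
  shells, and its bound does not depend on the mesh.\<close>

lemma second_moment:
  assumes S: "S \<in> sets borel" "S \<subseteq> {..R}"
  shows "(\<integral>\<^sup>+\<omega>. (count S \<omega>)\<^sup>2 \<partial>M) \<le> shell_mass S + shell_mass S * shell_mass S"
proof -
  note [measurable] = S(1)
  define T where "T = (\<lambda>s. split_square (nat \<lfloor>R * (real s + 1)\<rfloor> + 1) s S)"
  have "(\<integral>\<^sup>+\<omega>. (count S \<omega>)\<^sup>2 \<partial>M) \<le> (\<integral>\<^sup>+\<omega>. liminf (\<lambda>s. T s \<omega>) \<partial>M)"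
  proof (rule nn_integral_mono_AE)
    show "AE \<omega> in M. (count S \<omega>)\<^sup>2 \<le> liminf (\<lambda>s. T s \<omega>)"
      using count_finite[OF S] moduli_inj
    proof eventually_elim
      case (elim \<omega>)
      show ?case unfolding T_def
        by (intro Liminf_bounded square_le_liminf_split_square S elim)
    qed
  qed
  also have "\<dots> \<le> liminf (\<lambda>s. \<integral>\<^sup>+\<omega>. T s \<omega> \<partial>M)"
    unfolding T_def by (intro nn_integral_liminf) measurable
  also have "\<dots> \<le> liminf (\<lambda>s. shell_mass S + shell_mass S * shell_mass S)"
    unfolding T_def by (intro Liminf_mono always_eventually allI split_square_expectation[OF S])
  finally show ?thesis by (simp add: Liminf_const)
qed

text \<open>All sets occurring in one term of the expanded product are pairwise disjoint, as
  \<open>B\<close> and \<open>C\<close> are and the cells within each are different. Every term is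
  therefore bounded by a product of masses, and the bounds factor again.\<close>

lemma split_square_product_expectation:
  assumes B: "B \<in> sets borel" "B \<subseteq> {..R}" and C: "C \<in> sets borel" "C \<subseteq> {..R}" and BC: "B \<inter> C = {}"
  shows "(\<integral>\<^sup>+\<omega>. split_square K s B \<omega> * split_square K s C \<omega> \<partial>M) \<le>
    (shell_mass B + shell_mass B * shell_mass B) * (shell_mass C + shell_mass C * shell_mass C)"
proof -
  note [measurable] = B(1) C(1)
  define b where "b = (\<lambda>i. B \<inter> cell s i)"
  define c where "c = (\<lambda>i. C \<inter> cell s i)"
  have [measurable]: "b i \<in> sets borel" "c i \<in> sets borel" for i by (auto simp: b_def c_def)
  let ?n = "\<lambda>X \<omega>. count X \<omega>"
  have exp: "split_square K s B \<omega> * split_square K s C \<omega> =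
    ?n B \<omega> * ?n C \<omega> + (\<Sum>q\<in>offdiag K. ?n B \<omega> * ?n (c (fst q)) \<omega> * ?n (c (snd q)) \<omega>)
    + (\<Sum>p\<in>offdiag K. ?n (b (fst p)) \<omega> * ?n (b (snd p)) \<omega> * ?n C \<omega>)
    + (\<Sum>p\<in>offdiag K. \<Sum>q\<in>offdiag K. ?n (b (fst p)) \<omega> * ?n (b (snd p)) \<omega> * ?n (c (fst q)) \<omega> * ?n (c (snd q)) \<omega>)" for \<omega>
  proof -
    have *: "(x + P) * (y + Q) = x * y + x * Q + P * y + P * Q" for x y P Q :: ennreal
      by (simp add: distrib_left distrib_right add_ac)
    show ?thesis
      unfolding split_square_def * sum_product
      by (simp only: b_def c_def sum_distrib_left sum_distrib_right mult.assoc)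
  qed
  have corr: "(\<integral>\<^sup>+\<omega>. prod_list (map (\<lambda>X. count X \<omega>) xs) \<partial>M) \<le> prod_list (map shell_mass xs)"
    if "list_all (\<lambda>X. X \<in> sets borel \<and> X \<subseteq> {..R}) xs" "sorted_wrt (\<lambda>X Y. X \<inter> Y = {}) xs" for xs
    using that by (intro correlation_list_le[where R=R]) (auto simp: sorted_wrt_iff_nth_less list_all_iff)
  have bb: "b (fst p) \<inter> b (snd p) = {}" "c (fst p) \<inter> c (snd p) = {}" if "p \<in> offdiag K" for p
    using that cell_disjoint[of "fst p" "snd p" s] by (auto simp: offdiag_def b_def c_def)
  have disj: "b i \<inter> c j = {}" "B \<inter> c j = {}" "b i \<inter> C = {}" "b i \<subseteq> {..R}" "c i \<subseteq> {..R}" for i j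
    using BC B C by (auto simp: b_def c_def)
  have 1: "(\<integral>\<^sup>+\<omega>. ?n B \<omega> * ?n C \<omega> \<partial>M) \<le> shell_mass B * shell_mass C"
    using corr[of "[B, C]"] B C BC by simp
  have 2: "(\<integral>\<^sup>+\<omega>. ?n B \<omega> * ?n (c (fst q)) \<omega> * ?n (c (snd q)) \<omega> \<partial>M)
    \<le> shell_mass B * (shell_mass (c (fst q)) * shell_mass (c (snd q)))" if "q \<in> offdiag K" for q
    using corr[of "[B, c (fst q), c (snd q)]"] B disj bb[OF that] by (simp add: mult.assoc)
  have 3: "(\<integral>\<^sup>+\<omega>. ?n (b (fst p)) \<omega> * ?n (b (snd p)) \<omega> * ?n C \<omega> \<partial>M)
    \<le> shell_mass (b (fst p)) * shell_mass (b (snd p)) * shell_mass C" if "p \<in> offdiag K" for p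
    using corr[of "[b (fst p), b (snd p), C]"] C disj bb[OF that] by (simp add: mult.assoc)
  have 4: "(\<integral>\<^sup>+\<omega>. ?n (b (fst p)) \<omega> * ?n (b (snd p)) \<omega> * ?n (c (fst q)) \<omega> * ?n (c (snd q)) \<omega> \<partial>M)
    \<le> shell_mass (b (fst p)) * shell_mass (b (snd p)) * (shell_mass (c (fst q)) * shell_mass (c (snd q)))"
    if "p \<in> offdiag K" "q \<in> offdiag K" for p q
    using corr[of "[b (fst p), b (snd p), c (fst q), c (snd q)]"] disj bb[OF that(1)] bb[OF that(2)]
    by (simp add: mult.assoc)
  have sb: "(\<Sum>p\<in>offdiag K. shell_mass (b (fst p)) * shell_mass (b (snd p))) \<le> shell_mass B * shell_mass B"
    unfolding b_def by (intro order_trans[OF sum_offdiag_le] mult_mono sum_cells_le B) auto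
  have sc: "(\<Sum>q\<in>offdiag K. shell_mass (c (fst q)) * shell_mass (c (snd q))) \<le> shell_mass C * shell_mass C"
    unfolding c_def by (intro order_trans[OF sum_offdiag_le] mult_mono sum_cells_le C) auto
  have "(\<integral>\<^sup>+\<omega>. split_square K s B \<omega> * split_square K s C \<omega> \<partial>M) =
    (\<integral>\<^sup>+\<omega>. ?n B \<omega> * ?n C \<omega> \<partial>M) + (\<Sum>q\<in>offdiag K. \<integral>\<^sup>+\<omega>. ?n B \<omega> * ?n (c (fst q)) \<omega> * ?n (c (snd q)) \<omega> \<partial>M)
    + (\<Sum>p\<in>offdiag K. \<integral>\<^sup>+\<omega>. ?n (b (fst p)) \<omega> * ?n (b (snd p)) \<omega> * ?n C \<omega> \<partial>M)
    + (\<Sum>p\<in>offdiag K. \<Sum>q\<in>offdiag K. \<integral>\<^sup>+\<omega>. ?n (b (fst p)) \<omega> * ?n (b (snd p)) \<omega> * ?n (c (fst q)) \<omega> * ?n (c (snd q)) \<omega> \<partial>M)"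
    unfolding exp by (simp add: nn_integral_add nn_integral_sum)
  also have "\<dots> \<le> shell_mass B * shell_mass C
    + (\<Sum>q\<in>offdiag K. shell_mass B * (shell_mass (c (fst q)) * shell_mass (c (snd q))))
    + (\<Sum>p\<in>offdiag K. shell_mass (b (fst p)) * shell_mass (b (snd p)) * shell_mass C)
    + (\<Sum>p\<in>offdiag K. \<Sum>q\<in>offdiag K. shell_mass (b (fst p)) * shell_mass (b (snd p)) * (shell_mass (c (fst q)) * shell_mass (c (snd q))))"
    by (intro add_mono sum_mono 1 2 3 4)
  also have "\<dots> = shell_mass B * shell_mass C
    + shell_mass B * (\<Sum>q\<in>offdiag K. shell_mass (c (fst q)) * shell_mass (c (snd q)))
    + (\<Sum>p\<in>offdiag K. shell_mass (b (fst p)) * shell_mass (b (snd p))) * shell_mass C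
    + (\<Sum>p\<in>offdiag K. shell_mass (b (fst p)) * shell_mass (b (snd p))) * (\<Sum>q\<in>offdiag K. shell_mass (c (fst q)) * shell_mass (c (snd q)))"
    unfolding sum_product by (simp only: sum_distrib_left sum_distrib_right)
  also have "\<dots> \<le> shell_mass B * shell_mass C + shell_mass B * (shell_mass C * shell_mass C)
    + shell_mass B * shell_mass B * shell_mass C + shell_mass B * shell_mass B * (shell_mass C * shell_mass C)"
    by (intro add_mono mult_mono sb sc order_refl) auto
  also have "\<dots> = (shell_mass B + shell_mass B * shell_mass B) * (shell_mass C + shell_mass C * shell_mass C)"
    by (simp add: distrib_left distrib_right add.assoc)
  finally show ?thesis .
qed

lemma second_moment_product:
  assumes B: "B \<in> sets borel" "B \<subseteq> {..R}" and C: "C \<in> sets borel" "C \<subseteq> {..R}" and BC: "B \<inter> C = {}"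
  shows "(\<integral>\<^sup>+\<omega>. (count B \<omega> * count C \<omega>)\<^sup>2 \<partial>M) \<le>
    (shell_mass B + shell_mass B * shell_mass B) * (shell_mass C + shell_mass C * shell_mass C)"
proof -
  note [measurable] = B(1) C(1)
  define T where "T = (\<lambda>S s. split_square (nat \<lfloor>R * (real s + 1)\<rfloor> + 1) s S)"
  have "(\<integral>\<^sup>+\<omega>. (count B \<omega> * count C \<omega>)\<^sup>2 \<partial>M) \<le> (\<integral>\<^sup>+\<omega>. liminf (\<lambda>s. T B s \<omega> * T C s \<omega>) \<partial>M)"
  proof (rule nn_integral_mono_AE)
    show "AE \<omega> in M. (count B \<omega> * count C \<omega>)\<^sup>2 \<le> liminf (\<lambda>s. T B s \<omega> * T C s \<omega>)"
      using count_finite[OF B] count_finite[OF C] moduli_inj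
    proof eventually_elim
      case (elim \<omega>)
      have "eventually (\<lambda>s. (count B \<omega>)\<^sup>2 \<le> T B s \<omega>) sequentially" "eventually (\<lambda>s. (count C \<omega>)\<^sup>2 \<le> T C s \<omega>) sequentially"
        unfolding T_def by (intro square_le_liminf_split_square B C elim)+
      hence "eventually (\<lambda>s. (count B \<omega> * count C \<omega>)\<^sup>2 \<le> T B s \<omega> * T C s \<omega>) sequentially"
        by eventually_elim (simp add: power_mult_distrib mult_mono)
      thus ?case by (rule Liminf_bounded)
    qed
  qed
  also have "\<dots> \<le> liminf (\<lambda>s. \<integral>\<^sup>+\<omega>. T B s \<omega> * T C s \<omega> \<partial>M)"
    unfolding T_def by (intro nn_integral_liminf) measurable
  also have "\<dots> \<le> liminf (\<lambda>s :: nat. (shell_mass B + shell_mass B * shell_mass B) * (shell_mass C + shell_mass C * shell_mass C))"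
    unfolding T_def by (intro Liminf_mono always_eventually allI split_square_product_expectation[OF B C BC])
  finally show ?thesis by (simp add: Liminf_const)
qed

end

section \<open>Random angles\<close>

lemma norm_cis_diff: "cmod (cis a - cis b) = 2 * \<bar>sin ((a - b) / 2)\<bar>"
proof -
  have "cis a - cis b = cis b * (cis (a - b) - 1)"
    by (simp add: cis_mult right_diff_distrib)
  hence "cis a - cis b = cis b * (exp (\<i> * of_real (a - b)) - 1)"
    by (simp only: cis_conv_exp)
  thus ?thesis by (simp only: norm_mult norm_cis dist_exp_i_1)
qed

lemma norm_cis_diff_le: "cmod (cis a - cis b) \<le> \<bar>a - b\<bar>"
  using abs_sin_x_le_abs_x[of "(a - b) / 2"] by (simp add: norm_cis_diff)

lemma sin_ge_half:
  assumes "0 \<le> x" "x \<le> pi / 3" shows "x / 2 \<le> sin x"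
proof (cases "x = 0")
  case False
  have "\<exists>z. 0 < z \<and> z < x \<and> sin x - sin 0 = (x - 0) * cos z"
    using assms False by (intro MVT2) (auto intro!: derivative_eq_intros)
  then obtain z where z: "0 < z" "z < x" "sin x = x * cos z" by auto
  have "cos (pi / 3) \<le> cos z" using z assms by (intro cos_monotone_0_pi_le) auto
  hence "x * (1 / 2) \<le> x * cos z" using assms by (intro mult_left_mono) (auto simp: cos_60)
  thus ?thesis using z by simp
qed simp

lemma sin_ge_on_middle:
  assumes "0 < d" "d \<le> pi / 3" "d \<le> y" "y \<le> pi - d"
  shows "d / 2 \<le> sin y"
proof -
  have *: "d / 2 \<le> sin x" if "d \<le> x" "x \<le> pi / 2" for x
  proof -
    have "sin d \<le> sin x" using assms that by (intro sin_monotone_2pi_le) auto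
    thus ?thesis using sin_ge_half[of d] assms by linarith
  qed
  show ?thesis
  proof (cases "y \<le> pi / 2")
    case False
    thus ?thesis using *[of "pi - y"] assms by simp
  qed (use *[of y] assms in auto)
qed

lemma polar_dist_sq:
  "(cmod (of_real r * cis a - of_real s * cis b))\<^sup>2 = (r - s)\<^sup>2 + r * s * (cmod (cis a - cis b))\<^sup>2"
proof -
  have e: "cos x * cos x = 1 - sin x * sin x" for x :: real
    using sin_cos_squared_add3[of x] by linarith
  show ?thesis
    unfolding cmod_power2 by (simp add: power2_eq_square algebra_simps e)
qed

definition sector :: "nat \<Rightarrow> nat \<Rightarrow> real set" where
  "sector L i = {2 * pi * real i / real L..<2 * pi * real (Suc i) / real L}"

lemma sector_measurable [measurable]: "sector L i \<in> sets borel"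
  by (simp add: sector_def)

lemma sector_exists:
  assumes "L > 0" "0 \<le> t" "t < 2 * pi"
  obtains i where "i < L" "t \<in> sector L i"
proof -
  define x where "x = t * real L / (2 * pi)"
  have x: "0 \<le> x" "x < real L" using assms by (auto simp: x_def field_simps)
  define i where "i = nat \<lfloor>x\<rfloor>"
  have i: "real i \<le> x" "x < real (Suc i)" using x real_of_int_floor_add_one_gt[of x] by (auto simp: i_def add.commute)
  have "real i < real L" using i x by linarith
  moreover have t: "t = 2 * pi * x / real L" using assms by (simp add: x_def)
  have "2 * pi * real i / real L \<le> t" "t < 2 * pi * real (Suc i) / real L"
    unfolding t using i assms by (auto intro!: divide_right_mono divide_strict_right_mono mult_left_mono simp del: of_nat_Suc)
  ultimately show ?thesis by (intro that[of i]) (auto simp: sector_def)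
qed

definition adjacent_sectors :: "nat \<Rightarrow> (nat \<times> nat) set" where
  "adjacent_sectors L = {(i, j). i < L \<and> j < L \<and>
     (i = j \<or> i = Suc j \<or> j = Suc i \<or> (i = L - 1 \<and> j = 0) \<or> (i = 0 \<and> j = L - 1))}"

lemma card_adjacent_sectors: "L > 0 \<Longrightarrow> card (adjacent_sectors L) \<le> 5 * L"
proof -
  assume L: "L > 0"
  have sub: "adjacent_sectors L \<subseteq> ((\<lambda>i. (i, i)) ` {..<L} \<union> (\<lambda>i. (Suc i, i)) ` {..<L}) \<union>
      ((\<lambda>i. (i, Suc i)) ` {..<L} \<union> {(L - 1, 0), (0, L - 1)})"
    by (auto simp: adjacent_sectors_def)
  have "card (adjacent_sectors L) \<le> card (((\<lambda>i. (i, i)) ` {..<L} \<union> (\<lambda>i. (Suc i, i)) ` {..<L}) \<union>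
      ((\<lambda>i. (i, Suc i)) ` {..<L} \<union> {(L - 1, 0), (0, L - 1)}))"
    by (intro card_mono sub) auto
  also have "\<dots> \<le> (card ((\<lambda>i. (i, i)) ` {..<L}) + card ((\<lambda>i. (Suc i, i)) ` {..<L})) +
      (card ((\<lambda>i. (i, Suc i)) ` {..<L}) + card {(L - 1, 0), (0, L - 1)})"
    by (intro order_trans[OF card_Un_le] add_mono card_Un_le)
  also have "\<dots> \<le> (L + L) + (L + 2)"
    by (intro add_mono order_trans[OF card_image_le]) (auto simp: card_insert_if)
  also have "\<dots> \<le> 5 * L" using L by simp
  finally show ?thesis .
qed

lemma finite_adjacent_sectors [simp]: "finite (adjacent_sectors L)"
  by (rule finite_subset[of _ "{..<L} \<times> {..<L}"]) (auto simp: adjacent_sectors_def)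

text \<open>Angles in non-adjacent sectors are at least one sector width 2 pi / L apart modulo a
  full turn, so their unit vectors are at least pi / L apart. At moduli >= R the points then have
  distance at least R pi / L >= pi / 3 > 1, which is the origin of L <= 3 R. L >= 3 keeps pi / L in
  the range where sin x >= x / 2.\<close>

lemma close_points_adjacent:
  assumes L: "L \<ge> 3" "real L \<le> 3 * R" and R: "r \<ge> R" "s \<ge> R"
    and dist: "cmod (of_real r * cis a - of_real s * cis b) < 1"
    and ij: "i < L" "j < L" "a \<in> sector L i" "b \<in> sector L j"
  shows "(i, j) \<in> adjacent_sectors L"
proof (rule ccontr)
  assume n: "(i, j) \<notin> adjacent_sectors L"
  define d where "d = pi / real L"
  have R0: "R > 0" using L by linarith
  have "pi / real L \<le> pi / 3" using L by (intro divide_left_mono) auto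
  hence d: "0 < d" "d \<le> pi / 3" using L by (auto simp: d_def)
  have far: "d / 2 \<le> sin ((x - y) / 2)"
    if "x \<in> sector L k" "y \<in> sector L l" "k \<ge> Suc (Suc l)" "k - l \<le> L - 2" for x y k l
  proof -
    have "2 * d * real (Suc l) + 2 * d = 2 * d * real (Suc (Suc l))" by (simp add: algebra_simps)
    also have "\<dots> \<le> 2 * d * real k" using that d by (intro mult_left_mono) auto
    finally have "2 * d \<le> x - y" using that by (auto simp: sector_def d_def mult_ac)
    moreover have "2 * d * real (Suc k) \<le> 2 * d * real (L + l - 1)"
      using that d L by (intro mult_left_mono) auto
    moreover have "2 * d * real (L + l - 1) = 2 * pi - 2 * d + 2 * d * real l"
      using L by (simp add: d_def of_nat_diff field_simps)
    ultimately have "x - y \<le> 2 * pi - 2 * d" using that by (auto simp: sector_def d_def mult_ac)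
    thus ?thesis using \<open>2 * d \<le> x - y\<close> d by (intro sin_ge_on_middle) auto
  qed
  have "d / 2 \<le> \<bar>sin ((a - b) / 2)\<bar>"
  proof (cases "i \<ge> j")
    case True
    hence "i \<ge> Suc (Suc j)" "i - j \<le> L - 2" using n ij L by (auto simp: adjacent_sectors_def)
    from far[OF ij(3,4) this] show ?thesis by linarith
  next
    case False
    hence "j \<ge> Suc (Suc i)" "j - i \<le> L - 2" using n ij L by (auto simp: adjacent_sectors_def)
    from far[OF ij(4,3) this] have "d / 2 \<le> sin ((b - a) / 2)" .
    also have "(b - a) / 2 = - ((a - b) / 2)" by (simp add: field_simps)
    finally show ?thesis unfolding sin_minus by linarith
  qed
  hence "d \<le> cmod (cis a - cis b)" by (simp add: norm_cis_diff)
  hence "R * R * d\<^sup>2 \<le> r * s * (cmod (cis a - cis b))\<^sup>2"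
    using R R0 d by (intro mult_mono power_mono) auto
  also have "\<dots> \<le> (cmod (of_real r * cis a - of_real s * cis b))\<^sup>2" unfolding polar_dist_sq by simp
  also have "\<dots> < 1\<^sup>2" using dist by (intro power_strict_mono) auto
  finally have "(R * d)\<^sup>2 < 1\<^sup>2" by (simp add: power2_eq_square mult_ac)
  hence "R * d < 1" by (rule power_less_imp_less_base) simp
  moreover have "real L * d = pi" using L by (simp add: d_def)
  moreover have "real L * d \<le> 3 * R * d" using L d by (intro mult_right_mono) auto
  ultimately show False using pi_gt3 by linarith
qed

lemma same_sector_close:
  assumes "L > 0" "i < L" "a \<in> sector L i" "b \<in> sector L i" "0 \<le> r" "0 \<le> s"
  shows "cmod (of_real r * cis a - of_real s * cis b) \<le> \<bar>r - s\<bar> + s * (2 * pi / real L)"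
proof -
  have "of_real r * cis a - of_real s * cis b = of_real (r - s) * cis a + of_real s * (cis a - cis b)"
    by (simp add: algebra_simps)
  also have "cmod \<dots> \<le> \<bar>r - s\<bar> + s * cmod (cis a - cis b)"
    using assms norm_triangle_ineq[of "of_real (r - s) * cis a" "of_real s * (cis a - cis b)"]
    by (simp add: norm_mult del: of_real_diff)
  also have "cmod (cis a - cis b) \<le> \<bar>a - b\<bar>" by (rule norm_cis_diff_le)
  also have "\<bar>a - b\<bar> \<le> 2 * pi / real L"
  proof -
    have "2 * pi * real (Suc i) / real L = 2 * pi * real i / real L + 2 * pi / real L"
      by (simp add: algebra_simps add_divide_distrib)
    thus ?thesis using assms by (auto simp: sector_def)
  qed
  finally show ?thesis using assms by (simp add: mult_left_mono)
qed

text \<open>Sums are written as integrals over counting measure, so that exchanging them with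
  expectations, or regrouping them over pairs, is an instance of Fubini's theorem for any countable
  index type.\<close>

abbreviation nsum :: "('i \<Rightarrow> ennreal) \<Rightarrow> ennreal" where
  "nsum f \<equiv> (\<integral>\<^sup>+i. f i \<partial>count_space UNIV)"

lemma nsum_mult: "nsum f * nsum g = nsum (\<lambda>p. f (fst p) * g (snd p))"
  by (simp add: nn_integral_fst_count_space[symmetric] nn_integral_cmult nn_integral_multc)

lemma borel_measurable_nsum [measurable]:
  fixes f :: "'i :: countable \<Rightarrow> 'a \<Rightarrow> ennreal"
  assumes "\<And>i. f i \<in> borel_measurable N"
  shows "(\<lambda>x. nsum (\<lambda>i. f i x)) \<in> borel_measurable N"
proof -
  interpret sigma_finite_measure "count_space (UNIV :: 'i set)"
    by (intro sigma_finite_measure_count_space_countable) simp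
  have "(\<lambda>p. f (snd p) (fst p)) \<in> borel_measurable (N \<Otimes>\<^sub>M count_space UNIV)"
    by (rule measurable_compose_countable'[where f="\<lambda>i p. f i (fst p)" and g=snd and I=UNIV])
      (auto intro: measurable_compose[OF measurable_fst assms])
  thus ?thesis by (intro borel_measurable_nn_integral) (simp add: split_beta')
qed

locale hybrid_dpp = radial_dpp \<mu> M \<Lambda>
  for \<mu> :: "complex measure" and M :: "'w measure" and \<Lambda> +
  fixes \<theta> :: "nat \<Rightarrow> 'w \<Rightarrow> real"
  assumes angles_indep: "indep_vars (\<lambda>_. borel) \<theta> UNIV"
    and angles_uniform: "distr M borel (\<theta> k) = uniform_measure lborel {0..<2 * pi}"
    and points_angles_indep: "indep_set
           (sets (vimage_algebra (space M) (\<lambda>\<omega> k. \<Lambda> k \<omega>) (PiM UNIV (\<lambda>_. borel))))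
           (sets (vimage_algebra (space M) (\<lambda>\<omega> k. \<theta> k \<omega>) (PiM UNIV (\<lambda>_. borel))))"
begin

lemma angles_measurable [measurable]: "\<theta> k \<in> borel_measurable M"
  using angles_indep by (auto simp: indep_vars_def)

lemma indep_product:
  assumes [measurable]: "f \<in> borel_measurable (PiM UNIV (\<lambda>_. borel))" "g \<in> borel_measurable (PiM UNIV (\<lambda>_. borel))"
  shows "(\<integral>\<^sup>+\<omega>. f (\<lambda>k. \<Lambda> k \<omega>) * g (\<lambda>k. \<theta> k \<omega>) \<partial>M) =
    (\<integral>\<^sup>+\<omega>. f (\<lambda>k. \<Lambda> k \<omega>) \<partial>M) * (\<integral>\<^sup>+\<omega>. g (\<lambda>k. \<theta> k \<omega>) \<partial>M)"
proof -
  let ?P = "PiM UNIV (\<lambda>_ :: nat. borel :: complex measure)" and ?T = "PiM UNIV (\<lambda>_ :: nat. borel :: real measure)"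
  \<comment> \<open>The angles are read as complex numbers because \<open>indep_var\<close> relates
    two variables of the same type. \<open>sub\<close> shows that the embedding adds no events to
    their sigma-algebra.\<close>
  let ?X = "\<lambda>\<omega> k. \<Lambda> k \<omega>" and ?Y = "\<lambda>\<omega> k. complex_of_real (\<theta> k \<omega>)"
  have [measurable]: "?X \<in> M \<rightarrow>\<^sub>M ?P" "?Y \<in> M \<rightarrow>\<^sub>M ?P"
    by (auto intro!: measurable_PiM_single')
  have emb: "(\<lambda>t k. complex_of_real (t k)) \<in> ?T \<rightarrow>\<^sub>M ?P"
    by (auto intro!: measurable_PiM_single')
  have [measurable]: "(\<lambda>y. g (\<lambda>k. Re (y k))) \<in> borel_measurable ?P"
    by (rule measurable_compose[OF _ assms(2)]) (auto intro!: measurable_PiM_single')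
  have sub: "sets (vimage_algebra (space M) ?Y ?P) \<subseteq> sets (vimage_algebra (space M) (\<lambda>\<omega> k. \<theta> k \<omega>) ?T)"
  proof
    fix B assume "B \<in> sets (vimage_algebra (space M) ?Y ?P)"
    then obtain A where A: "A \<in> sets ?P" "B = ?Y -` A \<inter> space M"
      by (subst (asm) sets_vimage_algebra2) (auto simp: space_PiM)
    have "(\<lambda>t k. complex_of_real (t k)) -` A \<inter> space ?T \<in> sets ?T"
      using emb A(1) by (rule measurable_sets)
    from in_vimage_algebra[OF this, of "\<lambda>\<omega> k. \<theta> k \<omega>" "space M"]
    show "B \<in> sets (vimage_algebra (space M) (\<lambda>\<omega> k. \<theta> k \<omega>) ?T)"
      using A(2) by (simp add: space_PiM vimage_def)
  qed
  have "indep_set (sets (vimage_algebra (space M) ?X ?P)) (sets (vimage_algebra (space M) ?Y ?P))"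
    unfolding indep_set_def
    by (rule indep_sets_mono_sets[OF points_angles_indep[unfolded indep_set_def]])
       (use sub in \<open>auto split: bool.split\<close>)
  hence "indep_var ?P ?X ?P ?Y"
    by (simp add: indep_var_eq sets_vimage_algebra)
  hence eq: "distr M ?P ?X \<Otimes>\<^sub>M distr M ?P ?Y = distr M (?P \<Otimes>\<^sub>M ?P) (\<lambda>\<omega>. (?X \<omega>, ?Y \<omega>))"
    by (simp add: indep_var_distribution_eq)
  interpret Y: prob_space "distr M ?P ?Y" by (rule prob_space_distr) simp
  let ?g = "\<lambda>y. g (\<lambda>k. Re (y k))"
  have "(\<integral>\<^sup>+\<omega>. f (?X \<omega>) * ?g (?Y \<omega>) \<partial>M) =
    (\<integral>\<^sup>+p. f (fst p) * ?g (snd p) \<partial>distr M (?P \<Otimes>\<^sub>M ?P) (\<lambda>\<omega>. (?X \<omega>, ?Y \<omega>)))"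
    by (subst nn_integral_distr) auto
  also have "\<dots> = (\<integral>\<^sup>+x. \<integral>\<^sup>+y. f x * ?g y \<partial>distr M ?P ?Y \<partial>distr M ?P ?X)"
    unfolding eq[symmetric] by (subst Y.nn_integral_fst[symmetric]) auto
  also have "\<dots> = (\<integral>\<^sup>+x. f x \<partial>distr M ?P ?X) * (\<integral>\<^sup>+y. ?g y \<partial>distr M ?P ?Y)"
    by (simp add: nn_integral_cmult nn_integral_multc)
  finally show ?thesis by (simp add: nn_integral_distr)
qed

text \<open>The index \<open>i\<close> names a pair or quadruple of labels. For fixed labels one
  factor depends on the points and the other on the angles only, so no conditioning on the random
  configuration is needed.\<close>

lemma mixing:
  fixes f :: "'i :: countable \<Rightarrow> (nat \<Rightarrow> complex) \<Rightarrow> ennreal"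
  assumes [measurable]: "\<And>i. f i \<in> borel_measurable (PiM UNIV (\<lambda>_. borel))" "\<And>i. g i \<in> borel_measurable (PiM UNIV (\<lambda>_. borel))"
  shows "(\<integral>\<^sup>+\<omega>. nsum (\<lambda>i. f i (\<lambda>k. \<Lambda> k \<omega>) * g i (\<lambda>k. \<theta> k \<omega>)) \<partial>M) =
    nsum (\<lambda>i. (\<integral>\<^sup>+\<omega>. f i (\<lambda>k. \<Lambda> k \<omega>) \<partial>M) * (\<integral>\<^sup>+\<omega>. g i (\<lambda>k. \<theta> k \<omega>) \<partial>M))"
proof -
  have [measurable]: "(\<lambda>\<omega> k. \<Lambda> k \<omega>) \<in> M \<rightarrow>\<^sub>M PiM UNIV (\<lambda>_. borel)" "(\<lambda>\<omega> k. \<theta> k \<omega>) \<in> M \<rightarrow>\<^sub>M PiM UNIV (\<lambda>_. borel)"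
    by (auto intro!: measurable_PiM_single')
  show ?thesis
    by (subst nn_integral_count_space_nn_integral) (auto simp: indep_product)
qed

lemma nsum_points:
  fixes f :: "'i :: countable \<Rightarrow> (nat \<Rightarrow> complex) \<Rightarrow> ennreal"
  assumes [measurable]: "\<And>i. f i \<in> borel_measurable (PiM UNIV (\<lambda>_. borel))"
  shows "(\<integral>\<^sup>+\<omega>. nsum (\<lambda>i. f i (\<lambda>k. \<Lambda> k \<omega>)) \<partial>M) = nsum (\<lambda>i. \<integral>\<^sup>+\<omega>. f i (\<lambda>k. \<Lambda> k \<omega>) \<partial>M)"
  using mixing[of f "\<lambda>_ _. 1"] by (simp add: emeasure_space_1)

lemma angle_prob:
  assumes "i < L"
  shows "(\<integral>\<^sup>+\<omega>. indicator (sector L i) (\<theta> k \<omega>) \<partial>M) = ennreal (1 / real L)"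
proof -
  have L: "L > 0" using assms by simp
  have "2 * pi * real (Suc i) / real L \<le> 2 * pi * real L / real L"
    using assms by (intro divide_right_mono mult_left_mono) auto
  hence sub: "sector L i \<subseteq> {0..<2 * pi}" using L by (auto simp: sector_def intro: order_trans[rotated])
  have "(\<integral>\<^sup>+\<omega>. indicator (sector L i) (\<theta> k \<omega>) \<partial>M) = (\<integral>\<^sup>+t. indicator (sector L i) t \<partial>distr M borel (\<theta> k))"
    by (subst nn_integral_distr) auto
  also have "\<dots> = emeasure (uniform_measure lborel {0..<2 * pi}) (sector L i)"
    by (subst angles_uniform) simp
  also have "\<dots> = emeasure lborel (sector L i) / ennreal (2 * pi)"
    using sub by (subst emeasure_uniform_measure) (auto simp: Int_absorb1)
  also have "emeasure lborel (sector L i) = ennreal (2 * pi / real L)"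
    unfolding sector_def using L
    by (subst emeasure_lborel_Ico) (auto simp: diff_divide_distrib[symmetric] algebra_simps intro!: divide_right_mono)
  also have "ennreal (2 * pi / real L) / ennreal (2 * pi) = ennreal (1 / real L)"
    by (subst divide_ennreal) auto
  finally show ?thesis .
qed

text \<open>The event that the two angles fall into a listed pair of sectors, written as a sum of
  products so that its expectation splits over independent angles.\<close>

definition sector_pairs :: "nat \<Rightarrow> (nat \<times> nat) set \<Rightarrow> nat \<Rightarrow> nat \<Rightarrow> (nat \<Rightarrow> real) \<Rightarrow> ennreal" where
  "sector_pairs L Q j k t = (\<Sum>p\<in>Q. indicator (sector L (fst p)) (t j) * indicator (sector L (snd p)) (t k))"

lemma sector_pairs_measurable [measurable]:
  "sector_pairs L Q j k \<in> borel_measurable (PiM UNIV (\<lambda>_. borel))"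
  unfolding sector_pairs_def[abs_def] by measurable

lemma angles_product:
  assumes "finite J" "\<And>j. j \<in> J \<Longrightarrow> s j < L j"
  shows "(\<integral>\<^sup>+\<omega>. (\<Prod>j\<in>J. indicator (sector (L j) (s j)) (\<theta> j \<omega>)) \<partial>M) = (\<Prod>j\<in>J. ennreal (1 / real (L j)))"
proof -
  have "indep_vars (\<lambda>_. borel) (\<lambda>j \<omega>. indicator (sector (L j) (s j)) (\<theta> j \<omega>) :: ennreal) J"
    by (rule indep_vars_compose2[where Y="\<lambda>j x. indicator (sector (L j) (s j)) x"])
       (auto intro: indep_vars_subset[OF angles_indep])
  hence "(\<integral>\<^sup>+\<omega>. (\<Prod>j\<in>J. indicator (sector (L j) (s j)) (\<theta> j \<omega>)) \<partial>M) =
     (\<Prod>j\<in>J. \<integral>\<^sup>+\<omega>. indicator (sector (L j) (s j)) (\<theta> j \<omega>) \<partial>M)"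
    using assms by (intro indep_vars_nn_integral) auto
  also have "\<dots> = (\<Prod>j\<in>J. ennreal (1 / real (L j)))"
    using assms by (intro prod.cong refl angle_prob) auto
  finally show ?thesis .
qed

lemma sector_pairs_expectation:
  assumes "j \<noteq> k" "finite Q" "Q \<subseteq> {..<L} \<times> {..<L}"
  shows "(\<integral>\<^sup>+\<omega>. sector_pairs L Q j k (\<lambda>k. \<theta> k \<omega>) \<partial>M) = ennreal (real (card Q) / (real L)\<^sup>2)"
proof -
  have "(\<integral>\<^sup>+\<omega>. sector_pairs L Q j k (\<lambda>k. \<theta> k \<omega>) \<partial>M) =
     (\<Sum>p\<in>Q. \<integral>\<^sup>+\<omega>. indicator (sector L (fst p)) (\<theta> j \<omega>) * indicator (sector L (snd p)) (\<theta> k \<omega>) \<partial>M)"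
    unfolding sector_pairs_def by (subst nn_integral_sum) auto
  also have "\<dots> = (\<Sum>p\<in>Q. ennreal (1 / (real L)\<^sup>2))"
  proof (rule sum.cong[OF refl])
    fix p assume "p \<in> Q"
    hence "fst p < L" "snd p < L" using assms by auto
    thus "(\<integral>\<^sup>+\<omega>. indicator (sector L (fst p)) (\<theta> j \<omega>) * indicator (sector L (snd p)) (\<theta> k \<omega>) \<partial>M) = ennreal (1 / (real L)\<^sup>2)"
      using angles_product[of "{j, k}" "\<lambda>i. if i = j then fst p else snd p" "\<lambda>_. L"] assms(1)
      by (simp add: ennreal_mult'[symmetric] power2_eq_square)
  qed
  also have "\<dots> = ennreal (real (card Q) / (real L)\<^sup>2)"
    by (simp add: ennreal_of_nat_eq_real_of_nat ennreal_mult'[symmetric])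
  finally show ?thesis .
qed

lemma sector_pairs_product_expectation:
  assumes "distinct [j, k, j', k']" "finite Q" "Q \<subseteq> {..<L} \<times> {..<L}" "finite Q'" "Q' \<subseteq> {..<L'} \<times> {..<L'}"
  shows "(\<integral>\<^sup>+\<omega>. sector_pairs L Q j k (\<lambda>k. \<theta> k \<omega>) * sector_pairs L' Q' j' k' (\<lambda>k. \<theta> k \<omega>) \<partial>M) =
    ennreal (real (card Q) / (real L)\<^sup>2) * ennreal (real (card Q') / (real L')\<^sup>2)"
proof -
  let ?i = "\<lambda>L s j \<omega>. indicator (sector L s) (\<theta> j \<omega>) :: ennreal"
  have "(\<integral>\<^sup>+\<omega>. sector_pairs L Q j k (\<lambda>k. \<theta> k \<omega>) * sector_pairs L' Q' j' k' (\<lambda>k. \<theta> k \<omega>) \<partial>M) =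
     (\<Sum>p\<in>Q. \<Sum>q\<in>Q'. \<integral>\<^sup>+\<omega>. (?i L (fst p) j \<omega> * ?i L (snd p) k \<omega>) * (?i L' (fst q) j' \<omega> * ?i L' (snd q) k' \<omega>) \<partial>M)"
    unfolding sector_pairs_def sum_product by (simp add: nn_integral_sum)
  also have "\<dots> = (\<Sum>p\<in>Q. \<Sum>q\<in>Q'. ennreal (1 / (real L)\<^sup>2) * ennreal (1 / (real L')\<^sup>2))"
  proof (intro sum.cong refl)
    fix p q assume "p \<in> Q" "q \<in> Q'"
    hence "fst p < L" "snd p < L" "fst q < L'" "snd q < L'" using assms by auto
    thus "(\<integral>\<^sup>+\<omega>. (?i L (fst p) j \<omega> * ?i L (snd p) k \<omega>) * (?i L' (fst q) j' \<omega> * ?i L' (snd q) k' \<omega>) \<partial>M)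
      = ennreal (1 / (real L)\<^sup>2) * ennreal (1 / (real L')\<^sup>2)"
      using angles_product[of "{j, k, j', k'}"
        "\<lambda>i. if i = j then fst p else if i = k then snd p else if i = j' then fst q else snd q"
        "\<lambda>i. if i = j \<or> i = k then L else L'"] assms(1)
      by (simp add: ennreal_mult'[symmetric] power2_eq_square mult_ac)
  qed
  also have "\<dots> = ennreal (real (card Q) / (real L)\<^sup>2) * ennreal (real (card Q') / (real L')\<^sup>2)"
    by (simp add: ennreal_of_nat_eq_real_of_nat ennreal_mult'[symmetric] mult_ac)
  finally show ?thesis .
qed

definition diag_sectors :: "nat \<Rightarrow> (nat \<times> nat) set" where
  "diag_sectors L = (\<lambda>i. (i, i)) ` {..<L}"

lemma diag_sectors: "finite (diag_sectors L)" "diag_sectors L \<subseteq> {..<L} \<times> {..<L}" "card (diag_sectors L) = L"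
  by (auto simp: diag_sectors_def card_image inj_on_def)

end

section \<open>Intensity of the moduli for the Fock measure\<close>

lemma fock_measure_rotation:
  assumes \<alpha>: "\<alpha> > 0" and c: "cmod c = 1"
  shows "distr (fock_measure \<alpha>) borel ((*) c) = fock_measure \<alpha>"
proof (rule measure_eqI)
  fix A assume "A \<in> sets (distr (fock_measure \<alpha>) borel ((*) c))"
  hence A[measurable]: "A \<in> sets borel" by simp
  have [measurable]: "radius_fun \<alpha> \<in> borel_measurable borel" using \<alpha> by measurable
  let ?w = "\<lambda>z. ennreal (exp (- 2 * cmod z powr \<alpha>) / (radius_fun \<alpha> z)\<^sup>2)"
  have "emeasure (distr (fock_measure \<alpha>) borel ((*) c)) A = (\<integral>\<^sup>+z. indicator A (c * z) \<partial>fock_measure \<alpha>)"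
    by (subst nn_integral_indicator[symmetric], simp, subst nn_integral_distr) auto
  also have "\<dots> = (\<integral>\<^sup>+z. ?w (c * z) * indicator A (c * z) \<partial>lborel)"
    using \<alpha> c by (subst nn_integral_fock_measure) (auto simp: norm_mult radius_fun_rotate)
  also have "\<dots> = (\<integral>\<^sup>+z. ?w z * indicator A z \<partial>lborel)"
    by (rule nn_integral_rotate[OF _ c]) measurable
  also have "\<dots> = (\<integral>\<^sup>+z. indicator A z \<partial>fock_measure \<alpha>)"
    using \<alpha> by (subst nn_integral_fock_measure) auto
  finally show "emeasure (distr (fock_measure \<alpha>) borel ((*) c)) A = emeasure (fock_measure \<alpha>) A" by simp
qed simp

lemma fock_measure_circle:
  assumes \<alpha>: "\<alpha> > 0" shows "emeasure (fock_measure \<alpha>) {z. cmod z = r} = 0"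
proof -
  have eq: "{z :: complex. cmod z = r} = sphere 0 r" by (auto simp: sphere_def)
  have "sphere (0 :: complex) r \<in> null_sets lborel" using emeasure_lborel_sphere[of 0 r] by (auto simp: null_sets_def)
  hence "AE z in lborel. z \<notin> sphere (0 :: complex) r" by (rule AE_not_in)
  hence "AE z in lborel. ennreal (exp (- 2 * cmod z powr \<alpha>) / (radius_fun \<alpha> z)\<^sup>2) * indicator (sphere 0 r) z = 0"
    by eventually_elim simp
  hence "(\<integral>\<^sup>+z. ennreal (exp (- 2 * cmod z powr \<alpha>) / (radius_fun \<alpha> z)\<^sup>2) * indicator (sphere 0 r) z \<partial>lborel)
      = (\<integral>\<^sup>+z. 0 \<partial>(lborel :: complex measure))"
    by (rule nn_integral_cong_AE)
  moreover have "emeasure (fock_measure \<alpha>) (sphere 0 r) = (\<integral>\<^sup>+z. indicator (sphere 0 r) z \<partial>fock_measure \<alpha>)"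
    by (rule nn_integral_indicator[symmetric]) (simp add: borel_closed)
  moreover have "(\<integral>\<^sup>+z. indicator (sphere 0 r) z \<partial>fock_measure \<alpha>) =
      (\<integral>\<^sup>+z. ennreal (exp (- 2 * cmod z powr \<alpha>) / (radius_fun \<alpha> z)\<^sup>2) * indicator (sphere 0 r) z \<partial>lborel)"
    by (rule nn_integral_fock_measure[OF \<alpha>]) (intro borel_measurable_indicator borel_closed closed_sphere)
  ultimately show ?thesis unfolding eq by (simp only:) simp
qed

text \<open>The integral of u^s exp (- 2 u) over the half line, that is, the radial moment in the
  model case where \<open>radial_density\<close> is 1.\<close>

definition gam :: "real \<Rightarrow> real" where
  "gam s = Gamma (s + 1) / 2 powr (s + 1)"

lemma gam_pos: "s \<ge> 0 \<Longrightarrow> gam s > 0"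
  by (simp add: gam_def)

lemma gam_integral:
  assumes s: "s \<ge> 0"
  shows "(\<integral>\<^sup>+u. ennreal (u powr s * exp (- 2 * u)) * indicator {0..} u \<partial>lborel) = ennreal (gam s)"
proof -
  have powr2: "ennreal (2 powr (s + 1)) = ennreal 2 * ennreal (2 powr s)"
    by (subst ennreal_mult[symmetric]) (auto simp: powr_add)
  have "ennreal (Gamma (s + 1)) = (\<integral>\<^sup>+t. ennreal (indicator {0..} t * t powr s / exp t) \<partial>lborel)"
    using Gamma_conv_nn_integral_real[of "s + 1"] s by simp
  also have "\<dots> = ennreal 2 * (\<integral>\<^sup>+u. ennreal (indicator {0..} (0 + 2 * u) * (0 + 2 * u) powr s / exp (0 + 2 * u)) \<partial>lborel)"
    by (subst nn_integral_real_affine[where c=2 and t=0]) auto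
  also have "(\<integral>\<^sup>+u. ennreal (indicator {0..} (0 + 2 * u) * (0 + 2 * u) powr s / exp (0 + 2 * u)) \<partial>lborel)
     = (\<integral>\<^sup>+u. ennreal (2 powr s) * (ennreal (u powr s * exp (- 2 * u)) * indicator {0..} u) \<partial>lborel)"
    by (intro nn_integral_cong)
       (auto simp: indicator_def ennreal_mult'[symmetric] powr_mult exp_minus field_simps)
  also have "\<dots> = ennreal (2 powr s) * (\<integral>\<^sup>+u. ennreal (u powr s * exp (- 2 * u)) * indicator {0..} u \<partial>lborel)"
    by (rule nn_integral_cmult) measurable
  finally have *: "ennreal (Gamma (s + 1)) = ennreal (2 powr (s + 1)) * (\<integral>\<^sup>+u. ennreal (u powr s * exp (- 2 * u)) * indicator {0..} u \<partial>lborel)"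
    using powr2 by (simp only: mult.assoc)
  have "ennreal (gam s) = ennreal (1 / 2 powr (s + 1)) * ennreal (Gamma (s + 1))"
    using s by (simp add: gam_def ennreal_mult'[symmetric])
  also have "\<dots> = (ennreal (1 / 2 powr (s + 1)) * ennreal (2 powr (s + 1))) *
      (\<integral>\<^sup>+u. ennreal (u powr s * exp (- 2 * u)) * indicator {0..} u \<partial>lborel)"
    by (simp only: * mult.assoc)
  also have "ennreal (1 / 2 powr (s + 1)) * ennreal (2 powr (s + 1)) = 1"
    by (subst ennreal_mult'[symmetric]) auto
  finally show ?thesis by simp
qed

text \<open>Only the interval [v, v + 1] of the integral for \<open>gam s\<close> is kept. The
  constant is independent of \<open>s\<close>, so a contribution of order v^s from the region near
  the origin can be absorbed.\<close>

lemma power_le_gam: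
  assumes "s \<ge> 0" "v > 0"
  shows "v powr s \<le> exp (2 * v + 2) * gam s"
proof -
  have "ennreal (v powr s * exp (- 2 * v - 2)) = (\<integral>\<^sup>+u. ennreal (v powr s * exp (- 2 * v - 2)) * indicator {v..v + 1} u \<partial>lborel)"
    by (subst nn_integral_cmult_indicator) auto
  also have "\<dots> \<le> (\<integral>\<^sup>+u. ennreal (u powr s * exp (- 2 * u)) * indicator {0..} u \<partial>lborel)"
    using assms by (intro nn_integral_mono) (auto simp: indicator_def intro!: ennreal_leI mult_mono powr_mono2)
  also have "\<dots> = ennreal (gam s)" by (rule gam_integral[OF assms(1)])
  finally have "v powr s * exp (- 2 * v - 2) \<le> gam s"
    using gam_pos[OF assms(1)] by (subst (asm) ennreal_le_iff) auto
  hence "v powr s * exp (- 2 * v - 2) * exp (2 * v + 2) \<le> gam s * exp (2 * v + 2)"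
    by (intro mult_right_mono) auto
  moreover have "v powr s * exp (- 2 * v - 2) * exp (2 * v + 2) = v powr s"
    by (simp add: mult.assoc flip: exp_add)
  ultimately have "v powr s \<le> gam s * exp (2 * v + 2)" by (simp only:)
  thus ?thesis by (simp only: mult.commute)
qed

lemma ml_term_gam:
  assumes "u > 0" "s \<ge> 0"
  shows "u powr s * exp (- 2 * u) / gam s = 2 * exp (- (2 * u)) * ml_term (2 * u) s"
  using assms by (simp add: gam_def ml_term_def powr_mult powr_add)

definition radial_moment :: "real \<Rightarrow> real set \<Rightarrow> real \<Rightarrow> ennreal" where
  "radial_moment \<alpha> U s = (\<integral>\<^sup>+u. ennreal (radial_density \<alpha> u * exp (- 2 * u)) * (ennreal (u powr s) * indicator U u) \<partial>lborel)"

text \<open>Beyond \<open>v\<close> the density is comparable to a constant, and the part below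
  \<open>v\<close> is negligible uniformly in \<open>s\<close>: there u^s <= v^s, which is at most a
  constant times \<open>gam s\<close>. Weakening the constants lets the same pair bound both the
  density and the moments.\<close>

lemma radial_moment_bounds:
  assumes \<alpha>: "\<alpha> > 0"
  obtains c C v where "c > 0" "C > 0" "v > 0"
    "\<And>u. u \<ge> v \<Longrightarrow> c \<le> radial_density \<alpha> u" "\<And>u. u \<ge> v \<Longrightarrow> radial_density \<alpha> u \<le> C"
    "\<And>s. s \<ge> 0 \<Longrightarrow> ennreal (c * gam s) \<le> radial_moment \<alpha> UNIV s"
    "\<And>s. s \<ge> 0 \<Longrightarrow> radial_moment \<alpha> UNIV s \<le> ennreal (C * gam s)"
proof -
  have [measurable]: "radial_density \<alpha> \<in> borel_measurable borel" using \<alpha> by measurable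
  obtain c C v where v: "c > 0" "C > 0" "v > 0"
    "\<And>u. u \<ge> v \<Longrightarrow> c \<le> radial_density \<alpha> u" "\<And>u. u \<ge> v \<Longrightarrow> radial_density \<alpha> u \<le> C"
    "(\<integral>\<^sup>+u. ennreal (radial_density \<alpha> u) * indicator {..<v} u \<partial>lborel) < \<infinity>"
    using radial_density_bounds[OF \<alpha>] by metis
  obtain D where D: "D \<ge> 0" "(\<integral>\<^sup>+u. ennreal (radial_density \<alpha> u) * indicator {..<v} u \<partial>lborel) = ennreal D"
    using v(6) by (cases "\<integral>\<^sup>+u. ennreal (radial_density \<alpha> u) * indicator {..<v} u \<partial>lborel") auto
  \<comment> \<open>The integral defining \<open>gam s\<close> over [0, v] is at most v exp (2 v +
    2) times the one over [v, \<infinity>), so the latter is at least the fraction 1 / k of the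
    whole.\<close>
  define k where "k = 1 + v * exp (2 * v + 2)"
  have k: "k > 1" using v by (simp add: k_def)
  define c' where "c' = c / k"
  define C' where "C' = D * exp (2 * v + 2) + C"
  have "D * exp (2 * v + 2) \<ge> 0" using D by simp
  hence c': "c' > 0" "c' \<le> c" "C' > 0" "C \<le> C'"
    using v k by (auto simp: c'_def C'_def divide_le_eq mult_le_cancel_left1)
  show thesis
  proof (rule that[of c' C' v])
    fix s :: real assume s: "s \<ge> 0"
    have dens: "radial_density \<alpha> u \<ge> 0" for u by (rule radial_density_nonneg[OF \<alpha>])
    have up: "radial_moment \<alpha> UNIV s \<le> (\<integral>\<^sup>+u. ennreal (v powr s) * (ennreal (radial_density \<alpha> u) * indicator {..<v} u) +
       ennreal C * (ennreal (u powr s * exp (- 2 * u)) * indicator {0..} u) \<partial>lborel)"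
      unfolding radial_moment_def
    proof (rule nn_integral_mono)
      fix u :: real
      show "ennreal (radial_density \<alpha> u * exp (- 2 * u)) * (ennreal (u powr s) * indicator UNIV u) \<le>
        ennreal (v powr s) * (ennreal (radial_density \<alpha> u) * indicator {..<v} u) +
        ennreal C * (ennreal (u powr s * exp (- 2 * u)) * indicator {0..} u)"
      proof (cases "u \<le> 0")
        case False
        hence u: "u > 0" by simp
        show ?thesis
        proof (cases "u < v")
          case True
          have "radial_density \<alpha> u * exp (- 2 * u) * u powr s \<le> radial_density \<alpha> u * 1 * v powr s"
            using True u s dens by (intro mult_mono powr_mono2) auto
          hence "ennreal (radial_density \<alpha> u * exp (- 2 * u)) * ennreal (u powr s) \<le> ennreal (v powr s) * ennreal (radial_density \<alpha> u)"
            using dens by (simp add: ennreal_mult'[symmetric] mult.commute ennreal_leI)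
          thus ?thesis using True by (simp add: add_increasing2)
        next
          case False
          have "radial_density \<alpha> u * exp (- 2 * u) * u powr s \<le> C * exp (- 2 * u) * u powr s"
            using False v by (intro mult_right_mono) auto
          hence "ennreal (radial_density \<alpha> u * exp (- 2 * u)) * ennreal (u powr s) \<le> ennreal C * ennreal (u powr s * exp (- 2 * u))"
            using dens v by (simp add: ennreal_mult'[symmetric] mult_ac ennreal_leI)
          thus ?thesis using False u by simp
        qed
      qed (simp add: radial_density_def)
    qed
    also have "\<dots> = ennreal (v powr s) * ennreal D + ennreal C * ennreal (gam s)"
    proof (subst nn_integral_add)
      show "(\<integral>\<^sup>+u. ennreal (v powr s) * (ennreal (radial_density \<alpha> u) * indicator {..<v} u) \<partial>lborel) +
        (\<integral>\<^sup>+u. ennreal C * (ennreal (u powr s * exp (- 2 * u)) * indicator {0..} u) \<partial>lborel) =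
        ennreal (v powr s) * ennreal D + ennreal C * ennreal (gam s)"
        unfolding D(2)[symmetric] gam_integral[OF s, symmetric]
        by (intro arg_cong2[where f="(+)"] nn_integral_cmult) measurable
    qed measurable
    also have "\<dots> = ennreal (v powr s * D + C * gam s)"
      using D v gam_pos[OF s] by (simp add: ennreal_mult'[symmetric] ennreal_plus[symmetric] del: ennreal_plus)
    also have "\<dots> \<le> ennreal (C' * gam s)"
      using mult_right_mono[OF power_le_gam[OF s v(3)] D(1)] by (intro ennreal_leI) (simp add: C'_def algebra_simps)
    finally show "radial_moment \<alpha> UNIV s \<le> ennreal (C' * gam s)" .

    let ?tail = "\<integral>\<^sup>+u. ennreal (u powr s * exp (- 2 * u)) * indicator {v..} u \<partial>lborel"
    have tail: "ennreal (v powr s * exp (- 2 * v - 2)) \<le> ?tail"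
    proof -
      have "ennreal (v powr s * exp (- 2 * v - 2)) = (\<integral>\<^sup>+u. ennreal (v powr s * exp (- 2 * v - 2)) * indicator {v..v + 1} u \<partial>lborel)"
        by (subst nn_integral_cmult_indicator) auto
      also have "\<dots> \<le> ?tail"
        using v s by (intro nn_integral_mono) (auto simp: indicator_def intro!: ennreal_leI mult_mono powr_mono2)
      finally show ?thesis .
    qed
    have "ennreal (gam s) = (\<integral>\<^sup>+u. ennreal (u powr s * exp (- 2 * u)) * indicator {0..} u \<partial>lborel)"
      by (rule gam_integral[OF s, symmetric])
    also have "\<dots> \<le> (\<integral>\<^sup>+u. ennreal (v powr s) * indicator {0..v} u + ennreal (u powr s * exp (- 2 * u)) * indicator {v..} u \<partial>lborel)"
    proof (rule nn_integral_mono)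
      fix u :: real
      have "u powr s * exp (- 2 * u) \<le> v powr s * 1" if "0 \<le> u" "u \<le> v"
        using that s by (intro mult_mono powr_mono2) auto
      thus "ennreal (u powr s * exp (- 2 * u)) * indicator {0..} u \<le> ennreal (v powr s) * indicator {0..v} u +
          ennreal (u powr s * exp (- 2 * u)) * indicator {v..} u"
        using v by (auto simp: indicator_def intro!: add_increasing2 ennreal_leI)
    qed
    also have "\<dots> = ennreal (v powr s * v) + ?tail"
      using v by (subst nn_integral_add) (auto simp: nn_integral_cmult_indicator ennreal_mult)
    also have "ennreal (v powr s * v) = ennreal (v * exp (2 * v + 2)) * ennreal (v powr s * exp (- 2 * v - 2))"
    proof -
      have "exp (2 * v + 2) * exp (- 2 * v - 2) = (1 :: real)" by (simp flip: exp_add)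
      hence "v * exp (2 * v + 2) * (v powr s * exp (- 2 * v - 2)) = v powr s * v"
        by (simp add: mult_ac)
      thus ?thesis using v by (simp add: ennreal_mult'[symmetric])
    qed
    also have "ennreal (v * exp (2 * v + 2)) * ennreal (v powr s * exp (- 2 * v - 2)) + ?tail \<le>
        ennreal (v * exp (2 * v + 2)) * ?tail + ?tail"
      by (intro add_mono mult_left_mono tail) auto
    also have "\<dots> = ennreal k * ?tail"
      using v by (simp add: k_def ennreal_plus distrib_right add.commute)
    finally have gk: "ennreal (gam s) \<le> ennreal k * ?tail" .
    have "ennreal (c' * gam s) = ennreal (c / k) * ennreal (gam s)"
      using c' gam_pos[OF s] by (simp add: c'_def ennreal_mult'[symmetric])
    also have "\<dots> \<le> ennreal (c / k) * (ennreal k * ?tail)" using gk by (intro mult_left_mono) auto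
    also have "\<dots> = ennreal c * ?tail"
      using k v by (simp add: mult.assoc[symmetric] ennreal_mult'[symmetric])
    also have "\<dots> = (\<integral>\<^sup>+u. ennreal c * (ennreal (u powr s * exp (- 2 * u)) * indicator {v..} u) \<partial>lborel)"
      by (subst nn_integral_cmult) auto
    also have "\<dots> \<le> radial_moment \<alpha> UNIV s"
      unfolding radial_moment_def
    proof (rule nn_integral_mono)
      fix u :: real
      have "ennreal c * ennreal (u powr s * exp (- 2 * u)) \<le> ennreal (radial_density \<alpha> u * exp (- 2 * u)) * ennreal (u powr s)" if "u \<ge> v"
      proof -
        have "c * (u powr s * exp (- 2 * u)) \<le> radial_density \<alpha> u * (u powr s * exp (- 2 * u))"
          using v(4)[OF that] by (intro mult_right_mono) auto
        thus ?thesis using dens v by (simp add: ennreal_mult'[symmetric] mult_ac ennreal_leI)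
      qed
      thus "ennreal c * (ennreal (u powr s * exp (- 2 * u)) * indicator {v..} u) \<le>
        ennreal (radial_density \<alpha> u * exp (- 2 * u)) * (ennreal (u powr s) * indicator UNIV u)"
        by (auto simp: indicator_def)
    qed
    finally show "ennreal (c' * gam s) \<le> radial_moment \<alpha> UNIV s" .
  next
    fix u assume "u \<ge> v"
    thus "c' \<le> radial_density \<alpha> u" "radial_density \<alpha> u \<le> C'"
      using v(4)[of u] v(5)[of u] c' by auto
  qed (use c' v in auto)
qed

lemma fock_measure_moment:
  assumes \<alpha>: "\<alpha> > 0" and [measurable]: "U \<in> sets borel"
  shows "(\<integral>\<^sup>+z. ennreal (cmod z ^ n) * indicator U (cmod z powr \<alpha>) \<partial>fock_measure \<alpha>) = radial_moment \<alpha> U (real n / \<alpha>)"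
proof -
  have "{z. cmod z = 0} \<in> null_sets (fock_measure \<alpha>)"
    using fock_measure_circle[OF \<alpha>, of 0] by (auto simp: null_sets_def)
  hence "AE z in fock_measure \<alpha>. z \<notin> {z. cmod z = 0}" by (rule AE_not_in)
  hence "AE z in fock_measure \<alpha>. ennreal (cmod z ^ n) * indicator U (cmod z powr \<alpha>) =
      ennreal ((cmod z powr \<alpha>) powr (real n / \<alpha>)) * indicator U (cmod z powr \<alpha>)"
    by eventually_elim (use \<alpha> in \<open>simp add: powr_powr powr_realpow\<close>)
  hence "(\<integral>\<^sup>+z. ennreal (cmod z ^ n) * indicator U (cmod z powr \<alpha>) \<partial>fock_measure \<alpha>) =
    (\<integral>\<^sup>+z. ennreal ((cmod z powr \<alpha>) powr (real n / \<alpha>)) * indicator U (cmod z powr \<alpha>) \<partial>fock_measure \<alpha>)"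
    by (rule nn_integral_cong_AE)
  also have "\<dots> = radial_moment \<alpha> U (real n / \<alpha>)"
    unfolding radial_moment_def by (rule nn_integral_fock_measure_radial[OF \<alpha>]) measurable
  finally show ?thesis .
qed

lemma fock_radial_measure:
  assumes \<alpha>: "\<alpha> > 0" shows "radial_measure (fock_measure \<alpha>)"
proof
  have [measurable]: "radial_density \<alpha> \<in> borel_measurable borel" using \<alpha> by measurable
  obtain c C v where v: "c > 0" "C > 0" "v > 0"
    "\<And>u. u \<ge> v \<Longrightarrow> c \<le> radial_density \<alpha> u" "\<And>u. u \<ge> v \<Longrightarrow> radial_density \<alpha> u \<le> C"
    "\<And>s. s \<ge> 0 \<Longrightarrow> ennreal (c * gam s) \<le> radial_moment \<alpha> UNIV s"
    "\<And>s. s \<ge> 0 \<Longrightarrow> radial_moment \<alpha> UNIV s \<le> ennreal (C * gam s)"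
    using radial_moment_bounds[OF \<alpha>] by metis
  show "sets (fock_measure \<alpha>) = sets borel" by simp
  show "distr (fock_measure \<alpha>) borel ((*) c) = fock_measure \<alpha>" if "cmod c = 1" for c
    by (rule fock_measure_rotation[OF \<alpha> that])
  show "integrable (fock_measure \<alpha>) (\<lambda>z. cmod z ^ n)" for n
  proof (rule integrableI_bounded)
    have "(\<integral>\<^sup>+z. ennreal (norm (cmod z ^ n)) \<partial>fock_measure \<alpha>) = radial_moment \<alpha> UNIV (real n / \<alpha>)"
      using fock_measure_moment[OF \<alpha>, of UNIV n] by (simp add: norm_power)
    also have "\<dots> \<le> ennreal (C * gam (real n / \<alpha>))" using \<alpha> by (intro v) auto
    finally show "(\<integral>\<^sup>+z. ennreal (norm (cmod z ^ n)) \<partial>fock_measure \<alpha>) < \<infinity>"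
      by (rule le_less_trans) simp
  qed simp
  show "emeasure (fock_measure \<alpha>) {z. cmod z > L} > 0" for L
  proof -
    define w where "w = max v (max 0 L powr \<alpha> + 1)"
    have "ennreal (c * exp (- 2 * (w + 1))) = (\<integral>\<^sup>+u. ennreal (c * exp (- 2 * (w + 1))) * indicator {w..w + 1} u \<partial>lborel)"
      by (subst nn_integral_cmult_indicator) auto
    also have "\<dots> \<le> (\<integral>\<^sup>+u. ennreal (radial_density \<alpha> u * exp (- 2 * u)) * indicator {w..} u \<partial>lborel)"
      using v by (intro nn_integral_mono) (auto simp: indicator_def w_def radial_density_nonneg[OF \<alpha>] intro!: ennreal_leI mult_mono)
    also have "\<dots> = (\<integral>\<^sup>+z. indicator {w..} (cmod z powr \<alpha>) \<partial>fock_measure \<alpha>)"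
      by (rule nn_integral_fock_measure_radial[OF \<alpha>, symmetric]) measurable
    also have "\<dots> \<le> (\<integral>\<^sup>+z. indicator {z. cmod z > L} z \<partial>fock_measure \<alpha>)"
    proof (rule nn_integral_mono)
      fix z
      have "cmod z > L" if "w \<le> cmod z powr \<alpha>"
      proof (rule ccontr)
        assume "\<not> cmod z > L"
        hence "cmod z powr \<alpha> \<le> max 0 L powr \<alpha>" using \<alpha> by (intro powr_mono2) auto
        thus False using that by (simp add: w_def)
      qed
      thus "indicator {w..} (cmod z powr \<alpha>) \<le> (indicator {z. cmod z > L} z :: ennreal)"
        by (auto simp: indicator_def)
    qed
    also have "\<dots> = emeasure (fock_measure \<alpha>) {z. cmod z > L}" by simp
    finally show ?thesis using v(1) by (auto intro: less_le_trans[rotated])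
  qed
qed

section \<open>Masses of shells for the Fock measure\<close>

definition shell :: "real \<Rightarrow> real \<Rightarrow> real \<Rightarrow> real set" where
  "shell \<alpha> x y = {r. 0 \<le> r \<and> x \<le> r powr \<alpha> \<and> r powr \<alpha> < y}"

lemma shell_measurable [measurable]: "shell \<alpha> x y \<in> sets borel"
  unfolding shell_def by measurable

lemma shell_bounded: "\<alpha> > 0 \<Longrightarrow> shell \<alpha> x y \<subseteq> {..max 0 y powr (1 / \<alpha>)}"
proof
  fix r assume \<alpha>: "\<alpha> > 0" and "r \<in> shell \<alpha> x y"
  hence r: "0 \<le> r" "r powr \<alpha> \<le> max 0 y" by (auto simp: shell_def)
  hence "(r powr \<alpha>) powr (1 / \<alpha>) \<le> max 0 y powr (1 / \<alpha>)" using \<alpha> by (intro powr_mono2) auto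
  thus "r \<in> {..max 0 y powr (1 / \<alpha>)}" using r \<alpha> by (simp add: powr_powr)
qed

text \<open>The probability of a shell is a truncated radial moment over the full one, and 2 /
  \<alpha> * k is the exponent because |z|^(2 k) = u^(2 k / \<alpha>). Stated as a product to avoid
  division of extended reals.\<close>

lemma fock_shell_prob:
  assumes \<alpha>: "\<alpha> > 0"
  shows "ennreal (radial_measure.shell_prob (fock_measure \<alpha>) k (shell \<alpha> x y)) * radial_moment \<alpha> UNIV (2 / \<alpha> * real k)
    = radial_moment \<alpha> {x..<y} (2 / \<alpha> * real k)"
proof -
  interpret radial_measure "fock_measure \<alpha>" by (rule fock_radial_measure[OF \<alpha>])
  have m: "ennreal (moment k) = radial_moment \<alpha> UNIV (2 / \<alpha> * real k)"
  proof -
    have "ennreal (moment k) = (\<integral>\<^sup>+z. ennreal (cmod z ^ (2 * k)) \<partial>fock_measure \<alpha>)"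
      unfolding moment_def by (intro nn_integral_eq_integral[symmetric] moments) auto
    also have "\<dots> = radial_moment \<alpha> UNIV (2 / \<alpha> * real k)"
      using fock_measure_moment[OF \<alpha>, of UNIV "2 * k"] by simp
    finally show ?thesis .
  qed
  have "ennreal (shell_prob k (shell \<alpha> x y)) * ennreal (moment k) =
     (\<integral>\<^sup>+z. indicator (shell \<alpha> x y) (cmod z) * ennreal ((cmod (emon k z))\<^sup>2) * ennreal (moment k) \<partial>fock_measure \<alpha>)"
    by (subst nn_integral_shell[symmetric]) (auto simp: nn_integral_multc)
  also have "\<dots> = (\<integral>\<^sup>+z. ennreal (cmod z ^ (2 * k)) * indicator {x..<y} (cmod z powr \<alpha>) \<partial>fock_measure \<alpha>)"
  proof (rule nn_integral_cong)
    fix z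
    have "ennreal ((cmod (emon k z))\<^sup>2) * ennreal (moment k) = ennreal (cmod z ^ (2 * k))"
      using moment_pos[of k] by (simp add: cmod_emon_sq ennreal_mult''[symmetric])
    thus "indicator (shell \<alpha> x y) (cmod z) * ennreal ((cmod (emon k z))\<^sup>2) * ennreal (moment k) =
      ennreal (cmod z ^ (2 * k)) * indicator {x..<y} (cmod z powr \<alpha>)"
      by (auto simp: shell_def indicator_def)
  qed
  also have "\<dots> = radial_moment \<alpha> {x..<y} (2 / \<alpha> * real k)"
    using fock_measure_moment[OF \<alpha>, of "{x..<y}" "2 * k"] by simp
  finally show ?thesis by (simp add: m)
qed

text \<open>Each \<open>shell_prob\<close> is comparable to the integral of \<open>q\<close> over
  [x, y). Summed over all moduli, \<open>q\<close> becomes 2 exp (- 2 u) times the Mittag-Leffler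
  series at 2 u, which lies between positive constants: hence masses proportional to y - x. The
  third claim is the uniform smallness of the single terms.\<close>

lemma fock_shell_estimates:
  assumes \<alpha>: "\<alpha> > 0"
  obtains a A V where "a > 0" "A > 0" "V > 0"
    "\<And>x y. V \<le> x \<Longrightarrow> x \<le> y \<Longrightarrow> radial_measure.shell_mass (fock_measure \<alpha>) (shell \<alpha> x y) \<le> ennreal (A * (y - x))"
    "\<And>x y. V \<le> x \<Longrightarrow> x \<le> y \<Longrightarrow> ennreal (a * (y - x)) \<le> radial_measure.shell_mass (fock_measure \<alpha>) (shell \<alpha> x y)"
    "\<And>\<epsilon>. \<epsilon> > 0 \<Longrightarrow> \<exists>X. \<forall>x y k. X \<le> x \<longrightarrow> x \<le> y \<longrightarrow>
       radial_measure.shell_prob (fock_measure \<alpha>) k (shell \<alpha> x y) \<le> \<epsilon> * (y - x)"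
proof -
  interpret radial_measure "fock_measure \<alpha>" by (rule fock_radial_measure[OF \<alpha>])
  have [measurable]: "radial_density \<alpha> \<in> borel_measurable borel" using \<alpha> by measurable
  define \<beta> where "\<beta> = 2 / \<alpha>"
  have \<beta>: "\<beta> > 0" using \<alpha> by (simp add: \<beta>_def)
  obtain c C v where v: "c > 0" "C > 0" "v > 0"
    "\<And>u. u \<ge> v \<Longrightarrow> c \<le> radial_density \<alpha> u" "\<And>u. u \<ge> v \<Longrightarrow> radial_density \<alpha> u \<le> C"
    "\<And>s. s \<ge> 0 \<Longrightarrow> ennreal (c * gam s) \<le> radial_moment \<alpha> UNIV s"
    "\<And>s. s \<ge> 0 \<Longrightarrow> radial_moment \<alpha> UNIV s \<le> ennreal (C * gam s)"
    using radial_moment_bounds[OF \<alpha>] by metis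
  obtain B where B: "B > 0" "\<And>x. x > 0 \<Longrightarrow> summable (\<lambda>k. ml_term x (\<beta> * real k))"
    "\<And>x. x > 0 \<Longrightarrow> (\<Sum>k. ml_term x (\<beta> * real k)) \<le> B * exp x"
    using ml_series_upper[OF \<beta>] by metis
  obtain b X where b: "b > 0" "X \<ge> 1" "\<And>x. x \<ge> X \<Longrightarrow> b * exp x \<le> (\<Sum>k. ml_term x (\<beta> * real k))"
    using ml_series_lower[OF \<beta>] by metis
  \<comment> \<open>The density of the Gamma law with shape s + 1 and rate 2, the law of u for one
    modulus if \<open>radial_density\<close> were constant.\<close>
  define q where "q = (\<lambda>s u. 2 * exp (- (2 * u)) * ml_term (2 * u) s)"
  have q0: "q s u \<ge> 0" if "s \<ge> 0" for s u using that by (simp add: q_def ml_term_nonneg)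
  have qm[measurable]: "q s \<in> borel_measurable borel" for s
    unfolding q_def[abs_def] ml_term_def by measurable
  define Q where "Q = (\<lambda>k x y. \<integral>\<^sup>+u. ennreal (q (\<beta> * real k) u) * indicator {x..<y} u \<partial>lborel)"
  have s0: "\<beta> * real k \<ge> 0" for k using \<beta> by simp
  let ?p = "\<lambda>k x y. ennreal (shell_prob k (shell \<alpha> x y))"
  have dens_u: "ennreal (u powr s * exp (- 2 * u)) = ennreal (gam s) * ennreal (q s u)" if "u > 0" "s \<ge> 0" for u s
    using ml_term_gam[OF that] gam_pos[OF that(2)] q0[OF that(2), of u]
    by (simp add: q_def ennreal_mult'[symmetric] field_simps)
  have mom_up: "radial_moment \<alpha> {x..<y} s \<le> ennreal (C * gam s) * (\<integral>\<^sup>+u. ennreal (q s u) * indicator {x..<y} u \<partial>lborel)"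
    and mom_low: "ennreal (c * gam s) * (\<integral>\<^sup>+u. ennreal (q s u) * indicator {x..<y} u \<partial>lborel) \<le> radial_moment \<alpha> {x..<y} s"
    if x: "v \<le> x" and s: "s \<ge> 0" for x y s
  proof -
    have e: "ennreal (radial_density \<alpha> u * exp (- 2 * u)) * (ennreal (u powr s) * indicator {x..<y} u)
      = ennreal (radial_density \<alpha> u) * (ennreal (gam s) * (ennreal (q s u) * indicator {x..<y} u))" for u
    proof (cases "u \<in> {x..<y}")
      case True
      hence "u > 0" using x v by auto
      have "ennreal (radial_density \<alpha> u * exp (- 2 * u)) * ennreal (u powr s) = ennreal (radial_density \<alpha> u) * ennreal (u powr s * exp (- 2 * u))"
        using radial_density_nonneg[OF \<alpha>, of u] by (simp add: ennreal_mult'[symmetric] mult_ac)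
      also have "\<dots> = ennreal (radial_density \<alpha> u) * (ennreal (gam s) * ennreal (q s u))"
        by (simp only: dens_u[OF \<open>u > 0\<close> s])
      finally show ?thesis using True by simp
    qed simp
    have g: "ennreal (d * gam s) = ennreal d * ennreal (gam s)" if "d > 0" for d
      using gam_pos[OF s] that by (simp add: ennreal_mult)
    show "radial_moment \<alpha> {x..<y} s \<le> ennreal (C * gam s) * (\<integral>\<^sup>+u. ennreal (q s u) * indicator {x..<y} u \<partial>lborel)"
      unfolding radial_moment_def e g[OF v(2)]
      by (subst nn_integral_cmult[symmetric], measurable, intro nn_integral_mono)
         (use x v in \<open>auto simp: indicator_def mult.assoc intro!: mult_right_mono ennreal_leI\<close>)
    show "ennreal (c * gam s) * (\<integral>\<^sup>+u. ennreal (q s u) * indicator {x..<y} u \<partial>lborel) \<le> radial_moment \<alpha> {x..<y} s"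
      unfolding radial_moment_def e g[OF v(1)]
      by (subst nn_integral_cmult[symmetric], measurable, intro nn_integral_mono)
         (use x v in \<open>auto simp: indicator_def mult.assoc intro!: mult_right_mono ennreal_leI\<close>)
  qed
  \<comment> \<open>The upper bound for the truncated moment meets the lower bound for the full one;
    \<open>gam\<close> cancels, leaving a constant independent of \<open>k\<close>.\<close>
  have p_up: "?p k x y \<le> ennreal (C / c) * Q k x y" if x: "v \<le> x" for k x y
  proof -
    let ?s = "\<beta> * real k"
    have "?p k x y * ennreal (c * gam ?s) \<le> ?p k x y * radial_moment \<alpha> UNIV ?s"
      by (intro mult_left_mono v s0) auto
    also have "\<dots> \<le> ennreal (C * gam ?s) * Q k x y"
      unfolding \<beta>_def fock_shell_prob[OF \<alpha>] unfolding \<beta>_def[symmetric] Q_def by (intro mom_up x s0)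
    finally have "ennreal (1 / (c * gam ?s)) * (?p k x y * ennreal (c * gam ?s)) \<le> ennreal (1 / (c * gam ?s)) * (ennreal (C * gam ?s) * Q k x y)"
      by (rule mult_left_mono) auto
    moreover have "ennreal (1 / (c * gam ?s)) * (?p k x y * ennreal (c * gam ?s)) = ?p k x y"
      using v gam_pos[OF s0, of k] by (simp add: mult.left_commute[of _ "?p k x y"] ennreal_mult'[symmetric])
    moreover have "ennreal (1 / (c * gam ?s)) * (ennreal (C * gam ?s) * Q k x y) = ennreal (C / c) * Q k x y"
      using v gam_pos[OF s0, of k] by (simp add: mult.assoc[symmetric] ennreal_mult'[symmetric])
    ultimately show ?thesis by simp
  qed
  have p_low: "ennreal (c / C) * Q k x y \<le> ?p k x y" if x: "v \<le> x" for k x y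
  proof -
    let ?s = "\<beta> * real k"
    have "ennreal (c * gam ?s) * Q k x y \<le> ?p k x y * radial_moment \<alpha> UNIV ?s"
      unfolding \<beta>_def fock_shell_prob[OF \<alpha>] unfolding \<beta>_def[symmetric] Q_def by (intro mom_low x s0)
    also have "\<dots> \<le> ?p k x y * ennreal (C * gam ?s)"
      by (intro mult_left_mono v s0) auto
    finally have "ennreal (1 / (C * gam ?s)) * (ennreal (c * gam ?s) * Q k x y) \<le> ennreal (1 / (C * gam ?s)) * (?p k x y * ennreal (C * gam ?s))"
      by (rule mult_left_mono) auto
    moreover have "ennreal (1 / (C * gam ?s)) * (?p k x y * ennreal (C * gam ?s)) = ?p k x y"
      using v gam_pos[OF s0, of k] by (simp add: mult.left_commute[of _ "?p k x y"] ennreal_mult'[symmetric])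
    moreover have "ennreal (1 / (C * gam ?s)) * (ennreal (c * gam ?s) * Q k x y) = ennreal (c / C) * Q k x y"
      using v gam_pos[OF s0, of k] by (simp add: mult.assoc[symmetric] ennreal_mult'[symmetric])
    ultimately show ?thesis by simp
  qed
  have sumQ: "(\<Sum>k. Q k x y) = (\<integral>\<^sup>+u. ennreal (2 * exp (- (2 * u)) * (\<Sum>k. ml_term (2 * u) (\<beta> * real k))) * indicator {x..<y} u \<partial>lborel)"
    if "0 < x" for x y
  proof -
    have "(\<Sum>k. Q k x y) = (\<integral>\<^sup>+u. (\<Sum>k. ennreal (q (\<beta> * real k) u) * indicator {x..<y} u) \<partial>lborel)"
      unfolding Q_def by (subst nn_integral_suminf) auto
    also have "\<dots> = (\<integral>\<^sup>+u. ennreal (2 * exp (- (2 * u)) * (\<Sum>k. ml_term (2 * u) (\<beta> * real k))) * indicator {x..<y} u \<partial>lborel)"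
    proof (rule nn_integral_cong)
      fix u :: real
      show "(\<Sum>k. ennreal (q (\<beta> * real k) u) * indicator {x..<y} u) =
        ennreal (2 * exp (- (2 * u)) * (\<Sum>k. ml_term (2 * u) (\<beta> * real k))) * indicator {x..<y} u"
      proof (cases "u \<in> {x..<y}")
        case True
        hence sm: "summable (\<lambda>k. ml_term (2 * u) (\<beta> * real k))" using that by (intro B) auto
        hence "(\<Sum>k. ennreal (q (\<beta> * real k) u)) = ennreal (\<Sum>k. q (\<beta> * real k) u)"
          using q0[OF s0] by (intro suminf_ennreal2) (auto simp: q_def intro!: summable_mult)
        also have "(\<Sum>k. q (\<beta> * real k) u) = 2 * exp (- (2 * u)) * (\<Sum>k. ml_term (2 * u) (\<beta> * real k))"
          unfolding q_def by (rule suminf_mult[OF sm])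
        finally show ?thesis using True by simp
      qed simp
    qed
    finally show ?thesis .
  qed
  have const: "(\<integral>\<^sup>+u. ennreal d * indicator {x..<y} u \<partial>lborel) = ennreal (d * (y - x))" if "x \<le> y" "d \<ge> 0" for x y d :: real
    using that by (subst nn_integral_cmult_indicator) (auto simp: ennreal_mult)
  show thesis
  proof (rule that[of "c / C * (2 * b)" "C / c * (2 * B)" "max v X"])
    fix x y :: real assume xy: "max v X \<le> x" "x \<le> y"
    have x: "v \<le> x" "0 < x" "X \<le> x" using xy v by auto
    have "shell_mass (shell \<alpha> x y) \<le> (\<Sum>k. ennreal (C / c) * Q k x y)"
      unfolding shell_mass_def by (intro suminf_le p_up x) auto
    also have "\<dots> = ennreal (C / c) * (\<Sum>k. Q k x y)" by simp
    also have "(\<Sum>k. Q k x y) \<le> (\<integral>\<^sup>+u. ennreal (2 * B) * indicator {x..<y} u \<partial>lborel)"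
      unfolding sumQ[OF x(2)]
    proof (rule nn_integral_mono)
      fix u :: real
      have "2 * exp (- (2 * u)) * (\<Sum>k. ml_term (2 * u) (\<beta> * real k)) \<le> 2 * B" if "u > 0"
      proof -
        have "2 * exp (- (2 * u)) * (\<Sum>k. ml_term (2 * u) (\<beta> * real k)) \<le> 2 * exp (- (2 * u)) * (B * exp (2 * u))"
          using that by (intro mult_left_mono B) auto
        also have "\<dots> = 2 * B" by (simp add: exp_minus)
        finally show ?thesis .
      qed
      thus "ennreal (2 * exp (- (2 * u)) * (\<Sum>k. ml_term (2 * u) (\<beta> * real k))) * indicator {x..<y} u
        \<le> ennreal (2 * B) * indicator {x..<y} u"
        using x by (auto simp: indicator_def intro!: ennreal_leI)
    qed
    also have "\<dots> = ennreal (2 * B * (y - x))" using xy B by (intro const) auto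
    also have "ennreal (C / c) * ennreal (2 * B * (y - x)) = ennreal (C / c * (2 * B) * (y - x))"
      using v B xy by (subst ennreal_mult'[symmetric]) (auto simp: mult_ac)
    finally show "shell_mass (shell \<alpha> x y) \<le> ennreal (C / c * (2 * B) * (y - x))" by (simp add: mult_left_mono)
    have "ennreal (c / C * (2 * b) * (y - x)) = ennreal (c / C) * ennreal (2 * b * (y - x))"
      using v b xy by (subst ennreal_mult'[symmetric]) (auto simp: mult_ac)
    also have "ennreal (2 * b * (y - x)) = (\<integral>\<^sup>+u. ennreal (2 * b) * indicator {x..<y} u \<partial>lborel)"
      using xy b by (intro const[symmetric]) auto
    also have "\<dots> \<le> (\<Sum>k. Q k x y)"
      unfolding sumQ[OF x(2)]
    proof (rule nn_integral_mono)
      fix u :: real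
      have "2 * b \<le> 2 * exp (- (2 * u)) * (\<Sum>k. ml_term (2 * u) (\<beta> * real k))" if "X \<le> u"
      proof -
        have "2 * b = 2 * exp (- (2 * u)) * (b * exp (2 * u))" by (simp add: exp_minus)
        also have "\<dots> \<le> 2 * exp (- (2 * u)) * (\<Sum>k. ml_term (2 * u) (\<beta> * real k))"
          using that b(2) by (intro mult_left_mono b) auto
        finally show ?thesis .
      qed
      thus "ennreal (2 * b) * indicator {x..<y} u \<le>
        ennreal (2 * exp (- (2 * u)) * (\<Sum>k. ml_term (2 * u) (\<beta> * real k))) * indicator {x..<y} u"
        using x by (auto simp: indicator_def intro!: ennreal_leI)
    qed
    also have "ennreal (c / C) * (\<Sum>k. Q k x y) = (\<Sum>k. ennreal (c / C) * Q k x y)" by simp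
    also have "\<dots> \<le> shell_mass (shell \<alpha> x y)"
      unfolding shell_mass_def by (intro suminf_le p_low x) auto
    finally show "ennreal (c / C * (2 * b) * (y - x)) \<le> shell_mass (shell \<alpha> x y)" by (simp add: mult_left_mono)
  next
    fix \<epsilon> :: real assume \<epsilon>: "\<epsilon> > 0"
    define \<eta> where "\<eta> = \<epsilon> * c / (2 * C)"
    have \<eta>: "\<eta> > 0" using \<epsilon> v by (simp add: \<eta>_def)
    obtain Z where Z: "Z \<ge> 1" "\<And>x s. x \<ge> Z \<Longrightarrow> s \<ge> 0 \<Longrightarrow> ml_term x s \<le> \<eta> * exp x"
      using ml_term_uniformly_small[OF \<eta>] by blast
    show "\<exists>X. \<forall>x y k. X \<le> x \<longrightarrow> x \<le> y \<longrightarrow> shell_prob k (shell \<alpha> x y) \<le> \<epsilon> * (y - x)"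
    proof (intro exI[of _ "max v Z"] allI impI)
      fix x y :: real and k assume xy: "max v Z \<le> x" "x \<le> y"
      have "Q k x y \<le> (\<integral>\<^sup>+u. ennreal (2 * \<eta>) * indicator {x..<y} u \<partial>lborel)"
        unfolding Q_def
      proof (rule nn_integral_mono)
        fix u :: real
        have "q (\<beta> * real k) u \<le> 2 * \<eta>" if "Z \<le> u"
        proof -
          have "q (\<beta> * real k) u \<le> 2 * exp (- (2 * u)) * (\<eta> * exp (2 * u))"
            unfolding q_def using that Z(1) s0 by (intro mult_left_mono Z(2)) auto
          also have "\<dots> = 2 * \<eta>" by (simp add: exp_minus)
          finally show ?thesis .
        qed
        thus "ennreal (q (\<beta> * real k) u) * indicator {x..<y} u \<le> ennreal (2 * \<eta>) * indicator {x..<y} u"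
          using xy by (auto simp: indicator_def intro!: ennreal_leI)
      qed
      also have "\<dots> = ennreal (2 * \<eta> * (y - x))" using xy \<eta> by (intro const) auto
      finally have "ennreal (C / c) * Q k x y \<le> ennreal (C / c) * ennreal (2 * \<eta> * (y - x))"
        by (rule mult_left_mono) simp
      also have "\<dots> = ennreal (\<epsilon> * (y - x))"
        using v \<eta> xy by (subst ennreal_mult'[symmetric]) (auto simp: \<eta>_def)
      finally have "?p k x y \<le> ennreal (\<epsilon> * (y - x))"
        using p_up[of x k y] xy by (auto intro: order_trans)
      thus "shell_prob k (shell \<alpha> x y) \<le> \<epsilon> * (y - x)"
        using \<epsilon> xy by (subst (asm) ennreal_le_iff) auto
    qed
  qed (use v b B in auto)
qed

section \<open>Separation for exponents below one\<close>

text \<open>Subadditivity of t^a for a <= 1: split r^a = s r^(a - 1) + (r - s) r^(a - 1) and use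
  that t^(a - 1) is nonincreasing. Below exponent one it is applied with a = \<alpha>, otherwise
  with a = 1 / \<alpha>.\<close>

lemma powr_diff_le:
  fixes a r s :: real
  assumes "0 < a" "a \<le> 1" "0 \<le> s" "s \<le> r"
  shows "r powr a - s powr a \<le> (r - s) powr a"
proof (cases "s = 0 \<or> s = r")
  case False
  hence s: "0 < s" "0 < r - s" using assms by (auto simp: less_le)
  have base: "x powr a = x * x powr (a - 1)" if "x > 0" for x
    using powr_mult_base[of x "a - 1"] that by simp
  have "r powr a = s * r powr (a - 1) + (r - s) * r powr (a - 1)"
    using base[of r] s by (simp add: algebra_simps)
  also have "\<dots> \<le> s * s powr (a - 1) + (r - s) * (r - s) powr (a - 1)"
    using s assms by (intro add_mono mult_left_mono powr_mono2') auto
  also have "\<dots> = s powr a + (r - s) powr a" using base s by simp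
  finally show ?thesis by simp
qed (use assms in auto)

lemma finite_nsum_ge_1:
  assumes "nsum f < \<infinity>"
  shows "finite {i. f i \<ge> (1 :: ennreal)}"
proof -
  have "emeasure (count_space UNIV) {i. f i \<ge> 1} = nsum (indicator {i. f i \<ge> 1})"
    by (rule nn_integral_indicator[symmetric]) simp
  also have "\<dots> \<le> nsum f" by (intro nn_integral_mono) (auto simp: indicator_def)
  also have "\<dots> < \<infinity>" by (rule assms)
  finally show ?thesis by (auto simp: emeasure_count_space split: if_splits)
qed

lemma shell_disjoint: "y \<le> x' \<Longrightarrow> shell \<alpha> x y \<inter> shell \<alpha> x' y' = {}"
  by (auto simp: shell_def)

context hybrid_dpp begin

text \<open>The alternative in the hypothesis disposes of label tuples with repetitions: there the
  angles are not independent, but the factor of the points vanishes identically.\<close>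

lemma mixing_le:
  fixes f :: "'i :: countable \<Rightarrow> (nat \<Rightarrow> complex) \<Rightarrow> ennreal"
  assumes [measurable]: "\<And>i. f i \<in> borel_measurable (PiM UNIV (\<lambda>_. borel))" "\<And>i. g i \<in> borel_measurable (PiM UNIV (\<lambda>_. borel))"
    and c: "\<And>i. (\<forall>s. f i s = 0) \<or> (\<integral>\<^sup>+\<omega>. g i (\<lambda>k. \<theta> k \<omega>) \<partial>M) \<le> c"
  shows "(\<integral>\<^sup>+\<omega>. nsum (\<lambda>i. f i (\<lambda>k. \<Lambda> k \<omega>) * g i (\<lambda>k. \<theta> k \<omega>)) \<partial>M) \<le> c * (\<integral>\<^sup>+\<omega>. nsum (\<lambda>i. f i (\<lambda>k. \<Lambda> k \<omega>)) \<partial>M)"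
proof -
  have "nsum (\<lambda>i. (\<integral>\<^sup>+\<omega>. f i (\<lambda>k. \<Lambda> k \<omega>) \<partial>M) * (\<integral>\<^sup>+\<omega>. g i (\<lambda>k. \<theta> k \<omega>) \<partial>M))
      \<le> nsum (\<lambda>i. c * (\<integral>\<^sup>+\<omega>. f i (\<lambda>k. \<Lambda> k \<omega>) \<partial>M))"
  proof (rule nn_integral_mono)
    fix i
    show "(\<integral>\<^sup>+\<omega>. f i (\<lambda>k. \<Lambda> k \<omega>) \<partial>M) * (\<integral>\<^sup>+\<omega>. g i (\<lambda>k. \<theta> k \<omega>) \<partial>M) \<le> c * (\<integral>\<^sup>+\<omega>. f i (\<lambda>k. \<Lambda> k \<omega>) \<partial>M)"
      using c[of i]
    proof
      assume "(\<integral>\<^sup>+\<omega>. g i (\<lambda>k. \<theta> k \<omega>) \<partial>M) \<le> c"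
      thus ?thesis by (subst mult.commute) (rule mult_right_mono, auto)
    qed simp
  qed
  thus ?thesis by (simp add: mixing nn_integral_cmult nsum_points)
qed

lemma mixing_eq:
  fixes f :: "'i :: countable \<Rightarrow> (nat \<Rightarrow> complex) \<Rightarrow> ennreal"
  assumes [measurable]: "\<And>i. f i \<in> borel_measurable (PiM UNIV (\<lambda>_. borel))" "\<And>i. g i \<in> borel_measurable (PiM UNIV (\<lambda>_. borel))"
    and c: "\<And>i. (\<forall>s. f i s = 0) \<or> (\<integral>\<^sup>+\<omega>. g i (\<lambda>k. \<theta> k \<omega>) \<partial>M) = c"
  shows "(\<integral>\<^sup>+\<omega>. nsum (\<lambda>i. f i (\<lambda>k. \<Lambda> k \<omega>) * g i (\<lambda>k. \<theta> k \<omega>)) \<partial>M) = c * (\<integral>\<^sup>+\<omega>. nsum (\<lambda>i. f i (\<lambda>k. \<Lambda> k \<omega>)) \<partial>M)"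
proof -
  have "nsum (\<lambda>i. (\<integral>\<^sup>+\<omega>. f i (\<lambda>k. \<Lambda> k \<omega>) \<partial>M) * (\<integral>\<^sup>+\<omega>. g i (\<lambda>k. \<theta> k \<omega>) \<partial>M))
      = nsum (\<lambda>i. c * (\<integral>\<^sup>+\<omega>. f i (\<lambda>k. \<Lambda> k \<omega>) \<partial>M))"
  proof (rule nn_integral_cong)
    fix i
    show "(\<integral>\<^sup>+\<omega>. f i (\<lambda>k. \<Lambda> k \<omega>) \<partial>M) * (\<integral>\<^sup>+\<omega>. g i (\<lambda>k. \<theta> k \<omega>) \<partial>M) = c * (\<integral>\<^sup>+\<omega>. f i (\<lambda>k. \<Lambda> k \<omega>) \<partial>M)"
      using c[of i] by (auto simp: mult.commute)
  qed
  thus ?thesis by (simp add: mixing nn_integral_cmult nsum_points)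
qed

definition in_shells :: "real set \<Rightarrow> real set \<Rightarrow> nat \<times> nat \<Rightarrow> (nat \<Rightarrow> complex) \<Rightarrow> ennreal" where
  "in_shells B C p s = indicator B (cmod (s (fst p))) * indicator C (cmod (s (snd p)))"

lemma in_shells_measurable [measurable]:
  assumes [measurable]: "B \<in> sets borel" "C \<in> sets borel"
  shows "in_shells B C p \<in> borel_measurable (PiM UNIV (\<lambda>_. borel))"
  unfolding in_shells_def[abs_def] by measurable

lemma count_product: "nsum (\<lambda>p. in_shells B C p (\<lambda>k. \<Lambda> k \<omega>)) = count B \<omega> * count C \<omega>"
  unfolding in_shells_def count_def nn_integral_count_space_nat[symmetric] by (rule nsum_mult[symmetric])

lemma angles_range: "AE \<omega> in M. \<forall>k. 0 \<le> \<theta> k \<omega> \<and> \<theta> k \<omega> < 2 * pi"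
  unfolding AE_all_countable
proof
  fix k
  have "AE t in distr M borel (\<theta> k). t \<in> {0..<2 * pi}"
    unfolding angles_uniform by (rule AE_uniform_measureI) auto
  thus "AE \<omega> in M. 0 \<le> \<theta> k \<omega> \<and> \<theta> k \<omega> < 2 * pi"
    by (subst (asm) AE_distr_iff) auto
qed

abbreviation hyb :: "nat \<Rightarrow> 'w \<Rightarrow> complex" where
  "hyb k \<omega> \<equiv> hybrid_process \<Lambda> \<theta> k \<omega>"

lemma hyb_dist_ge: "\<bar>cmod (\<Lambda> j \<omega>) - cmod (\<Lambda> k \<omega>)\<bar> \<le> cmod (hyb j \<omega> - hyb k \<omega>)"
  using norm_triangle_ineq3[of "hyb j \<omega>" "hyb k \<omega>"] by (simp add: hybrid_process_def norm_mult)

text \<open>The infimum is at least the minimum of 1 and finitely many distances, which are positive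
  because distinct moduli keep the points apart whatever the angles are.\<close>

lemma separatedI:
  assumes "finite {(j, k). j \<noteq> k \<and> cmod (hyb j \<omega> - hyb k \<omega>) < 1}" "inj (\<lambda>k. cmod (\<Lambda> k \<omega>))"
  shows "separated (\<lambda>k. hyb k \<omega>)"
proof -
  define P where "P = {(j, k). j \<noteq> k \<and> cmod (hyb j \<omega> - hyb k \<omega>) < 1}"
  define d where "d = (\<lambda>(j, k). cmod (hyb j \<omega> - hyb k \<omega>))"
  define \<delta> where "\<delta> = Min (insert 1 (d ` P))"
  have fin: "finite (insert 1 (d ` P))" using assms(1) by (simp add: P_def)
  have "d p > 0" if "p \<in> P" for p
  proof -
    obtain j k where p: "p = (j, k)" by (cases p)
    hence "j \<noteq> k" using that by (simp add: P_def)
    hence "cmod (\<Lambda> j \<omega>) \<noteq> cmod (\<Lambda> k \<omega>)" using assms(2) by (auto dest: injD)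
    thus ?thesis using hyb_dist_ge[of j \<omega> k] by (auto simp: p d_def)
  qed
  hence "\<delta> > 0" unfolding \<delta>_def using fin by (subst Min_gr_iff) auto
  have "\<delta> \<le> (INF (j, k)\<in>{(j, k). j \<noteq> k}. cmod (hyb j \<omega> - hyb k \<omega>))"
  proof (rule cINF_greatest)
    have "(0 :: nat, 1 :: nat) \<in> {(j, k). j \<noteq> k}" by simp
    thus "{(j, k). j \<noteq> (k :: nat)} \<noteq> {}" by blast
    fix p :: "nat \<times> nat" assume "p \<in> {(j, k). j \<noteq> k}"
    hence "fst p \<noteq> snd p" by (simp add: split_beta)
    then obtain j k where p: "p = (j, k)" "j \<noteq> k" by (metis prod.collapse)
    have "\<delta> \<le> d p"
    proof (cases "p \<in> P")
      case True thus ?thesis unfolding \<delta>_def using fin by (intro Min_le) auto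
    next
      case False
      hence "1 \<le> d p" using p by (auto simp: P_def d_def)
      moreover have "\<delta> \<le> 1" unfolding \<delta>_def using fin by (intro Min_le) auto
      ultimately show ?thesis by simp
    qed
    thus "\<delta> \<le> (case p of (j, k) \<Rightarrow> cmod (hyb j \<omega> - hyb k \<omega>))" by (simp add: d_def)
  qed
  thus ?thesis using \<open>\<delta> > 0\<close> by (simp add: separated_def)
qed

lemma sector_pairs_ge_1:
  assumes "p \<in> Q" "finite Q" "t j \<in> sector L (fst p)" "t k \<in> sector L (snd p)"
  shows "1 \<le> sector_pairs L Q j k t"
proof -
  have "(1 :: ennreal) = (\<Sum>p\<in>{p}. indicator (sector L (fst p)) (t j) * indicator (sector L (snd p)) (t k))"
    using assms by simp
  also have "\<dots> \<le> sector_pairs L Q j k t"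
    unfolding sector_pairs_def using assms by (intro sum_mono2) auto
  finally show ?thesis .
qed

text \<open>Points at distance less than 1 have moduli differing by less than 1, hence values of u
  differing by at most 1 by subadditivity. Both therefore lie in a common shell m <= u < m + 2 and,
  for m >= 1, in adjacent sectors. The expected number of such pairs is summable over m.\<close>

lemma almost_surely_separated:
  assumes \<alpha>: "0 < \<alpha>" "\<alpha> < 1" and A: "A \<ge> 0"
    and mass: "\<And>m :: nat. shell_mass (shell \<alpha> (real m) (real m + 2)) \<le> ennreal A"
  shows "AE \<omega> in M. separated (\<lambda>k. hyb k \<omega>)"
proof -
  define S where "S = (\<lambda>m :: nat. shell \<alpha> (real m) (real m + 2))"
  define R where "R = (\<lambda>m :: nat. real m powr (1 / \<alpha>))"
  \<comment> \<open>As many sectors as \<open>close_points_adjacent\<close> allows at modulus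
    \<open>R m\<close>; still at least \<open>R m\<close>, so that adjacency has probability at most
    5 / \<open>R m\<close>.\<close>
  define L where "L = (\<lambda>m. nat \<lfloor>3 * R m\<rfloor>)"
  have [measurable]: "S m \<in> sets borel" for m by (simp add: S_def)
  have Sb: "S m \<subseteq> {..max 0 (real m + 2) powr (1 / \<alpha>)}" for m unfolding S_def by (rule shell_bounded[OF \<alpha>(1)])
  have R1: "R m \<ge> 1" if "m \<ge> 1" for m unfolding R_def using that \<alpha> by (intro ge_one_powr_ge_zero) auto
  have L: "L m \<ge> 3" "real (L m) \<le> 3 * R m" "R m \<le> real (L m)" if "m \<ge> 1" for m
  proof -
    have "3 \<le> \<lfloor>3 * R m\<rfloor>" using R1[OF that] by (simp add: le_floor_iff)
    thus "L m \<ge> 3" unfolding L_def by linarith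
    have r: "real (L m) = of_int \<lfloor>3 * R m\<rfloor>" using R1[OF that] by (simp add: L_def)
    thus "real (L m) \<le> 3 * R m" by simp
    show "R m \<le> real (L m)" unfolding r using R1[OF that] by linarith
  qed
  \<comment> \<open>\<open>of_bool\<close> excludes the pairs of a point with itself, which always
    lie in a common sector.\<close>
  define F where "F = (\<lambda>m p \<omega>. (of_bool (fst p \<noteq> snd p) * in_shells (S m) (S m) p (\<lambda>k. \<Lambda> k \<omega>))
      * sector_pairs (L m) (adjacent_sectors (L m)) (fst p) (snd p) (\<lambda>k. \<theta> k \<omega>))"
  have Fm[measurable]: "F m p \<in> borel_measurable M" for m p
    unfolding F_def in_shells_def sector_pairs_def by measurable
  have EF: "(\<integral>\<^sup>+\<omega>. nsum (\<lambda>p. F m p \<omega>) \<partial>M) \<le> ennreal (5 * (A + A * A) * (real m powr (- (1 / \<alpha>))))" if m: "m \<ge> 1" for m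
  proof -
    have "(\<integral>\<^sup>+\<omega>. nsum (\<lambda>p. F m p \<omega>) \<partial>M) \<le> ennreal (5 / R m) *
        (\<integral>\<^sup>+\<omega>. nsum (\<lambda>p. of_bool (fst p \<noteq> snd p) * in_shells (S m) (S m) p (\<lambda>k. \<Lambda> k \<omega>)) \<partial>M)"
      unfolding F_def
    proof (rule mixing_le)
      fix p :: "nat \<times> nat"
      have "(\<integral>\<^sup>+\<omega>. sector_pairs (L m) (adjacent_sectors (L m)) (fst p) (snd p) (\<lambda>k. \<theta> k \<omega>) \<partial>M) \<le> ennreal (5 / R m)"
        if "fst p \<noteq> snd p"
      proof -
        have "(\<integral>\<^sup>+\<omega>. sector_pairs (L m) (adjacent_sectors (L m)) (fst p) (snd p) (\<lambda>k. \<theta> k \<omega>) \<partial>M)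
            = ennreal (real (card (adjacent_sectors (L m))) / (real (L m))\<^sup>2)"
          by (rule sector_pairs_expectation[OF that finite_adjacent_sectors]) (auto simp: adjacent_sectors_def)
        also have "real (card (adjacent_sectors (L m))) \<le> real (5 * L m)"
          using card_adjacent_sectors[of "L m"] L[OF m] by (simp only: of_nat_le_iff)
        hence "real (card (adjacent_sectors (L m))) / (real (L m))\<^sup>2 \<le> real (5 * L m) / (real (L m))\<^sup>2"
          by (intro divide_right_mono) auto
        also have "\<dots> = 5 / real (L m)" using L[OF m] by (simp add: power2_eq_square)
        also have "\<dots> \<le> 5 / R m" using L[OF m] R1[OF m] by (intro divide_left_mono) auto
        finally show ?thesis by (simp add: ennreal_leI)
      qed
      thus "(\<forall>s. of_bool (fst p \<noteq> snd p) * in_shells (S m) (S m) p s = 0) \<or>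
        (\<integral>\<^sup>+\<omega>. sector_pairs (L m) (adjacent_sectors (L m)) (fst p) (snd p) (\<lambda>k. \<theta> k \<omega>) \<partial>M) \<le> ennreal (5 / R m)"
        by auto
    qed measurable
    also have "\<dots> \<le> ennreal (5 / R m) * (\<integral>\<^sup>+\<omega>. (count (S m) \<omega>)\<^sup>2 \<partial>M)"
      unfolding power2_eq_square count_product[symmetric]
      by (intro mult_left_mono nn_integral_mono) (auto split: split_of_bool)
    also have "\<dots> \<le> ennreal (5 / R m) * (shell_mass (S m) + shell_mass (S m) * shell_mass (S m))"
      by (intro mult_left_mono second_moment[OF _ Sb]) auto
    also have "\<dots> \<le> ennreal (5 / R m) * (ennreal A + ennreal A * ennreal A)"
      using mass[of m] by (intro mult_left_mono add_mono mult_mono) (auto simp: S_def)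
    also have "\<dots> = ennreal (5 * (A + A * A) * (real m powr (- (1 / \<alpha>))))"
      using A by (simp add: ennreal_mult'[symmetric] ennreal_plus[symmetric] R_def powr_minus divide_inverse mult_ac del: ennreal_plus)
    finally show ?thesis .
  qed
  \<comment> \<open>Convergence because 1 / \<alpha> > 1.\<close>
  have summ: "summable (\<lambda>m. 5 * (A + A * A) * (real (Suc m) powr (- (1 / \<alpha>))))"
  proof -
    have "summable (\<lambda>m. real m powr (- (1 / \<alpha>)))" using \<alpha> by (simp add: summable_real_powr_iff)
    hence "summable (\<lambda>m. real (Suc m) powr (- (1 / \<alpha>)))" by (subst summable_Suc_iff)
    thus ?thesis by (rule summable_mult)
  qed
  have "(\<integral>\<^sup>+\<omega>. nsum (\<lambda>m. nsum (\<lambda>p. F (Suc m) p \<omega>)) \<partial>M) = nsum (\<lambda>m. \<integral>\<^sup>+\<omega>. nsum (\<lambda>p. F (Suc m) p \<omega>) \<partial>M)"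
    by (rule nn_integral_count_space_nn_integral) (auto intro!: borel_measurable_nsum)
  also have "\<dots> \<le> nsum (\<lambda>m. ennreal (5 * (A + A * A) * (real (Suc m) powr (- (1 / \<alpha>)))))"
    by (intro nn_integral_mono EF) simp
  also have "\<dots> = ennreal (\<Sum>m. 5 * (A + A * A) * (real (Suc m) powr (- (1 / \<alpha>))))"
    unfolding nn_integral_count_space_nat using A by (intro suminf_ennreal2 summ) auto
  finally have "(\<integral>\<^sup>+\<omega>. nsum (\<lambda>m. nsum (\<lambda>p. F (Suc m) p \<omega>)) \<partial>M) \<noteq> \<infinity>"
    by (auto simp: top_unique)
  \<comment> \<open>Borel-Cantelli through a finite expected total: almost surely only finitely many
    pairs (m, p) have \<open>F\<close> at least 1.\<close>
  hence "AE \<omega> in M. nsum (\<lambda>m. nsum (\<lambda>p. F (Suc m) p \<omega>)) \<noteq> \<infinity>"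
    by (intro nn_integral_noteq_infinite) (auto intro!: borel_measurable_nsum)
  \<comment> \<open>The shell at m = 0 reaches the origin and admits no sector argument, but it
    contains only finitely many points.\<close>
  moreover have "AE \<omega> in M. finite {k. cmod (\<Lambda> k \<omega>) \<in> S 0}"
    by (rule count_finite[OF _ Sb]) simp
  ultimately show ?thesis using moduli_inj angles_range
  proof eventually_elim
    case (elim \<omega>)
    have "nsum (\<lambda>x. F (Suc (fst x)) (snd x) \<omega>) < \<infinity>"
      using elim(1) by (simp add: nn_integral_fst_count_space[symmetric] less_top)
    hence fin: "finite {x. F (Suc (fst x)) (snd x) \<omega> \<ge> 1}" by (rule finite_nsum_ge_1)
    define J where "J = {k. cmod (\<Lambda> k \<omega>) \<in> S 0}"
    have "{(j, k). j \<noteq> k \<and> cmod (hyb j \<omega> - hyb k \<omega>) < 1} \<subseteq> J \<times> J \<union> snd ` {x. F (Suc (fst x)) (snd x) \<omega> \<ge> 1}"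
    proof safe
      fix j k assume jk: "j \<noteq> k" "cmod (hyb j \<omega> - hyb k \<omega>) < 1"
        and nin: "(j, k) \<notin> snd ` {x. F (Suc (fst x)) (snd x) \<omega> \<ge> 1}"
      define u where "u = (\<lambda>i. cmod (\<Lambda> i \<omega>) powr \<alpha>)"
      have diff: "\<bar>u j - u k\<bar> \<le> 1"
      proof -
        have *: "r powr \<alpha> - s powr \<alpha> \<le> 1" if "0 \<le> s" "s \<le> r" "r - s < 1" for r s :: real
        proof -
          have "(r - s) powr \<alpha> \<le> 1" using that \<alpha> by (intro powr_le1) auto
          thus ?thesis using powr_diff_le[of \<alpha> s r] that \<alpha> by simp
        qed
        have d: "\<bar>cmod (\<Lambda> j \<omega>) - cmod (\<Lambda> k \<omega>)\<bar> < 1" using hyb_dist_ge[of j \<omega> k] jk by linarith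
        show ?thesis
        proof (cases "cmod (\<Lambda> j \<omega>) \<le> cmod (\<Lambda> k \<omega>)")
          case True
          hence "u j \<le> u k" unfolding u_def using \<alpha> by (intro powr_mono2) auto
          thus ?thesis using *[of "cmod (\<Lambda> j \<omega>)" "cmod (\<Lambda> k \<omega>)"] True d by (simp add: u_def)
        next
          case False
          hence "u k \<le> u j" unfolding u_def using \<alpha> by (intro powr_mono2) auto
          thus ?thesis using *[of "cmod (\<Lambda> k \<omega>)" "cmod (\<Lambda> j \<omega>)"] False d by (simp add: u_def)
        qed
      qed
      define m where "m = nat \<lfloor>min (u j) (u k)\<rfloor>"
      have "min (u j) (u k) \<ge> 0" by (simp add: u_def)
      hence "real m = of_int \<lfloor>min (u j) (u k)\<rfloor>" unfolding m_def by (intro of_nat_nat) (simp only: zero_le_floor)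
      hence "real m \<le> min (u j) (u k)" "min (u j) (u k) < real m + 1"
        using real_of_int_floor_add_one_gt[of "min (u j) (u k)"] of_int_floor_le[of "min (u j) (u k)"] by linarith+
      hence uu: "real m \<le> u j" "u j < real m + 2" "real m \<le> u k" "u k < real m + 2"
        using diff by auto
      hence inS: "cmod (\<Lambda> j \<omega>) \<in> S m" "cmod (\<Lambda> k \<omega>) \<in> S m" by (auto simp: S_def shell_def u_def)
      have "m = 0"
      proof (rule ccontr)
        assume "m \<noteq> 0"
        hence m: "m \<ge> 1" by simp
        have ge: "R m \<le> cmod (\<Lambda> i \<omega>)" if "real m \<le> u i" for i
        proof -
          have "real m powr (1 / \<alpha>) \<le> u i powr (1 / \<alpha>)" using that \<alpha> by (intro powr_mono2) auto
          thus ?thesis using \<alpha> by (simp add: R_def u_def powr_powr)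
        qed
        obtain a where a: "a < L m" "\<theta> j \<omega> \<in> sector (L m) a" using sector_exists[of "L m" "\<theta> j \<omega>"] elim(4) L[OF m] by force
        obtain b where b: "b < L m" "\<theta> k \<omega> \<in> sector (L m) b" using sector_exists[of "L m" "\<theta> k \<omega>"] elim(4) L[OF m] by force
        have "(a, b) \<in> adjacent_sectors (L m)"
          using jk(2) by (intro close_points_adjacent[OF L(1,2)[OF m] ge[OF uu(1)] ge[OF uu(3)] _ a(1) b(1) a(2) b(2)])
            (simp add: hybrid_process_def)
        from sector_pairs_ge_1[OF this, of "\<lambda>k. \<theta> k \<omega>" j "L m" k]
        have "1 \<le> F m (j, k) \<omega>"
          using a b inS jk(1) by (simp add: F_def in_shells_def)
        \<comment> \<open>The sum runs over \<open>F (Suc m)\<close>, hence the shift to m -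
          1.\<close>
        hence "(j, k) \<in> snd ` {x. F (Suc (fst x)) (snd x) \<omega> \<ge> 1}"
          using m by (intro image_eqI[of _ _ "(m - 1, (j, k))"]) auto
        thus False using nin by simp
      qed
      thus "j \<in> J" "k \<in> J" using inS by (auto simp: J_def)
    qed
    moreover have "finite (J \<times> J \<union> snd ` {x. F (Suc (fst x)) (snd x) \<omega> \<ge> 1})"
      using elim(2) fin by (simp add: J_def)
    ultimately have "finite {(j, k). j \<noteq> k \<and> cmod (hyb j \<omega> - hyb k \<omega>) < 1}" by (rule finite_subset)
    thus ?case using elim(3) by (rule separatedI)
  qed
qed

text \<open>Pairs with one point in \<open>B\<close>, the other in \<open>C\<close> and both angles
  in one sector. With \<open>B\<close> and \<open>C\<close> disjoint the first moment needs only the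
  two-point formula, and a common sector suffices for closeness, so this counts some of the close
  pairs.\<close>

definition shell_pairs :: "real set \<Rightarrow> real set \<Rightarrow> nat \<Rightarrow> 'w \<Rightarrow> ennreal" where
  "shell_pairs B C L \<omega> = nsum (\<lambda>p. in_shells B C p (\<lambda>k. \<Lambda> k \<omega>) *
     sector_pairs L (diag_sectors L) (fst p) (snd p) (\<lambda>k. \<theta> k \<omega>))"

lemma shell_pairs_measurable [measurable]:
  assumes [measurable]: "B \<in> sets borel" "C \<in> sets borel"
  shows "shell_pairs B C L \<in> borel_measurable M"
  unfolding shell_pairs_def[abs_def] in_shells_def sector_pairs_def
  by measurable

lemma sector_pairs_diag_expectation:
  assumes "j \<noteq> k" "L > 0"
  shows "(\<integral>\<^sup>+\<omega>. sector_pairs L (diag_sectors L) j k (\<lambda>k. \<theta> k \<omega>) \<partial>M) = ennreal (1 / real L)"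
  using sector_pairs_expectation[OF assms(1) diag_sectors(1,2)] assms(2)
  by (simp add: diag_sectors(3) power2_eq_square)

lemma sector_pairs_diag_le_1:
  assumes "L > 0" shows "sector_pairs L (diag_sectors L) j k t \<le> 1"
proof -
  have disj: "disjoint_family_on (sector L) {..<L}"
    unfolding disjoint_family_on_def
  proof (intro ballI impI)
    fix a b :: nat assume ab: "a \<noteq> b"
    have *: "sector L a \<inter> sector L b = {}" if "a < b" for a b
    proof -
      have "2 * pi * real (Suc a) / real L \<le> 2 * pi * real b / real L"
        using that by (intro divide_right_mono mult_left_mono) auto
      thus ?thesis by (auto simp: sector_def simp del: of_nat_Suc)
    qed
    show "sector L a \<inter> sector L b = {}" using *[of a b] *[of b a] ab by (cases a b rule: linorder_cases) auto
  qed
  have "sector_pairs L (diag_sectors L) j k t = (\<Sum>i<L. indicator (sector L i) (t j) * indicator (sector L i) (t k))"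
    unfolding sector_pairs_def diag_sectors_def by (subst sum.reindex) (auto simp: inj_on_def)
  also have "\<dots> \<le> (\<Sum>i<L. indicator (sector L i) (t j))"
    by (intro sum_mono) (auto simp: indicator_def)
  also have "\<dots> = indicator (\<Union>i<L. sector L i) (t j)"
    by (rule indicator_UN_disjoint[OF _ disj, symmetric]) simp
  also have "\<dots> \<le> 1" by (auto simp: indicator_def)
  finally show ?thesis .
qed

lemma shell_pairs_expectation:
  assumes [measurable]: "B \<in> sets borel" "C \<in> sets borel" and BC: "B \<inter> C = {}" and L: "L > 0"
  shows "(\<integral>\<^sup>+\<omega>. shell_pairs B C L \<omega> \<partial>M) = ennreal (1 / real L) * (\<integral>\<^sup>+\<omega>. count B \<omega> * count C \<omega> \<partial>M)"
  unfolding shell_pairs_def count_product[symmetric]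
proof (rule mixing_eq)
  fix p :: "nat \<times> nat"
  have "in_shells B C p s = 0" if "fst p = snd p" for s
    using that BC by (auto simp: in_shells_def indicator_def)
  thus "(\<forall>s. in_shells B C p s = 0) \<or>
    (\<integral>\<^sup>+\<omega>. sector_pairs L (diag_sectors L) (fst p) (snd p) (\<lambda>k. \<theta> k \<omega>) \<partial>M) = ennreal (1 / real L)"
    using sector_pairs_diag_expectation[OF _ L, of "fst p" "snd p"] by blast
qed measurable

text \<open>A quadruple of points in four disjoint shells has four distinct labels, so its two
  sector events are independent; the point factors form one product of four counts.\<close>

lemma shell_pairs_product_expectation:
  assumes meas: "B \<in> sets borel" "C \<in> sets borel" "B' \<in> sets borel" "C' \<in> sets borel"
    and sub: "B \<subseteq> {..R}" "C \<subseteq> {..R}" "B' \<subseteq> {..R}" "C' \<subseteq> {..R}"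
    and disj: "B \<inter> C = {}" "B \<inter> B' = {}" "B \<inter> C' = {}" "C \<inter> B' = {}" "C \<inter> C' = {}" "B' \<inter> C' = {}"
    and L: "L > 0" "L' > 0"
  shows "(\<integral>\<^sup>+\<omega>. shell_pairs B C L \<omega> * shell_pairs B' C' L' \<omega> \<partial>M) \<le>
    (ennreal (1 / real L) * ennreal (1 / real L')) *
      (shell_mass B * shell_mass C * (shell_mass B' * shell_mass C'))"
proof -
  note [measurable] = meas
  let ?f = "\<lambda>p s. in_shells B C (fst p) s * in_shells B' C' (snd p) s"
  let ?g = "\<lambda>p t. sector_pairs L (diag_sectors L) (fst (fst p)) (snd (fst p)) t *
      sector_pairs L' (diag_sectors L') (fst (snd p)) (snd (snd p)) t"
  have "(\<integral>\<^sup>+\<omega>. shell_pairs B C L \<omega> * shell_pairs B' C' L' \<omega> \<partial>M)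
    = (\<integral>\<^sup>+\<omega>. nsum (\<lambda>p. ?f p (\<lambda>k. \<Lambda> k \<omega>) * ?g p (\<lambda>k. \<theta> k \<omega>)) \<partial>M)"
    unfolding shell_pairs_def nsum_mult by (simp add: mult_ac)
  also have "\<dots> \<le> (ennreal (1 / real L) * ennreal (1 / real L')) * (\<integral>\<^sup>+\<omega>. nsum (\<lambda>p. ?f p (\<lambda>k. \<Lambda> k \<omega>)) \<partial>M)"
  proof (rule mixing_le)
    fix p :: "(nat \<times> nat) \<times> (nat \<times> nat)"
    obtain j k j' k' where p: "p = ((j, k), (j', k'))" by (metis surj_pair)
    show "(\<forall>s. ?f p s = 0) \<or> (\<integral>\<^sup>+\<omega>. ?g p (\<lambda>k. \<theta> k \<omega>) \<partial>M) \<le> ennreal (1 / real L) * ennreal (1 / real L')"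
    proof (cases "distinct [j, k, j', k']")
      case True
      have "(\<integral>\<^sup>+\<omega>. ?g p (\<lambda>k. \<theta> k \<omega>) \<partial>M) = ennreal (1 / real L) * ennreal (1 / real L')"
        using sector_pairs_product_expectation[OF True diag_sectors(1,2,1,2), of L L'] L
        by (simp add: p diag_sectors(3) power2_eq_square)
      thus ?thesis by simp
    next
      case False
      have "?f p s = 0" for s
        using False disj by (auto simp: p in_shells_def indicator_def)
      thus ?thesis by simp
    qed
  qed measurable
  also have "(\<integral>\<^sup>+\<omega>. nsum (\<lambda>p. ?f p (\<lambda>k. \<Lambda> k \<omega>)) \<partial>M) = (\<integral>\<^sup>+\<omega>. prod_list (map (\<lambda>X. count X \<omega>) [B, C, B', C']) \<partial>M)"
  proof (rule nn_integral_cong)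
    fix \<omega>
    have "nsum (\<lambda>p. ?f p (\<lambda>k. \<Lambda> k \<omega>)) = (count B \<omega> * count C \<omega>) * (count B' \<omega> * count C' \<omega>)"
      unfolding count_product[symmetric] by (rule nsum_mult[symmetric])
    thus "nsum (\<lambda>p. ?f p (\<lambda>k. \<Lambda> k \<omega>)) = prod_list (map (\<lambda>X. count X \<omega>) [B, C, B', C'])"
      by (simp add: mult.assoc)
  qed
  also have "\<dots> \<le> prod_list (map shell_mass [B, C, B', C'])"
  proof (rule correlation_list_le[where R=R])
    have "sorted_wrt (\<lambda>X Y. X \<inter> Y = {}) [B, C, B', C']" using disj by simp
    thus "[B, C, B', C'] ! i \<inter> [B, C, B', C'] ! j = {}" if "i < j" "j < length [B, C, B', C']" for i j
      using that by (rule sorted_wrt_nth_less)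
  qed (use meas sub in auto)
  finally show ?thesis by (simp add: mult.assoc mult_left_mono)
qed

text \<open>Two pairs from the same shells may share labels, so one sector factor is simply bounded
  by 1. The resulting 1 / L instead of 1 / L^2 is affordable, because it occurs only in the diagonal
  terms of the second moment.\<close>

lemma shell_pairs_square_expectation:
  assumes meas: "B \<in> sets borel" "C \<in> sets borel" and sub: "B \<subseteq> {..R}" "C \<subseteq> {..R}"
    and BC: "B \<inter> C = {}" and L: "L > 0"
  shows "(\<integral>\<^sup>+\<omega>. shell_pairs B C L \<omega> * shell_pairs B C L \<omega> \<partial>M) \<le> ennreal (1 / real L) *
    ((shell_mass B + shell_mass B * shell_mass B) * (shell_mass C + shell_mass C * shell_mass C))"
proof -
  note [measurable] = meas
  let ?f = "\<lambda>p s. in_shells B C (fst p) s * in_shells B C (snd p) s"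
  let ?g = "\<lambda>p t. sector_pairs L (diag_sectors L) (fst (fst p)) (snd (fst p)) t"
  have "shell_pairs B C L \<omega> \<le> nsum (\<lambda>p. in_shells B C p (\<lambda>k. \<Lambda> k \<omega>))" for \<omega>
  proof -
    have "shell_pairs B C L \<omega> \<le> nsum (\<lambda>p. in_shells B C p (\<lambda>k. \<Lambda> k \<omega>) * 1)"
      unfolding shell_pairs_def by (intro nn_integral_mono mult_left_mono sector_pairs_diag_le_1 L) auto
    thus ?thesis by simp
  qed
  hence "(\<integral>\<^sup>+\<omega>. shell_pairs B C L \<omega> * shell_pairs B C L \<omega> \<partial>M) \<le>
     (\<integral>\<^sup>+\<omega>. shell_pairs B C L \<omega> * nsum (\<lambda>p. in_shells B C p (\<lambda>k. \<Lambda> k \<omega>)) \<partial>M)"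
    by (intro nn_integral_mono mult_left_mono) auto
  also have "\<dots> = (\<integral>\<^sup>+\<omega>. nsum (\<lambda>p. ?f p (\<lambda>k. \<Lambda> k \<omega>) * ?g p (\<lambda>k. \<theta> k \<omega>)) \<partial>M)"
    unfolding shell_pairs_def nsum_mult by (simp add: mult_ac)
  also have "\<dots> \<le> ennreal (1 / real L) * (\<integral>\<^sup>+\<omega>. nsum (\<lambda>p. ?f p (\<lambda>k. \<Lambda> k \<omega>)) \<partial>M)"
  proof (rule mixing_le)
    fix p :: "(nat \<times> nat) \<times> (nat \<times> nat)"
    have "?f p s = 0" if "fst (fst p) = snd (fst p)" for s
      using that BC by (auto simp: in_shells_def indicator_def)
    thus "(\<forall>s. ?f p s = 0) \<or> (\<integral>\<^sup>+\<omega>. ?g p (\<lambda>k. \<theta> k \<omega>) \<partial>M) \<le> ennreal (1 / real L)"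
      using sector_pairs_diag_expectation[OF _ L, of "fst (fst p)" "snd (fst p)"] by (metis order_refl)
  qed measurable
  also have "(\<integral>\<^sup>+\<omega>. nsum (\<lambda>p. ?f p (\<lambda>k. \<Lambda> k \<omega>)) \<partial>M) = (\<integral>\<^sup>+\<omega>. (count B \<omega> * count C \<omega>)\<^sup>2 \<partial>M)"
  proof (rule nn_integral_cong)
    fix \<omega>
    show "nsum (\<lambda>p. ?f p (\<lambda>k. \<Lambda> k \<omega>)) = (count B \<omega> * count C \<omega>)\<^sup>2"
      unfolding power2_eq_square count_product[symmetric] by (rule nsum_mult[symmetric])
  qed
  also have "\<dots> \<le> (shell_mass B + shell_mass B * shell_mass B) * (shell_mass C + shell_mass C * shell_mass C)"
    by (rule second_moment_product[OF meas(1) sub(1) meas(2) sub(2) BC])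
  finally show ?thesis by (simp add: mult_left_mono)
qed

text \<open>
  Second moment method: the number \<open>T\<close> of pairs in a common sector and in a shell
  \<open>B m \<union> C m\<close>, \<open>m < N\<close>, has \<open>\<E> T \<ge> (1 - \<delta>) \<tau>\<close> and \<open>\<E> T\<^sup>2 \<le> \<tau>\<^sup>2 + K \<tau>\<close>, so that
  \<open>\<P>(T > 0) \<ge> (\<E> T)\<^sup>2 / \<E> T\<^sup>2\<close> is close to \<open>1\<close> when \<open>\<tau>\<close> is large.
\<close>

lemma second_moment_method:
  fixes N :: nat
  assumes meas: "\<And>m. B m \<in> sets borel" "\<And>m. C m \<in> sets borel"
    and sub: "\<And>m. m < N \<Longrightarrow> B m \<subseteq> {..R}" "\<And>m. m < N \<Longrightarrow> C m \<subseteq> {..R}"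
    and disj: "\<And>m. B m \<inter> C m = {}"
      "\<And>m m'. m \<noteq> m' \<Longrightarrow> B m \<inter> B m' = {}" "\<And>m m'. m \<noteq> m' \<Longrightarrow> B m \<inter> C m' = {}"
      "\<And>m m'. m \<noteq> m' \<Longrightarrow> C m \<inter> C m' = {}"
    and L: "\<And>m. L m > (0 :: nat)"
    and x: "\<And>m. shell_mass (B m) = ennreal (x m)" and y: "\<And>m. shell_mass (C m) = ennreal (y m)"
    and xb: "\<And>m. b \<le> x m" "\<And>m. x m \<le> D" and yb: "\<And>m. b \<le> y m" "\<And>m. y m \<le> D" and b: "b > 0"
    and \<delta>: "0 < \<delta>" "\<delta> < 1" and s: "\<And>m k. shell_prob k (B m) \<le> \<delta> * b"
    and no_pair: "G \<in> events" "\<And>\<omega> m p. \<omega> \<in> G \<Longrightarrow> in_shells (B m) (C m) p (\<lambda>k. \<Lambda> k \<omega>) *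
      sector_pairs (L m) (diag_sectors (L m)) (fst p) (snd p) (\<lambda>k. \<theta> k \<omega>) = 0"
  defines "\<tau> \<equiv> (\<Sum>m<N. x m * y m / real (L m))" and "K \<equiv> ((D + D * D) / b)\<^sup>2"
  assumes \<tau>: "\<tau> > 0"
  shows "prob G \<le> 1 - (1 - \<delta>)\<^sup>2 * (\<tau> / (\<tau> + K))"
proof -
  note [measurable] = meas no_pair(1)
  have xy0: "x m > 0" "y m > 0" for m using xb(1)[of m] yb(1)[of m] b by auto
  have D0: "D > 0" using xb(2)[of 0] xy0(1)[of 0] by linarith
  \<comment> \<open>The expected number of pairs if the counts in the two shells were
    uncorrelated.\<close>
  define w where "w = (\<lambda>m. x m * y m / real (L m))"
  have w0: "w m \<ge> 0" for m using xy0 by (simp add: w_def less_imp_le)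
  have \<tau>_w: "\<tau> = (\<Sum>m<N. w m)" by (simp add: \<tau>_def w_def)
  define X where "X = (\<lambda>m. shell_pairs (B m) (C m) (L m))"
  have [measurable]: "X m \<in> borel_measurable M" for m unfolding X_def by measurable
  define T where "T = (\<lambda>\<omega>. \<Sum>m<N. X m \<omega>)"
  have [measurable]: "T \<in> borel_measurable M" unfolding T_def by measurable
  have EX: "ennreal ((1 - \<delta>) * w m) \<le> (\<integral>\<^sup>+\<omega>. X m \<omega> \<partial>M)" if "m < N" for m
  proof -
    \<comment> \<open>x m >= b turns the absolute loss \<delta> b into a relative loss
      \<delta>.\<close>
    have "(1 - \<delta>) * x m * y m \<le> (x m - \<delta> * b) * y m"
      using xb(1)[of m] \<delta> xy0[of m] by (intro mult_right_mono) (auto simp: algebra_simps)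
    hence "ennreal ((1 - \<delta>) * x m * y m) \<le> ennreal ((x m - \<delta> * b) * y m)" by (rule ennreal_leI)
    also have "\<dots> \<le> (\<integral>\<^sup>+\<omega>. count (B m) \<omega> * count (C m) \<omega> \<partial>M)"
      by (intro expected_count_2_ge[where R=R] meas sub that disj s x y) (auto simp: xy0 less_imp_le)
    finally have "ennreal (1 / real (L m)) * ennreal ((1 - \<delta>) * x m * y m) \<le>
      ennreal (1 / real (L m)) * (\<integral>\<^sup>+\<omega>. count (B m) \<omega> * count (C m) \<omega> \<partial>M)"
      by (rule mult_left_mono) simp
    moreover have "ennreal (1 / real (L m)) * ennreal ((1 - \<delta>) * x m * y m) = ennreal ((1 - \<delta>) * w m)"
      by (subst ennreal_mult'[symmetric]) (auto simp: w_def mult.assoc)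
    ultimately show ?thesis unfolding X_def by (subst shell_pairs_expectation) (auto simp: disj L)
  qed
  have ET: "ennreal ((1 - \<delta>) * \<tau>) \<le> (\<integral>\<^sup>+\<omega>. T \<omega> \<partial>M)"
  proof -
    have "ennreal ((1 - \<delta>) * \<tau>) = (\<Sum>m<N. ennreal ((1 - \<delta>) * w m))"
      using w0 \<delta> by (subst sum_ennreal) (auto simp: \<tau>_w sum_distrib_left)
    also have "\<dots> \<le> (\<Sum>m<N. \<integral>\<^sup>+\<omega>. X m \<omega> \<partial>M)" by (intro sum_mono EX) auto
    also have "\<dots> = (\<integral>\<^sup>+\<omega>. T \<omega> \<partial>M)" unfolding T_def by (subst nn_integral_sum) auto
    finally show ?thesis .
  qed
  have EXX: "(\<integral>\<^sup>+\<omega>. X m \<omega> * X m' \<omega> \<partial>M) \<le> ennreal (w m * w m' + (if m = m' then K * w m else 0))"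
    if m: "m < N" "m' < N" for m m'
  proof (cases "m = m'")
    case False
    have d: "C m \<inter> B m' = {}" using disj(3)[of m' m] False by blast
    have "(\<integral>\<^sup>+\<omega>. X m \<omega> * X m' \<omega> \<partial>M) \<le> (ennreal (1 / real (L m)) * ennreal (1 / real (L m'))) *
      (shell_mass (B m) * shell_mass (C m) * (shell_mass (B m') * shell_mass (C m')))"
      unfolding X_def using False
      by (intro shell_pairs_product_expectation[where R=R] meas sub m disj d L) auto
    also have "\<dots> = ennreal (w m * w m')"
      unfolding x y using xy0 by (simp add: ennreal_mult'[symmetric] w_def less_imp_le mult_ac)
    finally show ?thesis using False by simp
  next
    case True
    have "(\<integral>\<^sup>+\<omega>. X m \<omega> * X m' \<omega> \<partial>M) \<le> ennreal (1 / real (L m)) *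
      ((shell_mass (B m) + shell_mass (B m) * shell_mass (B m)) * (shell_mass (C m) + shell_mass (C m) * shell_mass (C m)))"
      unfolding X_def True[symmetric]
      by (intro shell_pairs_square_expectation[where R=R] meas sub m disj L)
    also have "\<dots> = ennreal (1 / real (L m) * ((x m + x m * x m) * (y m + y m * y m)))"
    proof -
      have "shell_mass (B m) + shell_mass (B m) * shell_mass (B m) = ennreal (x m + x m * x m)"
        "shell_mass (C m) + shell_mass (C m) * shell_mass (C m) = ennreal (y m + y m * y m)"
        unfolding x y using xy0[of m] by (simp_all add: ennreal_mult ennreal_plus)
      moreover have "ennreal (1 / real (L m) * ((x m + x m * x m) * (y m + y m * y m))) =
        ennreal (1 / real (L m)) * (ennreal (x m + x m * x m) * ennreal (y m + y m * y m))"
      proof -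
        have "x m + x m * x m \<ge> 0" "y m + y m * y m \<ge> 0" using xy0[of m] by simp_all
        thus ?thesis by (simp only: ennreal_mult ennreal_mult'' mult_nonneg_nonneg)
      qed
      ultimately show ?thesis by (simp only:)
    qed
    also have "\<dots> \<le> ennreal (K * w m)"
    proof (rule ennreal_leI)
      \<comment> \<open>With masses between b and D, the square term is at most a fixed multiple of
        the mass itself. The product of two such factors is \<open>K\<close>, which makes the
        diagonal linear in \<tau>.\<close>
      have bb: "x m + x m * x m \<le> (D + D * D) / b * x m" if "b \<le> x m" "x m \<le> D" for x :: "nat \<Rightarrow> real"
      proof -
        have "x m + x m * x m \<le> D + D * D" using that b D0 by (intro add_mono mult_mono) auto
        also have "\<dots> = (D + D * D) / b * b" using b by simp
        also have "\<dots> \<le> (D + D * D) / b * x m" using that b D0 by (intro mult_left_mono) auto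
        finally show ?thesis .
      qed
      have "(x m + x m * x m) * (y m + y m * y m) \<le> ((D + D * D) / b * x m) * ((D + D * D) / b * y m)"
        using bb[of x] bb[of y] xb yb xy0[of m] b D0 by (intro mult_mono) (auto simp: less_imp_le intro!: add_nonneg_nonneg)
      also have "\<dots> = K * (x m * y m)" by (simp add: K_def power2_eq_square mult_ac)
      finally have "1 / real (L m) * ((x m + x m * x m) * (y m + y m * y m)) \<le> 1 / real (L m) * (K * (x m * y m))"
        by (rule mult_left_mono) simp
      thus "1 / real (L m) * ((x m + x m * x m) * (y m + y m * y m)) \<le> K * w m" by (simp add: w_def)
    qed
    also have "\<dots> \<le> ennreal (w m * w m' + (if m = m' then K * w m else 0))"
      using True w0 by (intro ennreal_leI) auto
    finally show ?thesis .
  qed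
  have K0: "K \<ge> 0" by (simp add: K_def)
  have ETT: "(\<integral>\<^sup>+\<omega>. (T \<omega>)\<^sup>2 \<partial>M) \<le> ennreal (\<tau>\<^sup>2 + K * \<tau>)"
  proof -
    have "(\<integral>\<^sup>+\<omega>. (T \<omega>)\<^sup>2 \<partial>M) = (\<Sum>m<N. \<Sum>m'<N. \<integral>\<^sup>+\<omega>. X m \<omega> * X m' \<omega> \<partial>M)"
      unfolding T_def power2_eq_square sum_product by (simp add: nn_integral_sum)
    also have "\<dots> \<le> (\<Sum>m<N. \<Sum>m'<N. ennreal (w m * w m' + (if m = m' then K * w m else 0)))"
      by (intro sum_mono EXX) auto
    also have "\<dots> = ennreal (\<Sum>m<N. \<Sum>m'<N. w m * w m' + (if m = m' then K * w m else 0))"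
    proof -
      have "0 \<le> w m * w m' + (if m = m' then K * w m else 0)" for m m' using w0 K0 by auto
      thus ?thesis by (simp add: sum_ennreal sum_nonneg del: ennreal_plus)
    qed
    also have "(\<Sum>m<N. \<Sum>m'<N. w m * w m' + (if m = m' then K * w m else 0)) = \<tau>\<^sup>2 + K * \<tau>"
      unfolding \<tau>_w power2_eq_square sum_product by (simp add: sum.distrib sum_distrib_left[of K])
    finally show ?thesis .
  qed
  \<comment> \<open>On \<open>G\<close> there is no pair, so T equals T times the indicator of the
    complement, and Cauchy-Schwarz bounds the probability of the complement from below.\<close>
  have "T \<omega> = 0" if "\<omega> \<in> G" for \<omega>
    unfolding T_def X_def shell_pairs_def no_pair(2)[OF that] by simp
  hence ind: "T \<omega> = T \<omega> * indicator (space M - G) \<omega>" if "\<omega> \<in> space M" for \<omega>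
    using that by (auto simp: indicator_def)
  have sq: "((1 - \<delta>) * \<tau>)\<^sup>2 \<le> (\<tau>\<^sup>2 + K * \<tau>) * prob (space M - G)"
  proof -
    have "(ennreal ((1 - \<delta>) * \<tau>))\<^sup>2 \<le> (\<integral>\<^sup>+\<omega>. T \<omega> * indicator (space M - G) \<omega> \<partial>M)\<^sup>2"
    proof (rule power_mono)
      have "(\<integral>\<^sup>+\<omega>. T \<omega> \<partial>M) = (\<integral>\<^sup>+\<omega>. T \<omega> * indicator (space M - G) \<omega> \<partial>M)"
        by (rule nn_integral_cong) (rule ind)
      thus "ennreal ((1 - \<delta>) * \<tau>) \<le> (\<integral>\<^sup>+\<omega>. T \<omega> * indicator (space M - G) \<omega> \<partial>M)" using ET by simp
    qed simp
    also have "\<dots> \<le> (\<integral>\<^sup>+\<omega>. (T \<omega>)\<^sup>2 \<partial>M) * (\<integral>\<^sup>+\<omega>. (indicator (space M - G) \<omega>)\<^sup>2 \<partial>M)"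
      by (rule Cauchy_Schwarz_nn_integral) measurable
    also have "(\<integral>\<^sup>+\<omega>. (indicator (space M - G) \<omega>)\<^sup>2 \<partial>M) = emeasure M (space M - G)"
      by (simp add: power2_eq_square indicator_inter_arith[symmetric])
    also have "(\<integral>\<^sup>+\<omega>. (T \<omega>)\<^sup>2 \<partial>M) * emeasure M (space M - G) \<le> ennreal (\<tau>\<^sup>2 + K * \<tau>) * emeasure M (space M - G)"
      by (intro mult_right_mono ETT) auto
    also have "\<dots> = ennreal ((\<tau>\<^sup>2 + K * \<tau>) * prob (space M - G))"
      using \<tau> K0 by (simp add: emeasure_eq_measure ennreal_mult)
    finally have "ennreal (((1 - \<delta>) * \<tau>)\<^sup>2) \<le> ennreal ((\<tau>\<^sup>2 + K * \<tau>) * prob (space M - G))"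
      using \<delta> \<tau> by (simp add: ennreal_power)
    thus ?thesis using \<tau> K0 by (subst (asm) ennreal_le_iff) auto
  qed
  have "\<tau> * ((1 - \<delta>)\<^sup>2 * \<tau>) \<le> \<tau> * ((\<tau> + K) * prob (space M - G))"
    using sq by (simp add: power2_eq_square algebra_simps)
  hence "(1 - \<delta>)\<^sup>2 * \<tau> \<le> (\<tau> + K) * prob (space M - G)" using \<tau> by simp
  hence "(1 - \<delta>)\<^sup>2 * (\<tau> / (\<tau> + K)) \<le> prob (space M - G)"
    using \<tau> K0 by (simp add: pos_divide_le_eq mult.commute)
  thus ?thesis using prob_compl[OF no_pair(1)] by simp
qed

end

section \<open>Absence of separation for exponents at least one\<close>

text \<open>Countable quantifiers make the event measurable and reduce the absence of separation to
  fixed distances 1 / (n + 1).\<close>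

lemma separated_iff:
  "separated s \<longleftrightarrow> (\<exists>n :: nat. \<forall>j k. j \<noteq> k \<longrightarrow> 1 / real (Suc n) \<le> cmod (s j - s k))"
proof
  have ne: "{(j, k). j \<noteq> (k :: nat)} \<noteq> {}"
  proof -
    have "(0 :: nat, 1 :: nat) \<in> {(j, k). j \<noteq> k}" by simp
    thus ?thesis by blast
  qed
  let ?d = "\<lambda>(j, k). cmod (s j - s k)"
  {
    assume "separated s"
    hence "(INF p\<in>{(j, k). j \<noteq> k}. ?d p) > 0" by (simp add: separated_def)
    then obtain n where n: "1 / real (Suc n) < (INF p\<in>{(j, k). j \<noteq> k}. ?d p)"
      using nat_approx_posE by metis
    have "1 / real (Suc n) \<le> cmod (s j - s k)" if "j \<noteq> k" for j k
    proof -
      have "bdd_below (?d ` {(j, k). j \<noteq> k})" by (intro bdd_belowI[of _ 0]) auto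
      hence "(INF p\<in>{(j, k). j \<noteq> k}. ?d p) \<le> ?d (j, k)" using that by (intro cINF_lower) auto
      thus ?thesis using n by simp
    qed
    thus "\<exists>n :: nat. \<forall>j k. j \<noteq> k \<longrightarrow> 1 / real (Suc n) \<le> cmod (s j - s k)" by blast
  next
    assume "\<exists>n :: nat. \<forall>j k. j \<noteq> k \<longrightarrow> 1 / real (Suc n) \<le> cmod (s j - s k)"
    then obtain n :: nat where n: "\<And>j k. j \<noteq> k \<Longrightarrow> 1 / real (Suc n) \<le> cmod (s j - s k)" by blast
    have "1 / real (Suc n) \<le> (INF p\<in>{(j, k). j \<noteq> k}. ?d p)"
      using n by (intro cINF_greatest[OF ne]) auto
    moreover have "0 < 1 / real (Suc n)" by simp
    ultimately show "separated s" unfolding separated_def by linarith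
  }
qed

lemma le_1_if_all_sq:
  fixes p :: real
  assumes "\<And>\<delta>. 0 < \<delta> \<Longrightarrow> \<delta> < 1 \<Longrightarrow> p \<le> 1 - (1 - \<delta>)\<^sup>2" "p \<ge> 0"
  shows "p = 0"
proof -
  have "((\<lambda>\<delta>::real. 1 - (1 - \<delta>)\<^sup>2) \<longlongrightarrow> 1 - (1 - 0)\<^sup>2) (at_right 0)" by (intro tendsto_intros)
  moreover have "\<forall>\<^sub>F \<delta> in at_right 0. p \<le> 1 - (1 - \<delta>)\<^sup>2"
    using assms(1) unfolding eventually_at_right_field by (intro exI[of _ 1]) auto
  ultimately have "p \<le> 1 - (1 - 0)\<^sup>2" by (intro tendsto_lowerbound) auto
  thus ?thesis using assms(2) by simp
qed

lemma sum_harmonic_unbounded: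
  assumes "c > 0"
  shows "filterlim (\<lambda>N. \<Sum>m<N. c / real (Suc m)) at_top sequentially"
proof -
  have "\<not> summable (\<lambda>m. inverse (real (Suc m)))"
    using not_summable_harmonic[where 'a=real] by (subst summable_Suc_iff) 
  hence ns: "\<not> summable (\<lambda>m. c / real (Suc m))"
    using assms summable_cmult_iff[of c "\<lambda>m. inverse (real (Suc m))"] by (simp add: field_simps)
  have "\<exists>N. Z < (\<Sum>m<N. c / real (Suc m))" for Z
  proof (rule ccontr)
    assume "\<not> ?thesis"
    hence "\<And>N. (\<Sum>m<N. c / real (Suc m)) \<le> Z" by (simp add: not_less)
    hence "summable (\<lambda>m. c / real (Suc m))"
      using assms by (intro summableI_nonneg_bounded[where x=Z]) auto
    thus False using ns by simp
  qed
  moreover have "(\<Sum>m<N. c / real (Suc m)) \<le> (\<Sum>m<n. c / real (Suc m))" if "n \<ge> N" for n N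
    using that assms by (intro sum_mono2) auto
  ultimately show ?thesis unfolding filterlim_at_top eventually_sequentially
    by (meson less_imp_le order_trans)
qed

context hybrid_dpp begin

lemma hyb_measurable [measurable]: "hyb k \<in> borel_measurable M"
proof -
  have [measurable]: "cis \<in> borel_measurable borel"
    by (intro borel_measurable_continuous_onI continuous_intros)
  have "(\<lambda>\<omega>. complex_of_real (cmod (\<Lambda> k \<omega>)) * cis (\<theta> k \<omega>)) \<in> borel_measurable M" by measurable
  thus ?thesis by (simp add: hybrid_process_def[abs_def])
qed

text \<open>In each block of u-length 2 h, split into halves \<open>B m\<close> and
  \<open>C m\<close>, a pair in a common sector is closer than \<open>d\<close>. Masses stay between
  constants while the number of sectors grows at most linearly in m, so \<tau> dominates a harmonic
  series. Hence prob G <= 1 - (1 - \<delta>)^2 for every \<delta>.\<close>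

lemma not_separated_by:
  assumes \<mu>: "\<mu> = fock_measure \<alpha>" and \<alpha>: "\<alpha> \<ge> 1" and d: "d > 0"
  defines "G \<equiv> {\<omega> \<in> space M. (\<forall>k. 0 \<le> \<theta> k \<omega> \<and> \<theta> k \<omega> < 2 * pi) \<and>
    (\<forall>j k. j \<noteq> k \<longrightarrow> d \<le> cmod (hyb j \<omega> - hyb k \<omega>))}"
  shows "G \<in> events" "prob G = 0"
proof -
  have \<alpha>_pos: "\<alpha> > 0" using \<alpha> by simp
  show G: "G \<in> events" unfolding G_def by measurable
  obtain a A V where aAV: "a > 0" "A > 0" "V > 0"
    and mass_le: "\<And>x y. V \<le> x \<Longrightarrow> x \<le> y \<Longrightarrow> shell_mass (shell \<alpha> x y) \<le> ennreal (A * (y - x))"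
    and mass_ge: "\<And>x y. V \<le> x \<Longrightarrow> x \<le> y \<Longrightarrow> ennreal (a * (y - x)) \<le> shell_mass (shell \<alpha> x y)"
    and small: "\<And>\<epsilon>. \<epsilon> > 0 \<Longrightarrow> \<exists>X. \<forall>x y k. X \<le> x \<longrightarrow> x \<le> y \<longrightarrow> shell_prob k (shell \<alpha> x y) \<le> \<epsilon> * (y - x)"
    using fock_shell_estimates[OF \<alpha>_pos, folded \<mu>] by metis
  \<comment> \<open>Values of u less than 2 h apart then have moduli at most (2 h)^(1 / \<alpha>) =
    d / 4 apart, by subadditivity with exponent 1 / \<alpha> <= 1.\<close>
  define h where "h = (d / 4) powr \<alpha> / 2"
  have h: "h > 0" using d by (simp add: h_def)
  have h2: "(2 * h) powr (1 / \<alpha>) = d / 4" using d \<alpha>_pos by (simp add: h_def powr_powr)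
  show "prob G = 0"
  proof (rule le_1_if_all_sq)
    fix \<delta> :: real assume \<delta>: "0 < \<delta>" "\<delta> < 1"
    obtain X where X: "\<And>x y k. X \<le> x \<Longrightarrow> x \<le> y \<Longrightarrow> shell_prob k (shell \<alpha> x y) \<le> \<delta> * a * (y - x)"
      using small[of "\<delta> * a"] \<delta> aAV by auto
    \<comment> \<open>Beyond \<open>V\<close> the masses are controlled, beyond \<open>X\<close>
      single moduli are negligible, and u >= 1 gives u^(1 / \<alpha>) <= u.\<close>
    define W where "W = max (max V 1) X"
    define u where "u = (\<lambda>m :: nat. W + 2 * h * real m)"
    have u: "V \<le> u m" "1 \<le> u m" "X \<le> u m" for m
    proof -
      have "0 \<le> 2 * h * real m" using h by simp
      thus "V \<le> u m" "1 \<le> u m" "X \<le> u m" unfolding u_def W_def by linarith+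
    qed
    have u_mono: "u m + 2 * h \<le> u m'" if "m < m'" for m m'
    proof -
      have "2 * h * real (Suc m) \<le> 2 * h * real m'" using that h by (intro mult_left_mono) auto
      thus ?thesis by (simp add: u_def algebra_simps)
    qed
    define B where "B = (\<lambda>m. shell \<alpha> (u m) (u m + h))"
    define C where "C = (\<lambda>m. shell \<alpha> (u m + h) (u m + 2 * h))"
    define x where "x = (\<lambda>m. enn2real (shell_mass (B m)))"
    define y where "y = (\<lambda>m. enn2real (shell_mass (C m)))"
    \<comment> \<open>Makes the arc spanned by one sector at modulus at most u m + 2 h no longer
      than d / 2. Using u instead of the true modulus u^(1 / \<alpha>) costs sectors, but linear
      growth is still slow enough.\<close>
    define L where "L = (\<lambda>m. nat \<lceil>4 * pi * (u m + 2 * h) / d\<rceil>)"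
    have Lge: "4 * pi * (u m + 2 * h) / d \<le> real (L m)" for m
      unfolding L_def by (rule real_nat_ceiling_ge)
    have pos: "4 * pi * (u m + 2 * h) / d > 0" for m
      using u(2)[of m] h d by (intro divide_pos_pos mult_pos_pos) auto
    have L0: "L m > 0" for m using Lge[of m] pos[of m] by (cases "L m") auto
    have Lle: "real (L m) \<le> 4 * pi * (u m + 2 * h) / d + 1" for m
      unfolding L_def using pos[of m] by (subst of_nat_nat) (auto intro: less_imp_le)
    have massB: "ennreal (a * h) \<le> shell_mass (B m)" "shell_mass (B m) \<le> ennreal (A * h)" for m
      using mass_ge[of "u m" "u m + h"] mass_le[of "u m" "u m + h"] u(1)[of m] h by (auto simp: B_def)
    have massC: "ennreal (a * h) \<le> shell_mass (C m)" "shell_mass (C m) \<le> ennreal (A * h)" for m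
    proof -
      have "u m + 2 * h - (u m + h) = h" by simp
      thus "ennreal (a * h) \<le> shell_mass (C m)" "shell_mass (C m) \<le> ennreal (A * h)"
        using mass_ge[of "u m + h" "u m + 2 * h"] mass_le[of "u m + h" "u m + 2 * h"] u(1)[of m] h
        by (auto simp: C_def)
    qed
    have enn: "v = ennreal (enn2real v) \<and> p \<le> enn2real v \<and> enn2real v \<le> q"
      if "ennreal p \<le> v" "v \<le> ennreal q" "0 \<le> q" for p q v
    proof -
      have "v < \<infinity>" using that(2) by (metis ennreal_less_top infinity_ennreal_def le_less_trans)
      hence v: "v = ennreal (enn2real v)" by simp
      moreover have "p \<le> enn2real v" using that(1) v by (metis enn2real_nonneg ennreal_le_iff)
      moreover have "enn2real v \<le> q" using that(2,3) v by (metis ennreal_le_iff)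
      ultimately show ?thesis by blast
    qed
    have Ah: "A * h \<ge> 0" using aAV h by simp
    have xB: "shell_mass (B m) = ennreal (x m)" "a * h \<le> x m" "x m \<le> A * h" for m
      using enn[OF massB Ah] by (simp_all add: x_def)
    have yC: "shell_mass (C m) = ennreal (y m)" "a * h \<le> y m" "y m \<le> A * h" for m
      using enn[OF massC Ah] by (simp_all add: y_def)
    define \<tau> where "\<tau> = (\<lambda>N. \<Sum>m<N. x m * y m / real (L m))"
    define K where "K = ((A * h + A * h * (A * h)) / (a * h))\<^sup>2"
    have K: "K \<ge> 0" by (simp add: K_def)
    have no_pair: "in_shells (B m) (C m) p (\<lambda>k. \<Lambda> k \<omega>) *
        sector_pairs (L m) (diag_sectors (L m)) (fst p) (snd p) (\<lambda>k. \<theta> k \<omega>) = 0" if \<omega>: "\<omega> \<in> G" for \<omega> m p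
    proof (rule ccontr)
      obtain j k where p: "p = (j, k)" by (cases p)
      assume "\<not> ?thesis"
      hence in_BC: "cmod (\<Lambda> j \<omega>) \<in> B m" "cmod (\<Lambda> k \<omega>) \<in> C m"
        and "sector_pairs (L m) (diag_sectors (L m)) j k (\<lambda>k. \<theta> k \<omega>) \<noteq> 0"
        by (auto simp: p in_shells_def indicator_def split: if_splits)
      then obtain i where i: "i < L m" "\<theta> j \<omega> \<in> sector (L m) i" "\<theta> k \<omega> \<in> sector (L m) i"
        unfolding sector_pairs_def diag_sectors_def
        by (auto simp: indicator_def sum_nonneg_eq_0_iff split: if_splits)
      have "j \<noteq> k" using in_BC shell_disjoint[of "u m + h" "u m + h" \<alpha> "u m" "u m + 2 * h"] by (auto simp: B_def C_def)
      hence "d \<le> cmod (hyb j \<omega> - hyb k \<omega>)" using \<omega> by (simp add: G_def)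
      also have "\<dots> \<le> \<bar>cmod (\<Lambda> j \<omega>) - cmod (\<Lambda> k \<omega>)\<bar> + cmod (\<Lambda> k \<omega>) * (2 * pi / real (L m))"
        unfolding hybrid_process_def by (rule same_sector_close[OF L0 i]) auto
      \<comment> \<open>Radial and angular parts of the distance, together 3 d / 4 < d.\<close>
      also have "\<dots> \<le> d / 4 + d / 2"
      proof (rule add_mono)
        define r where "r = cmod (\<Lambda> j \<omega>) powr \<alpha>"
        define s where "s = cmod (\<Lambda> k \<omega>) powr \<alpha>"
        have rs: "cmod (\<Lambda> j \<omega>) = r powr (1 / \<alpha>)" "cmod (\<Lambda> k \<omega>) = s powr (1 / \<alpha>)"
          using \<alpha>_pos by (simp_all add: r_def s_def powr_powr)
        have r: "u m \<le> r" "r < u m + h" "u m + h \<le> s" "s < u m + 2 * h"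
          using in_BC by (auto simp: B_def C_def shell_def r_def s_def)
        have le: "r powr (1 / \<alpha>) \<le> s powr (1 / \<alpha>)" using r u(2)[of m] \<alpha>_pos by (intro powr_mono2) auto
        have "s powr (1 / \<alpha>) - r powr (1 / \<alpha>) \<le> (s - r) powr (1 / \<alpha>)"
          using r u(2)[of m] \<alpha> by (intro powr_diff_le) auto
        also have "\<dots> \<le> (2 * h) powr (1 / \<alpha>)" using r u(2)[of m] \<alpha>_pos h by (intro powr_mono2) auto
        finally show "\<bar>cmod (\<Lambda> j \<omega>) - cmod (\<Lambda> k \<omega>)\<bar> \<le> d / 4" using le by (simp add: rs h2)
        have "s powr (1 / \<alpha>) \<le> s powr 1" using r u(2)[of m] \<alpha> h by (intro powr_mono) auto
        hence "s powr (1 / \<alpha>) \<le> u m + 2 * h" using r u(2)[of m] h by simp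
        hence "4 * pi * (s powr (1 / \<alpha>)) / d \<le> 4 * pi * (u m + 2 * h) / d"
          using d by (intro divide_right_mono mult_left_mono) auto
        hence "4 * pi * (s powr (1 / \<alpha>)) / d \<le> real (L m)" using Lge[of m] by linarith
        thus "cmod (\<Lambda> k \<omega>) * (2 * pi / real (L m)) \<le> d / 2"
          using d L0[of m] by (simp add: rs field_simps)
      qed
      finally show False using d by simp
    qed
    have bound: "prob G \<le> 1 - (1 - \<delta>)\<^sup>2 * (\<tau> N / (\<tau> N + K))" if "\<tau> N > 0" for N
      unfolding \<tau>_def K_def
    proof (rule second_moment_method[where R="max 0 (u N) powr (1 / \<alpha>)" and B=B and C=C])
      show "B m \<subseteq> {..max 0 (u N) powr (1 / \<alpha>)}" "C m \<subseteq> {..max 0 (u N) powr (1 / \<alpha>)}" if "m < N" for m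
      proof -
        have *: "shell \<alpha> v w \<subseteq> {..max 0 (u N) powr (1 / \<alpha>)}" if "w \<le> u N" for v w
        proof -
          have "max 0 w powr (1 / \<alpha>) \<le> max 0 (u N) powr (1 / \<alpha>)" using that \<alpha>_pos by (intro powr_mono2) auto
          thus ?thesis using shell_bounded[OF \<alpha>_pos, of v w] by auto
        qed
        show "B m \<subseteq> {..max 0 (u N) powr (1 / \<alpha>)}" "C m \<subseteq> {..max 0 (u N) powr (1 / \<alpha>)}"
          using u_mono[OF that] h unfolding B_def C_def by (intro *; linarith)+
      qed
      show "B m \<inter> C m = {}" for m unfolding B_def C_def by (intro shell_disjoint) simp
      show "B m \<inter> B m' = {}" "B m \<inter> C m' = {}" "C m \<inter> C m' = {}" if ne: "m \<noteq> m'" for m m'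
      proof -
        consider "u m + 2 * h \<le> u m'" | "u m' + 2 * h \<le> u m" using u_mono[of m m'] u_mono[of m' m] ne by (cases m m' rule: linorder_cases) auto
        hence "B m \<inter> B m' = {} \<and> B m \<inter> C m' = {} \<and> C m \<inter> C m' = {}"
        proof cases
          case 1
          thus ?thesis unfolding B_def C_def using h by (intro conjI shell_disjoint) auto
        next
          case 2
          have *: "shell \<alpha> v w \<inter> shell \<alpha> v' w' = {}" if "w' \<le> v" for v w v' w'
            using shell_disjoint[OF that] by blast
          show ?thesis unfolding B_def C_def using h 2 by (intro conjI *) auto
        qed
        thus "B m \<inter> B m' = {}" "B m \<inter> C m' = {}" "C m \<inter> C m' = {}" by auto
      qed
      show "shell_prob k (B m) \<le> \<delta> * (a * h)" for m k
        using X[of "u m" "u m + h" k] u(3)[of m] h by (simp add: B_def mult.assoc)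
      show "(\<Sum>m<N. x m * y m / real (L m)) > 0" using that by (simp add: \<tau>_def)
    qed (use L0 xB yC G no_pair \<delta> aAV h in \<open>auto simp: B_def C_def\<close>)
    have "filterlim \<tau> at_top sequentially"
    proof -
      \<comment> \<open>Chosen so that L m <= E (m + 1).\<close>
      define E where "E = 4 * pi * (W + 2 * h) / d + 1 + 4 * pi * (2 * h) / d"
      define c where "c = (a * h) * (a * h) / E"
      have W: "W \<ge> 1" by (simp add: W_def)
      have E: "E > 0" unfolding E_def using W h d by (intro add_nonneg_pos add_pos_nonneg) (auto intro!: divide_nonneg_nonneg mult_nonneg_nonneg)
      have c: "c > 0" unfolding c_def using aAV h E by simp
      have ge: "c / real (Suc m) \<le> x m * y m / real (L m)" for m
      proof -
        have "real (L m) \<le> E * real (Suc m)"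
        proof -
          have "4 * pi * (u m + 2 * h) / d + 1 = (4 * pi * (W + 2 * h) / d + 1) * 1 + (4 * pi * (2 * h) / d) * real m"
            by (simp add: u_def add_divide_distrib[symmetric] algebra_simps)
          also have "\<dots> \<le> (4 * pi * (W + 2 * h) / d + 1) * real (Suc m) + (4 * pi * (2 * h) / d) * real (Suc m)"
            using W h d by (intro add_mono mult_left_mono) (auto intro!: divide_nonneg_nonneg mult_nonneg_nonneg)
          also have "\<dots> = E * real (Suc m)" by (simp only: E_def distrib_right)
          finally show ?thesis using Lle[of m] by linarith
        qed
        moreover have "0 \<le> x m" "0 \<le> y m" by (simp_all add: x_def y_def)
        ultimately have "(a * h) * (a * h) / (E * real (Suc m)) \<le> x m * y m / real (L m)"
          using xB(2)[of m] yC(2)[of m] aAV h L0[of m] by (intro frac_le mult_mono) auto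
        thus ?thesis by (simp add: c_def)
      qed
      show ?thesis unfolding \<tau>_def
        by (rule filterlim_at_top_mono[OF sum_harmonic_unbounded[OF c]])
          (intro always_eventually allI sum_mono ge)
    qed
    hence "((\<lambda>N. 1 - (1 - \<delta>)\<^sup>2 * (\<tau> N / (\<tau> N + K))) \<longlongrightarrow> 1 - (1 - \<delta>)\<^sup>2 * 1) sequentially"
    proof (intro tendsto_intros)
      have "((\<lambda>t. t / (t + K)) \<longlongrightarrow> 1) at_top" by real_asymp
      from filterlim_compose[OF this \<open>filterlim \<tau> at_top sequentially\<close>]
      show "(\<lambda>N. \<tau> N / (\<tau> N + K)) \<longlonglongrightarrow> 1" .
    qed
    moreover have "\<forall>\<^sub>F N in sequentially. prob G \<le> 1 - (1 - \<delta>)\<^sup>2 * (\<tau> N / (\<tau> N + K))"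
      using filterlim_at_top_dense[THEN iffD1, OF \<open>filterlim \<tau> at_top sequentially\<close>, rule_format, of 0]
      by eventually_elim (rule bound)
    ultimately have "prob G \<le> 1 - (1 - \<delta>)\<^sup>2 * 1" by (intro tendsto_lowerbound) auto
    thus "prob G \<le> 1 - (1 - \<delta>)\<^sup>2" by simp
  qed simp
qed

lemma prob_separated:
  assumes \<mu>: "\<mu> = fock_measure \<alpha>" and \<alpha>_pos: "\<alpha> > 0"
  shows "prob {\<omega> \<in> space M. separated (\<lambda>k. hyb k \<omega>)} = (if \<alpha> < 1 then 1 else 0)"
proof -
  let ?S = "{\<omega> \<in> space M. separated (\<lambda>k. hyb k \<omega>)}"
  have S: "?S \<in> events" unfolding separated_iff by measurable
  show ?thesis
  proof (cases "\<alpha> < 1")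
    case True
    obtain A V where mass_le: "\<And>x y. V \<le> x \<Longrightarrow> x \<le> y \<Longrightarrow> shell_mass (shell \<alpha> x y) \<le> ennreal (A * (y - x))"
      using fock_shell_estimates[OF \<alpha>_pos, folded \<mu>] by metis
    have "shell_mass (shell \<alpha> 0 (V + 2)) < \<infinity>"
      by (rule shell_mass_finite[OF _ shell_bounded[OF \<alpha>_pos]]) simp
    then obtain E where E: "E \<ge> 0" "shell_mass (shell \<alpha> 0 (V + 2)) = ennreal E"
      by (cases "shell_mass (shell \<alpha> 0 (V + 2))") auto
    \<comment> \<open>The linear mass estimate starts only at \<open>V\<close>; the windows below it
      all lie in the single shell u < V + 2 of finite mass.\<close>
    have "shell_mass (shell \<alpha> (real m) (real m + 2)) \<le> ennreal (max (2 * A) E)" for m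
    proof (cases "V \<le> real m")
      case True
      have "shell_mass (shell \<alpha> (real m) (real m + 2)) \<le> ennreal (A * 2)"
        using mass_le[OF True, of "real m + 2"] by simp
      also have "\<dots> \<le> ennreal (max (2 * A) E)" by (intro ennreal_leI) simp
      finally show ?thesis .
    next
      case False
      have "shell_mass (shell \<alpha> (real m) (real m + 2)) \<le> shell_mass (shell \<alpha> 0 (V + 2))"
        using False by (intro shell_mass_mono) (auto simp: shell_def)
      also have "\<dots> \<le> ennreal (max (2 * A) E)" unfolding E by (intro ennreal_leI) simp
      finally show ?thesis .
    qed
    hence "AE \<omega> in M. separated (\<lambda>k. hyb k \<omega>)"
      using True \<alpha>_pos E by (intro almost_surely_separated[of \<alpha> "max (2 * A) E"]) auto
    hence "prob ?S = 1" using S by (subst prob_Collect_eq_1) auto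
    thus ?thesis using True by simp
  next
    case False
    define G where "G = (\<lambda>n :: nat. {\<omega> \<in> space M. (\<forall>k. 0 \<le> \<theta> k \<omega> \<and> \<theta> k \<omega> < 2 * pi) \<and>
      (\<forall>j k. j \<noteq> k \<longrightarrow> 1 / real (Suc n) \<le> cmod (hyb j \<omega> - hyb k \<omega>))})"
    have "G n \<in> events" "prob (G n) = 0" for n
      using not_separated_by[OF \<mu>, of "1 / real (Suc n)"] False by (auto simp: G_def)
    hence "AE \<omega> in M. \<omega> \<notin> G n" for n by (simp add: prob_eq_0)
    hence "AE \<omega> in M. \<forall>n. \<omega> \<notin> G n" by (simp add: AE_all_countable)
    hence "AE \<omega> in M. \<not> separated (\<lambda>k. hyb k \<omega>)"
      using angles_range AE_space
    proof eventually_elim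
      case (elim \<omega>)
      thus ?case unfolding separated_iff G_def by blast
    qed
    hence "prob ?S = 0" using S by (subst prob_Collect_eq_0) auto
    thus ?thesis using False by simp
  qed
qed

end

theorem corollary1p2:
  fixes \<alpha> :: real
    and M :: "'w measure"
    and \<Lambda> :: "nat \<Rightarrow> 'w \<Rightarrow> complex"
    and \<theta> :: "nat \<Rightarrow> 'w \<Rightarrow> real"
  assumes "\<alpha> > 0"
    and "prob_space M"
    and "determinantal_process M \<Lambda> (fock_kernel \<alpha>) (fock_measure \<alpha>)"
    and "prob_space.indep_vars M (\<lambda>_. borel) \<theta> UNIV"
    and "\<And>k. distr M borel (\<theta> k) = uniform_measure lborel {0..<2 * pi}"
    and "prob_space.indep_set M
           (sets (vimage_algebra (space M) (\<lambda>\<omega> k. \<Lambda> k \<omega>) (PiM UNIV (\<lambda>_. borel))))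
           (sets (vimage_algebra (space M) (\<lambda>\<omega> k. \<theta> k \<omega>) (PiM UNIV (\<lambda>_. borel))))"
  shows "measure M {\<omega> \<in> space M. separated (\<lambda>k. hybrid_process \<Lambda> \<theta> k \<omega>)}
         = (if \<alpha> < 1 then 1 else 0)"
proof -
  interpret prob_space M by fact
  interpret radial_measure "fock_measure \<alpha>" by (rule fock_radial_measure) fact
  have [simp]: "fock_kernel \<alpha> = kern" unfolding fock_kernel_def by (rule reproducing_kernel_eq)
  have "hybrid_dpp (fock_measure \<alpha>) M \<Lambda> \<theta>"
  proof unfold_locales
    show "emeasure (fock_measure \<alpha>) {z. cmod z = r} = 0" for r by (rule fock_measure_circle) fact
  qed (use assms in auto)
  thus ?thesis by (rule hybrid_dpp.prob_separated) (use assms(1) in simp_all)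
qed

end
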